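(* (Half-range completeness) Suppose the boundary conditions (I)–(II) are co-normal with respect to $l$ and that $L$ is positive definite. Let $(y_n)$ be an orthonormal basis of $\mathcal{D}(F)$ (with respect to $F$) consisting of eigenfunctions of the boundary-value problem $-y''+qy=\lambda By$ on $G$ with boundary conditions (I)–(II), $y_n$ having eigenvalue $\lambda_n$. Then $\{Q_+y_n:\lambda_n>0\}$ is a Riesz basis for $\mathcal{L}^2(G^+)$ and $\{Q_-y_n:\lambda_n<0\}$ is a Riesz basis for $\mathcal{L}^2(G^-)$.
   Context: Graph and spaces. $G$ is an oriented graph with finitely many edges $e_1,\dots,e_K$, each of length $1$; $e_i$ is identified with $[0,1]$, with $0$ the initial and $1$ the terminal point. A complex-valued function $y$ on $G$ is a tuple $(y_1,\dots,y_K)$ with $y_i=y|_{e_i}$ a function on $[0,1]$. Put $\mathcal{L}^2(G)=\bigoplus_{i=1}^K L^2(0,1)$ and $\mathcal{H}^m(G)=\bigoplus_{i=1}^K H^m(0,1)$ (Sobolev spaces), $\int_G h\,dt=\sum_i\int_0^1 h_i\,dt$, $(f,g)=\int_G f\bar g\,dt$, $\|f\|^2=(f,f)$. Equation. $q$ is real-valued and essentially bounded on $G$; $b=1$ on the edges $e_1,\dots,e_p$ and $b=-1$ on $e_{p+1},\dots,e_K$; $(By)(x)=b(x)y(x)$; $ly=-y''+qy$. $G^+$ (resp. $G^-$) is the subgraph of $G$ formed by the edges where $b=1$ (resp. $b=-1$). $Q_\pm$ are the spectral projections of $B$: $Q_\pm u(x)=u(x)$ where $b(x)=\pm1$ and $Q_\pm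 u(x)=0$ where $b(x)=\mp1$; the range of $Q_\pm$ is identified with $\mathcal{L}^2(G^\pm)$. Boundary conditions. At the nodes of $G$ one imposes in total $2K$ linearly independent linear homogeneous conditions with constant coefficients, each involving only the values of $y$ and $y'$ at the edge ends incident to one node, which are formally self-adjoint, i.e. $(lx,y)=(x,ly)$ for all $x,y\in\mathcal{H}^2(G)$ satisfying the conditions. They are written as (I) $\sum_{j=1}^K[\alpha_{ij}y_j(0)+\gamma_{ij}y_j(1)]=0$, $i=1,\dots,J$; (II) $\sum_{j=1}^K[\alpha_{ij}y_j(0)+\beta_{ij}y_j'(0)+\gamma_{ij}y_j(1)+\delta_{ij}y_j'(1)]=0$, $i=J+1,\dots,2K$, where all Dirichlet-like conditions are in (I), that is, every linear combination of (I)–(II) containing no derivative terms is a linear combination of the conditions (I) alone. Operator. $Lf=-f''+qf$ with domain $\mathcal{D}(L)=\{f: f,f'\in AC,\ Lf\in\mathcal{L}^2(G),\ f\text{ satisfies (I) and (II)}\}$, a self-adjoint operator in $\mathcal{L}^2(G)$. $L$ positive definite means $(Ly,y)>0$ for all $y\in\mathcal{D}(L)\setminus\{0\}$. Co-normal conditions and the form $F$. $\mathcal{D}(F)=\{y\in\mathcal{H}^1(G): y \text{ satisfies (I)}\}$. For a function $y$ on the set $\partial G$ of the $2K$ edge ends, $\int_{\partial G}y\,d\sigma=\sum_{i=1}^K[y_i(1)-y_i(0)]$. The boundary conditions are called co-normal (or elliptic) with respect to $l$ if there is a function $f$ on $\partial G$ (one scalar for each of the $2K$ edge ends) such that, for $x\in\mathcal{D}(F)\cap\mathcal{H}^2(G)$,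 one has $\int_{\partial G}(fx+x')\bar y\,d\sigma=0$ for all $y\in\mathcal{D}(F)$ if and only if $x$ satisfies (II). For co-normal conditions with such an $f$ fixed, $F(x,y)=\int_{\partial G}fx\bar y\,d\sigma+\int_G(x'\bar y'+qx\bar y)\,dt$ for $x,y\in\mathcal{D}(F)$. When $L$ is positive definite, $\mathcal{D}(F)$ is a Hilbert space with inner product $F$.
   Formalization: The Riesz basis property is proved for Q_±y_n divided by its L² norm on G^±; for the F-orthonormal y_n themselves it fails, since ‖Q_±y_n‖→0 (one edge, b=1, q=0, Dirichlet: y_n=√2 sin(nπt)/(nπ)), while Riesz basis members have norms bounded below. *)

theory Defs
  imports "HOL-Analysis.Analysis" "Graph_Theory.Digraph"
begin

section \<open>Functions on the unit-length edges of a graph\<close>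

text \<open>
  Edges are natural numbers, and a function on a graph is a map \<open>y\<close> with \<open>y i t\<close> the value on
  edge \<open>i\<close> at \<open>t \<in> [0,1]\<close>. Everything below depends only on the values for the edges of the graph
  and for \<open>t \<in> [0,1]\<close>. No quotient by null functions is taken: the spaces are sets of functions,
  and operators and expansions are considered up to functions of seminorm zero.
\<close>

type_synonym gfun = "nat \<Rightarrow> real \<Rightarrow> complex"

abbreviation unit_leb :: "real measure" where
  "unit_leb \<equiv> lebesgue_on {0..1}"

definition gsub :: "gfun \<Rightarrow> gfun \<Rightarrow> gfun" where
  "gsub x y = (\<lambda>i t. x i t - y i t)"

definition gscale :: "complex \<Rightarrow> gfun \<Rightarrow> gfun" where
  "gscale a x = (\<lambda>i t. a * x i t)"

definition glin :: "complex \<Rightarrow> gfun \<Rightarrow> complex \<Rightarrow> gfun \<Rightarrow> gfun" where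
  "glin a x b y = (\<lambda>i t. a * x i t + b * y i t)"

definition gsum :: "(nat \<Rightarrow> complex) \<Rightarrow> (nat \<Rightarrow> gfun) \<Rightarrow> nat set \<Rightarrow> gfun" where
  "gsum c x A = (\<lambda>i t. \<Sum>n\<in>A. c n * x n i t)"

text \<open>The derivative is one-sided at the end points of an edge.\<close>

definition gderiv :: "gfun \<Rightarrow> gfun" where
  "gderiv y = (\<lambda>i t. vector_derivative (y i) (at t within {0..1}))"

definition gint :: "nat set \<Rightarrow> gfun \<Rightarrow> complex" where
  "gint E h = (\<Sum>i\<in>E. \<integral>t. h i t \<partial>unit_leb)"

text \<open>
  Integral over the set of edge ends. A function on the edge ends is given as a function of the
  edge and of \<open>t \<in> {0,1}\<close>; its values at other \<open>t\<close> play no role.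
\<close>

definition bdint :: "nat set \<Rightarrow> gfun \<Rightarrow> complex" where
  "bdint E h = (\<Sum>i\<in>E. h i 1 - h i 0)"

definition L2 :: "nat set \<Rightarrow> gfun set" where
  "L2 E = {y. \<forall>i\<in>E. y i \<in> borel_measurable unit_leb \<and> integrable unit_leb (\<lambda>t. (cmod (y i t))\<^sup>2)}"

definition L2_inner :: "nat set \<Rightarrow> gfun \<Rightarrow> gfun \<Rightarrow> complex" where
  "L2_inner E x y = gint E (\<lambda>i t. x i t * cnj (y i t))"

definition abs_cont :: "(real \<Rightarrow> complex) \<Rightarrow> bool" where
  "abs_cont u \<longleftrightarrow> (\<forall>\<epsilon>>0. \<exists>\<delta>>0. \<forall>(n::nat) (a::nat \<Rightarrow> real) (b::nat \<Rightarrow> real).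
     (\<forall>k<n. 0 \<le> a k \<and> a k \<le> b k \<and> b k \<le> 1) \<and>
     disjoint_family_on (\<lambda>k. {a k<..<b k}) {..<n} \<and>
     (\<Sum>k<n. b k - a k) < \<delta> \<longrightarrow> (\<Sum>k<n. cmod (u (b k) - u (a k))) < \<epsilon>)"

text \<open>
  Almost everywhere differentiability follows from absolute continuity by Lebesgue's theorem; it
  is spelled out because \<^const>\<open>vector_derivative\<close> is total.
\<close>

definition AC :: "nat set \<Rightarrow> gfun set" where
  "AC E = {y. \<forall>i\<in>E. abs_cont (y i) \<and> (AE t in unit_leb. y i differentiable (at t within {0..1}))}"

text \<open>
  Sobolev functions are identified with their continuous representatives. If \<open>y\<close> and
  \<^term>\<open>gderiv y\<close> are both in \<^const>\<open>AC\<close>, then \<open>y\<close> is continuously differentiable on the closed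
  edges, so \<^term>\<open>gderiv y\<close> is the derivative at every point, the end points included.
\<close>

definition H1 :: "nat set \<Rightarrow> gfun set" where
  "H1 E = {y \<in> AC E. gderiv y \<in> L2 E}"

definition H2 :: "nat set \<Rightarrow> gfun set" where
  "H2 E = {y \<in> H1 E. gderiv y \<in> H1 E}"


section \<open>Orthonormal bases and Riesz bases\<close>

text \<open>
  \<open>V\<close> is a space of functions with a positive semidefinite Hermitian form \<open>ip\<close>. Families are
  indexed by a set \<open>I\<close> of natural numbers, which may be finite.
\<close>

definition form_norm :: "(gfun \<Rightarrow> gfun \<Rightarrow> complex) \<Rightarrow> gfun \<Rightarrow> real" where
  "form_norm ip x = sqrt (Re (ip x x))"

definition orthonormal_basis ::
    "gfun set \<Rightarrow> (gfun \<Rightarrow> gfun \<Rightarrow> complex) \<Rightarrow> nat set \<Rightarrow> (nat \<Rightarrow> gfun) \<Rightarrow> bool" where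
  "orthonormal_basis V ip I e \<longleftrightarrow>
     (\<forall>n\<in>I. e n \<in> V) \<and>
     (\<forall>m\<in>I. \<forall>n\<in>I. ip (e m) (e n) = (if m = n then 1 else 0)) \<and>
     (\<forall>x\<in>V. \<forall>\<epsilon>>0. \<exists>A c. finite A \<and> A \<subseteq> I \<and> form_norm ip (gsub x (gsum c e A)) < \<epsilon>)"

text \<open>
  A bounded linear bijection with bounded inverse of the space of classes modulo functions of
  seminorm zero.
\<close>

definition isomorphism_on ::
    "gfun set \<Rightarrow> (gfun \<Rightarrow> gfun \<Rightarrow> complex) \<Rightarrow> (gfun \<Rightarrow> gfun) \<Rightarrow> bool" where
  "isomorphism_on V ip T \<longleftrightarrow>
     (\<forall>x\<in>V. T x \<in> V) \<and>
     (\<forall>x\<in>V. \<forall>y\<in>V. \<forall>a b. form_norm ip (gsub (T (glin a x b y)) (glin a (T x) b (T y))) = 0) \<and>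
     (\<exists>c C. 0 < c \<and> (\<forall>x\<in>V. c * form_norm ip x \<le> form_norm ip (T x) \<and>
                           form_norm ip (T x) \<le> C * form_norm ip x)) \<and>
     (\<forall>z\<in>V. \<exists>x\<in>V. form_norm ip (gsub (T x) z) = 0)"

definition riesz_basis ::
    "gfun set \<Rightarrow> (gfun \<Rightarrow> gfun \<Rightarrow> complex) \<Rightarrow> nat set \<Rightarrow> (nat \<Rightarrow> gfun) \<Rightarrow> bool" where
  "riesz_basis V ip I x \<longleftrightarrow>
     (\<forall>n\<in>I. x n \<in> V) \<and>
     (\<exists>e T. orthonormal_basis V ip I e \<and> isomorphism_on V ip T \<and>
            (\<forall>n\<in>I. form_norm ip (gsub (T (e n)) (x n)) = 0))"

text \<open>
  The members of a Riesz basis have norms bounded away from \<open>0\<close>. Eigenfunctions that are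
  orthonormal with respect to the energy form \<open>F\<close> below have \<open>L\<^sup>2\<close> norms tending to \<open>0\<close> (for \<open>-y'' = \<lambda>y\<close>
  on one edge with Dirichlet conditions they are \<open>sqrt 2 sin(n\<pi>t)/(n\<pi>)\<close> up to constants of
  modulus 1), so for them the Riesz basis property is meant up to scaling of the individual
  members to unit \<open>L\<^sup>2\<close> norm.
\<close>

definition normalized :: "(gfun \<Rightarrow> gfun \<Rightarrow> complex) \<Rightarrow> gfun \<Rightarrow> gfun" where
  "normalized ip x = gscale (complex_of_real (1 / form_norm ip x)) x"


section \<open>The boundary value problem\<close>

text \<open>
  \<open>nedges\<close>, \<open>npos\<close>, \<open>ndir\<close> are \<open>K\<close>, \<open>p\<close>, \<open>J\<close>; the edges are \<open>1, \<dots>, K\<close>, and the end \<open>t = 0\<close> of edge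
  \<open>i\<close> lies at \<open>tail digraph i\<close>, the end \<open>t = 1\<close> at \<open>head digraph i\<close>. The row \<open>i\<close> of the boundary
  conditions has coefficients \<open>cA i j, cB i j, cC i j, cD i j\<close> at
  \<open>y\<^sub>j(0), y\<^sub>j'(0), y\<^sub>j(1), y\<^sub>j'(1)\<close>.
\<close>

record 'v graph_problem =
  digraph :: "('v, nat) pre_digraph"
  nedges :: nat
  npos :: nat
  potential :: "nat \<Rightarrow> real \<Rightarrow> real"
  ndir :: nat
  cA :: "nat \<Rightarrow> nat \<Rightarrow> complex"
  cB :: "nat \<Rightarrow> nat \<Rightarrow> complex"
  cC :: "nat \<Rightarrow> nat \<Rightarrow> complex"
  cD :: "nat \<Rightarrow> nat \<Rightarrow> complex"

definition edges :: "'v graph_problem \<Rightarrow> nat set" where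
  "edges P = {1..nedges P}"

definition weight :: "'v graph_problem \<Rightarrow> nat \<Rightarrow> real" where
  "weight P i = (if i \<le> npos P then 1 else -1)"

definition pos_edges :: "'v graph_problem \<Rightarrow> nat set" where
  "pos_edges P = {i \<in> edges P. weight P i = 1}"

definition neg_edges :: "'v graph_problem \<Rightarrow> nat set" where
  "neg_edges P = {i \<in> edges P. weight P i = -1}"

definition Q_pos :: "'v graph_problem \<Rightarrow> gfun \<Rightarrow> gfun" where
  "Q_pos P y = (\<lambda>i t. if weight P i = 1 then y i t else 0)"

definition Q_neg :: "'v graph_problem \<Rightarrow> gfun \<Rightarrow> gfun" where
  "Q_neg P y = (\<lambda>i t. if weight P i = -1 then y i t else 0)"

definition bc_I :: "'v graph_problem \<Rightarrow> gfun \<Rightarrow> bool" where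
  "bc_I P y \<longleftrightarrow> (\<forall>i\<in>{1..ndir P}. (\<Sum>j\<in>edges P. cA P i j * y j 0 + cC P i j * y j 1) = 0)"

definition bc_II :: "'v graph_problem \<Rightarrow> gfun \<Rightarrow> bool" where
  "bc_II P y \<longleftrightarrow> (\<forall>i\<in>{ndir P + 1..2 * nedges P}.
     (\<Sum>j\<in>edges P. cA P i j * y j 0 + cB P i j * gderiv y j 0 +
                   cC P i j * y j 1 + cD P i j * gderiv y j 1) = 0)"

definition lop :: "'v graph_problem \<Rightarrow> gfun \<Rightarrow> gfun" where
  "lop P y = (\<lambda>i t. - gderiv (gderiv y) i t + complex_of_real (potential P i t) * y i t)"

definition local_conditions :: "'v graph_problem \<Rightarrow> bool" where
  "local_conditions P \<longleftrightarrow> (\<forall>i\<in>{1..2 * nedges P}. \<exists>v\<in>verts (digraph P). \<forall>j\<in>edges P.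
     (cA P i j \<noteq> 0 \<or> cB P i j \<noteq> 0 \<longrightarrow> tail (digraph P) j = v) \<and>
     (cC P i j \<noteq> 0 \<or> cD P i j \<noteq> 0 \<longrightarrow> head (digraph P) j = v))"

definition independent_conditions :: "'v graph_problem \<Rightarrow> bool" where
  "independent_conditions P \<longleftrightarrow> (\<forall>c :: nat \<Rightarrow> complex.
     (\<forall>j\<in>edges P.
        (\<Sum>i=1..2 * nedges P. c i * cA P i j) = 0 \<and> (\<Sum>i=1..2 * nedges P. c i * cB P i j) = 0 \<and>
        (\<Sum>i=1..2 * nedges P. c i * cC P i j) = 0 \<and> (\<Sum>i=1..2 * nedges P. c i * cD P i j) = 0)
     \<longrightarrow> (\<forall>i\<in>{1..2 * nedges P}. c i = 0))"

definition dirichlet_in_I :: "'v graph_problem \<Rightarrow> bool" where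
  "dirichlet_in_I P \<longleftrightarrow> (\<forall>c :: nat \<Rightarrow> complex.
     (\<forall>j\<in>edges P. (\<Sum>i=1..2 * nedges P. c i * cB P i j) = 0 \<and>
                  (\<Sum>i=1..2 * nedges P. c i * cD P i j) = 0)
     \<longrightarrow> (\<exists>d. \<forall>j\<in>edges P.
           (\<Sum>i=1..2 * nedges P. c i * cA P i j) = (\<Sum>i=1..ndir P. d i * cA P i j) \<and>
           (\<Sum>i=1..2 * nedges P. c i * cC P i j) = (\<Sum>i=1..ndir P. d i * cC P i j)))"

definition formally_self_adjoint :: "'v graph_problem \<Rightarrow> bool" where
  "formally_self_adjoint P \<longleftrightarrow> (\<forall>x\<in>H2 (edges P). \<forall>y\<in>H2 (edges P).
     bc_I P x \<and> bc_II P x \<and> bc_I P y \<and> bc_II P y \<longrightarrow>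
     L2_inner (edges P) (lop P x) y = L2_inner (edges P) x (lop P y))"

definition graph_bvp :: "'v graph_problem \<Rightarrow> bool" where
  "graph_bvp P \<longleftrightarrow>
     wf_digraph (digraph P) \<and> arcs (digraph P) = edges P \<and> npos P \<le> nedges P \<and>
     (\<forall>i\<in>edges P. potential P i \<in> borel_measurable unit_leb \<and>
                  (\<exists>C. AE t in unit_leb. \<bar>potential P i t\<bar> \<le> C)) \<and>
     ndir P \<le> 2 * nedges P \<and>
     (\<forall>i\<in>{1..ndir P}. \<forall>j\<in>edges P. cB P i j = 0 \<and> cD P i j = 0) \<and>
     local_conditions P \<and> independent_conditions P \<and> dirichlet_in_I P \<and>
     formally_self_adjoint P"

definition dom_L :: "'v graph_problem \<Rightarrow> gfun set" where
  "dom_L P = {y \<in> AC (edges P). gderiv y \<in> AC (edges P) \<and> lop P y \<in> L2 (edges P) \<and>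
                               bc_I P y \<and> bc_II P y}"

definition L_positive_definite :: "'v graph_problem \<Rightarrow> bool" where
  "L_positive_definite P \<longleftrightarrow> (\<forall>y\<in>dom_L P. (\<exists>i\<in>edges P. \<exists>t\<in>{0..1}. y i t \<noteq> 0) \<longrightarrow>
     L2_inner (edges P) (lop P y) y \<in> \<real> \<and> 0 < Re (L2_inner (edges P) (lop P y) y))"

definition dom_F :: "'v graph_problem \<Rightarrow> gfun set" where
  "dom_F P = {y \<in> H1 (edges P). bc_I P y}"

definition conormal_via :: "'v graph_problem \<Rightarrow> gfun \<Rightarrow> bool" where
  "conormal_via P f \<longleftrightarrow> (\<forall>x\<in>dom_F P \<inter> H2 (edges P).
     (\<forall>y\<in>dom_F P. bdint (edges P) (\<lambda>i t. (f i t * x i t + gderiv x i t) * cnj (y i t)) = 0)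
     \<longleftrightarrow> bc_II P x)"

definition F_form :: "'v graph_problem \<Rightarrow> gfun \<Rightarrow> gfun \<Rightarrow> gfun \<Rightarrow> complex" where
  "F_form P f x y =
     bdint (edges P) (\<lambda>i t. f i t * x i t * cnj (y i t)) +
     gint (edges P) (\<lambda>i t. gderiv x i t * cnj (gderiv y i t) +
                          complex_of_real (potential P i t) * x i t * cnj (y i t))"

text \<open>Eigenvalues of the problem with \<open>L\<close> positive definite are real.\<close>

definition eigenfunction :: "'v graph_problem \<Rightarrow> real \<Rightarrow> gfun \<Rightarrow> bool" where
  "eigenfunction P ev y \<longleftrightarrow>
     y \<in> dom_L P \<and> (\<exists>i\<in>edges P. \<exists>t\<in>{0..1}. y i t \<noteq> 0) \<and>
     (\<forall>i\<in>edges P. AE t in unit_leb. lop P y i t = complex_of_real (ev * weight P i) * y i t)"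

end

theory Submission
  imports Defs "HOL-Complex_Analysis.Great_Picard"
begin

text \<open>
  Scale the eigenfunctions to \<open>z n = \<bar>\<lambda>\<^sub>n\<bar>\<^sup>1\<^sup>/\<^sup>2 y n\<close>. Then \<open>(B z\<^sub>m, z\<^sub>n)\<close> is \<open>sgn \<lambda>\<^sub>n\<close> for \<open>m = n\<close> and \<open>0\<close>
  otherwise, so the family is orthonormal up to signs for the indefinite form \<open>(B u, v)\<close>. For a finite
  combination \<open>u\<close> with coefficients \<open>c\<^sub>n\<close> over positive eigenvalues,
  \<open>\<Sum>\<bar>c\<^sub>n\<bar>\<^sup>2 = (B u, u) \<le> \<parallel>Q\<^sub>+ u\<parallel>\<^sup>2\<close>, which is the lower Riesz estimate. The theorem therefore rests on the
  upper estimate \<open>\<parallel>u\<parallel>\<^sup>2 \<le> C \<Sum>\<bar>c\<^sub>n\<bar>\<^sup>2\<close> for all finite combinations (\<open>norm_estimate\<close>) and on totality.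

  The upper estimate follows Beals and Curgus. There is an operator \<open>W\<close> on the form domain that is symmetric
  for \<open>(B u, v)\<close>, bounded in the energy norm, and satisfies \<open>(B W u, u) \<ge> \<parallel>u\<parallel>\<^sup>2 / 5\<close>. It is the identity on
  the edges with \<open>b = 1\<close>; on those with \<open>b = -1\<close> it is \<open>-1 + 2 K\<close>, where \<open>K\<close> (\<open>end_op\<close>) is a symmetric
  operator with quadratic form at most \<open>2/5\<close> that reproduces both end values. So \<open>W u\<close> has the same end
  values as \<open>u\<close> and satisfies the conditions (I) with it; no other property of these conditions is needed.
  In the coordinates \<open>z\<close>, \<open>W\<close> becomes a Hermitian matrix that is bounded in the energy norm; iteration
  (\<open>log_convex_ratio\<close>) bounds it in the Euclidean norm by the same constant, and positivity of \<open>W\<close> gives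
  the estimate.

  That \<open>W\<close> is bounded in the energy norm uses the coercivity of \<open>F\<close> (\<open>coercive\<close>). The minimum of the
  Rayleigh quotient of \<open>F\<close> is attained by compactness, the minimizer is an eigenfunction of \<open>L\<close>, and
  positive definiteness of \<open>L\<close> makes the minimum positive (\<open>Rayleigh_minimum\<close>). The form \<open>F\<close> is Hermitian
  because all admissible end values occur in the domain of \<open>L\<close> (\<open>F_herm\<close>).

  Totality of the half-range family (\<open>half_range_dense\<close>) is obtained by successive approximation: a
  function on \<open>G\<^sup>+\<close>, extended by zero, is nearly a combination of all \<open>z n\<close>, and a multiple of the part
  with positive eigenvalues, when subtracted, reduces its norm by a factor that depends only on \<open>C\<close>.
  Totality of all \<open>z n\<close> in the square integrable functions follows from that in the energy norm and the
  density of Sobolev functions that vanish at the ends (\<open>H1e_dense\<close>). A coefficient estimate from both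
  sides and totality give a Riesz basis (\<open>riesz_basis_criterion\<close>); normalization preserves both estimates
  because the norms of \<open>Q\<^sub>+ z n\<close> for \<open>\<lambda>\<^sub>n > 0\<close> are bounded above and away from zero. The negative half
  is the positive half with the signs exchanged.
\<close>

section \<open>Spaces with a positive semidefinite Hermitian form\<close>

lemma gsub_glin: "gsub x y = glin 1 x (-1) y"
  by (simp add: gsub_def glin_def)

lemma gscale_glin: "gscale a x = glin a x 0 x"
  by (simp add: gscale_def glin_def)

lemma gsum_insert:
  "finite A \<Longrightarrow> n \<notin> A \<Longrightarrow> gsum c x (insert n A) = glin (c n) (x n) 1 (gsum c x A)"
  by (simp add: gsum_def glin_def)

lemma gsum_cong: "(\<And>n. n \<in> A \<Longrightarrow> c n = d n) \<Longrightarrow> gsum c x A = gsum d x A"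
  by (simp add: gsum_def)

lemma gsum_superset:
  assumes "finite B" "A \<subseteq> B"
  shows "gsum c x A = gsum (\<lambda>n. if n \<in> A then c n else 0) x B"
proof -
  have "(\<Sum>n\<in>A. c n * x n i t) = (\<Sum>n\<in>B. (if n \<in> A then c n else 0) * x n i t)" for i t
    by (rule sum.mono_neutral_cong_left) (use assms in auto)
  then show ?thesis by (simp add: gsum_def)
qed

lemma glin_gsum:
  "glin a (gsum c x A) b (gsum d x A) = gsum (\<lambda>n. a * c n + b * d n) x A"
  by (simp add: glin_def gsum_def sum_distrib_left sum.distrib algebra_simps)

text \<open>The finite linear combinations of a family.\<close>

definition fspan :: "(nat \<Rightarrow> gfun) \<Rightarrow> nat set \<Rightarrow> gfun set" where
  "fspan x I = {gsum c x A | c A. finite A \<and> A \<subseteq> I}"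

lemma fspanI: "finite A \<Longrightarrow> A \<subseteq> I \<Longrightarrow> gsum c x A \<in> fspan x I"
  by (auto simp: fspan_def)

lemma fspan_mono: "I \<subseteq> J \<Longrightarrow> fspan x I \<subseteq> fspan x J"
  by (auto simp: fspan_def)

lemma fspan_glin:
  assumes "u \<in> fspan x I" "v \<in> fspan x I"
  shows "glin a u b v \<in> fspan x I"
proof -
  obtain A c B d where u: "u = gsum c x A" "finite A" "A \<subseteq> I"
    and v: "v = gsum d x B" "finite B" "B \<subseteq> I"
    using assms by (auto simp: fspan_def)
  have "glin a u b v = glin a (gsum (\<lambda>n. if n \<in> A then c n else 0) x (A \<union> B))
      b (gsum (\<lambda>n. if n \<in> B then d n else 0) x (A \<union> B))"
    using gsum_superset[of "A \<union> B" A c x] gsum_superset[of "A \<union> B" B d x] u v by simp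
  also have "\<dots> \<in> fspan x I"
    unfolding glin_gsum using u v by (intro fspanI) auto
  finally show ?thesis .
qed

lemma fspan_base: "n \<in> I \<Longrightarrow> x n \<in> fspan x I"
  using fspanI[of "{n}" I "\<lambda>_. 1" x] by (simp add: gsum_def)

lemma fspan_zero: "(\<lambda>i t. 0) \<in> fspan x I"
  using fspanI[of "{}" I "\<lambda>_. 1" x] by (simp add: gsum_def)

lemma gsum_in_fspan:
  assumes "finite A" "\<And>n. n \<in> A \<Longrightarrow> e n \<in> fspan x I"
  shows "gsum c e A \<in> fspan x I"
  using assms
proof (induction A rule: finite_induct)
  case empty
  then show ?case using fspan_zero by (simp add: gsum_def)
next
  case (insert n A)
  then show ?case by (auto simp: gsum_insert intro: fspan_glin)
qed

lemma fspan_trans: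
  assumes "\<And>n. n \<in> J \<Longrightarrow> e n \<in> fspan x I"
  shows "fspan e J \<subseteq> fspan x I"
proof
  fix u assume "u \<in> fspan e J"
  then obtain A c where "u = gsum c e A" "finite A" "A \<subseteq> J" by (auto simp: fspan_def)
  then show "u \<in> fspan x I" using assms by (auto intro!: gsum_in_fspan)
qed

text \<open>A subspace \<open>V\<close> of the functions on the edges with a positive semidefinite Hermitian form, linear in
  the first argument. No quotient is taken, so distinct functions may have distance zero.\<close>

locale semi_ip =
  fixes V :: "gfun set" and ip :: "gfun \<Rightarrow> gfun \<Rightarrow> complex"
  assumes zero_in: "(\<lambda>i t. 0) \<in> V"
    and glin_in: "x \<in> V \<Longrightarrow> y \<in> V \<Longrightarrow> glin a x b y \<in> V"
    and ip_glin_left: "x \<in> V \<Longrightarrow> y \<in> V \<Longrightarrow> z \<in> V \<Longrightarrow>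
        ip (glin a x b y) z = a * ip x z + b * ip y z"
    and ip_herm: "x \<in> V \<Longrightarrow> y \<in> V \<Longrightarrow> ip y x = cnj (ip x y)"
    and ip_nonneg: "x \<in> V \<Longrightarrow> 0 \<le> Re (ip x x)"
begin

abbreviation nrm :: "gfun \<Rightarrow> real" where "nrm \<equiv> form_norm ip"

lemma gsub_in: "x \<in> V \<Longrightarrow> y \<in> V \<Longrightarrow> gsub x y \<in> V"
  by (simp add: gsub_glin glin_in)

lemma gscale_in: "x \<in> V \<Longrightarrow> gscale a x \<in> V"
  by (simp add: gscale_glin glin_in)

lemma gsum_in: "finite A \<Longrightarrow> (\<And>n. n \<in> A \<Longrightarrow> x n \<in> V) \<Longrightarrow> gsum c x A \<in> V"
proof (induction A rule: finite_induct)
  case empty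
  then show ?case using zero_in by (simp add: gsum_def)
next
  case (insert n A)
  then show ?case by (auto simp: gsum_insert intro: glin_in)
qed

lemma fspan_subset: "(\<And>n. n \<in> I \<Longrightarrow> x n \<in> V) \<Longrightarrow> fspan x I \<subseteq> V"
  unfolding fspan_def by (auto intro!: gsum_in)

lemma ip_glin_right:
  assumes "x \<in> V" "y \<in> V" "z \<in> V"
  shows "ip z (glin a x b y) = cnj a * ip z x + cnj b * ip z y"
proof -
  have "ip z (glin a x b y) = cnj (ip (glin a x b y) z)"
    using assms by (intro ip_herm glin_in)
  also have "\<dots> = cnj a * cnj (ip x z) + cnj b * cnj (ip y z)"
    using assms by (simp add: ip_glin_left)
  also have "\<dots> = cnj a * ip z x + cnj b * ip z y"
    using assms ip_herm[of x z] ip_herm[of y z] by simp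
  finally show ?thesis .
qed

lemma ip_zero_left: "z \<in> V \<Longrightarrow> ip (\<lambda>i t. 0) z = 0"
  using ip_glin_left[of z z z 0 0] by (simp add: glin_def)

lemma ip_gsub_left: "x \<in> V \<Longrightarrow> y \<in> V \<Longrightarrow> z \<in> V \<Longrightarrow> ip (gsub x y) z = ip x z - ip y z"
  by (simp add: gsub_glin ip_glin_left)

lemma ip_gscale_left: "x \<in> V \<Longrightarrow> z \<in> V \<Longrightarrow> ip (gscale a x) z = a * ip x z"
  by (simp add: gscale_glin ip_glin_left)

lemma ip_gscale_right: "x \<in> V \<Longrightarrow> z \<in> V \<Longrightarrow> ip z (gscale a x) = cnj a * ip z x"
  by (simp add: gscale_glin ip_glin_right)

lemma ip_gsum_left:
  assumes "finite A" "\<And>n. n \<in> A \<Longrightarrow> x n \<in> V" "z \<in> V"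
  shows "ip (gsum c x A) z = (\<Sum>n\<in>A. c n * ip (x n) z)"
  using assms
proof (induction A rule: finite_induct)
  case empty
  then show ?case by (simp add: gsum_def ip_zero_left)
next
  case (insert n A)
  then show ?case by (simp add: gsum_insert ip_glin_left gsum_in)
qed

lemma ip_gsum_right:
  assumes "finite A" "\<And>n. n \<in> A \<Longrightarrow> x n \<in> V" "z \<in> V"
  shows "ip z (gsum c x A) = (\<Sum>n\<in>A. cnj (c n) * ip z (x n))"
proof -
  have "ip z (gsum c x A) = cnj (ip (gsum c x A) z)"
    using assms by (intro ip_herm gsum_in)
  also have "\<dots> = (\<Sum>n\<in>A. cnj (c n) * cnj (ip (x n) z))"
    using assms by (simp add: ip_gsum_left)
  also have "\<dots> = (\<Sum>n\<in>A. cnj (c n) * ip z (x n))"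
    using assms by (intro sum.cong) (simp_all add: ip_herm[of _ z])
  finally show ?thesis .
qed

lemma ip_real: "x \<in> V \<Longrightarrow> ip x x = complex_of_real (Re (ip x x))"
  using ip_herm[of x x] by (simp add: complex_eq_iff)

lemma nrm_sq: "x \<in> V \<Longrightarrow> (nrm x)\<^sup>2 = Re (ip x x)"
  by (simp add: form_norm_def ip_nonneg)

lemma nrm_nonneg: "x \<in> V \<Longrightarrow> 0 \<le> nrm x"
  by (simp add: form_norm_def ip_nonneg)

lemma ip_self: "x \<in> V \<Longrightarrow> ip x x = complex_of_real ((nrm x)\<^sup>2)"
  by (metis ip_real nrm_sq)

lemma nrm_sq_glin:
  assumes "x \<in> V" "y \<in> V"
  shows "(nrm (glin a x b y))\<^sup>2 =
    (cmod a)\<^sup>2 * (nrm x)\<^sup>2 + (cmod b)\<^sup>2 * (nrm y)\<^sup>2 + 2 * Re (a * cnj b * ip x y)"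
proof -
  have "ip (glin a x b y) (glin a x b y) =
      a * cnj a * ip x x + b * cnj b * ip y y + (a * cnj b * ip x y + cnj (a * cnj b * ip x y))"
    using assms ip_herm[of x y]
    by (simp add: ip_glin_left ip_glin_right glin_in algebra_simps)
  also have "\<dots> = of_real ((cmod a)\<^sup>2 * (nrm x)\<^sup>2 + (cmod b)\<^sup>2 * (nrm y)\<^sup>2 + 2 * Re (a * cnj b * ip x y))"
    unfolding complex_add_cnj complex_norm_square[symmetric] ip_self[OF assms(1)] ip_self[OF assms(2)]
    by simp
  finally show ?thesis
    using nrm_sq[OF glin_in[OF assms]] by (metis Re_complex_of_real)
qed

lemma Cauchy_Schwarz:
  assumes "x \<in> V" "y \<in> V"
  shows "cmod (ip x y) \<le> nrm x * nrm y"
proof (cases "ip x y = 0")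
  case True
  then show ?thesis using assms nrm_nonneg by simp
next
  case False
  define k where "k = cmod (ip x y)"
  have kp: "k > 0" using False by (simp add: k_def)
  \<comment> \<open>The polynomial \<open>t \<mapsto> \<parallel>t x - b y\<parallel>\<^sup>2\<close> is nonnegative, where \<open>b\<close> of modulus one makes
    \<open>cnj b * ip x y\<close> real and positive.\<close>
  define b where "b = ip x y / of_real k"
  have b1: "cmod b = 1" using kp by (simp add: b_def k_def norm_divide)
  have bk: "cnj b * ip x y = of_real k"
    using kp complex_norm_square[of "ip x y"]
    by (simp add: b_def k_def[symmetric] field_simps power2_eq_square)
  have pol: "0 \<le> t\<^sup>2 * (nrm x)\<^sup>2 + (nrm y)\<^sup>2 - 2 * t * k" for t :: real
  proof -
    have "(nrm (glin (of_real t) x (-b) y))\<^sup>2 = t\<^sup>2 * (nrm x)\<^sup>2 + (nrm y)\<^sup>2 + 2 * Re (- of_real t * (cnj b * ip x y))"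
      using nrm_sq_glin[OF assms, of "of_real t" "-b"] b1 by (simp add: mult.assoc)
    then show ?thesis unfolding bk
      by (metis (no_types, lifting) Re_complex_of_real ab_group_add_class.ab_diff_conv_add_uminus
          mult.assoc mult_minus_left mult_minus_right of_real_minus of_real_mult zero_le_power2)
  qed
  have disc: "k\<^sup>2 \<le> (nrm x)\<^sup>2 * (nrm y)\<^sup>2"
  proof (cases "nrm x = 0")
    case True
    have "0 \<le> (nrm y)\<^sup>2 - 2 * (((nrm y)\<^sup>2 + 1) / k) * k"
      using pol[of "((nrm y)\<^sup>2 + 1) / k"] True by simp
    moreover have "2 * (((nrm y)\<^sup>2 + 1) / k) * k = 2 * (nrm y)\<^sup>2 + 2" using kp by simp
    ultimately show ?thesis using zero_le_power2[of "nrm y"] by linarith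
  next
    case False
    then have "0 < (nrm x)\<^sup>2" by simp
    moreover have "0 \<le> (k / (nrm x)\<^sup>2)\<^sup>2 * (nrm x)\<^sup>2 + (nrm y)\<^sup>2 - 2 * (k / (nrm x)\<^sup>2) * k"
      by (rule pol)
    moreover have "(k / (nrm x)\<^sup>2)\<^sup>2 * (nrm x)\<^sup>2 = k\<^sup>2 / (nrm x)\<^sup>2"
      "2 * (k / (nrm x)\<^sup>2) * k = 2 * (k\<^sup>2 / (nrm x)\<^sup>2)"
      using False by (simp_all add: power2_eq_square field_simps)
    ultimately have "k\<^sup>2 / (nrm x)\<^sup>2 \<le> (nrm y)\<^sup>2" by linarith
    then show ?thesis using \<open>0 < (nrm x)\<^sup>2\<close> by (simp add: pos_divide_le_eq mult.commute)
  qed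
  have "0 \<le> nrm x * nrm y" using assms nrm_nonneg by simp
  with disc show ?thesis unfolding k_def[symmetric]
    by (metis power_mult_distrib power2_le_imp_le)
qed

lemma nrm_glin:
  assumes "x \<in> V" "y \<in> V"
  shows "nrm (glin a x b y) \<le> cmod a * nrm x + cmod b * nrm y"
proof -
  have "Re (a * cnj b * ip x y) \<le> cmod (a * cnj b * ip x y)"
    by (rule complex_Re_le_cmod)
  also have "\<dots> \<le> cmod a * cmod b * (nrm x * nrm y)"
    using Cauchy_Schwarz[OF assms] by (simp add: norm_mult mult_left_mono)
  finally have "(nrm (glin a x b y))\<^sup>2 \<le> (cmod a * nrm x + cmod b * nrm y)\<^sup>2"
    unfolding nrm_sq_glin[OF assms] by (simp add: power2_sum power_mult_distrib algebra_simps)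
  moreover have "0 \<le> cmod a * nrm x + cmod b * nrm y"
    using nrm_nonneg[OF assms(1)] nrm_nonneg[OF assms(2)] by simp
  ultimately show ?thesis by (rule power2_le_imp_le)
qed

lemma nrm_gscale: "x \<in> V \<Longrightarrow> nrm (gscale a x) = cmod a * nrm x"
proof -
  assume x: "x \<in> V"
  have "(nrm (gscale a x))\<^sup>2 = (cmod a * nrm x)\<^sup>2"
    using nrm_sq_glin[OF x x, of a 0] by (simp add: gscale_glin power_mult_distrib)
  then show ?thesis using x nrm_nonneg gscale_in
    by (metis mult_nonneg_nonneg norm_ge_zero power2_eq_imp_eq)
qed

lemma nrm_gsub_commute: "x \<in> V \<Longrightarrow> y \<in> V \<Longrightarrow> nrm (gsub x y) = nrm (gsub y x)"
  using nrm_gscale[of "gsub y x" "-1"] gsub_in[of y x] by (simp add: gscale_def gsub_def)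

lemma nrm_triangle:
  assumes "x \<in> V" "y \<in> V" "z \<in> V"
  shows "nrm (gsub x z) \<le> nrm (gsub x y) + nrm (gsub y z)"
  using nrm_glin[of "gsub x y" "gsub y z" 1 1] assms gsub_in
  by (simp add: gsub_def glin_def)

lemma nrm_triangle_sub:
  assumes "x \<in> V" "y \<in> V"
  shows "nrm x \<le> nrm y + nrm (gsub x y)" "nrm y \<le> nrm x + nrm (gsub x y)"
proof -
  have "nrm (glin 1 y 1 (gsub x y)) \<le> nrm y + nrm (gsub x y)"
    using nrm_glin[of y "gsub x y" 1 1] assms gsub_in by simp
  then show "nrm x \<le> nrm y + nrm (gsub x y)" by (simp add: glin_def gsub_def)
  have "nrm (glin 1 x (-1) (gsub x y)) \<le> nrm x + nrm (gsub x y)"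
    using nrm_glin[of x "gsub x y" 1 "-1"] assms gsub_in by simp
  then show "nrm y \<le> nrm x + nrm (gsub x y)" by (simp add: glin_def gsub_def)
qed

lemma nrm_gsum_orthonormal:
  assumes "finite A" "\<And>n. n \<in> A \<Longrightarrow> e n \<in> V"
    and "\<And>m n. m \<in> A \<Longrightarrow> n \<in> A \<Longrightarrow> ip (e m) (e n) = (if m = n then 1 else 0)"
  shows "(nrm (gsum c e A))\<^sup>2 = (\<Sum>n\<in>A. (cmod (c n))\<^sup>2)"
proof -
  have "ip (gsum c e A) (gsum c e A) = (\<Sum>m\<in>A. c m * (\<Sum>n\<in>A. cnj (c n) * ip (e m) (e n)))"
    by (subst ip_gsum_left) (use assms in \<open>auto simp: ip_gsum_right gsum_in\<close>)
  also have "\<dots> = (\<Sum>m\<in>A. c m * (\<Sum>n\<in>A. if m = n then cnj (c n) else 0))"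
    using assms by (intro sum.cong refl arg_cong2[where f="(*)"]) auto
  also have "\<dots> = (\<Sum>m\<in>A. complex_of_real ((cmod (c m))\<^sup>2))"
    using assms(1) by (simp only: complex_norm_square) (simp add: sum.delta')
  finally show ?thesis
    using nrm_sq[OF gsum_in[of A e c]] assms by simp
qed

end

text \<open>Completeness with respect to the seminorm.\<close>

locale complete_semi_ip = semi_ip +
  assumes complete: "(\<And>k::nat. u k \<in> V) \<Longrightarrow>
      (\<And>\<epsilon>. 0 < \<epsilon> \<Longrightarrow> \<exists>N. \<forall>j\<ge>N. \<forall>k\<ge>N. form_norm ip (gsub (u j) (u k)) < \<epsilon>) \<Longrightarrow>
      \<exists>z\<in>V. \<forall>\<epsilon>>0. \<exists>N. \<forall>k\<ge>N. form_norm ip (gsub (u k) z) < \<epsilon>"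

section \<open>Riesz bases in complete spaces\<close>

text \<open>The Gram-Schmidt process along the natural numbers; the first argument counts the members
  that are already final, and members with index outside \<open>I\<close> are skipped.\<close>

primrec gram_schmidt ::
    "(gfun \<Rightarrow> gfun \<Rightarrow> complex) \<Rightarrow> (nat \<Rightarrow> gfun) \<Rightarrow> nat set \<Rightarrow> nat \<Rightarrow> nat \<Rightarrow> gfun" where
  "gram_schmidt ip x I 0 = x"
| "gram_schmidt ip x I (Suc n) = (gram_schmidt ip x I n)
     (n := normalized ip (gsub (x n)
        (gsum (\<lambda>m. ip (x n) (gram_schmidt ip x I n m)) (gram_schmidt ip x I n) (I \<inter> {..<n}))))"

lemma gram_schmidt_stable: "m < n \<Longrightarrow> gram_schmidt ip x I n m = gram_schmidt ip x I (Suc m) m"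
proof (induction n)
  case (Suc n)
  then show ?case by (cases "m = n") auto
qed simp

context semi_ip
begin

text \<open>If the norm of every finite combination is bounded below by the Euclidean norm of its coefficients,
  the Gram-Schmidt process does not break down. Every member of the family is a finite combination of the
  resulting orthonormal family.\<close>

lemma orthonormalization:
  assumes x: "\<And>n. n \<in> I \<Longrightarrow> x n \<in> V"
    and "0 < m"
    and low: "\<And>A c. finite A \<Longrightarrow> A \<subseteq> I \<Longrightarrow> m * (\<Sum>n\<in>A. (cmod (c n))\<^sup>2) \<le> (nrm (gsum c x A))\<^sup>2"
  obtains e where "\<And>n. n \<in> I \<Longrightarrow> e n \<in> V"
    and "\<And>m n. m \<in> I \<Longrightarrow> n \<in> I \<Longrightarrow> ip (e m) (e n) = (if m = n then 1 else 0)"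
    and "fspan x I \<subseteq> fspan e I"
proof -
  define e where "e n = gram_schmidt ip x I (Suc n) n" for n
  define p where "p n = gsub (x n) (gsum (\<lambda>k. ip (x n) (e k)) e (I \<inter> {..<n}))" for n
  have e: "e n = normalized ip (p n)" for n
  proof -
    have "gsum (\<lambda>m. ip (x n) (gram_schmidt ip x I n m)) (gram_schmidt ip x I n) (I \<inter> {..<n})
        = gsum (\<lambda>k. ip (x n) (e k)) e (I \<inter> {..<n})"
      unfolding gsum_def e_def by (intro ext sum.cong refl) (simp add: gram_schmidt_stable)
    then show ?thesis by (simp add: e_def p_def)
  qed
  have main: "e n \<in> fspan x (I \<inter> {..n}) \<and> e n \<in> V \<and> 0 < nrm (p n) \<and> p n \<in> V \<and>
      ip (e n) (e n) = 1 \<and> (\<forall>k\<in>I. k < n \<longrightarrow> ip (e n) (e k) = 0)" if "n \<in> I" for n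
    using that
  proof (induction n rule: less_induct)
    case (less n)
    have IH: "e k \<in> fspan x (I \<inter> {..<n})" "e k \<in> V" "ip (e k) (e k) = 1" if "k \<in> I \<inter> {..<n}" for k
    proof -
      have "fspan x (I \<inter> {..k}) \<subseteq> fspan x (I \<inter> {..<n})" by (rule fspan_mono) (use that in auto)
      with less that show "e k \<in> fspan x (I \<inter> {..<n})" "e k \<in> V" "ip (e k) (e k) = 1" by auto
    qed
    have orth: "ip (e j) (e k) = 0" if "j \<in> I" "k \<in> I" "j < n" "k < n" "j \<noteq> k" for j k
    proof (cases "k < j")
      case True
      then show ?thesis using less that by auto
    next
      case False
      then have "ip (e k) (e j) = 0" using less that by auto
      then show ?thesis using ip_herm[of "e k" "e j"] IH that by auto
    qed
    define s where "s = gsum (\<lambda>k. ip (x n) (e k)) e (I \<inter> {..<n})"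
    have sV: "s \<in> V" unfolding s_def using IH by (intro gsum_in) auto
    have pn: "p n = gsub (x n) s" by (simp add: p_def s_def)
    have pV: "p n \<in> V" unfolding pn using x less.prems sV by (simp add: gsub_in)
    have "s \<in> fspan x (I \<inter> {..<n})"
      unfolding s_def using IH by (intro gsum_in_fspan) auto
    then obtain c A where s: "s = gsum c x A" "finite A" "A \<subseteq> I \<inter> {..<n}"
      by (auto simp: fspan_def)
    define d where "d k = (if k = n then 1 else - c k)" for k
    have nA: "n \<notin> A" using s by auto
    have "gsum d x A = gscale (-1) s"
    proof -
      have "gsum d x A = gsum (\<lambda>k. - c k) x A"
        using nA by (intro gsum_cong) (auto simp: d_def)
      then show ?thesis by (simp add: s gsum_def gscale_def sum_negf)
    qed
    then have pd: "p n = gsum d x (insert n A)"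
      using nA s unfolding pn by (simp add: gsum_insert d_def) (simp add: glin_def gscale_def gsub_def)
    have insub: "insert n A \<subseteq> I" using s less.prems by auto
    \<comment> \<open>The coefficient of \<open>x n\<close> in \<open>p n\<close> is one, so the lower estimate keeps \<open>p n\<close> away from zero.\<close>
    have "m * 1 \<le> m * (\<Sum>k\<in>insert n A. (cmod (d k))\<^sup>2)"
      using \<open>0 < m\<close> nA s by (intro mult_left_mono) (simp_all add: d_def sum_nonneg)
    also have "\<dots> \<le> (nrm (p n))\<^sup>2" unfolding pd using s insub by (intro low) auto
    finally have "0 < (nrm (p n))\<^sup>2" using \<open>0 < m\<close> by linarith
    then have np: "0 < nrm (p n)" using nrm_nonneg[OF pV] by (simp add: zero_less_power2)
    have eV: "e n \<in> V" unfolding e normalized_def using pV by (rule gscale_in)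
    have "nrm (e n) = 1" unfolding e normalized_def using np pV by (simp add: nrm_gscale norm_divide)
    then have e1: "ip (e n) (e n) = 1" using ip_self[OF eV] by simp
    have "p n \<in> fspan x (I \<inter> {..n})"
      unfolding pd using s less.prems by (intro fspanI) auto
    then have es: "e n \<in> fspan x (I \<inter> {..n})"
      unfolding e normalized_def gscale_glin by (intro fspan_glin)
    have "ip (e n) (e k) = 0" if k: "k \<in> I" "k < n" for k
    proof -
      have kV: "e k \<in> V" using IH k by auto
      have "ip s (e k) = (\<Sum>j\<in>I \<inter> {..<n}. ip (x n) (e j) * ip (e j) (e k))"
        unfolding s_def using IH kV by (intro ip_gsum_left) auto
      also have "\<dots> = (\<Sum>j\<in>I \<inter> {..<n}. if j = k then ip (x n) (e j) else 0)"
        using IH k orth by (intro sum.cong) auto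
      also have "\<dots> = ip (x n) (e k)" using k by simp
      finally have "ip (p n) (e k) = 0"
        unfolding pn using x less.prems sV kV by (simp add: ip_gsub_left)
      then show ?thesis unfolding e[of n] normalized_def using pV kV by (simp add: ip_gscale_left)
    qed
    then show ?case using es eV np pV e1 by blast
  qed
  have 1: "e n \<in> V" if "n \<in> I" for n using main that by blast
  have 2: "ip (e m) (e n) = (if m = n then 1 else 0)" if "m \<in> I" "n \<in> I" for m n
  proof (cases m n rule: linorder_cases)
    case less
    then have "ip (e n) (e m) = 0" using main that by blast
    then show ?thesis using ip_herm[of "e n" "e m"] 1 that less by simp
  next
    case equal
    then show ?thesis using main that by simp
  next
    case greater
    then show ?thesis using main that by simp
  qed
  have 3: "x n \<in> fspan e I" if "n \<in> I" for n
  proof -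
    have "x n = glin (of_real (nrm (p n))) (e n) 1 (gsum (\<lambda>k. ip (x n) (e k)) e (I \<inter> {..<n}))"
    proof -
      have "0 < nrm (p n)" using main that by blast
      then have "gscale (of_real (nrm (p n))) (e n) = p n"
        unfolding e normalized_def by (simp add: gscale_def field_simps)
      then show ?thesis unfolding p_def gscale_def gsub_def glin_def
        by (simp add: fun_eq_iff)
    qed
    moreover have "\<dots> \<in> fspan e I"
      using that by (intro fspan_glin fspan_base fspanI) auto
    ultimately show ?thesis by simp
  qed
  show ?thesis
    using that[of e] 1 2 fspan_trans[of I x e I] 3 by blast
qed

end

context complete_semi_ip
begin

text \<open>The closure of the graph of the map that takes a finite combination of \<open>e\<close> to the combination
  of \<open>x\<close> with the same coefficients. If both families are total and the two combinations have
  comparable seminorms, this closure is the graph of an isomorphism up to functions of seminorm zero.\<close>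

definition graph_closure :: "nat set \<Rightarrow> (nat \<Rightarrow> gfun) \<Rightarrow> (nat \<Rightarrow> gfun) \<Rightarrow> gfun \<Rightarrow> gfun \<Rightarrow> bool" where
  "graph_closure I e x w z \<longleftrightarrow> w \<in> V \<and> z \<in> V \<and>
     (\<forall>\<epsilon>>0. \<exists>A c. finite A \<and> A \<subseteq> I \<and> nrm (gsub w (gsum c e A)) < \<epsilon> \<and> nrm (gsub z (gsum c x A)) < \<epsilon>)"

lemma graph_closure_commute: "graph_closure I e x w z \<longleftrightarrow> graph_closure I x e z w"
  unfolding graph_closure_def by blast

lemma graph_closure_glin:
  assumes eV: "\<And>n. n \<in> I \<Longrightarrow> e n \<in> V" and xV: "\<And>n. n \<in> I \<Longrightarrow> x n \<in> V"
    and w: "graph_closure I e x w z" and w': "graph_closure I e x w' z'"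
  shows "graph_closure I e x (glin a w b w') (glin a z b z')"
proof -
  have V: "w \<in> V" "z \<in> V" "w' \<in> V" "z' \<in> V" using w w' by (auto simp: graph_closure_def)
  have "\<exists>A c. finite A \<and> A \<subseteq> I \<and> nrm (gsub (glin a w b w') (gsum c e A)) < \<epsilon> \<and>
      nrm (gsub (glin a z b z') (gsum c x A)) < \<epsilon>" if "\<epsilon> > 0" for \<epsilon>
  proof -
    define \<delta> where "\<delta> = \<epsilon> / (cmod a + cmod b + 1)"
    have ab: "0 < cmod a + cmod b + 1" using norm_ge_zero[of a] norm_ge_zero[of b] by linarith
    have \<delta>: "\<delta> > 0" using ab that by (simp add: \<delta>_def)
    have lt: "cmod a * \<delta> + cmod b * \<delta> < \<epsilon>"
    proof -
      have "(cmod a + cmod b) * \<delta> < (cmod a + cmod b + 1) * \<delta>" using \<delta> by simp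
      also have "\<dots> = \<epsilon>" using ab by (simp add: \<delta>_def)
      finally show ?thesis by (simp add: distrib_right)
    qed
    obtain A c where A: "finite A" "A \<subseteq> I" "nrm (gsub w (gsum c e A)) < \<delta>" "nrm (gsub z (gsum c x A)) < \<delta>"
      using w \<delta> unfolding graph_closure_def by blast
    obtain B d where B: "finite B" "B \<subseteq> I" "nrm (gsub w' (gsum d e B)) < \<delta>" "nrm (gsub z' (gsum d x B)) < \<delta>"
      using w' \<delta> unfolding graph_closure_def by blast
    define h where "h = (\<lambda>n. a * (if n \<in> A then c n else 0) + b * (if n \<in> B then d n else 0))"
    have bound: "nrm (gsub (glin a u b u') (gsum h y (A \<union> B))) < \<epsilon>"
      if y: "\<And>n. n \<in> I \<Longrightarrow> y n \<in> V" and u: "u \<in> V" "u' \<in> V"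
        and s: "nrm (gsub u (gsum c y A)) < \<delta>" "nrm (gsub u' (gsum d y B)) < \<delta>" for y u u'
    proof -
      have yV: "gsum c y A \<in> V" "gsum d y B \<in> V" using A B y by (auto intro!: gsum_in)
      have "gsum h y (A \<union> B) = glin a (gsum c y A) b (gsum d y B)"
        using gsum_superset[of "A \<union> B" A c y] gsum_superset[of "A \<union> B" B d y] A B
        by (simp add: glin_gsum h_def)
      then have "gsub (glin a u b u') (gsum h y (A \<union> B))
          = glin a (gsub u (gsum c y A)) b (gsub u' (gsum d y B))"
        by (simp add: glin_def gsub_def algebra_simps)
      then have "nrm (gsub (glin a u b u') (gsum h y (A \<union> B))) \<le>
          cmod a * nrm (gsub u (gsum c y A)) + cmod b * nrm (gsub u' (gsum d y B))"
        using nrm_glin gsub_in u yV by simp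
      also have "\<dots> \<le> cmod a * \<delta> + cmod b * \<delta>"
        using s by (intro add_mono mult_left_mono) auto
      finally show ?thesis using lt by simp
    qed
    show ?thesis
      using bound[of e w w'] bound[of x z z'] A B V eV xV
      by (intro exI[of _ "A \<union> B"] exI[of _ h]) auto
  qed
  then show ?thesis unfolding graph_closure_def using V by (auto intro: glin_in)
qed

lemma graph_closure_bound:
  assumes eV: "\<And>n. n \<in> I \<Longrightarrow> e n \<in> V" and xV: "\<And>n. n \<in> I \<Longrightarrow> x n \<in> V"
    and "0 \<le> b"
    and b: "\<And>A c. finite A \<Longrightarrow> A \<subseteq> I \<Longrightarrow> nrm (gsum c x A) \<le> b * nrm (gsum c e A)"
    and w: "graph_closure I e x w z"
  shows "nrm z \<le> b * nrm w"
proof (rule field_le_epsilon)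
  fix \<epsilon> :: real assume "0 < \<epsilon>"
  define \<delta> where "\<delta> = \<epsilon> / (b + 1)"
  have \<delta>: "\<delta> > 0" using \<open>0 \<le> b\<close> \<open>0 < \<epsilon>\<close> by (simp add: \<delta>_def)
  have V: "w \<in> V" "z \<in> V" using w by (auto simp: graph_closure_def)
  obtain A c where A: "finite A" "A \<subseteq> I" "nrm (gsub w (gsum c e A)) < \<delta>" "nrm (gsub z (gsum c x A)) < \<delta>"
    using w \<delta> unfolding graph_closure_def by blast
  have sV: "gsum c e A \<in> V" "gsum c x A \<in> V" using A eV xV by (auto intro!: gsum_in)
  have "nrm z \<le> nrm (gsum c x A) + \<delta>"
    using nrm_triangle_sub(1)[OF V(2) sV(2)] A by linarith
  also have "nrm (gsum c x A) \<le> b * nrm (gsum c e A)" using A by (intro b)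
  also have "nrm (gsum c e A) \<le> nrm w + \<delta>"
    using nrm_triangle_sub(2)[OF V(1) sV(1)] A by linarith
  finally have "nrm z \<le> b * (nrm w + \<delta>) + \<delta>" using \<open>0 \<le> b\<close> by (simp add: mult_left_mono)
  also have "\<dots> = b * nrm w + (b + 1) * \<delta>" by (simp add: algebra_simps)
  also have "(b + 1) * \<delta> = \<epsilon>" using \<open>0 \<le> b\<close> by (simp add: \<delta>_def)
  finally show "nrm z \<le> b * nrm w + \<epsilon>" .
qed

lemma graph_closure_total:
  assumes eV: "\<And>n. n \<in> I \<Longrightarrow> e n \<in> V" and xV: "\<And>n. n \<in> I \<Longrightarrow> x n \<in> V"
    and "0 \<le> b"
    and b: "\<And>A c. finite A \<Longrightarrow> A \<subseteq> I \<Longrightarrow> nrm (gsum c x A) \<le> b * nrm (gsum c e A)"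
    and dense: "\<And>w \<epsilon>. w \<in> V \<Longrightarrow> 0 < \<epsilon> \<Longrightarrow> \<exists>A c. finite A \<and> A \<subseteq> I \<and> nrm (gsub w (gsum c e A)) < \<epsilon>"
    and w: "w \<in> V"
  shows "\<exists>z. graph_closure I e x w z"
proof -
  have "\<forall>k::nat. \<exists>A c. finite A \<and> A \<subseteq> I \<and> nrm (gsub w (gsum c e A)) < 1 / (real k + 1)"
    using dense[OF w] by simp
  then obtain A c where A: "\<And>k. finite (A k)" "\<And>k. A k \<subseteq> I"
      "\<And>k::nat. nrm (gsub w (gsum (c k) e (A k))) < 1 / (real k + 1)"
    by metis
  define s t where "s k = gsum (c k) e (A k)" and "t k = gsum (c k) x (A k)" for k
  have sV: "s k \<in> V" and tV: "t k \<in> V" for k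
    unfolding s_def t_def using A(1) eV[OF subsetD[OF A(2)]] xV[OF subsetD[OF A(2)]] by (auto intro!: gsum_in)
  have diff: "nrm (gsub (t j) (t k)) \<le> b * nrm (gsub (s j) (s k))" for j k
  proof -
    define h where "h = (\<lambda>n. 1 * (if n \<in> A j then c j n else 0) + (-1) * (if n \<in> A k then c k n else 0))"
    have h: "gsub (gsum (c j) y (A j)) (gsum (c k) y (A k)) = gsum h y (A j \<union> A k)" for y
      using gsum_superset[of "A j \<union> A k" "A j" "c j" y] gsum_superset[of "A j \<union> A k" "A k" "c k" y] A
      by (simp only: gsub_glin glin_gsum h_def finite_Un Un_upper1 Un_upper2 simp_thms)
    show ?thesis unfolding s_def t_def h using A by (intro b) auto
  qed
  have small: "nrm (gsub (s j) (s k)) < \<epsilon>" if N: "2 / \<epsilon> < real N" "0 < \<epsilon>" "N \<le> j" "N \<le> k" for j k N \<epsilon>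
  proof -
    have "nrm (gsub (s j) (s k)) \<le> nrm (gsub w (s j)) + nrm (gsub w (s k))"
      using nrm_triangle[OF sV w sV, of j k] nrm_gsub_commute[OF sV w, of j] by simp
    also have "\<dots> < 1 / (real j + 1) + 1 / (real k + 1)"
      using A(3)[of j] A(3)[of k] by (simp add: s_def)
    also have "\<dots> \<le> 1 / real N + 1 / real N"
    proof -
      have "0 < real N" using N by (smt (verit) divide_pos_pos)
      then show ?thesis using N by (intro add_mono divide_left_mono) auto
    qed
    also have "\<dots> < \<epsilon>"
    proof -
      have "0 < real N" using N by (smt (verit) divide_pos_pos)
      then show ?thesis using N by (simp add: field_simps)
    qed
    finally show ?thesis .
  qed
  have "\<exists>z\<in>V. \<forall>\<epsilon>>0. \<exists>N. \<forall>k\<ge>N. nrm (gsub (t k) z) < \<epsilon>"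
  proof (rule complete)
    fix \<epsilon> :: real assume "0 < \<epsilon>"
    define \<delta> where "\<delta> = \<epsilon> / (b + 1)"
    have \<delta>: "\<delta> > 0" using \<open>0 \<le> b\<close> \<open>0 < \<epsilon>\<close> by (simp add: \<delta>_def)
    obtain N :: nat where N: "2 / \<delta> < real N" using reals_Archimedean2 by blast
    have "nrm (gsub (t j) (t k)) < \<epsilon>" if "N \<le> j" "N \<le> k" for j k
    proof -
      have "nrm (gsub (t j) (t k)) \<le> b * \<delta>"
        using diff[of j k] small[OF N \<delta> that] \<open>0 \<le> b\<close>
        by (meson less_imp_le mult_left_mono order_trans)
      also have "\<dots> < (b + 1) * \<delta>" using \<delta> by simp
      also have "\<dots> = \<epsilon>" using \<open>0 \<le> b\<close> by (simp add: \<delta>_def)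
      finally show ?thesis .
    qed
    then show "\<exists>N. \<forall>j\<ge>N. \<forall>k\<ge>N. nrm (gsub (t j) (t k)) < \<epsilon>" by blast
  qed (rule tV)
  then obtain z where z: "z \<in> V" "\<And>\<epsilon>. \<epsilon> > 0 \<Longrightarrow> \<exists>N. \<forall>k\<ge>N. nrm (gsub (t k) z) < \<epsilon>" by blast
  have "\<exists>A c. finite A \<and> A \<subseteq> I \<and> nrm (gsub w (gsum c e A)) < \<epsilon> \<and> nrm (gsub z (gsum c x A)) < \<epsilon>"
    if \<epsilon>: "\<epsilon> > 0" for \<epsilon>
  proof -
    obtain N where N: "\<forall>k\<ge>N. nrm (gsub (t k) z) < \<epsilon>" using z(2)[OF \<epsilon>] by blast
    obtain M :: nat where M: "1 / \<epsilon> < real M" using reals_Archimedean2 by blast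
    define k where "k = max N M"
    have "1 / (real k + 1) < \<epsilon>"
    proof -
      have "1 / \<epsilon> < real k + 1" using M by (simp add: k_def)
      then show ?thesis using \<epsilon> by (simp add: field_simps)
    qed
    then have "nrm (gsub w (gsum (c k) e (A k))) < \<epsilon>" using A(3)[of k] by linarith
    moreover have "nrm (gsub z (gsum (c k) x (A k))) < \<epsilon>"
    proof -
      have "nrm (gsub (t k) z) < \<epsilon>" using N by (simp add: k_def)
      then show ?thesis using nrm_gsub_commute[OF tV z(1), of k] by (simp add: t_def)
    qed
    ultimately show ?thesis using A(1,2)[of k] by (intro exI[of _ "A k"] exI[of _ "c k"] conjI)
  qed
  then have "graph_closure I e x w z" unfolding graph_closure_def using w z(1) by simp
  then show ?thesis by blast
qed

text \<open>A total family with two-sided coefficient estimates is a Riesz basis: it is the image of its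
  orthonormalization under the isomorphism that matches coefficients.\<close>

theorem riesz_basis_criterion:
  assumes xV: "\<And>n. n \<in> I \<Longrightarrow> x n \<in> V"
    and "0 < m" "0 \<le> M"
    and low: "\<And>A c. finite A \<Longrightarrow> A \<subseteq> I \<Longrightarrow> m * (\<Sum>n\<in>A. (cmod (c n))\<^sup>2) \<le> (nrm (gsum c x A))\<^sup>2"
    and up: "\<And>A c. finite A \<Longrightarrow> A \<subseteq> I \<Longrightarrow> (nrm (gsum c x A))\<^sup>2 \<le> M * (\<Sum>n\<in>A. (cmod (c n))\<^sup>2)"
    and dense: "\<And>w \<epsilon>. w \<in> V \<Longrightarrow> 0 < \<epsilon> \<Longrightarrow> \<exists>A c. finite A \<and> A \<subseteq> I \<and> nrm (gsub w (gsum c x A)) < \<epsilon>"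
  shows "riesz_basis V ip I x"
proof -
  obtain e where eV: "\<And>n. n \<in> I \<Longrightarrow> e n \<in> V"
    and eo: "\<And>m n. m \<in> I \<Longrightarrow> n \<in> I \<Longrightarrow> ip (e m) (e n) = (if m = n then 1 else 0)"
    and sp: "fspan x I \<subseteq> fspan e I"
    using orthonormalization[OF xV \<open>0 < m\<close> low] by blast
  have sq: "(nrm (gsum c e A))\<^sup>2 = (\<Sum>n\<in>A. (cmod (c n))\<^sup>2)" if "finite A" "A \<subseteq> I" for A c
    using that eV eo by (intro nrm_gsum_orthonormal) (auto simp: subset_iff)
  have up': "nrm (gsum c x A) \<le> sqrt M * nrm (gsum c e A)" if "finite A" "A \<subseteq> I" for A c
  proof (rule power2_le_imp_le)
    show "(nrm (gsum c x A))\<^sup>2 \<le> (sqrt M * nrm (gsum c e A))\<^sup>2"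
      using up[OF that, of c] sq[OF that, of c] \<open>0 \<le> M\<close> by (simp add: power_mult_distrib)
    show "0 \<le> sqrt M * nrm (gsum c e A)"
      using that eV \<open>0 \<le> M\<close> by (intro mult_nonneg_nonneg nrm_nonneg gsum_in) auto
  qed
  have low': "nrm (gsum c e A) \<le> (1 / sqrt m) * nrm (gsum c x A)" if "finite A" "A \<subseteq> I" for A c
  proof (rule power2_le_imp_le)
    show "(nrm (gsum c e A))\<^sup>2 \<le> (1 / sqrt m * nrm (gsum c x A))\<^sup>2"
      using low[OF that, of c] sq[OF that, of c] \<open>0 < m\<close>
      by (simp add: power_mult_distrib power_divide field_simps)
    show "0 \<le> 1 / sqrt m * nrm (gsum c x A)"
      using that xV \<open>0 < m\<close> by (intro mult_nonneg_nonneg nrm_nonneg gsum_in) auto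
  qed
  have edense: "\<exists>A c. finite A \<and> A \<subseteq> I \<and> nrm (gsub w (gsum c e A)) < \<epsilon>" if "w \<in> V" "0 < \<epsilon>" for w \<epsilon>
  proof -
    obtain A c where A: "finite A" "A \<subseteq> I" "nrm (gsub w (gsum c x A)) < \<epsilon>"
      using dense[OF \<open>w \<in> V\<close> \<open>0 < \<epsilon>\<close>] by blast
    have "gsum c x A \<in> fspan e I" using fspanI[OF A(1,2), of c x] sp by blast
    then obtain B d where "gsum c x A = gsum d e B" "finite B" "B \<subseteq> I" by (auto simp: fspan_def)
    then show ?thesis using A by metis
  qed
  have ob: "orthonormal_basis V ip I e"
    unfolding orthonormal_basis_def
  proof (intro conjI ballI allI impI)
    show "e n \<in> V" if "n \<in> I" for n using eV that .
    show "ip (e m) (e n) = (if m = n then 1 else 0)" if "m \<in> I" "n \<in> I" for m n using eo that .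
    show "\<exists>A c. finite A \<and> A \<subseteq> I \<and> nrm (gsub w (gsum c e A)) < \<epsilon>" if "w \<in> V" "0 < \<epsilon>" for w \<epsilon>
      using edense that .
  qed
  define T where "T w = (SOME z. graph_closure I e x w z)" for w
  have T: "graph_closure I e x w (T w)" if "w \<in> V" for w
  proof -
    have "\<exists>z. graph_closure I e x w z"
      by (rule graph_closure_total[OF eV xV _ up' edense that]) (simp_all add: \<open>0 \<le> M\<close>)
    then show ?thesis unfolding T_def by (rule someI_ex)
  qed
  have ub: "nrm z \<le> sqrt M * nrm w" if "graph_closure I e x w z" for w z
    by (rule graph_closure_bound[OF eV xV _ up' that]) (simp_all add: \<open>0 \<le> M\<close>)
  have lb: "nrm w \<le> 1 / sqrt m * nrm z" if "graph_closure I e x w z" for w z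
  proof -
    have "graph_closure I x e z w" using that graph_closure_commute by simp
    then show ?thesis by (rule graph_closure_bound[OF xV eV _ low', rotated -1]) (simp_all add: less_imp_le \<open>0 < m\<close>)
  qed
  have TV: "T w \<in> V" if "w \<in> V" for w using T[OF that] by (simp add: graph_closure_def)
  \<comment> \<open>The closed graph determines the value of \<open>T\<close> up to seminorm zero.\<close>
  have uniq: "nrm (gsub z z') = 0" if "graph_closure I e x w z" "graph_closure I e x w z'" for w z z'
  proof -
    have "graph_closure I e x (glin 1 w (-1) w) (glin 1 z (-1) z')"
      using that eV xV by (intro graph_closure_glin)
    from ub[OF this] have "nrm (gsub z z') \<le> sqrt M * nrm (\<lambda>i t. 0)"
      by (simp add: gsub_def glin_def)
    moreover have "nrm (\<lambda>i t. 0) = 0"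
      using zero_in ip_zero_left by (simp add: form_norm_def)
    moreover have "0 \<le> nrm (gsub z z')"
      using that by (intro nrm_nonneg gsub_in) (auto simp: graph_closure_def)
    ultimately show ?thesis by simp
  qed
  have lin: "nrm (gsub (T (glin a u b v)) (glin a (T u) b (T v))) = 0" if "u \<in> V" "v \<in> V" for a b u v
    by (rule uniq[of "glin a u b v"])
      (use that in \<open>simp_all add: T glin_in eV xV graph_closure_glin\<close>)
  \<comment> \<open>The roles of \<open>e\<close> and \<open>x\<close> are exchanged.\<close>
  have onto: "\<exists>w\<in>V. nrm (gsub (T w) z) = 0" if "z \<in> V" for z
  proof -
    have "\<exists>w. graph_closure I x e z w"
      by (rule graph_closure_total[OF xV eV _ low' dense that]) (simp_all add: less_imp_le \<open>0 < m\<close>)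
    then obtain w where "graph_closure I x e z w" ..
    then have w: "graph_closure I e x w z" using graph_closure_commute by simp
    then have "w \<in> V" by (simp add: graph_closure_def)
    then show ?thesis using uniq[OF T[OF \<open>w \<in> V\<close>] w] by (intro bexI)
  qed
  have Te: "nrm (gsub (T (e n)) (x n)) = 0" if "n \<in> I" for n
  proof (rule uniq[OF T])
    have z: "nrm (gsub u u) = 0" if "u \<in> V" for u
      using nrm_glin[OF that that, of 1 "-1"] nrm_gscale[OF that, of 0]
      by (simp add: gsub_def gscale_def)
    have "gsum (\<lambda>_. 1) y {n} = y n" for y by (simp add: gsum_def)
    then have "\<exists>A c. finite A \<and> A \<subseteq> I \<and> nrm (gsub (e n) (gsum c e A)) < \<epsilon> \<and>
        nrm (gsub (x n) (gsum c x A)) < \<epsilon>" if "\<epsilon> > 0" for \<epsilon>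
      using that z[OF eV[OF \<open>n \<in> I\<close>]] z[OF xV[OF \<open>n \<in> I\<close>]] \<open>n \<in> I\<close>
      by (intro exI[of _ "{n}"] exI[of _ "\<lambda>_. 1"]) simp
    then show "graph_closure I e x (e n) (x n)"
      unfolding graph_closure_def using eV[OF \<open>n \<in> I\<close>] xV[OF \<open>n \<in> I\<close>] by simp
  qed (rule eV[OF that])
  have "sqrt m * nrm u \<le> nrm (T u) \<and> nrm (T u) \<le> sqrt M * nrm u" if "u \<in> V" for u
    using lb[OF T[OF that]] ub[OF T[OF that]] \<open>0 < m\<close> by (simp add: field_simps)
  then have "\<exists>c C. 0 < c \<and> (\<forall>u\<in>V. c * nrm u \<le> nrm (T u) \<and> nrm (T u) \<le> C * nrm u)"
    using \<open>0 < m\<close> by (intro exI[of _ "sqrt m"] exI[of _ "sqrt M"]) simp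
  then have "isomorphism_on V ip T"
    unfolding isomorphism_on_def using TV lin onto by simp
  then show ?thesis
    unfolding riesz_basis_def using xV ob Te by (intro conjI ballI exI[of _ e] exI[of _ T])
qed

end

section \<open>Square integrable functions\<close>

text \<open>Square integrable functions on one edge, and the square of their norm.\<close>

definition sqint :: "(real \<Rightarrow> complex) \<Rightarrow> bool" where
  "sqint u \<longleftrightarrow> u \<in> borel_measurable unit_leb \<and> integrable unit_leb (\<lambda>t. (cmod (u t))\<^sup>2)"

definition sqn :: "(real \<Rightarrow> complex) \<Rightarrow> real" where
  "sqn u = (\<integral>t. (cmod (u t))\<^sup>2 \<partial>unit_leb)"

lemma L2_sqint: "L2 E = {y. \<forall>i\<in>E. sqint (y i)}"
  by (simp add: L2_def sqint_def)

lemma unit_leb_finite: "finite_measure unit_leb"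
  by (rule finite_measure_lebesgue_on) simp

lemma unit_leb_measure: "measure unit_leb {0..1} = 1"
  by (simp add: measure_restrict_space)

lemma unit_leb_const [simp]: "(\<integral>t. c \<partial>unit_leb) = (c :: 'a :: {banach, second_countable_topology})"
  by (simp add: unit_leb_measure)

lemma unit_leb_const_integrable [simp]: "integrable unit_leb (\<lambda>t. c :: 'a :: {banach, second_countable_topology})"
  using finite_measure.integrable_const[OF unit_leb_finite] .

lemma sqint_measurable [measurable_dest]: "sqint u \<Longrightarrow> u \<in> borel_measurable unit_leb"
  by (simp add: sqint_def)

lemma sqn_nonneg [simp]: "0 \<le> sqn u"
  by (simp add: sqn_def)

lemma sqint_bound:
  assumes "u \<in> borel_measurable unit_leb" "integrable unit_leb g"
    and "AE t in unit_leb. (cmod (u t))\<^sup>2 \<le> g t"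
  shows "sqint u"
  unfolding sqint_def
proof
  show "integrable unit_leb (\<lambda>t. (cmod (u t))\<^sup>2)"
    by (rule Bochner_Integration.integrable_bound[OF assms(2)]) (use assms in \<open>auto elim!: eventually_mono\<close>)
qed fact

lemma sqint_mult_integrable:
  assumes "sqint u" "sqint v"
  shows "integrable unit_leb (\<lambda>t. u t * v t)"
proof (rule Bochner_Integration.integrable_bound)
  show "integrable unit_leb (\<lambda>t. (cmod (u t))\<^sup>2 + (cmod (v t))\<^sup>2)"
    using assms by (simp add: sqint_def)
  show "(\<lambda>t. u t * v t) \<in> borel_measurable unit_leb"
    using assms by (intro borel_measurable_times) (simp_all add: sqint_def)
  have "cmod a * cmod b \<le> (cmod a)\<^sup>2 + (cmod b)\<^sup>2" for a b :: complex
    using zero_le_power2[of "cmod a - cmod b"] zero_le_power2[of "cmod a"] zero_le_power2[of "cmod b"]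
    unfolding power2_diff by linarith
  then show "AE t in unit_leb. norm (u t * v t) \<le> norm ((cmod (u t))\<^sup>2 + (cmod (v t))\<^sup>2)"
    by (simp add: norm_mult)
qed

lemma cnj_measurable [measurable]: "cnj \<in> borel_measurable borel"
  by (intro borel_measurable_continuous_onI continuous_intros)

lemma sqint_cnj [simp]: "sqint (\<lambda>t. cnj (u t)) \<longleftrightarrow> sqint u"
proof -
  have m: "(\<lambda>t. cnj (w t)) \<in> borel_measurable unit_leb" if "w \<in> borel_measurable unit_leb" for w
    using measurable_compose[OF that cnj_measurable] .
  have "(\<lambda>t. cnj (u t)) \<in> borel_measurable unit_leb \<longleftrightarrow> u \<in> borel_measurable unit_leb"
    using m[of u] m[of "\<lambda>t. cnj (u t)"] by (intro iffI) simp_all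
  then show ?thesis by (simp add: sqint_def)
qed

lemma sqint_mult_cnj_integrable:
  "sqint u \<Longrightarrow> sqint v \<Longrightarrow> integrable unit_leb (\<lambda>t. u t * cnj (v t))"
  by (rule sqint_mult_integrable) simp_all

lemma sqint_const [simp]: "sqint (\<lambda>t. c)"
  by (simp add: sqint_def)

lemma sqint_integrable: "sqint u \<Longrightarrow> integrable unit_leb u"
  using sqint_mult_integrable[of u "\<lambda>t. 1"] by simp

lemma sqint_bounded_mult:
  assumes "h \<in> borel_measurable unit_leb" "AE t in unit_leb. cmod (h t) \<le> C" "sqint u"
  shows "sqint (\<lambda>t. h t * u t)"
proof (rule sqint_bound)
  show "(\<lambda>t. h t * u t) \<in> borel_measurable unit_leb"
    using assms by (intro borel_measurable_times) (simp_all add: sqint_def)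
  show "integrable unit_leb (\<lambda>t. C\<^sup>2 * (cmod (u t))\<^sup>2)" using assms by (simp add: sqint_def)
  show "AE t in unit_leb. (cmod (h t * u t))\<^sup>2 \<le> C\<^sup>2 * (cmod (u t))\<^sup>2"
    using assms(2) by eventually_elim (simp add: norm_mult power_mult_distrib mult_right_mono power_mono)
qed

lemma sqint_bounded:
  assumes "u \<in> borel_measurable unit_leb" "AE t in unit_leb. cmod (u t) \<le> C"
  shows "sqint u"
  using sqint_bounded_mult[OF assms, of "\<lambda>t. 1"] by simp

lemma sqint_lin:
  assumes "sqint u" "sqint v"
  shows "sqint (\<lambda>t. a * u t + b * v t)"
proof (rule sqint_bound)
  show "(\<lambda>t. a * u t + b * v t) \<in> borel_measurable unit_leb"
    using assms by (intro borel_measurable_times borel_measurable_add borel_measurable_const)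
      (simp_all add: sqint_def)
  show "integrable unit_leb (\<lambda>t. 2 * (cmod a)\<^sup>2 * (cmod (u t))\<^sup>2 + 2 * (cmod b)\<^sup>2 * (cmod (v t))\<^sup>2)"
    using assms by (simp add: sqint_def)
  have "(cmod (a * x + b * y))\<^sup>2 \<le> 2 * (cmod a)\<^sup>2 * (cmod x)\<^sup>2 + 2 * (cmod b)\<^sup>2 * (cmod y)\<^sup>2" for x y
  proof -
    have "(cmod (a * x + b * y))\<^sup>2 \<le> (cmod (a * x) + cmod (b * y))\<^sup>2"
      by (intro power_mono norm_triangle_ineq) simp
    also have "\<dots> \<le> 2 * (cmod (a * x))\<^sup>2 + 2 * (cmod (b * y))\<^sup>2"
      using zero_le_power2[of "cmod (a * x) - cmod (b * y)"] unfolding power2_sum power2_diff by linarith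
    finally show ?thesis by (simp add: norm_mult power_mult_distrib)
  qed
  then show "AE t in unit_leb. (cmod (a * u t + b * v t))\<^sup>2 \<le>
      2 * (cmod a)\<^sup>2 * (cmod (u t))\<^sup>2 + 2 * (cmod b)\<^sup>2 * (cmod (v t))\<^sup>2" by simp
qed

lemma sqint_add: "sqint u \<Longrightarrow> sqint v \<Longrightarrow> sqint (\<lambda>t. u t + v t)"
  using sqint_lin[of u v 1 1] by simp

lemma sqint_diff: "sqint u \<Longrightarrow> sqint v \<Longrightarrow> sqint (\<lambda>t. u t - v t)"
  using sqint_lin[of u v 1 "-1"] by simp

lemma sqint_cmult: "sqint u \<Longrightarrow> sqint (\<lambda>t. a * u t)"
  using sqint_lin[of u u a 0] by simp

lemma unit_leb_AE_eq_measurable: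
  fixes u v :: "real \<Rightarrow> complex"
  assumes "u \<in> borel_measurable unit_leb" "AE t in unit_leb. u t = v t"
  shows "v \<in> borel_measurable unit_leb"
proof -
  have "(\<lambda>x. if x \<in> {0..1} then u x else 0) \<in> borel_measurable lebesgue"
    using assms(1) by (subst borel_measurable_if) auto
  moreover have "AE x in lebesgue. (if x \<in> {0..1} then u x else 0) = (if x \<in> {0..1} then v x else 0)"
    using assms(2) by (subst (asm) AE_restrict_space_iff) (auto elim!: eventually_mono)
  ultimately have "(\<lambda>x. if x \<in> {0..1} then v x else 0) \<in> borel_measurable lebesgue"
    by (rule borel_measurable_AE)
  then show ?thesis by (subst (asm) borel_measurable_if) auto
qed

lemma sqint_AE_cong:
  assumes "sqint u" "AE t in unit_leb. u t = v t"
  shows "sqint v" "sqn v = sqn u"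
proof -
  have m: "v \<in> borel_measurable unit_leb"
    by (rule unit_leb_AE_eq_measurable[OF sqint_measurable[OF assms(1)] assms(2)])
  have "AE t in unit_leb. (cmod (v t))\<^sup>2 \<le> (cmod (u t))\<^sup>2"
    using assms(2) by eventually_elim simp
  with m assms(1) show "sqint v" by (intro sqint_bound[of v "\<lambda>t. (cmod (u t))\<^sup>2"]) (auto simp: sqint_def)
  have "AE t in unit_leb. (cmod (v t))\<^sup>2 = (cmod (u t))\<^sup>2"
    using assms(2) by eventually_elim simp
  then show "sqn v = sqn u"
    unfolding sqn_def using m assms(1) by (intro integral_cong_AE) (auto simp: sqint_def)
qed

lemma sqint_continuous:
  assumes "continuous_on {0..1} u"
  shows "sqint u"
proof -
  have "bounded (u ` {0..1})"
    using assms by (intro compact_imp_bounded compact_continuous_image) auto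
  then obtain C where "\<forall>t\<in>{0..1}. cmod (u t) \<le> C"
    by (auto simp: bounded_iff)
  moreover have "u \<in> borel_measurable unit_leb"
    using assms by (intro continuous_imp_measurable_on_sets_lebesgue) auto
  ultimately show ?thesis by (intro sqint_bounded[of u C]) auto
qed

lemma sqn_mono:
  assumes "sqint u" "sqint v" "AE t in unit_leb. cmod (u t) \<le> C * cmod (v t)" "0 \<le> C"
  shows "sqn u \<le> C\<^sup>2 * sqn v"
proof -
  have "sqn u \<le> (\<integral>t. C\<^sup>2 * (cmod (v t))\<^sup>2 \<partial>unit_leb)"
    unfolding sqn_def
  proof (rule integral_mono_AE)
    show "AE t in unit_leb. (cmod (u t))\<^sup>2 \<le> C\<^sup>2 * (cmod (v t))\<^sup>2"
      using assms(3)
      by eventually_elim (metis norm_ge_zero power_mono power_mult_distrib)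
  qed (use assms in \<open>auto simp: sqint_def\<close>)
  then show ?thesis by (simp add: sqn_def)
qed

lemma sqn_lin:
  assumes "sqint u" "sqint v"
  shows "sqn (\<lambda>t. a * u t + b * v t) \<le> 2 * (cmod a)\<^sup>2 * sqn u + 2 * (cmod b)\<^sup>2 * sqn v"
proof -
  have "(cmod (a * x + b * y))\<^sup>2 \<le> 2 * (cmod a)\<^sup>2 * (cmod x)\<^sup>2 + 2 * (cmod b)\<^sup>2 * (cmod y)\<^sup>2" for x y
  proof -
    have "(cmod (a * x + b * y))\<^sup>2 \<le> (cmod (a * x) + cmod (b * y))\<^sup>2"
      by (intro power_mono norm_triangle_ineq) simp
    also have "\<dots> \<le> 2 * (cmod (a * x))\<^sup>2 + 2 * (cmod (b * y))\<^sup>2"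
      using zero_le_power2[of "cmod (a * x) - cmod (b * y)"] unfolding power2_sum power2_diff by linarith
    finally show ?thesis by (simp add: norm_mult power_mult_distrib)
  qed
  then have "sqn (\<lambda>t. a * u t + b * v t) \<le>
      (\<integral>t. 2 * (cmod a)\<^sup>2 * (cmod (u t))\<^sup>2 + 2 * (cmod b)\<^sup>2 * (cmod (v t))\<^sup>2 \<partial>unit_leb)"
    unfolding sqn_def using assms sqint_lin[OF assms, of a b] by (intro integral_mono) (auto simp: sqint_def)
  then show ?thesis using assms by (simp add: sqn_def sqint_def)
qed

lemma L2_inner_self: "L2_inner E x x = of_real (\<Sum>i\<in>E. sqn (x i))"
proof -
  have "(\<integral>t. x i t * cnj (x i t) \<partial>unit_leb) = of_real (sqn (x i))" for i
    unfolding sqn_def complex_norm_square[symmetric] by (rule integral_complex_of_real)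
  then show ?thesis by (simp add: L2_inner_def gint_def)
qed

lemma L2_semi_ip: "semi_ip (L2 E) (L2_inner E)"
proof
  show "(\<lambda>i t. 0) \<in> L2 E" by (simp add: L2_sqint)
  fix x y z a b assume x: "x \<in> L2 E" and y: "y \<in> L2 E"
  show "glin a x b y \<in> L2 E" using x y by (auto simp: L2_sqint glin_def intro: sqint_lin)
  show "L2_inner E y x = cnj (L2_inner E x y)"
    unfolding L2_inner_def gint_def cnj_sum by (simp add: mult.commute flip: Bochner_Integration.integral_cnj)
  show "0 \<le> Re (L2_inner E x x)" by (simp add: L2_inner_self sum_nonneg)
  assume z: "z \<in> L2 E"
  have "(\<integral>t. glin a x b y i t * cnj (z i t) \<partial>unit_leb) =
      a * (\<integral>t. x i t * cnj (z i t) \<partial>unit_leb) + b * (\<integral>t. y i t * cnj (z i t) \<partial>unit_leb)" if "i \<in> E" for i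
  proof -
    have i: "integrable unit_leb (\<lambda>t. x i t * cnj (z i t))" "integrable unit_leb (\<lambda>t. y i t * cnj (z i t))"
      using x y z that by (auto simp: L2_sqint intro: sqint_mult_cnj_integrable)
    have "(\<integral>t. glin a x b y i t * cnj (z i t) \<partial>unit_leb) =
       (\<integral>t. a * (x i t * cnj (z i t)) + b * (y i t * cnj (z i t)) \<partial>unit_leb)"
      by (intro Bochner_Integration.integral_cong refl) (simp add: glin_def algebra_simps)
    then show ?thesis using i by simp
  qed
  then show "L2_inner E (glin a x b y) z = a * L2_inner E x z + b * L2_inner E y z"
    by (simp add: L2_inner_def gint_def sum.distrib sum_distrib_left)
qed

lemma L2_norm_sq: "(form_norm (L2_inner E) x)\<^sup>2 = (\<Sum>i\<in>E. sqn (x i))"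
  by (simp add: form_norm_def L2_inner_self sum_nonneg)

lemma sqint_Cauchy_Schwarz:
  assumes "sqint u" "sqint v"
  shows "(cmod (\<integral>t. u t * cnj (v t) \<partial>unit_leb))\<^sup>2 \<le> sqn u * sqn v"
proof -
  interpret semi_ip "L2 {0}" "L2_inner {0}" by (rule L2_semi_ip)
  have "cmod (L2_inner {0} (\<lambda>i. u) (\<lambda>i. v)) \<le> nrm (\<lambda>i. u) * nrm (\<lambda>i. v)"
    using assms by (intro Cauchy_Schwarz) (auto simp: L2_sqint)
  then have "(cmod (L2_inner {0} (\<lambda>i. u) (\<lambda>i. v)))\<^sup>2 \<le> (nrm (\<lambda>i. u))\<^sup>2 * (nrm (\<lambda>i. v))\<^sup>2"
    by (metis norm_ge_zero power_mono power_mult_distrib)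
  then show ?thesis unfolding L2_norm_sq by (simp add: L2_inner_def gint_def)
qed

text \<open>Riesz-Fischer: a rapidly convergent subsequence converges almost everywhere, and Fatou's lemma
  identifies the pointwise limit as the limit in square mean.\<close>

lemma sqint_complete:
  assumes u: "\<And>k::nat. sqint (u k)"
    and cau: "\<And>\<epsilon>. 0 < \<epsilon> \<Longrightarrow> \<exists>N. \<forall>j\<ge>N. \<forall>k\<ge>N. sqn (\<lambda>t. u j t - u k t) < \<epsilon>"
  shows "\<exists>w. sqint w \<and> (\<forall>\<epsilon>>0. \<exists>N. \<forall>k\<ge>N. sqn (\<lambda>t. u k t - w t) < \<epsilon>)"
proof -
  have "\<exists>N. \<forall>j\<ge>N. \<forall>k\<ge>N. sqn (\<lambda>t. u j t - u k t) < (1/4)^n" for n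
    by (rule cau) simp
  then obtain N where N: "\<And>n j k. j \<ge> N n \<Longrightarrow> k \<ge> N n \<Longrightarrow> sqn (\<lambda>t. u j t - u k t) < (1/4)^n"
    by metis
  define r where "r n = (\<Sum>m\<le>n. N m) + n" for n
  have rN: "r n \<ge> N n" "r n \<ge> n" "r (Suc n) \<ge> r n" for n
    unfolding r_def by (auto simp: member_le_sum trans_le_add1)
  have rm: "k \<ge> n \<Longrightarrow> r k \<ge> r n" for n k using rN(3) by (rule lift_Suc_mono_le)
  define g where "g n t = u (r (Suc n)) t - u (r n) t" for n t
  have g: "sqint (g n)" for n unfolding g_def using u by (intro sqint_diff)
  have gm [measurable]: "g n \<in> borel_measurable unit_leb" for n using g by (rule sqint_measurable)
  have um [measurable]: "u n \<in> borel_measurable unit_leb" for n using u by (rule sqint_measurable)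
  have gs: "sqn (g n) < (1/4)^n" for n
    unfolding g_def using N[of n "r (Suc n)" "r n"] rN by (meson order_trans)
  have g1: "(\<integral>t. cmod (g n t) \<partial>unit_leb) \<le> (1/2)^n" for n
  proof -
    \<comment> \<open>The inequality \<open>2 a \<le> l + a\<^sup>2 / l\<close> with \<open>l = 2\<^sup>-\<^sup>n\<close>.\<close>
    define l :: real where "l = (1/2)^n"
    have l: "l > 0" "l * l = (1/4)^n" by (auto simp: l_def power_mult_distrib[symmetric])
    have "cmod (g n t) \<le> l / 2 + (cmod (g n t))\<^sup>2 / (2 * l)" for t
    proof -
      have "0 \<le> (cmod (g n t) - l)\<^sup>2" by simp
      then have "2 * l * cmod (g n t) \<le> l * l + (cmod (g n t))\<^sup>2"
        unfolding power2_diff power2_eq_square[of l] by (simp add: ac_simps)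
      then show ?thesis using l(1) by (simp add: field_simps)
    qed
    then have "(\<integral>t. cmod (g n t) \<partial>unit_leb) \<le> (\<integral>t. l / 2 + (cmod (g n t))\<^sup>2 / (2 * l) \<partial>unit_leb)"
      using g[of n] sqint_integrable[OF g[of n]] by (intro integral_mono) (auto simp: sqint_def)
    also have "\<dots> = l / 2 + sqn (g n) / (2 * l)"
      using g[of n] by (simp add: sqint_def sqn_def unit_leb_measure)
    also have "\<dots> \<le> l / 2 + l * l / (2 * l)"
      using gs[of n] l by (intro add_mono divide_right_mono) auto
    also have "\<dots> = l" using l(1) by simp
    finally show ?thesis by (simp add: l_def)
  qed
  have "(\<integral>\<^sup>+t. (\<Sum>n. ennreal (cmod (g n t))) \<partial>unit_leb) = (\<Sum>n. (\<integral>\<^sup>+t. ennreal (cmod (g n t)) \<partial>unit_leb))"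
    by (intro nn_integral_suminf) measurable
  also have "\<dots> = (\<Sum>n. ennreal (\<integral>t. cmod (g n t) \<partial>unit_leb))"
    using sqint_integrable[OF g] by (subst nn_integral_eq_integral) auto
  also have "\<dots> \<le> (\<Sum>n. ennreal ((1/2)^n))"
    using g1 by (intro suminf_le) (auto intro!: ennreal_leI)
  also have "\<dots> = ennreal (\<Sum>n. (1/2)^n)"
    by (rule suminf_ennreal2) (auto intro: summable_geometric)
  also have "\<dots> < \<infinity>" by simp
  finally have fin: "(\<integral>\<^sup>+t. (\<Sum>n. ennreal (cmod (g n t))) \<partial>unit_leb) \<noteq> \<infinity>" by simp
  have "AE t in unit_leb. (\<Sum>n. ennreal (cmod (g n t))) \<noteq> \<infinity>"
    by (intro nn_integral_noteq_infinite[OF _ fin]) measurable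
  then have conv: "AE t in unit_leb. convergent (\<lambda>n. u (r n) t)"
  proof eventually_elim
    case (elim t)
    then have "summable (\<lambda>n. cmod (g n t))" by (intro summable_suminf_not_top) auto
    then have "summable (\<lambda>n. g n t)" by (rule summable_norm_cancel)
    then have "convergent (\<lambda>n. \<Sum>k<n. g k t)" by (rule summable_iff_convergent[THEN iffD1])
    moreover have "(\<Sum>k<n. g k t) = u (r n) t - u (r 0) t" for n
      unfolding g_def by (rule sum_lessThan_telescope)
    ultimately have "convergent (\<lambda>n. u (r n) t - u (r 0) t + u (r 0) t)"
      by (intro convergent_add convergent_const) simp
    then show ?case by simp
  qed
  define w where "w t = lim (\<lambda>n. u (r n) t)" for t
  have lim: "AE t in unit_leb. (\<lambda>n. u (r n) t) \<longlonglongrightarrow> w t"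
    using conv by eventually_elim (simp add: w_def convergent_LIMSEQ_iff)
  have wm [measurable]: "w \<in> borel_measurable unit_leb"
    unfolding w_def by (intro borel_measurable_lim_metric um)
  have fatou: "integrable unit_leb (\<lambda>t. (cmod (u k t - w t))\<^sup>2) \<and> sqn (\<lambda>t. u k t - w t) \<le> (1/4)^n"
    if k: "k \<ge> N n" for k n
  proof -
    have "(\<integral>\<^sup>+t. ennreal ((cmod (u k t - w t))\<^sup>2) \<partial>unit_leb) =
        (\<integral>\<^sup>+t. liminf (\<lambda>m. ennreal ((cmod (u k t - u (r m) t))\<^sup>2)) \<partial>unit_leb)"
    proof (rule nn_integral_cong_AE)
      show "AE t in unit_leb. ennreal ((cmod (u k t - w t))\<^sup>2) =
          liminf (\<lambda>m. ennreal ((cmod (u k t - u (r m) t))\<^sup>2))"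
        using lim
      proof eventually_elim
        case (elim t)
        then have "(\<lambda>m. ennreal ((cmod (u k t - u (r m) t))\<^sup>2)) \<longlonglongrightarrow> ennreal ((cmod (u k t - w t))\<^sup>2)"
          by (intro tendsto_intros tendsto_ennrealI)
        then show ?case using lim_imp_Liminf[of sequentially] by force
      qed
    qed
    also have "\<dots> \<le> liminf (\<lambda>m. (\<integral>\<^sup>+t. ennreal ((cmod (u k t - u (r m) t))\<^sup>2) \<partial>unit_leb))"
      by (intro nn_integral_liminf) measurable
    also have "\<dots> = liminf (\<lambda>m. ennreal (sqn (\<lambda>t. u k t - u (r m) t)))"
      unfolding sqn_def using sqint_diff[OF u u] by (subst nn_integral_eq_integral) (auto simp: sqint_def)
    also have "\<dots> \<le> ennreal ((1/4)^n)"
    proof (rule Liminf_le)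
      show "\<forall>\<^sub>F m in sequentially. ennreal (sqn (\<lambda>t. u k t - u (r m) t)) \<le> ennreal ((1/4)^n)"
      proof (rule eventually_sequentiallyI[of n])
        fix m assume "n \<le> m"
        then have "r m \<ge> N n" using rN(1)[of n] rm[of n m] by linarith
        then show "ennreal (sqn (\<lambda>t. u k t - u (r m) t)) \<le> ennreal ((1/4)^n)"
          using N[OF k] by (intro ennreal_leI less_imp_le)
      qed
    qed simp
    finally have le: "(\<integral>\<^sup>+t. ennreal ((cmod (u k t - w t))\<^sup>2) \<partial>unit_leb) \<le> ennreal ((1/4)^n)" .
    have int: "integrable unit_leb (\<lambda>t. (cmod (u k t - w t))\<^sup>2)"
    proof (rule integrableI_bounded)
      show "(\<lambda>t. (cmod (u k t - w t))\<^sup>2) \<in> borel_measurable unit_leb"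
        by measurable
      have "(\<integral>\<^sup>+t. ennreal ((cmod (u k t - w t))\<^sup>2) \<partial>unit_leb) < \<infinity>"
        using le by (rule le_less_trans) simp
      then show "(\<integral>\<^sup>+t. ennreal (norm ((cmod (u k t - w t))\<^sup>2)) \<partial>unit_leb) < \<infinity>" by simp
    qed
    then have "ennreal (sqn (\<lambda>t. u k t - w t)) \<le> ennreal ((1/4)^n)"
      using le unfolding sqn_def by (subst (asm) nn_integral_eq_integral) auto
    then show ?thesis using int by (simp add: ennreal_le_iff)
  qed
  have "sqint (\<lambda>t. u (N 0) t - w t)"
    unfolding sqint_def using fatou[of 0 "N 0"] by simp
  from sqint_diff[OF u[of "N 0"] this] have "sqint w" by simp
  moreover have "\<exists>N. \<forall>k\<ge>N. sqn (\<lambda>t. u k t - w t) < \<epsilon>" if "\<epsilon> > 0" for \<epsilon>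
  proof -
    obtain n where "(1/4::real)^n < \<epsilon>" using real_arch_pow_inv[OF \<open>\<epsilon> > 0\<close>, of "1/4"] by auto
    then show ?thesis using fatou by (meson le_less_trans)
  qed
  ultimately show ?thesis by blast
qed

lemma L2_complete:
  assumes "finite E"
  shows "complete_semi_ip (L2 E) (L2_inner E)"
proof -
  interpret semi_ip "L2 E" "L2_inner E" by (rule L2_semi_ip)
  show ?thesis
  proof
    fix u :: "nat \<Rightarrow> gfun"
    assume u: "\<And>k. u k \<in> L2 E"
      and cau: "\<And>\<epsilon>. 0 < \<epsilon> \<Longrightarrow> \<exists>N. \<forall>j\<ge>N. \<forall>k\<ge>N. nrm (gsub (u j) (u k)) < \<epsilon>"
    have "\<exists>w. sqint w \<and> (\<forall>\<epsilon>>0. \<exists>N. \<forall>k\<ge>N. sqn (\<lambda>t. u k i t - w t) < \<epsilon>)" if i: "i \<in> E" for i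
    proof (rule sqint_complete)
      show "sqint (u k i)" for k using u i by (auto simp: L2_sqint)
      fix \<epsilon> :: real assume "\<epsilon> > 0"
      then obtain N where N: "\<And>j k. j \<ge> N \<Longrightarrow> k \<ge> N \<Longrightarrow> nrm (gsub (u j) (u k)) < sqrt \<epsilon>"
        using cau[of "sqrt \<epsilon>"] by auto
      have "sqn (\<lambda>t. u j i t - u k i t) < \<epsilon>" if "j \<ge> N" "k \<ge> N" for j k
      proof -
        have "sqn (\<lambda>t. u j i t - u k i t) \<le> (\<Sum>i\<in>E. sqn (gsub (u j) (u k) i))"
          using i \<open>finite E\<close> member_le_sum[of i E "\<lambda>i. sqn (gsub (u j) (u k) i)"] by (simp add: gsub_def)
        also have "\<dots> < (sqrt \<epsilon>)\<^sup>2"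
          unfolding L2_norm_sq[symmetric] using N[OF that] nrm_nonneg[OF gsub_in[OF u u], of j k]
          by (intro power_strict_mono) auto
        finally show ?thesis using \<open>\<epsilon> > 0\<close> by simp
      qed
      then show "\<exists>N. \<forall>j\<ge>N. \<forall>k\<ge>N. sqn (\<lambda>t. u j i t - u k i t) < \<epsilon>" by blast
    qed
    then obtain w where w: "\<And>i. i \<in> E \<Longrightarrow> sqint (w i)"
      and lim: "\<And>i \<epsilon>. i \<in> E \<Longrightarrow> \<epsilon> > 0 \<Longrightarrow> \<exists>N. \<forall>k\<ge>N. sqn (\<lambda>t. u k i t - w i t) < \<epsilon>"
      by metis
    have wV: "w \<in> L2 E" using w by (simp add: L2_sqint)
    moreover have "\<exists>N. \<forall>k\<ge>N. nrm (gsub (u k) w) < \<epsilon>" if "\<epsilon> > 0" for \<epsilon>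
    proof -
      define \<delta> where "\<delta> = \<epsilon>\<^sup>2 / (real (card E) + 1)"
      have \<delta>: "\<delta> > 0" using that by (simp add: \<delta>_def)
      then have "\<forall>i\<in>E. \<exists>N. \<forall>k\<ge>N. sqn (\<lambda>t. u k i t - w i t) < \<delta>" using lim by blast
      then obtain N where N: "\<And>i k. i \<in> E \<Longrightarrow> k \<ge> N i \<Longrightarrow> sqn (\<lambda>t. u k i t - w i t) < \<delta>" by metis
      have "nrm (gsub (u k) w) < \<epsilon>" if k: "k \<ge> (\<Sum>i\<in>E. N i)" for k
      proof -
        have "(\<Sum>i\<in>E. sqn (gsub (u k) w i)) \<le> (\<Sum>i\<in>E. \<delta>)"
        proof (intro sum_mono)
          fix i assume i: "i \<in> E"
          then have "N i \<le> k" using k member_le_sum[of i E N] \<open>finite E\<close> by fastforce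
          then show "sqn (gsub (u k) w i) \<le> \<delta>" using N[OF i, of k] by (simp add: gsub_def)
        qed
        also have "\<dots> < (real (card E) + 1) * \<delta>" using \<delta> by simp
        also have "\<dots> = \<epsilon>\<^sup>2" by (simp add: \<delta>_def)
        finally have "(nrm (gsub (u k) w))\<^sup>2 < \<epsilon>\<^sup>2" unfolding L2_norm_sq .
        then show ?thesis using \<open>\<epsilon> > 0\<close> by (simp add: power_less_imp_less_base)
      qed
      then show ?thesis by blast
    qed
    ultimately show "\<exists>z\<in>L2 E. \<forall>\<epsilon>>0. \<exists>N. \<forall>k\<ge>N. nrm (gsub (u k) z) < \<epsilon>" by blast
  qed
qed

section \<open>Absolutely continuous functions on the unit interval\<close>

lemma AE_unit_leb_negligible:
  "(AE t in unit_leb. P t) \<longleftrightarrow> negligible {t \<in> {0..1}. \<not> P t}"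
proof -
  have "(AE t in unit_leb. P t) \<longleftrightarrow> (AE t in lebesgue. t \<in> {0..1} \<longrightarrow> P t)"
    by (subst AE_restrict_space_iff) auto
  also have "\<dots> \<longleftrightarrow> negligible {t. \<not> (t \<in> {0..1} \<longrightarrow> P t)}"
    unfolding eventually_ae_filter_negligible
    by (metis (mono_tags, lifting) mem_Collect_eq negligible_subset subsetI subset_iff)
  also have "{t. \<not> (t \<in> {0..1} \<longrightarrow> P t)} = {t \<in> {0..1}. \<not> P t}" by auto
  finally show ?thesis .
qed

lemma abs_contE:
  assumes "abs_cont u" "\<epsilon> > 0"
  obtains \<delta> where "\<delta> > 0"
    and "\<And>(n::nat) a b. (\<And>k. k < n \<Longrightarrow> 0 \<le> a k \<and> a k \<le> b k \<and> b k \<le> 1) \<Longrightarrow>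
      disjoint_family_on (\<lambda>k. {a k<..<b k}) {..<n} \<Longrightarrow> (\<Sum>k<n. b k - a k) < \<delta> \<Longrightarrow>
      (\<Sum>k<n. cmod (u (b k) - u (a k))) < \<epsilon>"
  using assms unfolding abs_cont_def by meson

text \<open>The defining estimate for a finite family of intervals with an arbitrary index set.\<close>

lemma abs_cont_family:
  assumes "abs_cont u" "\<epsilon> > 0"
  obtains \<delta> where "\<delta> > 0"
    and "\<And>(I :: 'i set) a b. finite I \<Longrightarrow> (\<And>k. k \<in> I \<Longrightarrow> 0 \<le> a k \<and> a k \<le> b k \<and> b k \<le> 1) \<Longrightarrow>
      disjoint_family_on (\<lambda>k. {a k<..<b k}) I \<Longrightarrow> (\<Sum>k\<in>I. b k - a k) < \<delta> \<Longrightarrow>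
      (\<Sum>k\<in>I. cmod (u (b k) - u (a k))) < \<epsilon>"
proof -
  obtain \<delta> where \<delta>: "\<delta> > 0"
    and est: "\<And>(n::nat) a b. (\<And>k. k < n \<Longrightarrow> 0 \<le> a k \<and> a k \<le> b k \<and> b k \<le> 1) \<Longrightarrow>
      disjoint_family_on (\<lambda>k. {a k<..<b k}) {..<n} \<Longrightarrow> (\<Sum>k<n. b k - a k) < \<delta> \<Longrightarrow>
      (\<Sum>k<n. cmod (u (b k) - u (a k))) < \<epsilon>"
    using abs_contE[OF assms] by blast
  have "(\<Sum>k\<in>I. cmod (u (b k) - u (a k))) < \<epsilon>"
    if I: "finite I" and ab: "\<And>k. k \<in> I \<Longrightarrow> 0 \<le> a k \<and> a k \<le> b k \<and> b k \<le> 1"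
      and dis: "disjoint_family_on (\<lambda>k. {a k<..<b k}) I" and len: "(\<Sum>k\<in>I. b k - a k) < \<delta>"
    for I :: "'i set" and a b
  proof -
    obtain h where h: "bij_betw h {..<card I} I"
      using ex_bij_betw_nat_finite[OF I] by (auto simp: lessThan_atLeast0)
    have hI: "h k \<in> I" if "k < card I" for k using h that by (auto simp: bij_betw_def)
    have "(\<Sum>k<card I. cmod (u (b (h k)) - u (a (h k)))) < \<epsilon>"
    proof (rule est)
      show "0 \<le> a (h k) \<and> a (h k) \<le> b (h k) \<and> b (h k) \<le> 1" if "k < card I" for k
        using ab hI that by blast
      show "disjoint_family_on (\<lambda>k. {a (h k)<..<b (h k)}) {..<card I}"
        unfolding disjoint_family_on_def
      proof (intro ballI impI)
        fix i j assume "i \<in> {..<card I}" "j \<in> {..<card I}" "i \<noteq> j"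
        then have "h i \<in> I" "h j \<in> I" "h i \<noteq> h j"
          using h hI by (auto simp: bij_betw_def inj_on_def)
        then show "{a (h i)<..<b (h i)} \<inter> {a (h j)<..<b (h j)} = {}"
          using dis unfolding disjoint_family_on_def by blast
      qed
      show "(\<Sum>k<card I. b (h k) - a (h k)) < \<delta>"
        using sum.reindex_bij_betw[OF h, of "\<lambda>k. b k - a k"] len by simp
    qed
    then show ?thesis
      using sum.reindex_bij_betw[OF h, of "\<lambda>k. cmod (u (b k) - u (a k))"] by simp
  qed
  with \<delta> that show ?thesis by blast
qed

lemma abs_cont_two_points:
  assumes "abs_cont u" "\<epsilon> > 0"
  obtains \<delta> where "\<delta> > 0"
    and "\<And>s t. s \<in> {0..1} \<Longrightarrow> t \<in> {0..1} \<Longrightarrow> \<bar>s - t\<bar> < \<delta> \<Longrightarrow> cmod (u s - u t) < \<epsilon>"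
proof -
  obtain \<delta> where \<delta>: "\<delta> > 0"
    and est: "\<And>(n::nat) a b. (\<And>k. k < n \<Longrightarrow> 0 \<le> a k \<and> a k \<le> b k \<and> b k \<le> 1) \<Longrightarrow>
      disjoint_family_on (\<lambda>k. {a k<..<b k}) {..<n} \<Longrightarrow> (\<Sum>k<n. b k - a k) < \<delta> \<Longrightarrow>
      (\<Sum>k<n. cmod (u (b k) - u (a k))) < \<epsilon>"
    using abs_contE[OF assms] by blast
  have ord: "cmod (u t - u s) < \<epsilon>" if "s \<in> {0..1}" "t \<in> {0..1}" "s \<le> t" "t - s < \<delta>" for s t
    using est[of 1 "\<lambda>_. s" "\<lambda>_. t"] that by (simp add: disjoint_family_on_def)
  have "cmod (u s - u t) < \<epsilon>" if "s \<in> {0..1}" "t \<in> {0..1}" "\<bar>s - t\<bar> < \<delta>" for s t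
    using ord[of s t] ord[of t s] that by (cases "s \<le> t") (auto simp: norm_minus_commute)
  with \<delta> that show ?thesis by blast
qed

lemma abs_cont_continuous: "abs_cont u \<Longrightarrow> continuous_on {0..1} u"
  unfolding continuous_on_iff
proof (intro ballI allI impI)
  fix t \<epsilon> :: real assume u: "abs_cont u" and t: "t \<in> {0..1}" and \<epsilon>: "0 < \<epsilon>"
  obtain \<delta> where "\<delta> > 0" "\<And>s t. s \<in> {0..1} \<Longrightarrow> t \<in> {0..1} \<Longrightarrow> \<bar>s - t\<bar> < \<delta> \<Longrightarrow> cmod (u s - u t) < \<epsilon>"
    using abs_cont_two_points[OF u \<epsilon>] by blast
  then show "\<exists>d>0. \<forall>s\<in>{0..1}. dist s t < d \<longrightarrow> dist (u s) (u t) < \<epsilon>"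
    using t by (auto simp: dist_norm)
qed

lemma abs_cont_bounded:
  assumes "abs_cont u"
  obtains C where "C > 0" "\<And>t. t \<in> {0..1} \<Longrightarrow> cmod (u t) \<le> C"
proof -
  have "bounded (u ` {0..1})"
    using abs_cont_continuous[OF assms]
    by (intro compact_imp_bounded compact_continuous_image) auto
  then obtain C where "\<forall>t\<in>{0..1}. cmod (u t) \<le> C" by (auto simp: bounded_iff)
  then have "cmod (u t) \<le> \<bar>C\<bar> + 1" if "t \<in> {0..1}" for t using that by fastforce
  then show ?thesis using that[of "\<bar>C\<bar> + 1"] by simp
qed

text \<open>Increments dominated by those of finitely many absolutely continuous functions.\<close>

lemma abs_cont_dominated:
  assumes u: "abs_cont u" and v: "abs_cont v" and "0 \<le> C"
    and dom: "\<And>s t. 0 \<le> s \<Longrightarrow> s \<le> t \<Longrightarrow> t \<le> 1 \<Longrightarrow>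
      cmod (w t - w s) \<le> C * (cmod (u t - u s) + cmod (v t - v s))"
  shows "abs_cont w"
  unfolding abs_cont_def
proof (intro allI impI)
  fix \<epsilon> :: real assume \<epsilon>: "\<epsilon> > 0"
  define \<epsilon>' where "\<epsilon>' = \<epsilon> / (2 * (C + 1))"
  have \<epsilon>': "\<epsilon>' > 0" using \<epsilon> \<open>0 \<le> C\<close> by (simp add: \<epsilon>'_def)
  obtain d1 where d1: "d1 > 0"
    and e1: "\<And>(n::nat) a b. (\<And>k. k < n \<Longrightarrow> 0 \<le> a k \<and> a k \<le> b k \<and> b k \<le> 1) \<Longrightarrow>
      disjoint_family_on (\<lambda>k. {a k<..<b k}) {..<n} \<Longrightarrow> (\<Sum>k<n. b k - a k) < d1 \<Longrightarrow>
      (\<Sum>k<n. cmod (u (b k) - u (a k))) < \<epsilon>'"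
    using abs_contE[OF u \<epsilon>'] by blast
  obtain d2 where d2: "d2 > 0"
    and e2: "\<And>(n::nat) a b. (\<And>k. k < n \<Longrightarrow> 0 \<le> a k \<and> a k \<le> b k \<and> b k \<le> 1) \<Longrightarrow>
      disjoint_family_on (\<lambda>k. {a k<..<b k}) {..<n} \<Longrightarrow> (\<Sum>k<n. b k - a k) < d2 \<Longrightarrow>
      (\<Sum>k<n. cmod (v (b k) - v (a k))) < \<epsilon>'"
    using abs_contE[OF v \<epsilon>'] by blast
  show "\<exists>\<delta>>0. \<forall>(n::nat) a b. (\<forall>k<n. 0 \<le> a k \<and> a k \<le> b k \<and> b k \<le> 1) \<and>
     disjoint_family_on (\<lambda>k. {a k<..<b k}) {..<n} \<and>
     (\<Sum>k<n. b k - a k) < \<delta> \<longrightarrow> (\<Sum>k<n. cmod (w (b k) - w (a k))) < \<epsilon>"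
  proof (intro exI[of _ "min d1 d2"] conjI allI impI)
    show "0 < min d1 d2" using d1 d2 by simp
    fix n :: nat and a b :: "nat \<Rightarrow> real"
    assume A: "(\<forall>k<n. 0 \<le> a k \<and> a k \<le> b k \<and> b k \<le> 1) \<and>
     disjoint_family_on (\<lambda>k. {a k<..<b k}) {..<n} \<and> (\<Sum>k<n. b k - a k) < min d1 d2"
    have s1: "(\<Sum>k<n. cmod (u (b k) - u (a k))) < \<epsilon>'" by (rule e1) (use A in auto)
    have s2: "(\<Sum>k<n. cmod (v (b k) - v (a k))) < \<epsilon>'" by (rule e2) (use A in auto)
    have "(\<Sum>k<n. cmod (w (b k) - w (a k))) \<le>
        (\<Sum>k<n. C * (cmod (u (b k) - u (a k)) + cmod (v (b k) - v (a k))))"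
      using A by (intro sum_mono dom) auto
    also have "\<dots> = C * ((\<Sum>k<n. cmod (u (b k) - u (a k))) + (\<Sum>k<n. cmod (v (b k) - v (a k))))"
      unfolding sum.distrib[symmetric] sum_distrib_left ..
    also have "\<dots> \<le> C * (2 * \<epsilon>')"
      using s1 s2 \<open>0 \<le> C\<close> by (intro mult_left_mono) auto
    also have "\<dots> < (C + 1) * (2 * \<epsilon>')" using \<epsilon>' by simp
    also have "\<dots> = 2 * (C + 1) * \<epsilon>'" by (simp add: algebra_simps)
    also have "\<dots> = \<epsilon>" unfolding \<epsilon>'_def using \<open>0 \<le> C\<close> by (intro nonzero_mult_div_cancel_left[THEN trans[OF times_divide_eq_right]]) auto
    finally show "(\<Sum>k<n. cmod (w (b k) - w (a k))) < \<epsilon>" .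
  qed
qed

lemma abs_cont_Lipschitz:
  assumes "0 \<le> C" and lip: "\<And>s t. 0 \<le> s \<Longrightarrow> s \<le> t \<Longrightarrow> t \<le> 1 \<Longrightarrow> cmod (w t - w s) \<le> C * (t - s)"
  shows "abs_cont w"
proof -
  have id: "abs_cont (\<lambda>t. of_real t)"
    unfolding abs_cont_def
  proof (intro allI impI)
    fix \<epsilon> :: real assume "\<epsilon> > 0"
    then show "\<exists>\<delta>>0. \<forall>(n::nat) a b. (\<forall>k<n. 0 \<le> a k \<and> a k \<le> b k \<and> b k \<le> 1) \<and>
     disjoint_family_on (\<lambda>k. {a k<..<b k}) {..<n} \<and>
     (\<Sum>k<n. b k - a k) < \<delta> \<longrightarrow> (\<Sum>k<n. cmod (of_real (b k) - of_real (a k))) < \<epsilon>"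
      by (intro exI[of _ \<epsilon>]) (simp flip: of_real_diff)
  qed
  show ?thesis
  proof (rule abs_cont_dominated[OF id id \<open>0 \<le> C\<close>])
    fix s t :: real assume "0 \<le> s" "s \<le> t" "t \<le> 1"
    then have "cmod (w t - w s) \<le> C * (t - s)" by (rule lip)
    also have "\<dots> \<le> C * (cmod (of_real t - of_real s) + cmod (of_real t - of_real s))"
      using \<open>0 \<le> C\<close> \<open>s \<le> t\<close> by (intro mult_left_mono) (simp_all flip: of_real_diff)
    finally show "cmod (w t - w s) \<le> C * (cmod (of_real t - of_real s) + cmod (of_real t - of_real s))" .
  qed
qed

lemma abs_cont_lin:
  assumes "abs_cont u" "abs_cont v"
  shows "abs_cont (\<lambda>t. a * u t + b * v t)"
proof (rule abs_cont_dominated[OF assms, of "cmod a + cmod b"])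
  fix s t :: real
  have "cmod (a * u t + b * v t - (a * u s + b * v s)) = cmod (a * (u t - u s) + b * (v t - v s))"
    by (simp add: algebra_simps)
  also have "\<dots> \<le> cmod a * cmod (u t - u s) + cmod b * cmod (v t - v s)"
    using norm_triangle_ineq[of "a * (u t - u s)" "b * (v t - v s)"] by (simp add: norm_mult)
  also have "\<dots> \<le> (cmod a + cmod b) * (cmod (u t - u s) + cmod (v t - v s))"
    by (simp add: algebra_simps)
  finally show "cmod (a * u t + b * v t - (a * u s + b * v s)) \<le>
    (cmod a + cmod b) * (cmod (u t - u s) + cmod (v t - v s))" .
qed simp

lemma abs_cont_cnj: "abs_cont u \<Longrightarrow> abs_cont (\<lambda>t. cnj (u t))"
  by (rule abs_cont_dominated[of u u 1]) (auto simp flip: complex_cnj_diff)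

lemma abs_cont_mult:
  assumes "abs_cont u" "abs_cont v"
  shows "abs_cont (\<lambda>t. u t * v t)"
proof -
  obtain C where C: "C > 0" "\<And>t. t \<in> {0..1} \<Longrightarrow> cmod (u t) \<le> C" using abs_cont_bounded[OF assms(1)] by blast
  obtain D where D: "D > 0" "\<And>t. t \<in> {0..1} \<Longrightarrow> cmod (v t) \<le> D" using abs_cont_bounded[OF assms(2)] by blast
  show ?thesis
  proof (rule abs_cont_dominated[OF assms, of "C + D"])
    fix s t :: real assume st: "0 \<le> s" "s \<le> t" "t \<le> 1"
    have "cmod (u t * v t - u s * v s) = cmod ((u t - u s) * v t + u s * (v t - v s))"
      by (simp add: algebra_simps)
    also have "\<dots> \<le> cmod (u t - u s) * cmod (v t) + cmod (u s) * cmod (v t - v s)"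
      using norm_triangle_ineq[of "(u t - u s) * v t" "u s * (v t - v s)"] by (simp add: norm_mult)
    also have "\<dots> \<le> cmod (u t - u s) * D + C * cmod (v t - v s)"
      using C D st by (intro add_mono mult_left_mono mult_right_mono) auto
    also have "\<dots> \<le> (C + D) * (cmod (u t - u s) + cmod (v t - v s))"
      using C(1) D(1) by (simp add: algebra_simps)
    finally show "cmod (u t * v t - u s * v s) \<le> (C + D) * (cmod (u t - u s) + cmod (v t - v s))" .
  qed (use C D in auto)
qed

lemma abs_cont_compose:
  assumes u: "abs_cont u"
    and range: "\<And>t. t \<in> {0..1} \<Longrightarrow> \<phi> t \<in> {0..1}"
    and mono: "\<And>s t. 0 \<le> s \<Longrightarrow> s \<le> t \<Longrightarrow> t \<le> 1 \<Longrightarrow> \<phi> s \<le> \<phi> t"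
    and "C > 0" and lip: "\<And>s t. 0 \<le> s \<Longrightarrow> s \<le> t \<Longrightarrow> t \<le> 1 \<Longrightarrow> \<phi> t - \<phi> s \<le> C * (t - s)"
  shows "abs_cont (\<lambda>t. u (\<phi> t))"
  unfolding abs_cont_def
proof (intro allI impI)
  fix \<epsilon> :: real assume \<epsilon>: "\<epsilon> > 0"
  obtain \<delta> where \<delta>: "\<delta> > 0"
    and est: "\<And>(n::nat) a b. (\<And>k. k < n \<Longrightarrow> 0 \<le> a k \<and> a k \<le> b k \<and> b k \<le> 1) \<Longrightarrow>
      disjoint_family_on (\<lambda>k. {a k<..<b k}) {..<n} \<Longrightarrow> (\<Sum>k<n. b k - a k) < \<delta> \<Longrightarrow>
      (\<Sum>k<n. cmod (u (b k) - u (a k))) < \<epsilon>"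
    using abs_contE[OF u \<epsilon>] by blast
  show "\<exists>\<delta>>0. \<forall>(n::nat) a b. (\<forall>k<n. 0 \<le> a k \<and> a k \<le> b k \<and> b k \<le> 1) \<and>
     disjoint_family_on (\<lambda>k. {a k<..<b k}) {..<n} \<and>
     (\<Sum>k<n. b k - a k) < \<delta> \<longrightarrow> (\<Sum>k<n. cmod (u (\<phi> (b k)) - u (\<phi> (a k)))) < \<epsilon>"
  proof (intro exI[of _ "\<delta> / C"] conjI allI impI)
    show "0 < \<delta> / C" using \<delta> \<open>C > 0\<close> by simp
    fix n :: nat and a b :: "nat \<Rightarrow> real"
    assume A: "(\<forall>k<n. 0 \<le> a k \<and> a k \<le> b k \<and> b k \<le> 1) \<and>
     disjoint_family_on (\<lambda>k. {a k<..<b k}) {..<n} \<and> (\<Sum>k<n. b k - a k) < \<delta> / C"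
    then have ab: "0 \<le> a k" "a k \<le> b k" "b k \<le> 1" if "k < n" for k using that by auto
    show "(\<Sum>k<n. cmod (u (\<phi> (b k)) - u (\<phi> (a k)))) < \<epsilon>"
    proof (rule est)
      show "0 \<le> \<phi> (a k) \<and> \<phi> (a k) \<le> \<phi> (b k) \<and> \<phi> (b k) \<le> 1" if "k < n" for k
        using ab[OF that] range[of "a k"] range[of "b k"] mono[of "a k" "b k"] by auto
      show "disjoint_family_on (\<lambda>k. {\<phi> (a k)<..<\<phi> (b k)}) {..<n}"
        unfolding disjoint_family_on_def
      proof (intro ballI impI)
        fix i j assume ij: "i \<in> {..<n}" "j \<in> {..<n}" "i \<noteq> j"
        have bi: "{a i<..<b i} \<inter> {a j<..<b j} = {}"
          using A ij unfolding disjoint_family_on_def by blast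
        have less: "s < t" if "\<phi> s < \<phi> t" "s \<in> {0..1}" "t \<in> {0..1}" for s t
          using mono[of t s] that by (cases "s < t") auto
        show "{\<phi> (a i)<..<\<phi> (b i)} \<inter> {\<phi> (a j)<..<\<phi> (b j)} = {}"
        proof (rule ccontr)
          assume "\<not> ?thesis"
          then obtain s where "s \<in> {\<phi> (a i)<..<\<phi> (b i)}" "s \<in> {\<phi> (a j)<..<\<phi> (b j)}" by blast
          then have s: "\<phi> (a i) < s" "s < \<phi> (b i)" "\<phi> (a j) < s" "s < \<phi> (b j)" by auto
          have "a i \<in> {0..1}" "b i \<in> {0..1}" "a j \<in> {0..1}" "b j \<in> {0..1}"
            using ab[of i] ab[of j] ij by auto
          moreover have "\<phi> (a i) < \<phi> (b i)" "\<phi> (a i) < \<phi> (b j)" "\<phi> (a j) < \<phi> (b i)" "\<phi> (a j) < \<phi> (b j)"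
            using s by linarith+
          ultimately have "a i < b i" "a i < b j" "a j < b i" "a j < b j"
            by (simp_all only: less)
          then have "max (a i) (a j) < min (b i) (b j)" by simp
          then obtain r where "max (a i) (a j) < r" "r < min (b i) (b j)" using dense by blast
          then have "r \<in> {a i<..<b i} \<inter> {a j<..<b j}" by simp
          then show False using bi by blast
        qed
      qed
      have "(\<Sum>k<n. \<phi> (b k) - \<phi> (a k)) \<le> (\<Sum>k<n. C * (b k - a k))"
        using ab by (intro sum_mono lip) auto
      also have "\<dots> < C * (\<delta> / C)"
        unfolding sum_distrib_left[symmetric] using A \<open>C > 0\<close> by (intro mult_strict_left_mono) auto
      finally show "(\<Sum>k<n. \<phi> (b k) - \<phi> (a k)) < \<delta>" using \<open>C > 0\<close> by simp
    qed
  qed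
qed

lemma abs_cont_reflect:
  assumes u: "abs_cont u"
  shows "abs_cont (\<lambda>t. u (1 - t))"
  unfolding abs_cont_def
proof (intro allI impI)
  fix \<epsilon> :: real assume \<epsilon>: "\<epsilon> > 0"
  obtain \<delta> where \<delta>: "\<delta> > 0"
    and est: "\<And>(n::nat) a b. (\<And>k. k < n \<Longrightarrow> 0 \<le> a k \<and> a k \<le> b k \<and> b k \<le> 1) \<Longrightarrow>
      disjoint_family_on (\<lambda>k. {a k<..<b k}) {..<n} \<Longrightarrow> (\<Sum>k<n. b k - a k) < \<delta> \<Longrightarrow>
      (\<Sum>k<n. cmod (u (b k) - u (a k))) < \<epsilon>"
    using abs_contE[OF u \<epsilon>] by blast
  show "\<exists>\<delta>>0. \<forall>(n::nat) a b. (\<forall>k<n. 0 \<le> a k \<and> a k \<le> b k \<and> b k \<le> 1) \<and>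
     disjoint_family_on (\<lambda>k. {a k<..<b k}) {..<n} \<and>
     (\<Sum>k<n. b k - a k) < \<delta> \<longrightarrow> (\<Sum>k<n. cmod (u (1 - b k) - u (1 - a k))) < \<epsilon>"
  proof (intro exI[of _ \<delta>] conjI allI impI \<delta>)
    fix n :: nat and a b :: "nat \<Rightarrow> real"
    assume A: "(\<forall>k<n. 0 \<le> a k \<and> a k \<le> b k \<and> b k \<le> 1) \<and>
     disjoint_family_on (\<lambda>k. {a k<..<b k}) {..<n} \<and> (\<Sum>k<n. b k - a k) < \<delta>"
    have "(\<Sum>k<n. cmod (u (1 - a k) - u (1 - b k))) < \<epsilon>"
    proof (rule est)
      show "disjoint_family_on (\<lambda>k. {1 - b k<..<1 - a k}) {..<n}"
        unfolding disjoint_family_on_def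
      proof (intro ballI impI)
        fix i j assume ij: "i \<in> {..<n}" "j \<in> {..<n}" "i \<noteq> j"
        have bi: "{a i<..<b i} \<inter> {a j<..<b j} = {}"
          using A ij unfolding disjoint_family_on_def by blast
        show "{1 - b i<..<1 - a i} \<inter> {1 - b j<..<1 - a j} = {}"
        proof (rule ccontr)
          assume "\<not> ?thesis"
          then obtain s where "s \<in> {1 - b i<..<1 - a i}" "s \<in> {1 - b j<..<1 - a j}" by blast
          then have "1 - s \<in> {a i<..<b i} \<inter> {a j<..<b j}" by auto
          then show False using bi by blast
        qed
      qed
    qed (use A in auto)
    then show "(\<Sum>k<n. cmod (u (1 - b k) - u (1 - a k))) < \<epsilon>" by (simp add: norm_minus_commute)
  qed
qed

text \<open>The fundamental theorem of calculus. In a fine tagged division the intervals with a tag in the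
  exceptional null set lie in an open set of small measure, where absolute continuity makes the
  increments negligible; on the others the derivative controls the increments.\<close>

theorem abs_cont_FTC:
  assumes u: "abs_cont u" and N: "negligible N"
    and der: "\<And>t. t \<in> {0..1} - N \<Longrightarrow> (u has_vector_derivative g t) (at t within {0..1})"
    and ab: "0 \<le> a" "a \<le> b" "b \<le> 1"
  shows "(g has_integral (u b - u a)) {a..b}"
proof (cases "a < b")
  case False
  then have "a = b" using ab by simp
  then show ?thesis using has_integral_refl(2)[of g a] by simp
next
  case True
  define g0 where "g0 t = (if t \<in> N then 0 else g t)" for t
  have "(g0 has_integral (u b - u a)) {a..b}"
    unfolding has_integral_factor_content_real
  proof (intro allI impI)
    fix e :: real assume "e > 0"
    define e' where "e' = e / 2"
    have e': "e' > 0" using \<open>e > 0\<close> by (simp add: e'_def)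
    have "e' * (b - a) > 0" using e' True by simp
    from abs_cont_family[OF u this]
    obtain \<delta> where \<delta>: "\<delta> > 0"
      and est: "\<And>(I :: (real \<times> real set) set) a' b'. finite I \<Longrightarrow> (\<And>k. k \<in> I \<Longrightarrow> 0 \<le> a' k \<and> a' k \<le> b' k \<and> b' k \<le> 1) \<Longrightarrow>
      disjoint_family_on (\<lambda>k. {a' k<..<b' k}) I \<Longrightarrow> (\<Sum>k\<in>I. b' k - a' k) < \<delta> \<Longrightarrow>
      (\<Sum>k\<in>I. cmod (u (b' k) - u (a' k))) < e' * (b - a)"
      by blast
    obtain T where T: "open T" "N \<subseteq> T" "(T - N) \<in> lmeasurable" "emeasure lebesgue (T - N) < ennreal \<delta>"
      using sets_lebesgue_outer_open[OF negligible_imp_sets[OF N] \<delta>] by blast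
    have Tm: "T \<in> lmeasurable" "measure lebesgue T < \<delta>"
    proof -
      have un: "T = (T - N) \<union> N" using T by auto
      show "T \<in> lmeasurable"
        by (subst un) (intro fmeasurable.Un T(3) negligible_imp_measurable N)
      have "measure lebesgue T \<le> measure lebesgue (T - N) + measure lebesgue N"
        by (subst un) (intro measure_Un_le negligible_imp_sets N fmeasurableD T(3))
      also have "measure lebesgue N = 0" using N negligible_imp_measure0 by blast
      also have "measure lebesgue (T - N) < \<delta>"
        using T(3,4) \<delta> by (simp add: emeasure_eq_measure2 ennreal_less_iff)
      finally show "measure lebesgue T < \<delta>" by simp
    qed
    have "\<exists>d>0. t \<in> {0..1} - N \<longrightarrow>
         (\<forall>s\<in>{0..1}. norm (s - t) < d \<longrightarrow> norm (u s - u t - (s - t) *\<^sub>R g t) \<le> e' * norm (s - t))" for t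
    proof (cases "t \<in> {0..1} - N")
      case True
      then show ?thesis
        using der[OF True] e' unfolding has_vector_derivative_def has_derivative_within_alt by blast
    qed (auto intro: exI[of _ 1])
    then obtain d where d: "\<And>t. 0 < d t"
      "\<And>t s. t \<in> {0..1} - N \<Longrightarrow> s \<in> {0..1} \<Longrightarrow> norm (s - t) < d t \<Longrightarrow>
         norm (u s - u t - (s - t) *\<^sub>R g t) \<le> e' * norm (s - t)"
      by metis
    \<comment> \<open>A division interval with a tag in \<open>N\<close> lies in \<open>T\<close>; on any other division interval the
      derivative at the tag approximates the increments.\<close>
    define \<gamma> where "\<gamma> t = (if t \<in> N then T else ball t (d t))" for t
    show "\<exists>\<gamma>. gauge \<gamma> \<and> (\<forall>p. p tagged_division_of {a..b} \<and> \<gamma> fine p \<longrightarrow>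
      norm ((\<Sum>(x, k)\<in>p. measure lborel k *\<^sub>R g0 x) - (u b - u a)) \<le> e * measure lborel {a..b})"
    proof (intro exI[of _ \<gamma>] conjI allI impI)
      show "gauge \<gamma>" unfolding gauge_def \<gamma>_def using T d(1) by auto
      fix p assume "p tagged_division_of {a..b} \<and> \<gamma> fine p"
      then have p: "p tagged_division_of {a..b}" and fine: "\<gamma> fine p" by auto
      have fin: "finite p" using p by blast
      have pK: "\<exists>c d. K = {c..d} \<and> c \<le> x \<and> x \<le> d \<and> a \<le> c \<and> d \<le> b" if "(x, K) \<in> p" for x K
      proof -
        obtain c d where K: "K = cbox c d" using tagged_division_ofD(4)[OF p \<open>(x, K) \<in> p\<close>] by blast
        moreover have "x \<in> K" "K \<subseteq> {a..b}" using tagged_division_ofD(2,3)[OF p that] by auto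
        ultimately show ?thesis by (intro exI[of _ c] exI[of _ d]) auto
      qed
      have local_bound: "norm (measure lborel K *\<^sub>R g0 x - (u (Sup K) - u (Inf K))) \<le>
          e' * (Sup K - Inf K) + (if x \<in> N then norm (u (Sup K) - u (Inf K)) else 0)"
        if xK: "(x, K) \<in> p" for x K
      proof -
        obtain v w where K: "K = {v..w}" "v \<le> x" "x \<le> w" "a \<le> v" "w \<le> b" using pK[OF xK] by blast
        show ?thesis
        proof (cases "x \<in> N")
          case True
          then show ?thesis using K e' by (simp add: g0_def norm_minus_commute)
        next
          case False
          have sub: "K \<subseteq> ball x (d x)" using fine xK False unfolding fine_def \<gamma>_def by fastforce
          have "v \<in> ball x (d x)" "w \<in> ball x (d x)"
            using subsetD[OF sub, of v] subsetD[OF sub, of w] K by simp_all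
          then have close: "norm (v - x) < d x" "norm (w - x) < d x" by (auto simp: dist_real_def)
          have xx: "x \<in> {0..1} - N" "v \<in> {0..1}" "w \<in> {0..1}" using K False ab by auto
          have "norm (u v - u x - (v - x) *\<^sub>R g x) \<le> e' * norm (v - x)"
            "norm (u w - u x - (w - x) *\<^sub>R g x) \<le> e' * norm (w - x)"
            using d(2)[OF xx(1,2) close(1)] d(2)[OF xx(1,3) close(2)] .
          moreover have "norm ((w - v) *\<^sub>R g x - (u w - u v)) =
              norm (u v - u x - (v - x) *\<^sub>R g x - (u w - u x - (w - x) *\<^sub>R g x))"
            by (simp add: algebra_simps)
          moreover have "\<dots> \<le> norm (u v - u x - (v - x) *\<^sub>R g x) + norm (u w - u x - (w - x) *\<^sub>R g x)"
            by (rule norm_triangle_ineq4)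
          ultimately have "norm ((w - v) *\<^sub>R g x - (u w - u v)) \<le> e' * norm (v - x) + e' * norm (w - x)"
            by linarith
          also have "\<dots> = e' * (w - v)" using K by (simp add: algebra_simps)
          finally show ?thesis using K False by (simp add: g0_def)
        qed
      qed
      \<comment> \<open>The division intervals with a tag in \<open>N\<close> have total length less than \<open>\<delta>\<close>.\<close>
      define p' where "p' = {z \<in> p. fst z \<in> N}"
      have p': "p' tagged_partial_division_of {a..b}"
        using tagged_partial_division_subset[of p "{a..b}" p'] p by (auto simp: p'_def tagged_division_of_def)
      have tagU: "p' tagged_division_of \<Union>(snd ` p')"
        by (rule tagged_partial_division_of_Union_self[OF p'])
      have div: "(snd ` p') division_of \<Union>(snd ` p')" by (rule division_of_tagged_division[OF tagU])
      have U: "\<Union>(snd ` p') \<subseteq> T"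
        using fine unfolding p'_def fine_def \<gamma>_def by fastforce
      have "(\<Sum>z\<in>p'. Sup (snd z) - Inf (snd z)) = (\<Sum>(x,K)\<in>p'. measure lborel K)"
        using pK by (intro sum.cong refl) (force simp: p'_def)
      also have "\<dots> = sum (measure lborel) (snd ` p')"
        by (rule sum.over_tagged_division_lemma[OF tagU]) (simp add: content_eq_0)
      also have "\<dots> = measure lebesgue (\<Union>(snd ` p'))"
        unfolding content_division[OF div, symmetric]
      proof (rule sum.cong[OF refl])
        fix K assume "K \<in> snd ` p'"
        then obtain c d where "K = cbox c d" using division_ofD(4)[OF div] by blast
        then show "measure lborel K = measure lebesgue K" by simp
      qed
      also have "\<dots> \<le> measure lebesgue T"
        using lmeasurable_division[OF div] U Tm by (intro measure_mono_fmeasurable) auto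
      also have "\<dots> < \<delta>" by (rule Tm)
      finally have len: "(\<Sum>z\<in>p'. Sup (snd z) - Inf (snd z)) < \<delta>" .
      have small: "(\<Sum>z\<in>p'. cmod (u (Sup (snd z)) - u (Inf (snd z)))) < e' * (b - a)"
      proof (rule est[OF _ _ _ len])
        show "finite p'" using fin by (simp add: p'_def)
        show "0 \<le> Inf (snd z) \<and> Inf (snd z) \<le> Sup (snd z) \<and> Sup (snd z) \<le> 1" if "z \<in> p'" for z
          using that pK[of "fst z" "snd z"] ab by (fastforce simp: p'_def)
        show "disjoint_family_on (\<lambda>z. {Inf (snd z)<..<Sup (snd z)}) p'"
          unfolding disjoint_family_on_def
        proof (intro ballI impI)
          fix y z assume yz: "y \<in> p'" "z \<in> p'" "y \<noteq> z"
          have "interior (snd y) \<inter> interior (snd z) = {}"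
            using tagged_division_ofD(5)[OF p, of "fst y" "snd y" "fst z" "snd z"] yz
            by (auto simp: p'_def prod_eq_iff)
          moreover have "interior (snd w) = {Inf (snd w)<..<Sup (snd w)}" if "w \<in> p'" for w
            using that pK[of "fst w" "snd w"] by (fastforce simp: p'_def)
          ultimately show "{Inf (snd y)<..<Sup (snd y)} \<inter> {Inf (snd z)<..<Sup (snd z)} = {}"
            using yz by simp
        qed
      qed
      have tele: "b - a = (\<Sum>(x,K)\<in>p. Sup K - Inf K)" "u b - u a = (\<Sum>(x,K)\<in>p. u (Sup K) - u (Inf K))"
        using additive_tagged_division_1[OF \<open>a \<le> b\<close> p, of "\<lambda>x. x"] additive_tagged_division_1[OF \<open>a \<le> b\<close> p, of u]
        by simp_all
      have "norm ((\<Sum>(x, K)\<in>p. measure lborel K *\<^sub>R g0 x) - (u b - u a)) =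
          norm (\<Sum>(x, K)\<in>p. measure lborel K *\<^sub>R g0 x - (u (Sup K) - u (Inf K)))"
        unfolding tele(2) by (simp add: split_def sum_subtractf)
      also have "\<dots> \<le> (\<Sum>(x, K)\<in>p. e' * (Sup K - Inf K) + (if x \<in> N then norm (u (Sup K) - u (Inf K)) else 0))"
        using local_bound by (intro sum_norm_le) auto
      also have "\<dots> = e' * (b - a) + (\<Sum>z\<in>p'. cmod (u (Sup (snd z)) - u (Inf (snd z))))"
        unfolding tele(1) p'_def using fin
        by (simp add: split_def sum.distrib sum_distrib_left sum.inter_filter)
      also have "\<dots> \<le> e' * (b - a) + e' * (b - a)" using small by simp
      also have "\<dots> = e * measure lborel {a..b}" using ab by (simp add: e'_def)
      finally show "norm ((\<Sum>(x, k)\<in>p. measure lborel k *\<^sub>R g0 x) - (u b - u a)) \<le> e * measure lborel {a..b}" .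
    qed
  qed
  then show ?thesis
    by (rule has_integral_spike[OF N, rotated]) (simp add: g0_def)
qed

section \<open>Sobolev functions on the unit interval\<close>

text \<open>The derivative on an edge, one-sided at the ends.\<close>

abbreviation ud :: "(real \<Rightarrow> complex) \<Rightarrow> real \<Rightarrow> complex" where
  "ud u t \<equiv> vector_derivative u (at t within {0..1})"

text \<open>The memberships in \<open>AC\<close> and \<open>H1\<close> on a single edge.\<close>

definition AC1 :: "(real \<Rightarrow> complex) \<Rightarrow> bool" where
  "AC1 u \<longleftrightarrow> abs_cont u \<and> (AE t in unit_leb. u differentiable (at t within {0..1}))"

definition H1e :: "(real \<Rightarrow> complex) \<Rightarrow> bool" where
  "H1e u \<longleftrightarrow> AC1 u \<and> sqint (ud u)"

lemma AC_AC1: "AC E = {y. \<forall>i\<in>E. AC1 (y i)}"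
  by (simp add: AC_def AC1_def)

lemma H1_H1e: "H1 E = {y. \<forall>i\<in>E. H1e (y i)}"
  by (auto simp: H1_def AC_AC1 L2_sqint gderiv_def H1e_def)

lemma AE_unit_leb: "(\<And>t. t \<in> {0..1} \<Longrightarrow> P t) \<Longrightarrow> AE t in unit_leb. P t"
  by (rule AE_I2) simp

lemma ud_eq: "t \<in> {0..1} \<Longrightarrow> (u has_vector_derivative d) (at t within {0..1}) \<Longrightarrow> ud u t = d"
  by (rule vector_derivative_within_closed_interval) auto

lemma AE_ud_eq:
  assumes "AE t in unit_leb. (u has_vector_derivative g t) (at t within {0..1})"
  shows "AE t in unit_leb. ud u t = g t"
proof -
  have "AE t in unit_leb. t \<in> {0..1}" by (rule AE_unit_leb)
  with assms show ?thesis by eventually_elim (rule ud_eq)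
qed

lemma AC1I:
  assumes "abs_cont u" "AE t in unit_leb. (u has_vector_derivative g t) (at t within {0..1})"
  shows "AC1 u"
  unfolding AC1_def using assms by (auto elim!: eventually_mono intro: differentiableI_vector)

lemma H1eI:
  assumes "abs_cont u" "AE t in unit_leb. (u has_vector_derivative g t) (at t within {0..1})" "sqint g"
  shows "H1e u"
proof -
  have "AE t in unit_leb. g t = ud u t" using AE_ud_eq[OF assms(2)] by eventually_elim simp
  then have "sqint (ud u)" by (rule sqint_AE_cong(1)[OF assms(3)])
  then show ?thesis using AC1I[OF assms(1,2)] by (simp add: H1e_def)
qed

lemma AC1_abs_cont: "AC1 u \<Longrightarrow> abs_cont u"
  by (simp add: AC1_def)

lemma H1e_AC1: "H1e u \<Longrightarrow> AC1 u"
  by (simp add: H1e_def)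

lemma H1e_abs_cont: "H1e u \<Longrightarrow> abs_cont u"
  by (simp add: H1e_def AC1_def)

lemma H1e_sqint_ud: "H1e u \<Longrightarrow> sqint (ud u)"
  by (simp add: H1e_def)

lemma AC1_sqint: "AC1 u \<Longrightarrow> sqint u"
  by (intro sqint_continuous abs_cont_continuous AC1_abs_cont)

lemma H1e_sqint: "H1e u \<Longrightarrow> sqint u"
  by (intro AC1_sqint H1e_AC1)

lemma AC1_derivative:
  "AC1 u \<Longrightarrow> AE t in unit_leb. (u has_vector_derivative ud u t) (at t within {0..1})"
  unfolding AC1_def by (auto simp: vector_derivative_works)

lemma AC1_FTC:
  assumes "AC1 u" "AE t in unit_leb. (u has_vector_derivative g t) (at t within {0..1})"
    "0 \<le> a" "a \<le> b" "b \<le> 1"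
  shows "(g has_integral (u b - u a)) {a..b}"
proof (rule abs_cont_FTC)
  show "negligible {t \<in> {0..1}. \<not> (u has_vector_derivative g t) (at t within {0..1})}"
    using assms(2) unfolding AE_unit_leb_negligible .
qed (use assms AC1_abs_cont in auto)

lemma AC1_integral:
  assumes "AC1 u" "AE t in unit_leb. (u has_vector_derivative g t) (at t within {0..1})"
    "integrable unit_leb g"
  shows "(\<integral>t. g t \<partial>unit_leb) = u 1 - u 0"
  using AC1_FTC[OF assms(1,2), of 0 1] lebesgue_integral_eq_integral[OF assms(3)]
  by (simp add: integral_unique)

lemma interval_sets_unit_leb: "0 \<le> a \<Longrightarrow> b \<le> 1 \<Longrightarrow> {a..b} \<in> sets unit_leb"
  by (subst sets_restrict_space_iff) auto

lemma integral_indicator_unit: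
  assumes "integrable unit_leb g" "0 \<le> a" "b \<le> 1"
  shows "(\<integral>t. g t * indicator {a..b} t \<partial>unit_leb) = (integral {a..b} g :: complex)"
proof -
  have sub: "{a..b} \<inter> {0..1} = {a..b}" using assms by auto
  have eq: "(\<lambda>t. g t * indicator {a..b} t) = (\<lambda>t. if t \<in> {a..b} then g t else 0)"
    by (auto simp: indicator_def)
  have "integrable unit_leb (\<lambda>t. indicator {a..b} t *\<^sub>R g t)"
    by (intro integrable_mult_indicator assms interval_sets_unit_leb)
  moreover have "(\<lambda>t. indicat_real {a..b} t *\<^sub>R g t) = (\<lambda>t. g t * indicator {a..b} t)"
    by (auto simp: indicator_def)
  ultimately have "integrable unit_leb (\<lambda>t. g t * indicator {a..b} t)" by simp
  then have "(\<integral>t. g t * indicator {a..b} t \<partial>unit_leb) = integral {0..1} (\<lambda>t. g t * indicator {a..b} t)"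
    by (rule lebesgue_integral_eq_integral) simp
  also have "\<dots> = integral {a..b} g" unfolding eq integral_restrict_Int sub ..
  finally show ?thesis .
qed

lemma H1e_Hoelder:
  assumes u: "H1e u" and ab: "0 \<le> a" "a \<le> b" "b \<le> 1"
  shows "(cmod (u b - u a))\<^sup>2 \<le> (b - a) * sqn (ud u)"
proof -
  define c where "c t = (indicator {a..b} t :: complex)" for t
  have cb: "c \<in> borel_measurable unit_leb"
    unfolding c_def using ab by (intro borel_measurable_indicator interval_sets_unit_leb)
  have sc: "sqint c" by (rule sqint_bounded[OF cb, of 1]) (auto simp: c_def indicator_def)
  have "(u b - u a) = (\<integral>t. ud u t * cnj (c t) \<partial>unit_leb)"
  proof -
    have "u b - u a = integral {a..b} (ud u)"
      using AC1_FTC[OF H1e_AC1[OF u] AC1_derivative[OF H1e_AC1[OF u]] ab] by (simp add: integral_unique)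
    also have "\<dots> = (\<integral>t. ud u t * indicator {a..b} t \<partial>unit_leb)"
      using ab by (intro integral_indicator_unit[symmetric] sqint_integrable H1e_sqint_ud u) auto
    also have "(\<lambda>t. ud u t * indicator {a..b} t) = (\<lambda>t. ud u t * cnj (c t))"
      by (auto simp: c_def indicator_def)
    finally show ?thesis .
  qed
  then have "(cmod (u b - u a))\<^sup>2 \<le> sqn (ud u) * sqn c"
    using sqint_Cauchy_Schwarz[OF H1e_sqint_ud[OF u] sc] by simp
  moreover have "sqn c = b - a"
  proof -
    have "complex_of_real (sqn c) = (\<integral>t. 1 * indicator {a..b} t \<partial>unit_leb)"
      unfolding sqn_def integral_complex_of_real[symmetric]
      by (intro Bochner_Integration.integral_cong) (auto simp: c_def indicator_def)
    also have "\<dots> = integral {a..b} (\<lambda>t. 1)" using ab by (intro integral_indicator_unit) auto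
    also have "\<dots> = of_real (b - a)" using ab by (simp add: scaleR_conv_of_real)
    finally show ?thesis using of_real_eq_iff by blast
  qed
  ultimately show ?thesis by (simp add: mult.commute)
qed

text \<open>A value is controlled by averaging over an interval of length \<open>\<eta>\<close> that contains the point.\<close>

lemma H1e_trace:
  assumes u: "H1e u" and s: "s \<in> {0..1}" and \<eta>: "0 < \<eta>" "\<eta> \<le> 1"
  shows "(cmod (u s))\<^sup>2 \<le> (2 / \<eta>) * sqn u + 2 * \<eta> * sqn (ud u)"
proof -
  define a where "a = min s (1 - \<eta>)"
  have a: "0 \<le> a" "a \<le> s" "s \<le> a + \<eta>" "a + \<eta> \<le> 1" using s \<eta> by (auto simp: a_def)
  define I where "I = {a..a + \<eta>}"
  have pt: "(cmod (u s))\<^sup>2 \<le> 2 * (cmod (u t))\<^sup>2 + 2 * \<eta> * sqn (ud u)" if t: "t \<in> I" for t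
  proof -
    have h: "(cmod (u s - u t))\<^sup>2 \<le> \<eta> * sqn (ud u)"
    proof (cases "t \<le> s")
      case True
      have "(cmod (u s - u t))\<^sup>2 \<le> (s - t) * sqn (ud u)"
        using H1e_Hoelder[OF u, of t s] True t s a by (auto simp: I_def)
      also have "\<dots> \<le> \<eta> * sqn (ud u)" using t a by (intro mult_right_mono) (auto simp: I_def)
      finally show ?thesis .
    next
      case False
      have "(cmod (u t - u s))\<^sup>2 \<le> (t - s) * sqn (ud u)"
        using H1e_Hoelder[OF u, of s t] False t s a by (auto simp: I_def)
      also have "\<dots> \<le> \<eta> * sqn (ud u)" using t a by (intro mult_right_mono) (auto simp: I_def)
      finally show ?thesis by (simp add: norm_minus_commute)
    qed
    have "cmod (u s) \<le> cmod (u t) + cmod (u s - u t)"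
      using norm_triangle_ineq[of "u t" "u s - u t"] by simp
    then have "(cmod (u s))\<^sup>2 \<le> (cmod (u t) + cmod (u s - u t))\<^sup>2" by (intro power_mono) auto
    also have "\<dots> \<le> 2 * (cmod (u t))\<^sup>2 + 2 * (cmod (u s - u t))\<^sup>2"
      using zero_le_power2[of "cmod (u t) - cmod (u s - u t)"] unfolding power2_sum power2_diff by linarith
    finally show ?thesis using h by linarith
  qed
  have sI: "I \<in> sets unit_leb" using a unfolding I_def by (intro interval_sets_unit_leb)
  have iI: "integrable unit_leb (\<lambda>t. indicator I t * c)" for c :: real
    using integrable_mult_indicator[OF sI unit_leb_const_integrable[of c]] by simp
  have mI: "(\<integral>t. indicator I t * c \<partial>unit_leb) = \<eta> * c" for c :: real
  proof -
    have "measure unit_leb I = \<eta>"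
      using a \<eta> unfolding I_def by (subst measure_restrict_space) auto
    moreover have "I \<inter> {0..1} = I" using a by (auto simp: I_def)
    ultimately show ?thesis using sI by simp
  qed
  have su: "integrable unit_leb (\<lambda>t. (cmod (u t))\<^sup>2)" using H1e_sqint[OF u] by (simp add: sqint_def)
  have "\<eta> * (cmod (u s))\<^sup>2 = (\<integral>t. indicator I t * (cmod (u s))\<^sup>2 \<partial>unit_leb)" by (rule mI[symmetric])
  also have "\<dots> \<le> (\<integral>t. 2 * (cmod (u t))\<^sup>2 + indicator I t * (2 * \<eta> * sqn (ud u)) \<partial>unit_leb)"
  proof (rule integral_mono)
    show "integrable unit_leb (\<lambda>t. 2 * (cmod (u t))\<^sup>2 + indicator I t * (2 * \<eta> * sqn (ud u)))"
      using su iI by (intro Bochner_Integration.integrable_add) auto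
    show "indicator I t * (cmod (u s))\<^sup>2 \<le> 2 * (cmod (u t))\<^sup>2 + indicator I t * (2 * \<eta> * sqn (ud u))"
      for t using pt[of t] by (cases "t \<in> I") auto
  qed (rule iI)
  also have "\<dots> = 2 * sqn u + \<eta> * (2 * \<eta> * sqn (ud u))"
    using su iI[of "2 * \<eta> * sqn (ud u)"] mI[of "2 * \<eta> * sqn (ud u)"]
    by (subst Bochner_Integration.integral_add) (simp_all only: integrable_mult_right integral_mult_right_zero sqn_def)
  finally have "(cmod (u s))\<^sup>2 \<le> (2 * sqn u + \<eta> * (2 * \<eta> * sqn (ud u))) / \<eta>"
    using \<eta> by (simp add: pos_le_divide_eq mult.commute)
  also have "\<dots> = (2 / \<eta>) * sqn u + 2 * \<eta> * sqn (ud u)" using \<eta> by (simp add: field_simps)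
  finally show ?thesis .
qed

subsection \<open>Closure properties\<close>

lemma AC1_lin_derivative:
  assumes "AC1 u" "AC1 v"
  shows "AE t in unit_leb. ((\<lambda>t. a * u t + b * v t) has_vector_derivative a * ud u t + b * ud v t)
    (at t within {0..1})"
  using AC1_derivative[OF assms(1)] AC1_derivative[OF assms(2)]
proof eventually_elim
  case (elim t)
  from has_vector_derivative_add[OF has_vector_derivative_mult_right[OF elim(1), of a]
      has_vector_derivative_mult_right[OF elim(2), of b]]
  show ?case .
qed

lemma H1e_lin:
  assumes "H1e u" "H1e v"
  shows "H1e (\<lambda>t. a * u t + b * v t)"
  by (rule H1eI[OF abs_cont_lin AC1_lin_derivative])
    (use assms in \<open>auto intro!: sqint_lin intro: H1e_abs_cont H1e_AC1 H1e_sqint_ud\<close>)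

lemma ud_lin: "AC1 u \<Longrightarrow> AC1 v \<Longrightarrow> AE t in unit_leb. ud (\<lambda>t. a * u t + b * v t) t = a * ud u t + b * ud v t"
  by (rule AE_ud_eq[OF AC1_lin_derivative])

lemma AC1_mult_cnj_derivative:
  assumes "AC1 u" "AC1 v"
  shows "AE t in unit_leb. ((\<lambda>t. u t * cnj (v t)) has_vector_derivative u t * cnj (ud v t) + ud u t * cnj (v t))
    (at t within {0..1})"
  using AC1_derivative[OF assms(1)] AC1_derivative[OF assms(2)]
  by eventually_elim (intro has_vector_derivative_mult has_vector_derivative_cnj)

lemma integration_by_parts:
  assumes "H1e u" "H1e v"
  shows "(\<integral>t. u t * cnj (ud v t) \<partial>unit_leb) + (\<integral>t. ud u t * cnj (v t) \<partial>unit_leb)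
    = u 1 * cnj (v 1) - u 0 * cnj (v 0)"
proof -
  have i: "integrable unit_leb (\<lambda>t. u t * cnj (ud v t))" "integrable unit_leb (\<lambda>t. ud u t * cnj (v t))"
    using assms by (auto intro: sqint_mult_cnj_integrable H1e_sqint H1e_sqint_ud)
  have ac: "AC1 u" "AC1 v" using assms by (auto intro: H1e_AC1)
  have "abs_cont (\<lambda>t. u t * cnj (v t))"
    using ac by (intro abs_cont_mult abs_cont_cnj AC1_abs_cont)
  then have "AC1 (\<lambda>t. u t * cnj (v t))" by (rule AC1I[OF _ AC1_mult_cnj_derivative[OF ac]])
  then have "(\<integral>t. u t * cnj (ud v t) + ud u t * cnj (v t) \<partial>unit_leb) = u 1 * cnj (v 1) - u 0 * cnj (v 0)"
    using AC1_integral[OF _ AC1_mult_cnj_derivative[OF ac]] i by simp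
  then show ?thesis using i by simp
qed

lemma continuous_H1e:
  assumes "\<And>t. t \<in> {0..1} \<Longrightarrow> (u has_vector_derivative g t) (at t within {0..1})" "continuous_on {0..1} g"
  shows "H1e u"
proof (rule H1eI[OF _ AE_unit_leb sqint_continuous[OF assms(2)]])
  have "bounded (g ` {0..1})"
    using assms(2) by (intro compact_imp_bounded compact_continuous_image) auto
  then obtain C where C: "\<forall>t\<in>{0..1}. norm (g t) \<le> C" by (auto simp: bounded_iff)
  have "norm (g 0) \<le> C" using C by simp
  then have C0: "0 \<le> C" using norm_ge_zero[of "g 0"] by linarith
  show "abs_cont u"
  proof (rule abs_cont_Lipschitz[OF C0])
    fix s t :: real assume st: "0 \<le> s" "s \<le> t" "t \<le> 1"
    have "norm (u t - u s) \<le> C * norm (t - s)"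
    proof (rule differentiable_bound[of "{0..1}" u "\<lambda>t h. h *\<^sub>R g t"])
      show "(u has_derivative (\<lambda>h. h *\<^sub>R g x)) (at x within {0..1})" if "x \<in> {0..1}" for x
        using assms(1)[OF that] unfolding has_vector_derivative_def .
      show "onorm (\<lambda>h. h *\<^sub>R g x) \<le> C" if "x \<in> {0..1}" for x
        proof (rule onorm_bound[OF C0])
          show "norm (h *\<^sub>R g x) \<le> C * norm h" for h
            using mult_right_mono[of "norm (g x)" C "norm h"] C that by (simp add: mult.commute)
        qed
    qed (use st in auto)
    then show "cmod (u t - u s) \<le> C * (t - s)" using st by simp
  qed
qed (rule assms(1))

lemma forward_quotient_limit:
  fixes w :: "real \<Rightarrow> complex"
  assumes der: "(w has_vector_derivative D) (at t within {0..1})" and t: "0 \<le> t" "t < 1"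
  shows "(\<lambda>k. of_nat (Suc k) * (w (min 1 (t + 1 / real (Suc k))) - w t)) \<longlonglongrightarrow> D"
proof (rule LIMSEQ_I)
  define Q where "Q k = of_nat (Suc k) * (w (min 1 (t + 1 / real (Suc k))) - w t)" for k
  fix e :: real assume "e > 0"
  then have "e / 2 > 0" by simp
  with der obtain d where d: "d > 0"
    "\<And>s. s \<in> {0..1} \<Longrightarrow> norm (s - t) < d \<Longrightarrow> norm (w s - w t - (s - t) *\<^sub>R D) \<le> e / 2 * norm (s - t)"
    unfolding has_vector_derivative_def has_derivative_within_alt by blast
  obtain N :: nat where N: "1 / min d (1 - t) < real N" using reals_Archimedean2 by blast
  have "norm (Q k - D) < e" if "k \<ge> N" for k
  proof -
    define h where "h = 1 / real (Suc k)"
    have m: "min d (1 - t) > 0" using d t by simp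
    have "1 / min d (1 - t) < real (Suc k)" using N that by linarith
    then have "0 < h" "h < min d (1 - t)"
        using m unfolding h_def by (simp_all add: divide_less_eq mult.commute del: of_nat_Suc min_less_iff_conj)
      then have h: "0 < h" "h < d" "h < 1 - t" by auto
    have "norm (w (t + h) - w t - h *\<^sub>R D) \<le> e / 2 * h"
      using d(2)[of "t + h"] h t by simp
    moreover have "Q k - D = (1 / h) *\<^sub>R (w (t + h) - w t - h *\<^sub>R D)"
    proof -
      have "min 1 (t + h) = t + h" using h by simp
      then have "Q k = (1 / h) *\<^sub>R (w (t + h) - w t)"
        unfolding Q_def h_def[symmetric] using h(1)
        by (simp add: h_def scaleR_conv_of_real)
      then show ?thesis using h(1) by (simp add: scaleR_right_diff_distrib)
    qed
    ultimately have "norm (Q k - D) \<le> (1 / h) * (e / 2 * h)"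
      using h(1) by (simp only: norm_scaleR) (intro mult_mono; simp)
    also have "\<dots> < e" using h(1) \<open>e > 0\<close> by simp
    finally show ?thesis .
  qed
  then show "\<exists>N. \<forall>k\<ge>N. norm (of_nat (Suc k) * (w (min 1 (t + 1 / real (Suc k))) - w t) - D) < e"
    unfolding Q_def by blast
qed

text \<open>For a Lipschitz function the derivative is a bounded limit of difference quotients, hence square
  integrable.\<close>

lemma Lipschitz_H1e:
  assumes "0 \<le> C" and lip: "\<And>s t. 0 \<le> s \<Longrightarrow> s \<le> t \<Longrightarrow> t \<le> 1 \<Longrightarrow> cmod (w t - w s) \<le> C * (t - s)"
    and dif: "AE t in unit_leb. (w has_vector_derivative g t) (at t within {0..1})"
  shows "H1e w"
proof -
  have ac: "abs_cont w" using assms(1) lip by (rule abs_cont_Lipschitz)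
  define q where "q k t = of_nat (Suc k) * (w (min 1 (t + 1 / real (Suc k))) - w t)" for k t
  have qm: "q k \<in> borel_measurable unit_leb" for k
  proof -
    have "continuous_on {0..1} (\<lambda>t. w (min 1 (t + 1 / real (Suc k))))"
      by (intro continuous_on_compose2[OF abs_cont_continuous[OF ac]] continuous_intros) auto
    then have "continuous_on {0..1} (q k)"
      unfolding q_def using abs_cont_continuous[OF ac] by (intro continuous_intros)
    then show ?thesis by (intro continuous_imp_measurable_on_sets_lebesgue) auto
  qed
  have ne1: "AE t in unit_leb. t \<noteq> 1"
    unfolding AE_unit_leb_negligible by (rule negligible_subset[of "{1}"]) auto
  have "AE t in unit_leb. t \<in> {0..1}" by (rule AE_unit_leb)
  with dif ne1 have lim: "AE t in unit_leb. (\<lambda>k. q k t) \<longlonglongrightarrow> g t"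
  proof eventually_elim
    case (elim t)
    then show ?case unfolding q_def by (intro forward_quotient_limit) auto
  qed
  have qb: "cmod (q k t) \<le> C" if "t \<in> {0..1}" for k t
  proof -
    have "cmod (w (min 1 (t + 1 / real (Suc k))) - w t) \<le> C * (min 1 (t + 1 / real (Suc k)) - t)"
      using that by (intro lip) auto
    also have "\<dots> \<le> C * (1 / real (Suc k))" using \<open>0 \<le> C\<close> by (intro mult_left_mono) auto
    finally have "real (Suc k) * cmod (w (min 1 (t + 1 / real (Suc k))) - w t) \<le> real (Suc k) * (C * (1 / real (Suc k)))"
      by (intro mult_left_mono) auto
    then show ?thesis by (simp add: q_def norm_mult del: of_nat_Suc)
  qed
  have "AE t in unit_leb. lim (\<lambda>k. q k t) = g t" using lim by eventually_elim (rule limI)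
  then have gm: "g \<in> borel_measurable unit_leb"
    by (rule unit_leb_AE_eq_measurable[OF borel_measurable_lim_metric[OF qm]])
  have "AE t in unit_leb. t \<in> {0..1}" by (rule AE_unit_leb)
  with lim have "AE t in unit_leb. cmod (g t) \<le> C"
  proof eventually_elim
    case (elim t)
    then show ?case using qb
      by (intro LIMSEQ_le_const2[OF tendsto_norm[OF elim(1)]]) auto
  qed
  then have "sqint g" by (rule sqint_bounded[OF gm])
  then show ?thesis by (rule H1eI[OF ac dif])
qed

text \<open>Almost everywhere statements are transported along affine maps.\<close>

lemma AE_affine:
  assumes "AE t in unit_leb. P t" "c \<noteq> 0"
  shows "AE t in unit_leb. p + c * t \<in> {0..1} \<longrightarrow> P (p + c * t)"
proof -
  define N where "N = {t \<in> {0..1}. \<not> P t}"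
  have N: "negligible N" using assms(1) unfolding AE_unit_leb_negligible N_def .
  have "negligible ((\<lambda>s. (s - p) / c) ` N)"
  proof (rule negligible_differentiable_image_negligible[OF _ N])
    show "(\<lambda>s. (s - p) / c) differentiable_on N"
      using assms(2) by (intro differentiable_at_imp_differentiable_on derivative_intros) auto
  qed simp
  moreover have "{t \<in> {0..1}. \<not> (p + c * t \<in> {0..1} \<longrightarrow> P (p + c * t))} \<subseteq> (\<lambda>s. (s - p) / c) ` N"
  proof
    fix t assume "t \<in> {t \<in> {0..1}. \<not> (p + c * t \<in> {0..1} \<longrightarrow> P (p + c * t))}"
    then have "p + c * t \<in> N" "t = ((p + c * t) - p) / c" using assms(2) by (auto simp: N_def)
    then show "t \<in> (\<lambda>s. (s - p) / c) ` N" by (rule rev_image_eqI)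
  qed
  ultimately show ?thesis unfolding AE_unit_leb_negligible by (rule negligible_subset)
qed

text \<open>The chain rule for an inner function that is affine near the point.\<close>

lemma affine_chain:
  fixes u :: "real \<Rightarrow> complex"
  assumes u: "(u has_vector_derivative D) (at (p + c * t) within {0..1})" and t: "t \<in> {0..1}"
    and range: "\<And>s. s \<in> {0..1} \<Longrightarrow> \<phi> s \<in> {0..1}"
    and "\<delta> > 0" and loc: "\<And>s. s \<in> {0..1} \<Longrightarrow> dist s t < \<delta> \<Longrightarrow> \<phi> s = p + c * s"
  shows "((\<lambda>s. u (\<phi> s)) has_vector_derivative of_real c * D) (at t within {0..1})"
proof -
  have "((\<lambda>s. p + c * s) has_vector_derivative c) (at t within {0..1})"
    by (auto intro!: derivative_eq_intros)
  then have \<phi>: "(\<phi> has_vector_derivative c) (at t within {0..1})"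
    by (rule has_vector_derivative_transform_within[OF _ \<open>\<delta> > 0\<close> t]) (simp add: loc)
  have "\<phi> t = p + c * t" using loc[OF t] \<open>\<delta> > 0\<close> by simp
  then have "(u has_vector_derivative D) (at (\<phi> t) within \<phi> ` {0..1})"
    using u range by (auto intro: has_vector_derivative_within_subset)
  from vector_diff_chain_within[OF \<phi> this] show ?thesis
    by (simp add: o_def scaleR_conv_of_real)
qed

lemma AC1_reflect:
  assumes "AC1 u"
  shows "AC1 (\<lambda>t. u (1 - t))"
    and "AE t in unit_leb. ((\<lambda>t. u (1 - t)) has_vector_derivative - ud u (1 - t)) (at t within {0..1})"
proof -
  have "AE t in unit_leb. 1 + (-1) * t \<in> {0..1} \<longrightarrow>
      (u has_vector_derivative ud u (1 + (-1) * t)) (at (1 + (-1) * t) within {0..1})"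
    by (rule AE_affine[OF AC1_derivative[OF assms]]) simp
  moreover have "AE t in unit_leb. t \<in> {0..1}" by (rule AE_unit_leb)
  ultimately show der: "AE t in unit_leb. ((\<lambda>t. u (1 - t)) has_vector_derivative - ud u (1 - t)) (at t within {0..1})"
  proof eventually_elim
    case (elim t)
    then have "(u has_vector_derivative ud u (1 - t)) (at (1 + (-1) * t) within {0..1})" by simp
    from affine_chain[OF this elim(2), of "\<lambda>s. 1 - s" 1] show ?case by simp
  qed
  show "AC1 (\<lambda>t. u (1 - t))"
    by (rule AC1I[OF abs_cont_reflect[OF AC1_abs_cont[OF assms]] der])
qed

subsection \<open>Indefinite integrals\<close>

text \<open>Lebesgue's differentiation theorem on the unit interval: the one-sided version is applied to the
  function and to its reflection.\<close>

lemma indefinite_integral_derivative: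
  fixes h :: "real \<Rightarrow> complex"
  assumes h: "h integrable_on {0..1}"
  shows "AE t in unit_leb. ((\<lambda>s. integral {0..s} h) has_vector_derivative h t) (at t within {0..1})"
proof -
  define f where "f t = (if t \<in> {0..1} then h t else 0)" for t
  have fU: "f integrable_on UNIV" unfolding f_def by (subst integrable_restrict_UNIV) (rule h)
  have fi: "f integrable_on cbox a b" for a b
    using integrable_on_subcbox[OF fU] by simp
  have ri: "(\<lambda>t. f (- t)) integrable_on cbox a b" for a b
    using fi[of "-b" "-a"] Henstock_Kurzweil_Integration.integrable_reflect_real[of f "-a" "-b"] by simp
  obtain N1 where N1: "negligible N1" "\<And>x e. x \<notin> N1 \<Longrightarrow> 0 < e \<Longrightarrow>
      \<exists>d>0. \<forall>k. 0 < k \<and> k < d \<longrightarrow> norm (integral (cbox x (x + k *\<^sub>R One)) f /\<^sub>R k ^ DIM(real) - f x) < e"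
    using integrable_ccontinuous_explicit[of f, OF fi] by blast
  obtain N2 where N2: "negligible N2" "\<And>x e. x \<notin> N2 \<Longrightarrow> 0 < e \<Longrightarrow>
      \<exists>d>0. \<forall>k. 0 < k \<and> k < d \<longrightarrow>
        norm (integral (cbox x (x + k *\<^sub>R One)) (\<lambda>t. f (- t)) /\<^sub>R k ^ DIM(real) - f (- x)) < e"
    using integrable_ccontinuous_explicit[of "\<lambda>t. f (- t)", OF ri] by blast
  have neg2: "negligible (uminus ` N2)"
    by (rule negligible_differentiable_image_negligible[OF _ N2(1)]) (auto intro: derivative_intros)
  have diff: "integral {0..t} h - integral {0..s} h = integral {s..t} f"
    if "0 \<le> s" "s \<le> t" "t \<le> 1" for s t
  proof -
    have "h integrable_on {0..t}" using h by (rule integrable_on_subinterval) (use that in auto)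
    then have "integral {0..s} h + integral {s..t} h = integral {0..t} h"
      using that by (intro Henstock_Kurzweil_Integration.integral_combine) auto
    moreover have "integral {s..t} h = integral {s..t} f"
      using that by (intro integral_cong) (auto simp: f_def)
    ultimately show ?thesis by (metis add_diff_cancel_left')
  qed
  have main: "((\<lambda>s. integral {0..s} h) has_vector_derivative h t) (at t within {0..1})"
    if t: "0 \<le> t" "t \<le> 1" "t \<notin> N1" "- t \<notin> N2" for t
    unfolding has_vector_derivative_def has_derivative_within_alt
  proof (intro conjI allI impI)
    show "bounded_linear (\<lambda>x. x *\<^sub>R h t)" by (rule bounded_linear_scaleR_left)
    fix e :: real assume e: "0 < e"
    obtain d1 where d1: "d1 > 0" "\<And>k. 0 < k \<Longrightarrow> k < d1 \<Longrightarrow> norm (integral {t..t + k} f /\<^sub>R k - f t) < e"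
      using N1(2)[OF t(3) e] by auto
    obtain d2 where d2: "d2 > 0"
      "\<And>k. 0 < k \<Longrightarrow> k < d2 \<Longrightarrow> norm (integral {- t..- t + k} (\<lambda>t. f (- t)) /\<^sub>R k - f (- (- t))) < e"
      using N2(2)[OF t(4) e] by auto
    have ft: "f t = h t" using t by (simp add: f_def)
    have scale: "norm (X - k *\<^sub>R z) \<le> e * k" if "0 < k" "norm (X /\<^sub>R k - z) < e" for X z :: complex and k
    proof -
      have "X - k *\<^sub>R z = k *\<^sub>R (X /\<^sub>R k - z)" using that(1) by (simp add: scaleR_right_diff_distrib)
      then have "norm (X - k *\<^sub>R z) = k * norm (X /\<^sub>R k - z)" using that(1) by simp
      also have "\<dots> \<le> k * e" using that by (intro mult_left_mono) auto
      finally show ?thesis by (simp add: mult.commute)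
    qed
    show "\<exists>d>0. \<forall>s\<in>{0..1}. norm (s - t) < d \<longrightarrow>
        norm (integral {0..s} h - integral {0..t} h - (s - t) *\<^sub>R h t) \<le> e * norm (s - t)"
    proof (intro exI[of _ "min d1 d2"] conjI ballI impI)
      show "0 < min d1 d2" using d1 d2 by simp
      fix s :: real assume s: "s \<in> {0..1}" "norm (s - t) < min d1 d2"
      consider "s = t" | "t < s" | "s < t" by linarith
      then show "norm (integral {0..s} h - integral {0..t} h - (s - t) *\<^sub>R h t) \<le> e * norm (s - t)"
      proof cases
        case 2
        have "norm (integral {t..s} f /\<^sub>R (s - t) - f t) < e"
          using d1(2)[of "s - t"] 2 s by simp
        then have "norm (integral {t..s} f - (s - t) *\<^sub>R f t) \<le> e * (s - t)"
          using 2 by (intro scale) auto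
        then show ?thesis using diff[of t s] 2 s t ft by simp
      next
        case 3
        have "norm (integral {- t..- t + (t - s)} (\<lambda>t. f (- t)) /\<^sub>R (t - s) - f t) < e"
          using d2(2)[of "t - s"] 3 s by simp
        moreover have "integral {- t..- t + (t - s)} (\<lambda>t. f (- t)) = integral {s..t} f"
          using Henstock_Kurzweil_Integration.integral_reflect_real[where f=f and a=s and b=t] by simp
        ultimately have "norm (integral {s..t} f - (t - s) *\<^sub>R f t) \<le> e * (t - s)"
          using 3 by (intro scale) auto
        moreover have "integral {0..s} h - integral {0..t} h - (s - t) *\<^sub>R h t =
            - (integral {s..t} f - (t - s) *\<^sub>R f t)"
          using diff[of s t] 3 s t ft by (simp add: algebra_simps)
        ultimately show ?thesis using 3 by (simp only: norm_minus_cancel) simp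
      qed simp
    qed
  qed
  have "negligible {t \<in> {0..1}. \<not> ((\<lambda>s. integral {0..s} h) has_vector_derivative h t) (at t within {0..1})}"
  proof (rule negligible_subset)
    show "negligible (N1 \<union> uminus ` N2)" using N1(1) neg2 by (rule negligible_Un)
    show "{t \<in> {0..1}. \<not> ((\<lambda>s. integral {0..s} h) has_vector_derivative h t) (at t within {0..1})}
        \<subseteq> N1 \<union> uminus ` N2"
      using main by (force simp: image_iff)
  qed
  then show ?thesis unfolding AE_unit_leb_negligible .
qed

lemma indefinite_integral_Lipschitz:
  fixes h :: "real \<Rightarrow> complex"
  assumes h: "h integrable_on {0..1}" and C: "\<And>t. t \<in> {0..1} \<Longrightarrow> cmod (h t) \<le> C"
    and st: "0 \<le> s" "s \<le> t" "t \<le> 1"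
  shows "cmod (integral {0..t} h - integral {0..s} h) \<le> C * (t - s)"
proof -
  have hi: "h integrable_on {a..b}" if "0 \<le> a" "b \<le> 1" for a b
    using h by (rule integrable_on_subinterval) (use that in auto)
  have "integral {0..s} h + integral {s..t} h = integral {0..t} h"
    using st hi by (intro Henstock_Kurzweil_Integration.integral_combine) auto
  then have "integral {0..t} h - integral {0..s} h = integral {s..t} h"
    by (metis add_diff_cancel_left')
  also have "cmod \<dots> \<le> integral {s..t} (\<lambda>_. C)"
    using st hi C by (intro integral_norm_bound_integral) auto
  finally show ?thesis using st by (simp add: mult.commute)
qed

text \<open>Truncated functions supported inside the interval are limits of their Steklov averages, so the
  Sobolev functions that vanish at both ends are dense in the square integrable ones.\<close>

lemma H1e_dense:
  assumes w: "sqint w" and "\<epsilon> > 0"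
  obtains v where "H1e v" "v 0 = 0" "v 1 = 0" "sqn (\<lambda>t. w t - v t) < \<epsilon>"
proof -
  have conv0: "\<exists>n. sqn (G n) < \<epsilon>'"
    if G: "\<And>n. G n \<in> borel_measurable unit_leb" and lim: "AE t in unit_leb. (\<lambda>n. G n t) \<longlonglongrightarrow> 0"
      and dom: "\<And>n. AE t in unit_leb. (cmod (G n t))\<^sup>2 \<le> D t" and D: "integrable unit_leb D" and "\<epsilon>' > 0"
    for G :: "nat \<Rightarrow> real \<Rightarrow> complex" and D and \<epsilon>' :: real
  proof -
    have "(\<lambda>n. \<integral>t. (cmod (G n t))\<^sup>2 \<partial>unit_leb) \<longlonglongrightarrow> (\<integral>t. 0 \<partial>unit_leb)"
    proof (rule integral_dominated_convergence[OF _ _ D])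
      show "AE t in unit_leb. (\<lambda>n. (cmod (G n t))\<^sup>2) \<longlonglongrightarrow> 0"
        using lim
      proof eventually_elim
        case (elim t)
        from tendsto_power[OF tendsto_norm[OF elim], of 2] show ?case by simp
      qed
    qed (use G dom in auto)
    then have "(\<lambda>n. sqn (G n)) \<longlonglongrightarrow> 0" unfolding sqn_def by simp
    from order_tendstoD(2)[OF this \<open>\<epsilon>' > 0\<close>] have "\<forall>\<^sub>F n in sequentially. sqn (G n) < \<epsilon>'" .
    then show ?thesis by (auto simp: eventually_sequentially)
  qed
  \<comment> \<open>Truncation in height and near the two ends.\<close>
  define S where "S n = {t. cmod (w t) \<le> real n \<and> 1 / real (Suc n) \<le> t \<and> t \<le> 1 - 1 / real (Suc n)}" for n
  define wn where "wn n t = (if t \<in> S n then w t else 0)" for n t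
  have wm: "w \<in> borel_measurable unit_leb" using w by (rule sqint_measurable)
  have wnm: "wn n \<in> borel_measurable unit_leb" for n
    unfolding wn_def
  proof (rule measurable_If_set)
    have idm: "(\<lambda>t. t) \<in> borel_measurable unit_leb"
      by (intro continuous_imp_measurable_on_sets_lebesgue continuous_intros) auto
    have "{t \<in> space unit_leb. cmod (w t) \<le> real n \<and> 1 / real (Suc n) \<le> t \<and> t \<le> 1 - 1 / real (Suc n)} \<in> sets unit_leb"
      using wm idm by measurable
    also have "{t \<in> space unit_leb. cmod (w t) \<le> real n \<and> 1 / real (Suc n) \<le> t \<and> t \<le> 1 - 1 / real (Suc n)}
      = S n \<inter> space unit_leb" by (auto simp: S_def)
    finally show "S n \<inter> space unit_leb \<in> sets unit_leb" .
  qed (use wm in auto)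
  have "\<exists>n. sqn (\<lambda>t. w t - wn n t) < \<epsilon> / 4"
  proof (rule conv0)
    show "(\<lambda>t. w t - wn n t) \<in> borel_measurable unit_leb" for n using wm wnm by measurable
    have "AE t in unit_leb. t \<in> {0<..<1}"
      unfolding AE_unit_leb_negligible by (rule negligible_subset[of "{0, 1}"]) auto
    then show "AE t in unit_leb. (\<lambda>n. w t - wn n t) \<longlonglongrightarrow> 0"
    proof eventually_elim
      case (elim t)
      obtain N :: nat where N: "cmod (w t) + 1 / t + 1 / (1 - t) < real N" using reals_Archimedean2 by blast
      have "w t - wn n t = 0" if "n \<ge> N" for n
      proof -
        have p: "0 < t" "0 < 1 - t" using elim by auto
        have q: "0 \<le> cmod (w t)" "0 \<le> 1 / t" "0 \<le> 1 / (1 - t)" using p by auto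
        have "real N \<le> real n" using that by simp
        then have "cmod (w t) \<le> real n" "1 / t \<le> real (Suc n)" "1 / (1 - t) \<le> real (Suc n)"
          using N q by linarith+
        then have "cmod (w t) \<le> real n" "1 / real (Suc n) \<le> t" "1 / real (Suc n) \<le> 1 - t"
          using p by (auto simp: field_simps simp del: of_nat_Suc)
        then show ?thesis by (simp add: wn_def S_def)
      qed
      then show ?case by (intro tendsto_eventually) (auto simp: eventually_sequentially)
    qed
    show "AE t in unit_leb. (cmod (w t - wn n t))\<^sup>2 \<le> (cmod (w t))\<^sup>2" for n
      by (rule AE_I2) (simp add: wn_def)
    show "integrable unit_leb (\<lambda>t. (cmod (w t))\<^sup>2)" using w by (simp add: sqint_def)
  qed (use \<open>\<epsilon> > 0\<close> in simp)
  then obtain n where n: "sqn (\<lambda>t. w t - wn n t) < \<epsilon> / 4" by blast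
  define h where "h = wn n"
  define \<eta> where "\<eta> = 1 / real (Suc n)"
  have \<eta>: "\<eta> > 0" by (simp add: \<eta>_def)
  have hb: "cmod (h t) \<le> real n" for t by (simp add: h_def wn_def S_def)
  have hm: "h \<in> borel_measurable unit_leb" using wnm by (simp add: h_def)
  have hs: "sqint h" using hm hb by (intro sqint_bounded) auto
  have h0: "h t = 0" if "t < \<eta>" for t using that by (simp add: h_def wn_def S_def \<eta>_def)
  have hi: "h integrable_on {0..1}"
    by (rule integrable_on_lebesgue_on[OF sqint_integrable[OF hs]]) simp
  define A where "A s = integral {0..s} h" for s
  have Alip: "cmod (A t - A s) \<le> real n * (t - s)" if "0 \<le> s" "s \<le> t" "t \<le> 1" for s t
    unfolding A_def using indefinite_integral_Lipschitz[OF hi hb that] .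
  have Ad: "AE t in unit_leb. (A has_vector_derivative h t) (at t within {0..1})"
    unfolding A_def[abs_def] by (rule indefinite_integral_derivative[OF hi])
  \<comment> \<open>The average of \<open>h\<close> over \<open>[t, t + 1 / (k + 1)]\<close>, where \<open>h\<close> is continued by zero beyond the end \<open>1\<close>.\<close>
  define m where "m k t = min 1 (t + 1 / real (Suc k))" for k t
  define v where "v k t = of_nat (Suc k) * (A (m k t) - A t)" for k t
  have mr: "m k t \<in> {0..1}" if "t \<in> {0..1}" for k t using that by (auto simp: m_def)
  have vd: "AE t in unit_leb. \<exists>D. (v k has_vector_derivative D) (at t within {0..1})" for k
  proof -
    have ne: "AE t in unit_leb. t \<noteq> 1 - 1 / real (Suc k)"
      unfolding AE_unit_leb_negligible by (rule negligible_subset[of "{1 - 1 / real (Suc k)}"]) auto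
    have "AE t in unit_leb. 1 / real (Suc k) + 1 * t \<in> {0..1} \<longrightarrow>
        (A has_vector_derivative h (1 / real (Suc k) + 1 * t)) (at (1 / real (Suc k) + 1 * t) within {0..1})"
      by (rule AE_affine[OF Ad]) simp
    moreover have "AE t in unit_leb. t \<in> {0..1}" by (rule AE_unit_leb)
    ultimately show ?thesis using ne Ad
    proof eventually_elim
      case (elim t)
      have "\<exists>E. ((\<lambda>s. A (m k s)) has_vector_derivative E) (at t within {0..1})"
      proof (cases "t < 1 - 1 / real (Suc k)")
        case True
        then have r: "1 / real (Suc k) + 1 * t \<in> {0..1}" using elim by auto
        have "((\<lambda>s. A (m k s)) has_vector_derivative of_real 1 * h (1 / real (Suc k) + 1 * t)) (at t within {0..1})"
        proof (rule affine_chain[where p = "1 / real (Suc k)" and \<delta> = "1 - 1 / real (Suc k) - t"])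
          show "(A has_vector_derivative h (1 / real (Suc k) + 1 * t)) (at (1 / real (Suc k) + 1 * t) within {0..1})"
            using elim r by blast
          show "m k s = 1 / real (Suc k) + 1 * s" if "s \<in> {0..1}" "dist s t < 1 - 1 / real (Suc k) - t" for s
            using that by (auto simp: m_def dist_real_def)
        qed (use elim True mr in auto)
        then show ?thesis by blast
      next
        case False
        then have gt: "t > 1 - 1 / real (Suc k)" using elim by simp
        have "((\<lambda>s. A 1) has_vector_derivative 0) (at t within {0..1})" by simp
        then have "((\<lambda>s. A (m k s)) has_vector_derivative 0) (at t within {0..1})"
          by (rule has_vector_derivative_transform_within[of _ _ _ _ "t - (1 - 1 / real (Suc k))"])
            (use gt elim in \<open>auto simp: m_def dist_real_def\<close>)
        then show ?thesis by blast
      qed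
      then obtain E where E: "((\<lambda>s. A (m k s)) has_vector_derivative E) (at t within {0..1})" by blast
      show ?case
        unfolding v_def
        by (rule exI, rule has_vector_derivative_mult_right, rule has_vector_derivative_diff[OF E elim(4)])
    qed
  qed
  have vH: "H1e (v k)" for k
  proof (rule Lipschitz_H1e)
    show "0 \<le> 2 * real (Suc k) * real n" by simp
    show "AE t in unit_leb. (v k has_vector_derivative (SOME D. (v k has_vector_derivative D) (at t within {0..1})))
        (at t within {0..1})"
      using vd[of k] by eventually_elim (rule someI_ex)
    fix s t :: real assume st: "0 \<le> s" "s \<le> t" "t \<le> 1"
    have "cmod (A (m k t) - A (m k s)) \<le> real n * (m k t - m k s)"
      using st by (intro Alip) (auto simp: m_def)
    also have "\<dots> \<le> real n * (t - s)" using st by (intro mult_left_mono) (auto simp: m_def)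
    finally have 1: "cmod (A (m k t) - A (m k s)) \<le> real n * (t - s)" .
    have 2: "cmod (A t - A s) \<le> real n * (t - s)" using st by (rule Alip)
    have "v k t - v k s = of_nat (Suc k) * ((A (m k t) - A (m k s)) - (A t - A s))"
      unfolding v_def by (simp add: algebra_simps)
    then have "cmod (v k t - v k s) = real (Suc k) * cmod ((A (m k t) - A (m k s)) - (A t - A s))"
      by (simp add: norm_mult del: of_nat_Suc)
    also have "\<dots> \<le> real (Suc k) * (real n * (t - s) + real n * (t - s))"
      using 1 2 norm_triangle_ineq4[of "A (m k t) - A (m k s)" "A t - A s"] by (intro mult_left_mono) auto
    finally show "cmod (v k t - v k s) \<le> 2 * real (Suc k) * real n * (t - s)" by (simp add: algebra_simps)
  qed
  have v1: "v k 1 = 0" for k by (simp add: v_def m_def)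
  have v0: "v k 0 = 0" if "k > n" for k
  proof -
    have "1 / real (Suc k) < \<eta>" using that unfolding \<eta>_def by (intro divide_strict_left_mono) auto
    then have "integral {0..1 / real (Suc k)} h = integral {0..1 / real (Suc k)} (\<lambda>_. 0)"
      by (intro integral_cong) (auto intro: h0)
    then show ?thesis by (simp add: v_def m_def A_def)
  qed
  have vb: "cmod (v k t) \<le> real n" if "t \<in> {0..1}" for k t
  proof -
    have "cmod (A (m k t) - A t) \<le> real n * (m k t - t)" using that by (intro Alip) (auto simp: m_def)
    also have "\<dots> \<le> real n * (1 / real (Suc k))" by (intro mult_left_mono) (auto simp: m_def)
    finally have "real (Suc k) * cmod (A (m k t) - A t) \<le> real (Suc k) * (real n * (1 / real (Suc k)))"
      by (intro mult_left_mono) auto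
    then show ?thesis by (simp add: v_def norm_mult del: of_nat_Suc)
  qed
  have "\<exists>k. sqn (\<lambda>t. h t - v (Suc n + k) t) < \<epsilon> / 4"
  proof (rule conv0)
    show "(\<lambda>t. h t - v (Suc n + k) t) \<in> borel_measurable unit_leb" for k
      using hm sqint_measurable[OF H1e_sqint[OF vH]] by (intro borel_measurable_diff)
    have ne: "AE t in unit_leb. t \<noteq> 1"
      unfolding AE_unit_leb_negligible by (rule negligible_subset[of "{1}"]) auto
    have "AE t in unit_leb. t \<in> {0..1}" by (rule AE_unit_leb)
    with ne Ad have "AE t in unit_leb. (\<lambda>k. v k t) \<longlonglongrightarrow> h t"
    proof eventually_elim
      case (elim t)
      then show ?case unfolding v_def m_def by (intro forward_quotient_limit) auto
    qed
    then show "AE t in unit_leb. (\<lambda>k. h t - v (Suc n + k) t) \<longlonglongrightarrow> 0"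
    proof eventually_elim
      case (elim t)
      have "(\<lambda>k. v (Suc n + k) t) \<longlonglongrightarrow> h t"
        using LIMSEQ_ignore_initial_segment[OF elim, of "Suc n"] by (simp add: add.commute)
      from tendsto_diff[OF tendsto_const[of "h t"] this] show ?case by simp
    qed
    show "AE t in unit_leb. (cmod (h t - v (Suc n + k) t))\<^sup>2 \<le> (2 * real n)\<^sup>2" for k
    proof (rule AE_unit_leb)
      fix t :: real assume "t \<in> {0..1}"
      then have "cmod (h t - v (Suc n + k) t) \<le> 2 * real n"
        using hb[of t] vb[of t "Suc n + k"] norm_triangle_ineq4[of "h t" "v (Suc n + k) t"] by linarith
      then show "(cmod (h t - v (Suc n + k) t))\<^sup>2 \<le> (2 * real n)\<^sup>2" by (intro power_mono) auto
    qed
  qed (use \<open>\<epsilon> > 0\<close> in simp_all)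
  then obtain k where k: "sqn (\<lambda>t. h t - v (Suc n + k) t) < \<epsilon> / 4" by blast
  define V where "V = v (Suc n + k)"
  have "sqn (\<lambda>t. 1 * (w t - h t) + 1 * (h t - V t)) \<le> 2 * (cmod 1)\<^sup>2 * sqn (\<lambda>t. w t - h t) + 2 * (cmod 1)\<^sup>2 * sqn (\<lambda>t. h t - V t)"
    using w hs H1e_sqint[OF vH] unfolding V_def by (intro sqn_lin sqint_diff)
  also have "\<dots> < \<epsilon>" using n k unfolding h_def V_def by simp
  finally have "sqn (\<lambda>t. w t - V t) < \<epsilon>" by simp
  moreover have "V 0 = 0" unfolding V_def by (rule v0) simp
  ultimately show ?thesis using that[of V] vH v1 by (simp add: V_def)
qed

section \<open>A symmetric operator that reproduces end values\<close>

subsection \<open>Affine substitutions\<close>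

text \<open>Substitution of an affine map, with the value zero where that map leaves the unit interval.\<close>

definition aff :: "real \<Rightarrow> real \<Rightarrow> (real \<Rightarrow> 'a :: zero) \<Rightarrow> real \<Rightarrow> 'a" where
  "aff p c f t = (if p + c * t \<in> {0..1} then f (p + c * t) else 0)"

lemma unit_leb_lebesgue:
  fixes f :: "real \<Rightarrow> 'a :: euclidean_space"
  shows "integrable unit_leb f \<longleftrightarrow> integrable lebesgue (\<lambda>t. if t \<in> {0..1} then f t else 0)"
    and "(\<integral>t. f t \<partial>unit_leb) = (\<integral>t. (if t \<in> {0..1} then f t else 0) \<partial>lebesgue)"
proof -
  have eq: "(\<lambda>t. indicat_real {0..1} t *\<^sub>R f t) = (\<lambda>t. if t \<in> {0..1} then f t else 0)"
    by (auto simp: indicator_def)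
  show "integrable unit_leb f \<longleftrightarrow> integrable lebesgue (\<lambda>t. if t \<in> {0..1} then f t else 0)"
    by (subst integrable_restrict_space) (simp_all add: eq del: atLeastAtMost_iff)
  show "(\<integral>t. f t \<partial>unit_leb) = (\<integral>t. (if t \<in> {0..1} then f t else 0) \<partial>lebesgue)"
    by (subst integral_restrict_space) (simp_all add: eq del: atLeastAtMost_iff)
qed

lemma aff_integrable:
  fixes f :: "real \<Rightarrow> 'a :: euclidean_space"
  assumes "integrable unit_leb f" "c \<noteq> 0"
  shows "integrable unit_leb (aff p c f)"
proof -
  have "integrable lebesgue (\<lambda>t. if t \<in> {0..1} then f t else 0)"
    using assms(1) by (simp only: unit_leb_lebesgue(1))
  from lebesgue_integrable_real_affine[OF this assms(2), of p]
  have "integrable lebesgue (aff p c f)" by (simp only: aff_def[abs_def])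
  then have "integrable lebesgue (\<lambda>t. indicat_real {0..1} t *\<^sub>R aff p c f t)"
    by (intro integrable_mult_indicator) auto
  also have "(\<lambda>t. indicat_real {0..1} t *\<^sub>R aff p c f t) = (\<lambda>t. if t \<in> {0..1} then aff p c f t else 0)"
    by (auto simp: indicator_def)
  finally show ?thesis by (simp only: unit_leb_lebesgue(1))
qed

lemma aff_integral:
  fixes f :: "real \<Rightarrow> 'a :: euclidean_space"
  assumes "c \<noteq> 0" and sub: "\<And>t. p + c * t \<in> {0..1} \<Longrightarrow> t \<in> {0..1}"
  shows "(\<integral>t. f t \<partial>unit_leb) = \<bar>c\<bar> *\<^sub>R (\<integral>t. aff p c f t \<partial>unit_leb)"
proof -
  have eq: "(\<lambda>t. if t \<in> {0..1} then aff p c f t else 0) =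
      (\<lambda>t. if p + c * t \<in> {0..1} then f (p + c * t) else 0)"
    proof
      fix t
      show "(if t \<in> {0..1} then aff p c f t else 0) = (if p + c * t \<in> {0..1} then f (p + c * t) else 0)"
      proof (cases "p + c * t \<in> {0..1}")
        case True
        then show ?thesis using sub[OF True] by (simp add: aff_def)
      qed (auto simp: aff_def)
    qed
  show ?thesis unfolding unit_leb_lebesgue(2) eq
    using lebesgue_integral_real_affine[OF assms(1), of "\<lambda>t. if t \<in> {0..1} then f t else 0" p] .
qed

lemma sqint_aff:
  assumes "sqint f" "c \<noteq> 0"
  shows "sqint (aff p c f)"
proof -
  have "aff p c f \<in> borel_measurable unit_leb"
    using aff_integrable[OF sqint_integrable[OF assms(1)] assms(2)] by (rule borel_measurable_integrable)
  moreover have "integrable unit_leb (aff p c (\<lambda>t. (cmod (f t))\<^sup>2))"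
    using assms by (intro aff_integrable) (auto simp: sqint_def)
  moreover have "aff p c (\<lambda>t. (cmod (f t))\<^sup>2) = (\<lambda>t. (cmod (aff p c f t))\<^sup>2)"
    by (auto simp: aff_def)
  ultimately show ?thesis by (simp add: sqint_def)
qed

lemma sqn_aff:
  assumes "c \<noteq> 0" "\<And>t. p + c * t \<in> {0..1} \<Longrightarrow> t \<in> {0..1}"
  shows "sqn f = \<bar>c\<bar> * sqn (aff p c f)"
proof -
  have "aff p c (\<lambda>t. (cmod (f t))\<^sup>2) = (\<lambda>t. (cmod (aff p c f t))\<^sup>2)"
    by (auto simp: aff_def)
  then show ?thesis
    using aff_integral[OF assms, of p "\<lambda>t. (cmod (f t))\<^sup>2"] by (simp add: sqn_def)
qed

lemma sqn_aff_stretch: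
  assumes "sqint f" "\<alpha> \<ge> 1"
  shows "sqn (aff 0 (1 / \<alpha>) f) \<le> \<alpha> * sqn f"
proof -
  let ?h = "aff 0 (1 / \<alpha>) f"
  have sub: "0 + \<alpha> * t \<in> {0..1} \<Longrightarrow> t \<in> {0..1}" for t
    using assms(2) mult_right_mono[of 1 \<alpha> t] by (auto simp: zero_le_mult_iff)
  have "sqn ?h = \<bar>\<alpha>\<bar> * sqn (aff 0 \<alpha> ?h)"
    by (rule sqn_aff[OF _ sub]) (use assms(2) in simp_all)
  also have "sqn (aff 0 \<alpha> ?h) \<le> 1\<^sup>2 * sqn f"
  proof (rule sqn_mono)
    show "sqint (aff 0 \<alpha> ?h)" using assms by (intro sqint_aff) auto
    show "AE t in unit_leb. cmod (aff 0 \<alpha> ?h t) \<le> 1 * cmod (f t)"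
      using assms(2) by (intro AE_I2) (auto simp: aff_def)
  qed (use assms in auto)
  finally show ?thesis using assms(2) by simp
qed

lemma aff_reflect: "t \<in> {0..1} \<Longrightarrow> aff 1 (-1) f t = f (1 - t)"
  by (simp add: aff_def)

lemma integral_reflect_unit:
  fixes f :: "real \<Rightarrow> 'a :: euclidean_space"
  shows "(\<integral>t. f (1 - t) \<partial>unit_leb) = (\<integral>t. f t \<partial>unit_leb)"
proof -
  have "(\<integral>t. f (1 - t) \<partial>unit_leb) = (\<integral>t. aff 1 (-1) f t \<partial>unit_leb)"
    by (intro Bochner_Integration.integral_cong refl) (simp add: aff_reflect)
  then show ?thesis using aff_integral[of "-1" 1 f] by simp
qed

lemma sqn_reflect: "sqn (\<lambda>t. f (1 - t)) = sqn f"
  unfolding sqn_def using integral_reflect_unit[of "\<lambda>t. (cmod (f t))\<^sup>2"] by simp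

lemma sqint_reflect:
  assumes "sqint f"
  shows "sqint (\<lambda>t. f (1 - t))"
  by (rule sqint_AE_cong(1)[OF sqint_aff[OF assms, of "-1" 1]])
    (auto intro!: AE_unit_leb simp: aff_reflect)

lemma H1e_reflect:
  assumes "H1e u"
  shows "H1e (\<lambda>t. u (1 - t))" and "sqn (ud (\<lambda>t. u (1 - t))) = sqn (ud u)"
proof -
  have d: "AE t in unit_leb. ud (\<lambda>t. u (1 - t)) t = - ud u (1 - t)"
    using AE_ud_eq[OF AC1_reflect(2)[OF H1e_AC1[OF assms]]] .
  have "sqint (\<lambda>t. (-1) * ud u (1 - t))"
    by (intro sqint_cmult sqint_reflect H1e_sqint_ud assms)
  then have s: "sqint (\<lambda>t. - ud u (1 - t))" by simp
  have d': "AE t in unit_leb. - ud u (1 - t) = ud (\<lambda>t. u (1 - t)) t"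
    using d by eventually_elim simp
  show "H1e (\<lambda>t. u (1 - t))"
    unfolding H1e_def using AC1_reflect(1)[OF H1e_AC1[OF assms]] sqint_AE_cong(1)[OF s d'] by simp
  have "sqn (ud (\<lambda>t. u (1 - t))) = sqn (\<lambda>t. - ud u (1 - t))" by (rule sqint_AE_cong(2)[OF s d'])
  also have "\<dots> = sqn (ud u)" using sqn_reflect[of "ud u"] by (simp add: sqn_def)
  finally show "sqn (ud (\<lambda>t. u (1 - t))) = sqn (ud u)" .
qed

subsection \<open>Compressed copies near an end\<close>

text \<open>\<open>compress u\<close> has the value \<open>u 0\<close> at \<open>0\<close>, vanishes on \<open>[1/100, 1]\<close>, and its norm is at most a
  tenth of that of \<open>u\<close>: a copy of \<open>u\<close> compressed towards the end \<open>0\<close>. \<open>stretch\<close> is its adjoint.\<close>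

definition compress :: "(real \<Rightarrow> complex) \<Rightarrow> real \<Rightarrow> complex" where
  "compress u t = of_real (max 0 (1 - 100 * t)) * u (min 1 (100 * t))"

definition stretch :: "(real \<Rightarrow> complex) \<Rightarrow> real \<Rightarrow> complex" where
  "stretch u t = of_real ((1 - t) / 100) * u (t / 100)"

lemma compress_aff: "t \<in> {0..1} \<Longrightarrow> compress u t = of_real (max 0 (1 - 100 * t)) * aff 0 100 u t"
  by (auto simp: compress_def aff_def max_def min_def)

lemma stretch_aff: "t \<in> {0..1} \<Longrightarrow> stretch u t = of_real ((1 - t) / 100) * aff 0 (1 / 100) u t"
  by (simp add: stretch_def aff_def)

lemma continuous_unit_measurable:
  "continuous_on {0..1} u \<Longrightarrow> u \<in> borel_measurable unit_leb" for u :: "real \<Rightarrow> complex"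
  by (intro continuous_imp_measurable_on_sets_lebesgue) auto

lemma sqint_compress:
  assumes "sqint u"
  shows "sqint (compress u)" and "sqn (compress u) \<le> sqn u / 100"
proof -
  have a: "sqint (aff 0 100 u)" using assms by (intro sqint_aff) auto
  have "sqint (\<lambda>t. of_real (max 0 (1 - 100 * t)) * aff 0 100 u t)"
  proof (rule sqint_bounded_mult[OF _ _ a])
    show "(\<lambda>t. complex_of_real (max 0 (1 - 100 * t))) \<in> borel_measurable unit_leb"
      by (intro continuous_unit_measurable continuous_intros)
    show "AE t in unit_leb. cmod (complex_of_real (max 0 (1 - 100 * t))) \<le> 1"
      by (rule AE_unit_leb) (auto simp: max_def)
  qed
  then show s: "sqint (compress u)"
    by (rule sqint_AE_cong(1)) (auto intro!: AE_unit_leb simp: compress_aff)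
  have "sqn (compress u) \<le> 1\<^sup>2 * sqn (aff 0 100 u)"
  proof (rule sqn_mono[OF s a])
    show "AE t in unit_leb. cmod (compress u t) \<le> 1 * cmod (aff 0 100 u t)"
      proof (rule AE_unit_leb)
        fix t :: real assume t: "t \<in> {0..1}"
        have "cmod (complex_of_real (max 0 (1 - 100 * t))) \<le> 1"
          unfolding norm_of_real using t by (auto simp: max_def)
        then show "cmod (compress u t) \<le> 1 * cmod (aff 0 100 u t)"
          unfolding compress_aff[OF t] norm_mult by (intro mult_right_mono) auto
      qed
  qed simp
  moreover have "sqn u = \<bar>100\<bar> * sqn (aff 0 100 u)" by (rule sqn_aff) auto
  ultimately show "sqn (compress u) \<le> sqn u / 100" by simp
qed

lemma sqint_stretch:
  assumes "sqint u"
  shows "sqint (stretch u)"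
proof -
  have a: "sqint (aff 0 (1 / 100) u)" using assms by (intro sqint_aff) auto
  have "sqint (\<lambda>t. of_real ((1 - t) / 100) * aff 0 (1 / 100) u t)"
  proof (rule sqint_bounded_mult[OF _ _ a])
    show "(\<lambda>t. complex_of_real ((1 - t) / 100)) \<in> borel_measurable unit_leb"
      by (intro continuous_unit_measurable continuous_intros) auto
    show "AE t in unit_leb. cmod (complex_of_real ((1 - t) / 100)) \<le> 1"
      by (rule AE_unit_leb) (unfold norm_of_real, auto)
  qed
  then show ?thesis
    by (rule sqint_AE_cong(1)) (auto intro!: AE_unit_leb simp: stretch_aff)
qed

lemma sqn_stretch:
  assumes "sqint u"
  shows "sqn (stretch u) \<le> 100 * sqn u"
proof -
  have a: "sqint (aff 0 (1 / 100) u)" using assms by (intro sqint_aff) auto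
  have "sqn (stretch u) \<le> 1\<^sup>2 * sqn (aff 0 (1 / 100) u)"
  proof (rule sqn_mono[OF sqint_stretch[OF assms] a])
    show "AE t in unit_leb. cmod (stretch u t) \<le> 1 * cmod (aff 0 (1 / 100) u t)"
    proof (rule AE_unit_leb)
      fix t :: real assume t: "t \<in> {0..1}"
      have "cmod (complex_of_real ((1 - t) / 100)) \<le> 1"
        unfolding norm_of_real using t by auto
      then show "cmod (stretch u t) \<le> 1 * cmod (aff 0 (1 / 100) u t)"
        unfolding stretch_aff[OF t] norm_mult by (intro mult_right_mono) auto
    qed
  qed simp
  also have "sqn (aff 0 (1 / 100) u) \<le> 100 * sqn u"
    by (rule sqn_aff_stretch[OF assms]) simp
  finally show ?thesis by simp
qed

lemma compress_adjoint:
  "(\<integral>t. compress u t * cnj (v t) \<partial>unit_leb) = (\<integral>t. u t * cnj (stretch v t) \<partial>unit_leb)"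
proof -
  define h where "h t = u t * cnj (stretch v t)" for t
  have "(\<integral>t. h t \<partial>unit_leb) = \<bar>100\<bar> *\<^sub>R (\<integral>t. aff 0 100 h t \<partial>unit_leb)" by (rule aff_integral) auto
  also have "\<dots> = (\<integral>t. 100 * aff 0 100 h t \<partial>unit_leb)" by (simp add: scaleR_conv_of_real)
  also have "\<dots> = (\<integral>t. compress u t * cnj (v t) \<partial>unit_leb)"
    by (intro Bochner_Integration.integral_cong refl)
      (auto simp: aff_def h_def stretch_def compress_aff max_def)
  finally show ?thesis by (simp add: h_def)
qed

lemma H1e_compress:
  assumes u: "H1e u"
  shows "H1e (compress u)" and "sqn (ud (compress u)) \<le> 200 * (sqn u + sqn (ud u))"
proof -
  define \<phi> where "\<phi> t = min 1 (100 * t)" for t :: real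
  define m where "m t = complex_of_real (max 0 (1 - 100 * t))" for t :: real
  define g where "g t = (-100) * aff 0 100 u t + 100 * (m t * aff 0 100 (ud u) t)" for t
  have au: "sqint (aff 0 100 u)" "sqint (aff 0 100 (ud u))"
    using u by (simp_all add: sqint_aff H1e_sqint H1e_sqint_ud)
  have m1: "AE t in unit_leb. cmod (m t) \<le> 1"
    unfolding m_def norm_of_real by (rule AE_unit_leb) (auto simp: max_def)
  have mm: "m \<in> borel_measurable unit_leb"
    unfolding m_def by (intro continuous_unit_measurable continuous_intros)
  have mu: "sqint (\<lambda>t. m t * aff 0 100 (ud u) t)" by (rule sqint_bounded_mult[OF mm m1 au(2)])
  have g: "sqint g" unfolding g_def using au(1) mu by (rule sqint_lin)
  have "abs_cont (\<lambda>t. u (\<phi> t))"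
    by (rule abs_cont_compose[OF H1e_abs_cont[OF u], of \<phi> 100]) (auto simp: \<phi>_def)
  moreover have "abs_cont m"
    by (rule abs_cont_Lipschitz[of 100])
      (unfold m_def of_real_diff[symmetric] norm_of_real, auto simp: max_def)
  ultimately have ac: "abs_cont (compress u)"
    unfolding compress_def[abs_def] m_def \<phi>_def by (intro abs_cont_mult)
  have ne: "AE t in unit_leb. t \<noteq> 1 / 100"
    unfolding AE_unit_leb_negligible by (rule negligible_subset[of "{1 / 100}"]) auto
  have af: "AE t in unit_leb. 0 + 100 * t \<in> {0..1} \<longrightarrow>
      (u has_vector_derivative ud u (0 + 100 * t)) (at (0 + 100 * t) within {0..1})"
    by (rule AE_affine[OF AC1_derivative[OF H1e_AC1[OF u]]]) simp
  have "AE t in unit_leb. t \<in> {0..1}" by (rule AE_unit_leb)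
  with ne af have der: "AE t in unit_leb. (compress u has_vector_derivative g t) (at t within {0..1})"
  proof eventually_elim
    case (elim t)
    show ?case
    proof (cases "t < 1 / 100")
      case True
      then have r: "0 + 100 * t \<in> {0..1}" using elim by auto
      have d1: "((\<lambda>s. u (\<phi> s)) has_vector_derivative of_real 100 * ud u (0 + 100 * t)) (at t within {0..1})"
      proof (rule affine_chain[where p = 0 and \<delta> = "1 / 100 - t"])
        show "(u has_vector_derivative ud u (0 + 100 * t)) (at (0 + 100 * t) within {0..1})"
          using elim r by blast
        show "\<phi> s = 0 + 100 * s" if "s \<in> {0..1}" "dist s t < 1 / 100 - t" for s
          using that by (auto simp: \<phi>_def dist_real_def)
      qed (use elim True in \<open>auto simp: \<phi>_def\<close>)
      have d2: "((\<lambda>s. complex_of_real (1 - 100 * s)) has_vector_derivative of_real (-100)) (at t within {0..1})"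
        by (auto intro!: derivative_eq_intros)
      have "((\<lambda>s. complex_of_real (1 - 100 * s) * u (\<phi> s)) has_vector_derivative
          complex_of_real (1 - 100 * t) * (of_real 100 * ud u (0 + 100 * t)) + of_real (-100) * u (\<phi> t)) (at t within {0..1})"
        by (rule has_vector_derivative_mult[OF d2 d1])
      then have "(compress u has_vector_derivative
          complex_of_real (1 - 100 * t) * (of_real 100 * ud u (0 + 100 * t)) + of_real (-100) * u (\<phi> t)) (at t within {0..1})"
        by (rule has_vector_derivative_transform_within[of _ _ _ _ "1 / 100 - t"])
          (use elim True in \<open>auto simp: compress_def \<phi>_def dist_real_def max_def\<close>)
      also have "complex_of_real (1 - 100 * t) * (of_real 100 * ud u (0 + 100 * t)) + of_real (-100) * u (\<phi> t) = g t"
        using True r by (simp add: g_def m_def \<phi>_def aff_def max_def min_def algebra_simps)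
      finally show ?thesis .
    next
      case False
      then have gt: "t > 1 / 100" using elim by simp
      have "((\<lambda>s. 0) has_vector_derivative 0) (at t within {0..1})" by simp
      then have "(compress u has_vector_derivative 0) (at t within {0..1})"
        by (rule has_vector_derivative_transform_within[of _ _ _ _ "t - 1 / 100"])
          (use elim gt in \<open>auto simp: compress_def dist_real_def max_def\<close>)
      moreover have "g t = 0" using gt by (simp add: g_def aff_def)
      ultimately show ?thesis by simp
    qed
  qed
  show "H1e (compress u)" by (rule H1eI[OF ac der g])
  have "AE t in unit_leb. g t = ud (compress u) t" using AE_ud_eq[OF der] by eventually_elim simp
  then have "sqn (ud (compress u)) = sqn g" by (rule sqint_AE_cong(2)[OF g])
  also have "\<dots> \<le> 2 * (cmod (-100))\<^sup>2 * sqn (aff 0 100 u) + 2 * (cmod 100)\<^sup>2 * sqn (\<lambda>t. m t * aff 0 100 (ud u) t)"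
    unfolding g_def by (rule sqn_lin[OF au(1) mu])
  also have "sqn (\<lambda>t. m t * aff 0 100 (ud u) t) \<le> 1\<^sup>2 * sqn (aff 0 100 (ud u))"
  proof (rule sqn_mono[OF mu au(2)])
    show "AE t in unit_leb. cmod (m t * aff 0 100 (ud u) t) \<le> 1 * cmod (aff 0 100 (ud u) t)"
      using m1 by eventually_elim (simp add: norm_mult mult_left_le_one_le)
  qed simp
  also have "sqn (aff 0 100 u) = sqn u / 100" using sqn_aff[of 100 0 u] by simp
  also have "sqn (aff 0 100 (ud u)) = sqn (ud u) / 100" using sqn_aff[of 100 0 "ud u"] by simp
  finally show "sqn (ud (compress u)) \<le> 200 * (sqn u + sqn (ud u))" by simp
qed

lemma H1e_stretch:
  assumes u: "H1e u"
  shows "H1e (stretch u)" and "sqn (ud (stretch u)) \<le> 200 * (sqn u + sqn (ud u))"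
proof -
  define m where "m t = complex_of_real ((1 - t) / 100)" for t :: real
  define g where "g t = (-1 / 100) * aff 0 (1 / 100) u t + (1 / 100) * (m t * aff 0 (1 / 100) (ud u) t)" for t
  have au: "sqint (aff 0 (1 / 100) u)" "sqint (aff 0 (1 / 100) (ud u))"
    using u by (simp_all add: sqint_aff H1e_sqint H1e_sqint_ud)
  have m1: "AE t in unit_leb. cmod (m t) \<le> 1"
    unfolding m_def norm_of_real by (rule AE_unit_leb) auto
  have mm: "m \<in> borel_measurable unit_leb"
    unfolding m_def by (intro continuous_unit_measurable continuous_intros) auto
  have mu: "sqint (\<lambda>t. m t * aff 0 (1 / 100) (ud u) t)" by (rule sqint_bounded_mult[OF mm m1 au(2)])
  have g: "sqint g" unfolding g_def using au(1) mu by (rule sqint_lin)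
  have "abs_cont (\<lambda>t. u (t / 100))"
    by (rule abs_cont_compose[OF H1e_abs_cont[OF u], of "\<lambda>t. t / 100" 1]) auto
  moreover have "abs_cont m"
    by (rule abs_cont_Lipschitz[of 1])
      (unfold m_def of_real_diff[symmetric] norm_of_real, auto simp: field_simps)
  ultimately have ac: "abs_cont (stretch u)"
    unfolding stretch_def[abs_def] m_def by (intro abs_cont_mult)
  have af: "AE t in unit_leb. 0 + 1 / 100 * t \<in> {0..1} \<longrightarrow>
      (u has_vector_derivative ud u (0 + 1 / 100 * t)) (at (0 + 1 / 100 * t) within {0..1})"
    by (rule AE_affine[OF AC1_derivative[OF H1e_AC1[OF u]]]) simp
  have "AE t in unit_leb. t \<in> {0..1}" by (rule AE_unit_leb)
  with af have der: "AE t in unit_leb. (stretch u has_vector_derivative g t) (at t within {0..1})"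
  proof eventually_elim
    case (elim t)
    then have r: "0 + 1 / 100 * t \<in> {0..1}" by auto
    have d1: "((\<lambda>s. u (s / 100)) has_vector_derivative of_real (1 / 100) * ud u (0 + 1 / 100 * t)) (at t within {0..1})"
      by (rule affine_chain[where p = 0 and \<delta> = 1]) (use elim r in auto)
    have d2: "(m has_vector_derivative of_real (-1 / 100)) (at t within {0..1})"
      unfolding m_def by (auto intro!: derivative_eq_intros)
    have "((\<lambda>s. m s * u (s / 100)) has_vector_derivative
          m t * (of_real (1 / 100) * ud u (0 + 1 / 100 * t)) + of_real (-1 / 100) * u (t / 100)) (at t within {0..1})"
      by (rule has_vector_derivative_mult[OF d2 d1])
    moreover have "m t * (of_real (1 / 100) * ud u (0 + 1 / 100 * t)) + of_real (-1 / 100) * u (t / 100) = g t"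
      using r by (simp add: g_def aff_def)
    ultimately show ?case by (simp add: stretch_def[abs_def] m_def)
  qed
  show "H1e (stretch u)" by (rule H1eI[OF ac der g])
  have "AE t in unit_leb. g t = ud (stretch u) t" using AE_ud_eq[OF der] by eventually_elim simp
  then have "sqn (ud (stretch u)) = sqn g" by (rule sqint_AE_cong(2)[OF g])
  also have "\<dots> \<le> 2 * (cmod (-1 / 100))\<^sup>2 * sqn (aff 0 (1 / 100) u) +
      2 * (cmod (1 / 100))\<^sup>2 * sqn (\<lambda>t. m t * aff 0 (1 / 100) (ud u) t)"
    unfolding g_def by (rule sqn_lin[OF au(1) mu])
  also have "\<dots> \<le> 1 * sqn (aff 0 (1 / 100) u) + 1 * sqn (\<lambda>t. m t * aff 0 (1 / 100) (ud u) t)"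
    by (intro add_mono mult_right_mono) (auto simp: norm_divide power2_eq_square)
  also have "sqn (\<lambda>t. m t * aff 0 (1 / 100) (ud u) t) \<le> 1\<^sup>2 * sqn (aff 0 (1 / 100) (ud u))"
  proof (rule sqn_mono[OF mu au(2)])
    show "AE t in unit_leb. cmod (m t * aff 0 (1 / 100) (ud u) t) \<le> 1 * cmod (aff 0 (1 / 100) (ud u) t)"
      using m1 by eventually_elim (simp add: norm_mult mult_left_le_one_le)
  qed simp
  also have "sqn (aff 0 (1 / 100) u) \<le> 100 * sqn u"
    by (rule sqn_aff_stretch[OF H1e_sqint[OF u]]) simp
  also have "sqn (aff 0 (1 / 100) (ud u)) \<le> 100 * sqn (ud u)"
    by (rule sqn_aff_stretch[OF H1e_sqint_ud[OF u]]) simp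
  finally have "sqn (ud (stretch u)) \<le> 100 * sqn u + 100 * sqn (ud u)" by simp
  then show "sqn (ud (stretch u)) \<le> 200 * (sqn u + sqn (ud u))"
    proof (rule order_trans)
      show "100 * sqn u + 100 * sqn (ud u) \<le> 200 * (sqn u + sqn (ud u))" by simp
    qed
qed

subsection \<open>The operator\<close>

text \<open>The symmetrized compression. Its value at \<open>0\<close> is \<open>(1 + 1/100) u 0\<close> and its value at \<open>1\<close> is zero.\<close>

definition sym0 :: "(real \<Rightarrow> complex) \<Rightarrow> real \<Rightarrow> complex" where
  "sym0 u t = compress u t + stretch u t"

text \<open>The factor \<open>100/101\<close> corrects the value of \<open>sym0\<close> at the end \<open>0\<close>; the end \<open>1\<close> is treated by
  reflection.\<close>

definition end_op :: "(real \<Rightarrow> complex) \<Rightarrow> real \<Rightarrow> complex" where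
  "end_op u t = (100 / 101) * sym0 u t + (100 / 101) * sym0 (\<lambda>s. u (1 - s)) (1 - t)"

lemma end_op_ends: "end_op u 0 = u 0" "end_op u 1 = u 1"
  by (simp_all add: end_op_def sym0_def compress_def stretch_def algebra_simps)

lemma sqint_sym0: "sqint u \<Longrightarrow> sqint (sym0 u)"
  unfolding sym0_def[abs_def] by (intro sqint_add sqint_compress sqint_stretch)

lemma sqint_end_op: "sqint u \<Longrightarrow> sqint (end_op u)"
  unfolding end_op_def[abs_def] by (intro sqint_lin sqint_sym0 sqint_reflect)

lemma sym0_symmetric:
  assumes "sqint u" "sqint v"
  shows "(\<integral>t. sym0 u t * cnj (v t) \<partial>unit_leb) = (\<integral>t. u t * cnj (sym0 v t) \<partial>unit_leb)"
proof -
  have adj2: "(\<integral>t. stretch u t * cnj (v t) \<partial>unit_leb) = (\<integral>t. u t * cnj (compress v t) \<partial>unit_leb)"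
  proof -
    have "cnj (\<integral>t. compress v t * cnj (u t) \<partial>unit_leb) = cnj (\<integral>t. v t * cnj (stretch u t) \<partial>unit_leb)"
      by (simp only: compress_adjoint)
    then show ?thesis by (simp add: mult.commute flip: Bochner_Integration.integral_cnj)
  qed
  have i: "integrable unit_leb (\<lambda>t. compress u t * cnj (v t))" "integrable unit_leb (\<lambda>t. stretch u t * cnj (v t))"
    "integrable unit_leb (\<lambda>t. u t * cnj (compress v t))" "integrable unit_leb (\<lambda>t. u t * cnj (stretch v t))"
    using assms by (auto intro!: sqint_mult_cnj_integrable sqint_compress sqint_stretch)
  show ?thesis
    unfolding sym0_def using i compress_adjoint[of u v] adj2 by (simp add: distrib_left distrib_right)
qed

lemma sym0_bound:
  assumes u: "sqint u"
  shows "Re (\<integral>t. sym0 u t * cnj (u t) \<partial>unit_leb) \<le> sqn u / 5"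
proof -
  have i: "integrable unit_leb (\<lambda>t. compress u t * cnj (u t))" "integrable unit_leb (\<lambda>t. stretch u t * cnj (u t))"
    using u by (auto intro!: sqint_mult_cnj_integrable sqint_compress sqint_stretch)
  define z where "z = (\<integral>t. compress u t * cnj (u t) \<partial>unit_leb)"
  have "(\<integral>t. stretch u t * cnj (u t) \<partial>unit_leb) = cnj z"
    unfolding z_def compress_adjoint by (simp add: mult.commute flip: Bochner_Integration.integral_cnj)
  then have "(\<integral>t. sym0 u t * cnj (u t) \<partial>unit_leb) = z + cnj z"
    unfolding sym0_def using i by (simp add: distrib_right z_def)
  then have 1: "Re (\<integral>t. sym0 u t * cnj (u t) \<partial>unit_leb) = 2 * Re z" by simp
  have "(cmod z)\<^sup>2 \<le> sqn (compress u) * sqn u"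
    unfolding z_def by (intro sqint_Cauchy_Schwarz sqint_compress u)
  also have "\<dots> \<le> sqn u / 100 * sqn u" by (intro mult_right_mono sqint_compress u) simp
  also have "\<dots> = (sqn u / 10)\<^sup>2" by (simp add: power2_eq_square)
  finally have "cmod z \<le> sqn u / 10" by (rule power2_le_imp_le) simp
  then show ?thesis unfolding 1 using complex_Re_le_cmod[of z] by simp
qed

lemma H1e_sym0:
  assumes "H1e u"
  shows "H1e (sym0 u)" and "sqn (ud (sym0 u)) \<le> 800 * (sqn u + sqn (ud u))"
proof -
  have H: "H1e (compress u)" "H1e (stretch u)" using assms H1e_compress H1e_stretch by auto
  have eq: "sym0 u = (\<lambda>t. 1 * compress u t + 1 * stretch u t)" by (simp add: sym0_def[abs_def])
  show "H1e (sym0 u)" unfolding eq using H by (rule H1e_lin)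
  have d: "AE t in unit_leb. 1 * ud (compress u) t + 1 * ud (stretch u) t = ud (sym0 u) t"
    using ud_lin[OF H1e_AC1[OF H(1)] H1e_AC1[OF H(2)], of 1 1] unfolding eq by eventually_elim simp
  have s: "sqint (\<lambda>t. 1 * ud (compress u) t + 1 * ud (stretch u) t)"
    using H by (intro sqint_lin H1e_sqint_ud)
  have "sqn (ud (sym0 u)) = sqn (\<lambda>t. 1 * ud (compress u) t + 1 * ud (stretch u) t)"
    by (rule sqint_AE_cong(2)[OF s d])
  also have "\<dots> \<le> 2 * (cmod 1)\<^sup>2 * sqn (ud (compress u)) + 2 * (cmod 1)\<^sup>2 * sqn (ud (stretch u))"
    using H by (intro sqn_lin H1e_sqint_ud)
  finally show "sqn (ud (sym0 u)) \<le> 800 * (sqn u + sqn (ud u))"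
    using H1e_compress(2)[OF assms] H1e_stretch(2)[OF assms] by simp
qed

lemma H1e_end_op:
  assumes "H1e u"
  shows "H1e (end_op u)" and "sqn (ud (end_op u)) \<le> 3200 * (sqn u + sqn (ud u))"
proof -
  let ?r = "\<lambda>t. sym0 (\<lambda>s. u (1 - s)) (1 - t)"
  have R: "H1e (\<lambda>s. u (1 - s))" by (rule H1e_reflect(1)[OF assms])
  have H: "H1e (sym0 u)" "H1e ?r"
    using H1e_sym0(1)[OF assms] H1e_reflect(1)[OF H1e_sym0(1)[OF R]] by auto
  have b2: "sqn (ud ?r) \<le> 800 * (sqn u + sqn (ud u))"
    using H1e_sym0(2)[OF R] H1e_reflect(2)[OF H1e_sym0(1)[OF R]] H1e_reflect(2)[OF assms] sqn_reflect[of u]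
    by simp
  show "H1e (end_op u)" unfolding end_op_def[abs_def] using H by (rule H1e_lin)
  have d: "AE t in unit_leb. (100 / 101) * ud (sym0 u) t + (100 / 101) * ud ?r t = ud (end_op u) t"
    using ud_lin[OF H1e_AC1[OF H(1)] H1e_AC1[OF H(2)], of "100 / 101" "100 / 101"]
    unfolding end_op_def[abs_def] by eventually_elim simp
  have s: "sqint (\<lambda>t. (100 / 101) * ud (sym0 u) t + (100 / 101) * ud ?r t)"
    using H by (intro sqint_lin H1e_sqint_ud)
  have "sqn (ud (end_op u)) = sqn (\<lambda>t. (100 / 101) * ud (sym0 u) t + (100 / 101) * ud ?r t)"
    by (rule sqint_AE_cong(2)[OF s d])
  also have "\<dots> \<le> 2 * (cmod (100 / 101))\<^sup>2 * sqn (ud (sym0 u)) + 2 * (cmod (100 / 101))\<^sup>2 * sqn (ud ?r)"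
    using H by (intro sqn_lin H1e_sqint_ud)
  also have "\<dots> \<le> 2 * sqn (ud (sym0 u)) + 2 * sqn (ud ?r)"
    by (intro add_mono mult_right_mono) (auto simp: norm_divide power2_eq_square)
  finally show "sqn (ud (end_op u)) \<le> 3200 * (sqn u + sqn (ud u))"
    using H1e_sym0(2)[OF assms] b2 by simp
qed

lemma sqn_end_op:
  assumes "sqint u"
  shows "sqn (end_op u) \<le> 1000 * sqn u"
proof -
  have s: "sqn (sym0 v) \<le> 202 * sqn v" if v: "sqint v" for v
  proof -
    have "sqn (\<lambda>t. 1 * compress v t + 1 * stretch v t) \<le>
        2 * (cmod 1)\<^sup>2 * sqn (compress v) + 2 * (cmod 1)\<^sup>2 * sqn (stretch v)"
      by (intro sqn_lin sqint_compress sqint_stretch v)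
    then have "sqn (sym0 v) \<le> 2 * sqn (compress v) + 2 * sqn (stretch v)" by (simp add: sym0_def[abs_def])
    then show ?thesis
      using sqint_compress(2)[OF v] sqn_stretch[OF v] sqn_nonneg[of v] by linarith
  qed
  have R: "sqint (\<lambda>t. u (1 - t))" using assms by (rule sqint_reflect)
  have "sqn (end_op u) \<le> 2 * (cmod (100 / 101))\<^sup>2 * sqn (sym0 u) +
      2 * (cmod (100 / 101))\<^sup>2 * sqn (\<lambda>t. sym0 (\<lambda>s. u (1 - s)) (1 - t))"
    unfolding end_op_def[abs_def] by (intro sqn_lin sqint_sym0 sqint_reflect assms)
  also have "\<dots> \<le> 2 * sqn (sym0 u) + 2 * sqn (\<lambda>t. sym0 (\<lambda>s. u (1 - s)) (1 - t))"
    by (intro add_mono mult_right_mono) (auto simp: norm_divide power2_eq_square)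
  finally show ?thesis
    using s[OF assms] s[OF R] sqn_reflect[of u] sqn_reflect[of "sym0 (\<lambda>s. u (1 - s))"] sqn_nonneg[of u]
    by linarith
qed

lemma end_op_symmetric:
  assumes "sqint u" "sqint v"
  shows "(\<integral>t. end_op u t * cnj (v t) \<partial>unit_leb) = (\<integral>t. u t * cnj (end_op v t) \<partial>unit_leb)"
proof -
  let ?R = "\<lambda>(w :: real \<Rightarrow> complex) t. w (1 - t)"
  have R: "sqint (?R u)" "sqint (?R v)" using assms by (auto intro: sqint_reflect)
  have r: "(\<integral>t. sym0 (?R u) (1 - t) * cnj (v t) \<partial>unit_leb) = (\<integral>t. u t * cnj (sym0 (?R v) (1 - t)) \<partial>unit_leb)"
  proof -
    have "(\<integral>t. sym0 (?R u) (1 - t) * cnj (v t) \<partial>unit_leb) = (\<integral>t. sym0 (?R u) t * cnj (?R v t) \<partial>unit_leb)"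
      using integral_reflect_unit[of "\<lambda>t. sym0 (?R u) t * cnj (?R v t)"] by simp
    also have "\<dots> = (\<integral>t. ?R u t * cnj (sym0 (?R v) t) \<partial>unit_leb)" by (rule sym0_symmetric[OF R])
    also have "\<dots> = (\<integral>t. u t * cnj (sym0 (?R v) (1 - t)) \<partial>unit_leb)"
      using integral_reflect_unit[of "\<lambda>t. u t * cnj (sym0 (?R v) (1 - t))"] by simp
    finally show ?thesis .
  qed
  have i: "integrable unit_leb (\<lambda>t. sym0 u t * cnj (v t))" "integrable unit_leb (\<lambda>t. sym0 (?R u) (1 - t) * cnj (v t))"
    "integrable unit_leb (\<lambda>t. u t * cnj (sym0 v t))" "integrable unit_leb (\<lambda>t. u t * cnj (sym0 (?R v) (1 - t)))"
    using assms R by (auto intro!: sqint_mult_cnj_integrable sqint_sym0 sqint_reflect)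
  have "(\<integral>t. end_op u t * cnj (v t) \<partial>unit_leb) =
      (\<integral>t. (100 / 101) * (sym0 u t * cnj (v t)) + (100 / 101) * (sym0 (?R u) (1 - t) * cnj (v t)) \<partial>unit_leb)"
    by (intro Bochner_Integration.integral_cong refl) (simp add: end_op_def algebra_simps)
  also have "\<dots> = (100 / 101) * (\<integral>t. sym0 u t * cnj (v t) \<partial>unit_leb) +
      (100 / 101) * (\<integral>t. sym0 (?R u) (1 - t) * cnj (v t) \<partial>unit_leb)"
    using i(1,2) by (simp only: Bochner_Integration.integral_add integrable_mult_right integral_mult_right_zero)
  also have "\<dots> = (100 / 101) * (\<integral>t. u t * cnj (sym0 v t) \<partial>unit_leb) +
      (100 / 101) * (\<integral>t. u t * cnj (sym0 (?R v) (1 - t)) \<partial>unit_leb)"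
    unfolding r sym0_symmetric[OF assms] ..
  also have "\<dots> = (\<integral>t. (100 / 101) * (u t * cnj (sym0 v t)) + (100 / 101) * (u t * cnj (sym0 (?R v) (1 - t))) \<partial>unit_leb)"
    using i(3,4) by (simp only: Bochner_Integration.integral_add integrable_mult_right integral_mult_right_zero)
  also have "\<dots> = (\<integral>t. u t * cnj (end_op v t) \<partial>unit_leb)"
    by (intro Bochner_Integration.integral_cong refl) (simp add: end_op_def algebra_simps)
  finally show ?thesis .
qed

lemma end_op_bound:
  assumes u: "sqint u"
  shows "Re (\<integral>t. end_op u t * cnj (u t) \<partial>unit_leb) \<le> (2 / 5) * sqn u"
proof -
  let ?R = "\<lambda>(w :: real \<Rightarrow> complex) t. w (1 - t)"
  have R: "sqint (?R u)" using u by (rule sqint_reflect)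
  have i: "integrable unit_leb (\<lambda>t. sym0 u t * cnj (u t))" "integrable unit_leb (\<lambda>t. sym0 (?R u) (1 - t) * cnj (u t))"
    using u R by (auto intro!: sqint_mult_cnj_integrable sqint_sym0 sqint_reflect)
  have "(\<integral>t. end_op u t * cnj (u t) \<partial>unit_leb) =
      (\<integral>t. (100 / 101) * (sym0 u t * cnj (u t)) + (100 / 101) * (sym0 (?R u) (1 - t) * cnj (u t)) \<partial>unit_leb)"
    by (intro Bochner_Integration.integral_cong refl) (simp add: end_op_def algebra_simps)
  also have "\<dots> = (100 / 101) * (\<integral>t. sym0 u t * cnj (u t) \<partial>unit_leb) +
      (100 / 101) * (\<integral>t. sym0 (?R u) (1 - t) * cnj (u t) \<partial>unit_leb)"
    using i by (simp only: Bochner_Integration.integral_add integrable_mult_right integral_mult_right_zero)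
  also have "(\<integral>t. sym0 (?R u) (1 - t) * cnj (u t) \<partial>unit_leb) = (\<integral>t. sym0 (?R u) t * cnj (?R u t) \<partial>unit_leb)"
    using integral_reflect_unit[of "\<lambda>t. sym0 (?R u) t * cnj (?R u t)"] by simp
  finally have "Re (\<integral>t. end_op u t * cnj (u t) \<partial>unit_leb) =
      (100 / 101) * Re (\<integral>t. sym0 u t * cnj (u t) \<partial>unit_leb) +
      (100 / 101) * Re (\<integral>t. sym0 (?R u) t * cnj (?R u t) \<partial>unit_leb)" by simp
  then show ?thesis
    using sym0_bound[OF u] sym0_bound[OF R] sqn_reflect[of u] sqn_nonneg[of u] by linarith
qed

section \<open>The energy form\<close>

lemma gderiv_ud: "gderiv y i t = ud (y i) t"
  by (simp add: gderiv_def)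

lemma gderiv_ud': "gderiv y i = ud (y i)"
  by (simp add: gderiv_def)

lemma H2_H1e: "H2 E = {y. \<forall>i\<in>E. H1e (y i) \<and> H1e (ud (y i))}"
  by (auto simp: H2_def H1_H1e gderiv_ud')

lemma smooth_H1e:
  assumes u: "\<And>t. t \<in> {0..1} \<Longrightarrow> (u has_vector_derivative g t) (at t within {0..1})"
    and g: "\<And>t. t \<in> {0..1} \<Longrightarrow> (g has_vector_derivative h t) (at t within {0..1})"
    and h: "continuous_on {0..1} h"
  shows "H1e u" "H1e (ud u)" "\<And>t. t \<in> {0..1} \<Longrightarrow> ud u t = g t"
proof -
  have eq: "ud u t = g t" if "t \<in> {0..1}" for t using ud_eq[OF that u[OF that]] .
  have gc: "continuous_on {0..1} g"
    by (rule continuous_on_vector_derivative[OF g])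
  show "H1e u" by (rule continuous_H1e[OF u gc])
  show "ud u t = g t" if "t \<in> {0..1}" for t using eq[OF that] .
  have "(ud u has_vector_derivative h t) (at t within {0..1})" if t: "t \<in> {0..1}" for t
    by (rule has_vector_derivative_transform[OF t _ g[OF t]]) (use eq in simp)
  then show "H1e (ud u)" by (rule continuous_H1e[OF _ h])
qed

text \<open>Cubic Hermite interpolation of end values and end derivatives.\<close>

definition hermite :: "complex \<Rightarrow> complex \<Rightarrow> complex \<Rightarrow> complex \<Rightarrow> real \<Rightarrow> complex" where
  "hermite a0 a1 d0 d1 t = a0 * of_real (1 - 3 * t^2 + 2 * t^3) + a1 * of_real (3 * t^2 - 2 * t^3)
     + d0 * of_real (t - 2 * t^2 + t^3) + d1 * of_real (t^3 - t^2)"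

lemma hermite:
  fixes a0 a1 d0 d1 :: complex
  defines "u \<equiv> hermite a0 a1 d0 d1"
  shows "u 0 = a0" "u 1 = a1" "ud u 0 = d0" "ud u 1 = d1" "H1e u" "H1e (ud u)"
proof -
  define g where "g t = a0 * of_real (6 * t^2 - 6 * t) + a1 * of_real (6 * t - 6 * t^2)
     + d0 * of_real (1 - 4 * t + 3 * t^2) + d1 * of_real (3 * t^2 - 2 * t)" for t
  define h where "h t = a0 * of_real (12 * t - 6) + a1 * of_real (6 - 12 * t)
     + d0 * of_real (6 * t - 4) + d1 * of_real (6 * t - 2)" for t
  have u: "(u has_vector_derivative g t) (at t within {0..1})" for t
    unfolding u_def hermite_def[abs_def] g_def
    by (rule derivative_eq_intros refl | simp add: algebra_simps power2_eq_square)+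
  have g: "(g has_vector_derivative h t) (at t within {0..1})" for t
    unfolding g_def[abs_def] h_def
    by (rule derivative_eq_intros refl | simp add: algebra_simps power2_eq_square)+
  have h: "continuous_on {0..1} h" unfolding h_def by (intro continuous_intros)
  note * = smooth_H1e[OF u g h]
  show "H1e u" "H1e (ud u)" by (rule *)+
  show "ud u 0 = d0" "ud u 1 = d1" using *(3)[of 0] *(3)[of 1] by (simp_all add: g_def)
  show "u 0 = a0" "u 1 = a1" by (simp_all add: u_def hermite_def)
qed

text \<open>A boundary value problem whose conditions are co-normal through \<open>f\<close>.\<close>

locale conormal_bvp =
  fixes P :: "'v graph_problem" and f :: gfun
  assumes bvp: "graph_bvp P" and conormal: "conormal_via P f"
begin

abbreviation "E \<equiv> edges P"
abbreviation "DF \<equiv> dom_F P"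
abbreviation "F \<equiv> F_form P f"
abbreviation "q i t \<equiv> complex_of_real (potential P i t)"

lemma finite_E: "finite E"
  by (simp add: edges_def)

lemma potential_bound:
  obtains Q where "Q \<ge> 0" "\<And>i. i \<in> E \<Longrightarrow> AE t in unit_leb. cmod (q i t) \<le> Q"
proof -
  have "\<forall>i\<in>E. \<exists>C. AE t in unit_leb. \<bar>potential P i t\<bar> \<le> C" using bvp by (simp add: graph_bvp_def)
  then obtain C where C: "\<And>i. i \<in> E \<Longrightarrow> AE t in unit_leb. \<bar>potential P i t\<bar> \<le> C i" by metis
  define Q where "Q = (\<Sum>i\<in>E. \<bar>C i\<bar>)"
  have "AE t in unit_leb. cmod (q i t) \<le> Q" if "i \<in> E" for i
    using C[OF that]
  proof eventually_elim
    case (elim t)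
    have "\<bar>C i\<bar> \<le> Q" unfolding Q_def using finite_E that by (intro member_le_sum) auto
    then show ?case using elim by simp
  qed
  moreover have "Q \<ge> 0" unfolding Q_def by (rule sum_nonneg) simp
  ultimately show ?thesis using that by blast
qed

lemma q_measurable: "i \<in> E \<Longrightarrow> q i \<in> borel_measurable unit_leb"
proof -
  assume "i \<in> E"
  then have "potential P i \<in> borel_measurable unit_leb" using bvp by (simp add: graph_bvp_def)
  then show ?thesis by measurable
qed

lemma sqint_q: "i \<in> E \<Longrightarrow> sqint u \<Longrightarrow> sqint (\<lambda>t. q i t * u t)"
proof -
  assume i: "i \<in> E" and u: "sqint u"
  obtain Q where "AE t in unit_leb. cmod (q i t) \<le> Q" using potential_bound i by blast
  from sqint_bounded_mult[OF q_measurable[OF i] this u] show ?thesis .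
qed

lemma DF_iff: "y \<in> DF \<longleftrightarrow> (\<forall>i\<in>E. H1e (y i)) \<and> bc_I P y"
  by (auto simp: dom_F_def H1_H1e)

lemma DF_H1e: "y \<in> DF \<Longrightarrow> i \<in> E \<Longrightarrow> H1e (y i)"
  by (simp add: DF_iff)

lemma DF_L2: "y \<in> DF \<Longrightarrow> y \<in> L2 E"
  by (auto simp: L2_sqint DF_iff intro: H1e_sqint)

lemma bc_I_cong:
  assumes "\<And>i. i \<in> E \<Longrightarrow> x i 0 = y i 0" "\<And>i. i \<in> E \<Longrightarrow> x i 1 = y i 1"
  shows "bc_I P x \<longleftrightarrow> bc_I P y"
  using assms by (simp add: bc_I_def)

lemma bc_I_glin: "bc_I P x \<Longrightarrow> bc_I P y \<Longrightarrow> bc_I P (glin a x b y)"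
proof -
  assume x: "bc_I P x" and y: "bc_I P y"
  have "(\<Sum>j\<in>E. cA P i j * glin a x b y j 0 + cC P i j * glin a x b y j 1) =
     a * (\<Sum>j\<in>E. cA P i j * x j 0 + cC P i j * x j 1) + b * (\<Sum>j\<in>E. cA P i j * y j 0 + cC P i j * y j 1)" for i
    unfolding sum_distrib_left sum.distrib[symmetric]
    by (intro sum.cong refl) (simp add: glin_def algebra_simps)
  then show ?thesis using x y by (simp add: bc_I_def)
qed

lemma glin_DF: "x \<in> DF \<Longrightarrow> y \<in> DF \<Longrightarrow> glin a x b y \<in> DF"
proof -
  assume x: "x \<in> DF" and y: "y \<in> DF"
  have "H1e (glin a x b y i)" if "i \<in> E" for i
    unfolding glin_def using x y that by (intro H1e_lin DF_H1e)
  then show ?thesis using x y bc_I_glin by (simp add: DF_iff)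
qed

lemma zero_DF: "(\<lambda>i t. 0) \<in> DF"
proof -
  have "H1e (\<lambda>t. 0)" by (rule continuous_H1e[of _ "\<lambda>_. 0"]) auto
  then show ?thesis by (simp add: DF_iff bc_I_def)
qed

subsection \<open>Sesquilinearity and symmetry\<close>

text \<open>The part of the form carried by the ends of the edges, and the part carried by their interior.\<close>

definition Fbd :: "gfun \<Rightarrow> gfun \<Rightarrow> complex" where
  "Fbd x y = (\<Sum>i\<in>E. f i 1 * x i 1 * cnj (y i 1) - f i 0 * x i 0 * cnj (y i 0))"

definition Fint :: "gfun \<Rightarrow> gfun \<Rightarrow> complex" where
  "Fint x y = (\<Sum>i\<in>E. (\<integral>t. ud (x i) t * cnj (ud (y i) t) \<partial>unit_leb)
      + (\<integral>t. q i t * x i t * cnj (y i t) \<partial>unit_leb))"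

lemma F_integrable:
  assumes "x \<in> DF" "y \<in> DF" "i \<in> E"
  shows "integrable unit_leb (\<lambda>t. ud (x i) t * cnj (ud (y i) t))"
    and "integrable unit_leb (\<lambda>t. q i t * x i t * cnj (y i t))"
  using assms sqint_mult_cnj_integrable[OF sqint_q[OF assms(3) H1e_sqint[OF DF_H1e[OF assms(1,3)]]]
      H1e_sqint[OF DF_H1e[OF assms(2,3)]]]
  by (auto intro!: sqint_mult_cnj_integrable H1e_sqint_ud DF_H1e)

lemma F_split:
  assumes "x \<in> DF" "y \<in> DF"
  shows "F x y = Fbd x y + Fint x y"
proof -
  have "gint E (\<lambda>i t. gderiv x i t * cnj (gderiv y i t) + q i t * x i t * cnj (y i t)) = Fint x y"
    unfolding gint_def Fint_def
    by (intro sum.cong refl) (simp add: gderiv_ud F_integrable[OF assms])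
  then show ?thesis by (simp add: F_form_def Fbd_def bdint_def)
qed

lemma F_glin_left:
  assumes "x \<in> DF" "y \<in> DF" "z \<in> DF"
  shows "F (glin a x b y) z = a * F x z + b * F y z"
proof -
  have bd: "Fbd (glin a x b y) z = a * Fbd x z + b * Fbd y z"
    unfolding Fbd_def sum_distrib_left sum.distrib[symmetric]
    by (intro sum.cong refl) (simp add: glin_def algebra_simps)
  have "(\<integral>t. ud (glin a x b y i) t * cnj (ud (z i) t) \<partial>unit_leb) =
      a * (\<integral>t. ud (x i) t * cnj (ud (z i) t) \<partial>unit_leb) + b * (\<integral>t. ud (y i) t * cnj (ud (z i) t) \<partial>unit_leb)"
    if i: "i \<in> E" for i
  proof -
    have "(\<integral>t. ud (glin a x b y i) t * cnj (ud (z i) t) \<partial>unit_leb) =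
        (\<integral>t. a * (ud (x i) t * cnj (ud (z i) t)) + b * (ud (y i) t * cnj (ud (z i) t)) \<partial>unit_leb)"
    proof (rule integral_cong_AE)
      have "H1e (glin a x b y i)" "H1e (z i)" using assms i by (auto intro!: DF_H1e glin_DF)
      then show "(\<lambda>t. ud (glin a x b y i) t * cnj (ud (z i) t)) \<in> borel_measurable unit_leb"
        by (intro borel_measurable_integrable sqint_mult_cnj_integrable H1e_sqint_ud)
      show "(\<lambda>t. a * (ud (x i) t * cnj (ud (z i) t)) + b * (ud (y i) t * cnj (ud (z i) t))) \<in> borel_measurable unit_leb"
        using F_integrable(1)[OF assms(1,3) i] F_integrable(1)[OF assms(2,3) i]
        by (intro borel_measurable_integrable Bochner_Integration.integrable_add integrable_mult_right) auto
      show "AE t in unit_leb. ud (glin a x b y i) t * cnj (ud (z i) t) =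
          a * (ud (x i) t * cnj (ud (z i) t)) + b * (ud (y i) t * cnj (ud (z i) t))"
        using ud_lin[OF H1e_AC1[OF DF_H1e[OF assms(1) i]] H1e_AC1[OF DF_H1e[OF assms(2) i]], of a b]
        unfolding glin_def by eventually_elim (simp add: algebra_simps)
    qed
    then show ?thesis using F_integrable(1)[OF assms(1,3) i] F_integrable(1)[OF assms(2,3) i] by simp
  qed
  moreover have "(\<integral>t. q i t * glin a x b y i t * cnj (z i t) \<partial>unit_leb) =
      a * (\<integral>t. q i t * x i t * cnj (z i t) \<partial>unit_leb) + b * (\<integral>t. q i t * y i t * cnj (z i t) \<partial>unit_leb)"
    if i: "i \<in> E" for i
  proof -
    have "(\<integral>t. q i t * glin a x b y i t * cnj (z i t) \<partial>unit_leb) =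
        (\<integral>t. a * (q i t * x i t * cnj (z i t)) + b * (q i t * y i t * cnj (z i t)) \<partial>unit_leb)"
      by (intro Bochner_Integration.integral_cong refl) (simp add: glin_def algebra_simps)
    then show ?thesis using F_integrable(2)[OF assms(1,3) i] F_integrable(2)[OF assms(2,3) i] by simp
  qed
  ultimately have "Fint (glin a x b y) z = a * Fint x z + b * Fint y z"
    unfolding Fint_def sum_distrib_left sum.distrib[symmetric]
    by (intro sum.cong refl) (simp add: algebra_simps)
  then show ?thesis using bd assms glin_DF[OF assms(1,2)] by (simp add: F_split algebra_simps)
qed

lemma Fint_herm: "Fint y x = cnj (Fint x y)"
proof -
  have 1: "(\<integral>t. ud (y i) t * cnj (ud (x i) t) \<partial>unit_leb) = cnj (\<integral>t. ud (x i) t * cnj (ud (y i) t) \<partial>unit_leb)" for i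
    by (simp add: mult.commute flip: Bochner_Integration.integral_cnj)
  have 2: "(\<integral>t. q i t * y i t * cnj (x i t) \<partial>unit_leb) = cnj (\<integral>t. q i t * x i t * cnj (y i t) \<partial>unit_leb)" for i
    by (simp add: mult_ac flip: Bochner_Integration.integral_cnj)
  show ?thesis unfolding Fint_def 1 2 by simp
qed

lemma lop_sqint:
  assumes "x \<in> H2 E" "i \<in> E"
  shows "sqint (lop P x i)"
proof -
  have H: "H1e (x i)" "H1e (ud (x i))" using assms by (auto simp: H2_H1e)
  have "sqint (\<lambda>t. (-1) * ud (ud (x i)) t + 1 * (q i t * x i t))"
    using H assms(2) by (intro sqint_lin H1e_sqint_ud sqint_q H1e_sqint)
  then show ?thesis by (simp add: lop_def gderiv_ud')
qed

text \<open>Green's formula. The co-normal condition turns its boundary terms into those of the form.\<close>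

lemma Green:
  assumes x: "x \<in> DF" "x \<in> H2 E" "bc_II P x" and y: "y \<in> DF"
  shows "L2_inner E (lop P x) y = F x y"
proof -
  have bd0: "bdint E (\<lambda>i t. (f i t * x i t + gderiv x i t) * cnj (y i t)) = 0"
    using conormal x y unfolding conormal_via_def by blast
  have edge: "(\<integral>t. lop P x i t * cnj (y i t) \<partial>unit_leb) =
      (\<integral>t. ud (x i) t * cnj (ud (y i) t) \<partial>unit_leb) + (\<integral>t. q i t * x i t * cnj (y i t) \<partial>unit_leb)
      - (ud (x i) 1 * cnj (y i 1) - ud (x i) 0 * cnj (y i 0))" if i: "i \<in> E" for i
  proof -
    have H: "H1e (ud (x i))" "H1e (y i)" using x(2) i DF_H1e[OF y] by (auto simp: H2_H1e)
    have i1: "integrable unit_leb (\<lambda>t. ud (ud (x i)) t * cnj (y i t))"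
      using H by (intro sqint_mult_cnj_integrable H1e_sqint H1e_sqint_ud)
    have "(\<integral>t. lop P x i t * cnj (y i t) \<partial>unit_leb) =
        (\<integral>t. q i t * x i t * cnj (y i t) - ud (ud (x i)) t * cnj (y i t) \<partial>unit_leb)"
      by (intro Bochner_Integration.integral_cong refl) (simp add: lop_def gderiv_ud' algebra_simps)
    also have "\<dots> = (\<integral>t. q i t * x i t * cnj (y i t) \<partial>unit_leb) - (\<integral>t. ud (ud (x i)) t * cnj (y i t) \<partial>unit_leb)"
      using F_integrable(2)[OF x(1) y i] i1 by simp
    also have "(\<integral>t. ud (ud (x i)) t * cnj (y i t) \<partial>unit_leb) =
        ud (x i) 1 * cnj (y i 1) - ud (x i) 0 * cnj (y i 0) - (\<integral>t. ud (x i) t * cnj (ud (y i) t) \<partial>unit_leb)"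
      using integration_by_parts[OF H] by (simp only: eq_diff_eq add.commute)
    finally show ?thesis by (simp only: algebra_simps)
  qed
  have "L2_inner E (lop P x) y = Fint x y - (\<Sum>i\<in>E. ud (x i) 1 * cnj (y i 1) - ud (x i) 0 * cnj (y i 0))"
    unfolding L2_inner_def gint_def Fint_def sum_subtractf[symmetric] by (intro sum.cong refl edge)
  moreover have "(\<Sum>i\<in>E. ud (x i) 1 * cnj (y i 1) - ud (x i) 0 * cnj (y i 0)) = - Fbd x y"
  proof -
    have "Fbd x y + (\<Sum>i\<in>E. ud (x i) 1 * cnj (y i 1) - ud (x i) 0 * cnj (y i 0)) = 0"
      unfolding bd0[symmetric] Fbd_def bdint_def sum.distrib[symmetric]
      by (intro sum.cong refl) (simp add: gderiv_ud algebra_simps)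
    then show ?thesis by (simp add: eq_neg_iff_add_eq_0 add.commute)
  qed
  ultimately show ?thesis using F_split[OF x(1) y] by simp
qed

text \<open>Every set of admissible end values is attained in the domain of the operator: with end
  derivatives \<open>- f x\<close> the co-normal condition makes (II) automatic.\<close>

lemma domain_interpolation:
  assumes y: "y \<in> DF"
  obtains x where "x \<in> DF" "x \<in> H2 E" "bc_II P x"
    "\<And>i. i \<in> E \<Longrightarrow> x i 0 = y i 0" "\<And>i. i \<in> E \<Longrightarrow> x i 1 = y i 1"
proof -
  define x where "x i = hermite (y i 0) (y i 1) (- f i 0 * y i 0) (- f i 1 * y i 1)" for i
  have ends: "x i 0 = y i 0" "x i 1 = y i 1" "ud (x i) 0 = - f i 0 * x i 0" "ud (x i) 1 = - f i 1 * x i 1" for i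
    using hermite[of "y i 0" "y i 1" "- f i 0 * y i 0" "- f i 1 * y i 1"] by (simp_all add: x_def)
  have H: "x \<in> H2 E" using hermite(5,6) by (simp add: H2_H1e x_def)
  have "bc_I P x" using y bc_I_cong[of x y] ends by (simp add: DF_iff)
  then have D: "x \<in> DF" using H by (simp add: DF_iff H2_H1e)
  have "bdint E (\<lambda>i t. (f i t * x i t + gderiv x i t) * cnj (z i t)) = 0" for z
    unfolding bdint_def gderiv_ud by (rule sum.neutral) (simp add: ends(3,4))
  then have "bc_II P x" using conormal D H unfolding conormal_via_def by blast
  then show ?thesis using that[of x] D H ends by blast
qed

lemma F_herm:
  assumes x: "x \<in> DF" and y: "y \<in> DF"
  shows "F y x = cnj (F x y)"
proof -
  obtain x' where x': "x' \<in> DF" "x' \<in> H2 E" "bc_II P x'" "\<And>i. i \<in> E \<Longrightarrow> x' i 0 = x i 0" "\<And>i. i \<in> E \<Longrightarrow> x' i 1 = x i 1"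
    using domain_interpolation[OF x] by blast
  obtain y' where y': "y' \<in> DF" "y' \<in> H2 E" "bc_II P y'" "\<And>i. i \<in> E \<Longrightarrow> y' i 0 = y i 0" "\<And>i. i \<in> E \<Longrightarrow> y' i 1 = y i 1"
    using domain_interpolation[OF y] by blast
  interpret L: semi_ip "L2 E" "L2_inner E" by (rule L2_semi_ip)
  \<comment> \<open>By \<open>domain_interpolation\<close> formal self-adjointness applies to functions with the end values of \<open>x\<close> and \<open>y\<close>.
    The interior part of the form is Hermitian anyway, and the other part depends on these values only.\<close>
  have lx: "lop P x' \<in> L2 E" "lop P y' \<in> L2 E" using lop_sqint x'(2) y'(2) by (auto simp: L2_sqint)
  have "bc_I P x'" "bc_I P y'" using x' y' by (auto simp: DF_iff)
  then have "L2_inner E (lop P x') y' = L2_inner E x' (lop P y')"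
    using bvp x' y' unfolding graph_bvp_def formally_self_adjoint_def by blast
  also have "\<dots> = cnj (L2_inner E (lop P y') x')"
    by (rule L.ip_herm) (use lx DF_L2 x' in auto)
  finally have "F x' y' = cnj (F y' x')"
    using Green[OF x'(1,2,3) y'(1)] Green[OF y'(1,2,3) x'(1)] by simp
  then have "Fbd x' y' = cnj (Fbd y' x')"
    using F_split[OF x'(1) y'(1)] F_split[OF y'(1) x'(1)] Fint_herm[of y' x'] by simp
  moreover have "Fbd x' y' = Fbd x y" "Fbd y' x' = Fbd y x"
    unfolding Fbd_def using x' y' by (auto intro!: sum.cong)
  ultimately have "Fbd x y = cnj (Fbd y x)" by simp
  then show ?thesis using F_split[OF x y] F_split[OF y x] Fint_herm[of y x] by simp
qed

lemma dom_L_H2: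
  "y \<in> dom_L P \<longleftrightarrow> y \<in> DF \<and> y \<in> H2 E \<and> bc_II P y"
proof
  assume y: "y \<in> dom_L P"
  have A: "AC1 (y i)" "AC1 (ud (y i))" "sqint (lop P y i)" if "i \<in> E" for i
    using y that by (auto simp: dom_L_def AC_AC1 gderiv_ud' L2_sqint)
  have H1: "H1e (y i)" if "i \<in> E" for i
    using A[OF that] by (simp add: H1e_def AC1_sqint)
  have H2: "H1e (ud (y i))" if i: "i \<in> E" for i
  proof -
    have "sqint (\<lambda>t. 1 * (q i t * y i t) + (-1) * lop P y i t)"
      by (intro sqint_lin sqint_q H1e_sqint H1 A(3) i)
    then have "sqint (ud (ud (y i)))" by (simp add: lop_def gderiv_ud')
    then show ?thesis using A[OF i] by (simp add: H1e_def)
  qed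
  show "y \<in> DF \<and> y \<in> H2 E \<and> bc_II P y"
    using y H1 H2 by (auto simp: DF_iff H2_H1e dom_L_def)
next
  assume y: "y \<in> DF \<and> y \<in> H2 E \<and> bc_II P y"
  then show "y \<in> dom_L P"
    using lop_sqint[of y] by (auto simp: dom_L_def DF_iff H2_H1e AC_AC1 gderiv_ud' L2_sqint H1e_AC1)
qed

subsection \<open>Bounds\<close>

text \<open>The squares of the norms of a function and of its derivative.\<close>

definition N0 :: "gfun \<Rightarrow> real" where "N0 x = (\<Sum>i\<in>E. sqn (x i))"
definition N1 :: "gfun \<Rightarrow> real" where "N1 x = (\<Sum>i\<in>E. sqn (ud (x i)))"

lemma N_nonneg: "0 \<le> N0 x" "0 \<le> N1 x"
  by (auto simp: N0_def N1_def intro: sum_nonneg)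

lemma L2_inner_N0: "L2_inner E x x = of_real (N0 x)"
  by (simp add: L2_inner_self N0_def)

lemma f_bound:
  obtains C where "C \<ge> 1" "\<And>i. i \<in> E \<Longrightarrow> cmod (f i 0) \<le> C" "\<And>i. i \<in> E \<Longrightarrow> cmod (f i 1) \<le> C"
proof -
  define C where "C = 1 + (\<Sum>i\<in>E. cmod (f i 0) + cmod (f i 1))"
  have s: "cmod (f i 0) + cmod (f i 1) \<le> (\<Sum>i\<in>E. cmod (f i 0) + cmod (f i 1))" if "i \<in> E" for i
    using finite_E that by (intro member_le_sum[of i E "\<lambda>i. cmod (f i 0) + cmod (f i 1)"]) auto
  have "cmod (f i 0) \<le> C" "cmod (f i 1) \<le> C" if "i \<in> E" for i
    using s[OF that] norm_ge_zero[of "f i 0"] norm_ge_zero[of "f i 1"] unfolding C_def by linarith+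
  moreover have "C \<ge> 1" unfolding C_def by (simp add: sum_nonneg)
  ultimately show ?thesis using that by blast
qed

lemma F_diag:
  assumes x: "x \<in> DF"
  shows "Re (F x x) = Re (Fbd x x) + N1 x + (\<Sum>i\<in>E. Re (\<integral>t. q i t * x i t * cnj (x i t) \<partial>unit_leb))"
proof -
  have "(\<integral>t. ud (x i) t * cnj (ud (x i) t) \<partial>unit_leb) = of_real (sqn (ud (x i)))" for i
    unfolding sqn_def complex_norm_square[symmetric] by (rule integral_complex_of_real)
  then show ?thesis unfolding F_split[OF x x] Fint_def N1_def by (simp add: sum.distrib)
qed

lemma q_form_bound:
  assumes x: "x \<in> DF" and i: "i \<in> E" and Q: "AE t in unit_leb. cmod (q i t) \<le> Q"
  shows "\<bar>Re (\<integral>t. q i t * x i t * cnj (x i t) \<partial>unit_leb)\<bar> \<le> Q * sqn (x i)"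
proof -
  have "\<bar>Re (\<integral>t. q i t * x i t * cnj (x i t) \<partial>unit_leb)\<bar> \<le> cmod (\<integral>t. q i t * x i t * cnj (x i t) \<partial>unit_leb)"
    by (rule abs_Re_le_cmod)
  also have "\<dots> \<le> (\<integral>t. cmod (q i t * x i t * cnj (x i t)) \<partial>unit_leb)" by (rule integral_norm_bound)
  also have "\<dots> \<le> (\<integral>t. Q * (cmod (x i t))\<^sup>2 \<partial>unit_leb)"
  proof (rule integral_mono_AE)
    show "integrable unit_leb (\<lambda>t. cmod (q i t * x i t * cnj (x i t)))"
      using F_integrable(2)[OF x x i] by (rule integrable_norm)
    show "integrable unit_leb (\<lambda>t. Q * (cmod (x i t))\<^sup>2)"
      using H1e_sqint[OF DF_H1e[OF x i]] by (simp add: sqint_def)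
    show "AE t in unit_leb. cmod (q i t * x i t * cnj (x i t)) \<le> Q * (cmod (x i t))\<^sup>2"
      using Q by eventually_elim (simp add: norm_mult power2_eq_square mult.assoc mult_right_mono)
  qed
  also have "\<dots> = Q * sqn (x i)" by (simp add: sqn_def)
  finally show ?thesis .
qed

lemma Fbd_bound:
  assumes C: "C \<ge> 1" "\<And>i. i \<in> E \<Longrightarrow> cmod (f i 0) \<le> C" "\<And>i. i \<in> E \<Longrightarrow> cmod (f i 1) \<le> C"
    and x: "x \<in> DF"
  shows "\<bar>Re (Fbd x x)\<bar> \<le> 32 * C\<^sup>2 * N0 x + N1 x / 2"
proof -
  have tr: "C * (cmod (x i s))\<^sup>2 \<le> 16 * C\<^sup>2 * sqn (x i) + sqn (ud (x i)) / 4" if i: "i \<in> E" and s: "s \<in> {0..1}" for i s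
  proof -
    \<comment> \<open>The length of averaging is small enough for the derivative term to be absorbed.\<close>
    have "(cmod (x i s))\<^sup>2 \<le> 2 / (1 / (8 * C)) * sqn (x i) + 2 * (1 / (8 * C)) * sqn (ud (x i))"
      using C(1) by (intro H1e_trace[OF DF_H1e[OF x i] s]) auto
    then have "C * (cmod (x i s))\<^sup>2 \<le> C * (2 / (1 / (8 * C)) * sqn (x i) + 2 * (1 / (8 * C)) * sqn (ud (x i)))"
      using C(1) by (intro mult_left_mono) auto
    also have "\<dots> = 16 * C\<^sup>2 * sqn (x i) + sqn (ud (x i)) / 4"
      using C(1) by (simp add: power2_eq_square field_simps)
    finally show ?thesis .
  qed
  have "\<bar>Re (Fbd x x)\<bar> \<le> cmod (Fbd x x)" by (rule abs_Re_le_cmod)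
  also have "\<dots> \<le> (\<Sum>i\<in>E. cmod (f i 1 * x i 1 * cnj (x i 1) - f i 0 * x i 0 * cnj (x i 0)))"
    unfolding Fbd_def by (rule norm_sum)
  also have "\<dots> \<le> (\<Sum>i\<in>E. 32 * C\<^sup>2 * sqn (x i) + sqn (ud (x i)) / 2)"
  proof (rule sum_mono)
    fix i assume i: "i \<in> E"
    have m: "cmod (f i s * x i s * cnj (x i s)) = cmod (f i s) * (cmod (x i s))\<^sup>2" for s
      by (simp add: norm_mult power2_eq_square)
    have "cmod (f i 1 * x i 1 * cnj (x i 1) - f i 0 * x i 0 * cnj (x i 0)) \<le>
        cmod (f i 1) * (cmod (x i 1))\<^sup>2 + cmod (f i 0) * (cmod (x i 0))\<^sup>2"
      using norm_triangle_ineq4 unfolding m[symmetric] .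
    also have "\<dots> \<le> C * (cmod (x i 1))\<^sup>2 + C * (cmod (x i 0))\<^sup>2"
      using C i by (intro add_mono mult_right_mono) auto
    also have "\<dots> \<le> 32 * C\<^sup>2 * sqn (x i) + sqn (ud (x i)) / 2"
      using tr[OF i, of 0] tr[OF i, of 1] by simp
    finally show "cmod (f i 1 * x i 1 * cnj (x i 1) - f i 0 * x i 0 * cnj (x i 0)) \<le>
      32 * C\<^sup>2 * sqn (x i) + sqn (ud (x i)) / 2" .
  qed
  also have "\<dots> = 32 * C\<^sup>2 * N0 x + N1 x / 2"
    by (simp add: N0_def N1_def sum.distrib sum_distrib_left sum_divide_distrib)
  finally show ?thesis .
qed

text \<open>Garding's inequality and boundedness of the form.\<close>

lemma Garding:
  obtains k where "k \<ge> 0"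
    "\<And>x. x \<in> DF \<Longrightarrow> N1 x / 2 - k * N0 x \<le> Re (F x x)"
    "\<And>x. x \<in> DF \<Longrightarrow> Re (F x x) \<le> 2 * N1 x + k * N0 x"
proof -
  obtain C where C: "C \<ge> 1" "\<And>i. i \<in> E \<Longrightarrow> cmod (f i 0) \<le> C" "\<And>i. i \<in> E \<Longrightarrow> cmod (f i 1) \<le> C"
    using f_bound by blast
  obtain Q where Q: "Q \<ge> 0" "\<And>i. i \<in> E \<Longrightarrow> AE t in unit_leb. cmod (q i t) \<le> Q"
    using potential_bound by blast
  define k where "k = 32 * C\<^sup>2 + Q"
  have *: "\<bar>Re (F x x) - N1 x\<bar> \<le> k * N0 x + N1 x / 2" if x: "x \<in> DF" for x
  proof -
    have "\<bar>\<Sum>i\<in>E. Re (\<integral>t. q i t * x i t * cnj (x i t) \<partial>unit_leb)\<bar> \<le> (\<Sum>i\<in>E. Q * sqn (x i))"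
      by (rule sum_abs[THEN order_trans], rule sum_mono, rule q_form_bound[OF x _ Q(2)])
    then have "\<bar>\<Sum>i\<in>E. Re (\<integral>t. q i t * x i t * cnj (x i t) \<partial>unit_leb)\<bar> \<le> Q * N0 x"
      by (simp add: N0_def sum_distrib_left)
    then show ?thesis
      unfolding F_diag[OF x] k_def using Fbd_bound[OF C x] by (simp add: algebra_simps)
  qed
  have "k \<ge> 0" using Q by (simp add: k_def)
  moreover have "N1 x / 2 - k * N0 x \<le> Re (F x x)" if "x \<in> DF" for x
    using *[OF that] by (simp add: abs_le_iff)
  moreover have "Re (F x x) \<le> 2 * N1 x + k * N0 x" if "x \<in> DF" for x
    using *[OF that] N_nonneg[of x] by (simp add: abs_le_iff)
  ultimately show ?thesis using that[of k] by blast
qed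

lemma F_shift_semi_ip:
  assumes "\<And>x. x \<in> DF \<Longrightarrow> \<mu> * N0 x \<le> Re (F x x)"
  shows "semi_ip DF (\<lambda>x y. F x y - of_real \<mu> * L2_inner E x y)"
proof -
  interpret L: semi_ip "L2 E" "L2_inner E" by (rule L2_semi_ip)
  show ?thesis
  proof
    fix x y z a b assume x: "x \<in> DF" and y: "y \<in> DF"
    show "glin a x b y \<in> DF" using x y by (rule glin_DF)
    show "F y x - of_real \<mu> * L2_inner E y x = cnj (F x y - of_real \<mu> * L2_inner E x y)"
      using F_herm[OF x y] L.ip_herm[OF DF_L2[OF x] DF_L2[OF y]] by simp
    show "0 \<le> Re (F x x - of_real \<mu> * L2_inner E x x)"
      using assms[OF x] by (simp add: L2_inner_N0)
    assume z: "z \<in> DF"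
    show "F (glin a x b y) z - of_real \<mu> * L2_inner E (glin a x b y) z =
      a * (F x z - of_real \<mu> * L2_inner E x z) + b * (F y z - of_real \<mu> * L2_inner E y z)"
      using F_glin_left[OF x y z] L.ip_glin_left[OF DF_L2[OF x] DF_L2[OF y] DF_L2[OF z]]
      by (simp add: algebra_simps)
  qed (rule zero_DF)
qed

end

section \<open>Coercivity of the energy form\<close>

subsection \<open>Tent functions\<close>

lemma H1e_cong:
  assumes u: "H1e u" and eq: "\<And>t. t \<in> {0..1} \<Longrightarrow> v t = u t"
  shows "H1e v" and "AE t in unit_leb. ud v t = ud u t"
proof -
  have ac: "abs_cont v"
    by (rule abs_cont_dominated[OF H1e_abs_cont[OF u] H1e_abs_cont[OF u], of 1]) (simp_all add: eq)
  have "AE t in unit_leb. t \<in> {0..1}" by (rule AE_unit_leb)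
  with AC1_derivative[OF H1e_AC1[OF u]]
  have der: "AE t in unit_leb. (v has_vector_derivative ud u t) (at t within {0..1})"
  proof eventually_elim
    case (elim t)
    show ?case
      by (rule has_vector_derivative_transform[OF elim(2) _ elim(1)]) (rule eq)
  qed
  show "H1e v" by (rule H1eI[OF ac der H1e_sqint_ud[OF u]])
  show "AE t in unit_leb. ud v t = ud u t" by (rule AE_ud_eq[OF der])
qed

text \<open>Green's function of the second derivative with Dirichlet conditions; its peak is at \<open>s\<close>.\<close>

definition tent :: "real \<Rightarrow> real \<Rightarrow> complex" where
  "tent s t = of_real (min (t * (1 - s)) (s * (1 - t)))"

lemma tent_eq: "t \<le> s \<Longrightarrow> tent s t = of_real (t * (1 - s))" "s \<le> t \<Longrightarrow> tent s t = of_real (s * (1 - t))"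
  by (simp_all add: tent_def min_def algebra_simps)

lemma tent_ends: "0 \<le> s \<Longrightarrow> s \<le> 1 \<Longrightarrow> tent s 0 = 0" "0 \<le> s \<Longrightarrow> s \<le> 1 \<Longrightarrow> tent s 1 = 0"
  by (simp_all add: tent_def)

lemma tent_H1e:
  assumes s: "0 \<le> s" "s \<le> 1"
  shows "H1e (tent s)"
    and "AE t in unit_leb. ud (tent s) t = of_real (if t \<le> s then 1 - s else - s)"
proof -
  have ne: "AE t in unit_leb. t \<noteq> s"
    unfolding AE_unit_leb_negligible by (rule negligible_subset[of "{s}"]) auto
  have "AE t in unit_leb. t \<in> {0..1}" by (rule AE_unit_leb)
  with ne have der: "AE t in unit_leb. (tent s has_vector_derivative of_real (if t \<le> s then 1 - s else - s)) (at t within {0..1})"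
  proof eventually_elim
    case (elim t)
    show ?case
    proof (cases "t < s")
      case True
      have "((\<lambda>r. complex_of_real (r * (1 - s))) has_vector_derivative of_real (1 - s)) (at t within {0..1})"
        by (auto intro!: derivative_eq_intros)
      then have "(tent s has_vector_derivative of_real (1 - s)) (at t within {0..1})"
        by (rule has_vector_derivative_transform_within[of _ _ _ _ "s - t"])
          (use True elim in \<open>auto simp: tent_eq dist_real_def\<close>)
      then show ?thesis using True by simp
    next
      case False
      then have gt: "s < t" using elim by simp
      have "((\<lambda>r. complex_of_real (s * (1 - r))) has_vector_derivative of_real (- s)) (at t within {0..1})"
        by (auto intro!: derivative_eq_intros)
      then have "(tent s has_vector_derivative of_real (- s)) (at t within {0..1})"
        by (rule has_vector_derivative_transform_within[of _ _ _ _ "t - s"])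
          (use gt elim in \<open>auto simp: tent_eq dist_real_def\<close>)
      then show ?thesis using gt by simp
    qed
  qed
  have "cmod (tent s t - tent s r) \<le> 1 * (t - r)" if "0 \<le> r" "r \<le> t" "t \<le> 1" for r t
  proof -
    have a: "t * (1 - s) - r * (1 - s) \<le> t - r" "0 \<le> t * (1 - s) - r * (1 - s)"
      unfolding left_diff_distrib[symmetric]
      using that s mult_left_mono[of "1 - s" 1 "t - r"] by simp_all
    have b: "s * (1 - r) - s * (1 - t) \<le> t - r" "0 \<le> s * (1 - r) - s * (1 - t)"
      unfolding right_diff_distrib[symmetric]
      using that s mult_right_mono[of s 1 "t - r"] by simp_all
    have "\<bar>min p p' - min p1 p1'\<bar> \<le> D" if "p - p1 \<le> D" "0 \<le> p - p1" "p1' - p' \<le> D" "0 \<le> p1' - p'"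
      for p p' p1 p1' D :: real
      using that by (auto simp: min_def)
    from this[OF a b] show ?thesis
      unfolding tent_def of_real_diff[symmetric] norm_of_real by simp
  qed
  from Lipschitz_H1e[OF _ this der] show "H1e (tent s)" by simp
  show "AE t in unit_leb. ud (tent s) t = of_real (if t \<le> s then 1 - s else - s)"
    by (rule AE_ud_eq[OF der])
qed

lemma tent_integral:
  assumes u: "AC1 u" and der: "AE t in unit_leb. (u has_vector_derivative g t) (at t within {0..1})"
    and g: "sqint g" and s: "0 \<le> s" "s \<le> 1"
  shows "(\<integral>t. g t * cnj (ud (tent s) t) \<partial>unit_leb) = u s - of_real (1 - s) * u 0 - of_real s * u 1"
proof -
  define d where "d t = complex_of_real (if t \<le> s then 1 - s else - s)" for t
  have i: "integrable unit_leb (\<lambda>t. g t * cnj (ud (tent s) t))"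
    by (rule sqint_mult_cnj_integrable[OF g H1e_sqint_ud[OF tent_H1e(1)[OF s]]])
  have ae: "AE t in unit_leb. g t * cnj (ud (tent s) t) = g t * d t"
    using tent_H1e(2)[OF s] unfolding d_def by eventually_elim simp
  have m: "(\<lambda>t. g t * d t) \<in> borel_measurable unit_leb"
    by (rule unit_leb_AE_eq_measurable[OF borel_measurable_integrable[OF i] ae])
  have i2: "integrable unit_leb (\<lambda>t. g t * d t)"
    by (rule integrable_cong_AE_imp[OF i m]) (use ae in eventually_elim, simp)
  have "(\<integral>t. g t * cnj (ud (tent s) t) \<partial>unit_leb) = (\<integral>t. g t * d t \<partial>unit_leb)"
    by (rule integral_cong_AE[OF borel_measurable_integrable[OF i] m ae])
  also have "\<dots> = integral {0..1} (\<lambda>t. g t * d t)"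
    by (rule lebesgue_integral_eq_integral[OF i2]) simp
  also have "((\<lambda>t. g t * d t) has_integral (u s - u 0) * of_real (1 - s) + (u 1 - u s) * of_real (- s)) {0..1}"
  proof (rule has_integral_combine[OF s])
    have "((\<lambda>t. g t * of_real (1 - s)) has_integral (u s - u 0) * of_real (1 - s)) {0..s}"
      by (intro has_integral_mult_left AC1_FTC[OF u der]) (use s in auto)
    then show "((\<lambda>t. g t * d t) has_integral (u s - u 0) * of_real (1 - s)) {0..s}"
      by (rule has_integral_eq[rotated]) (simp add: d_def)
    have "((\<lambda>t. g t * of_real (- s)) has_integral (u 1 - u s) * of_real (- s)) {s..1}"
      by (intro has_integral_mult_left AC1_FTC[OF u der]) (use s in auto)
    then show "((\<lambda>t. g t * d t) has_integral (u 1 - u s) * of_real (- s)) {s..1}"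
      by (rule has_integral_spike[of "{s}", rotated 2]) (auto simp: d_def)
  qed
  then have "integral {0..1} (\<lambda>t. g t * d t) = (u s - u 0) * of_real (1 - s) + (u 1 - u s) * of_real (- s)"
    by (rule integral_unique)
  also have "\<dots> = u s - of_real (1 - s) * u 0 - of_real s * u 1" by (simp add: algebra_simps)
  finally show ?thesis .
qed

text \<open>The equation \<open>X'' = h\<close> in the weak form obtained from tent functions determines \<open>X\<close> as a twice
  differentiable function.\<close>

lemma weak_solution_regular:
  fixes X h :: "real \<Rightarrow> complex"
  assumes hm: "h \<in> borel_measurable unit_leb" and hb: "\<And>t. t \<in> {0..1} \<Longrightarrow> cmod (h t) \<le> C"
    and weak: "\<And>s. 0 < s \<Longrightarrow> s < 1 \<Longrightarrow>
      X s - of_real (1 - s) * X 0 - of_real s * X 1 + (\<integral>t. h t * cnj (tent s t) \<partial>unit_leb) = 0"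
  shows "H1e X" "H1e (ud X)" "AE t in unit_leb. ud (ud X) t = h t"
proof -
  have hs: "sqint h" using hm hb by (intro sqint_bounded[of h C] AE_unit_leb)
  have hi: "h integrable_on {0..1}" by (rule integrable_on_lebesgue_on[OF sqint_integrable[OF hs]]) simp
  define A where "A s = integral {0..s} h" for s
  have C0: "0 \<le> C" by (rule order_trans[OF norm_ge_zero hb[of 0]]) simp
  have Ad: "AE t in unit_leb. (A has_vector_derivative h t) (at t within {0..1})"
    unfolding A_def[abs_def] by (rule indefinite_integral_derivative[OF hi])
  have AH: "H1e A"
  proof (rule Lipschitz_H1e[OF C0 _ Ad])
    show "cmod (A t - A s) \<le> C * (t - s)" if "0 \<le> s" "s \<le> t" "t \<le> 1" for s t
      unfolding A_def using hi hb that by (rule indefinite_integral_Lipschitz)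
  qed
  have A0: "A 0 = 0" by (simp add: A_def)
  have Ac: "continuous_on {0..1} A" by (intro abs_cont_continuous H1e_abs_cont AH)
  define B where "B s = integral {0..s} A" for s
  have Bd: "(B has_vector_derivative A t) (at t within {0..1})" if "t \<in> {0..1}" for t
    unfolding B_def[abs_def] by (rule integral_has_vector_derivative[OF Ac that])
  have BH: "H1e B" by (rule continuous_H1e[OF Bd Ac])
  have B0: "B 0 = 0" by (simp add: B_def)
  have hT: "(\<integral>t. h t * cnj (tent s t) \<partial>unit_leb) = of_real s * B 1 - B s" if s: "0 \<le> s" "s \<le> 1" for s
  proof -
    have "(\<integral>t. A t * cnj (ud (tent s) t) \<partial>unit_leb) + (\<integral>t. ud A t * cnj (tent s t) \<partial>unit_leb) = 0"
      using integration_by_parts[OF AH tent_H1e(1)[OF s]] tent_ends[OF s] by simp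
    moreover have "(\<integral>t. A t * cnj (ud (tent s) t) \<partial>unit_leb) = B s - of_real s * B 1"
      using tent_integral[OF H1e_AC1[OF BH] AE_unit_leb[OF Bd] H1e_sqint[OF AH] s] B0 by simp
    moreover have "(\<integral>t. ud A t * cnj (tent s t) \<partial>unit_leb) = (\<integral>t. h t * cnj (tent s t) \<partial>unit_leb)"
    proof (rule integral_cong_AE)
      show "AE t in unit_leb. ud A t * cnj (tent s t) = h t * cnj (tent s t)"
        using AE_ud_eq[OF Ad] by eventually_elim simp
      show "(\<lambda>t. ud A t * cnj (tent s t)) \<in> borel_measurable unit_leb"
        by (intro borel_measurable_integrable sqint_mult_cnj_integrable H1e_sqint_ud[OF AH] H1e_sqint tent_H1e(1)[OF s])
      show "(\<lambda>t. h t * cnj (tent s t)) \<in> borel_measurable unit_leb"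
        by (intro borel_measurable_integrable sqint_mult_cnj_integrable hs H1e_sqint tent_H1e(1)[OF s])
    qed
    ultimately show ?thesis by (metis (no_types, lifting) add.inverse_inverse add_eq_0_iff minus_diff_eq)
  qed
  define c where "c = X 1 - X 0 - B 1"
  have X: "X t = X 0 + of_real t * c + B t" if t: "t \<in> {0..1}" for t
  proof -
    consider "t = 0" | "t = 1" | "0 < t" "t < 1" using t by fastforce
    then show ?thesis
    proof cases
      case 3
      have solve: "a = b + d - z" if "a - b - d + z = 0" for a b d z :: complex
        using that by (metis add_diff_cancel_right' diff_add_cancel diff_diff_add minus_diff_eq diff_0 diff_minus_eq_add)
      have "X t = of_real (1 - t) * X 0 + of_real t * X 1 - (\<integral>s. h s * cnj (tent t s) \<partial>unit_leb)"
        by (rule solve[OF weak[OF 3]])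
      then show ?thesis unfolding hT[of t, OF less_imp_le[OF 3(1)] less_imp_le[OF 3(2)]] c_def by (simp add: algebra_simps)
    qed (simp_all add: B0 c_def)
  qed
  have Xd: "(X has_vector_derivative c + A t) (at t within {0..1})" if t: "t \<in> {0..1}" for t
  proof (rule has_vector_derivative_transform[OF t X])
    have "((\<lambda>t. complex_of_real t) has_vector_derivative 1) (at t within {0..1})"
      by (auto intro!: derivative_eq_intros)
    from has_vector_derivative_add[OF has_vector_derivative_add[OF has_vector_derivative_const[of "X 0"]
          has_vector_derivative_mult_left[OF this, of c]] Bd[OF t]]
    show "((\<lambda>t. X 0 + of_real t * c + B t) has_vector_derivative c + A t) (at t within {0..1})" by simp
  qed
  show "H1e X" using Xd Ac by (intro continuous_H1e[of X "\<lambda>t. c + A t"] continuous_intros)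
  have "H1e (\<lambda>t. 1 * c + 1 * A t)"
    by (rule H1e_lin[OF _ AH]) (rule continuous_H1e[of _ "\<lambda>_. 0"]; simp)
  then have cA: "H1e (\<lambda>t. c + A t)" by simp
  have udX: "ud X t = c + A t" if "t \<in> {0..1}" for t using ud_eq[OF that Xd[OF that]] .
  show "H1e (ud X)" by (rule H1e_cong(1)[OF cA udX])
  have "AE t in unit_leb. ud (\<lambda>t. c + A t) t = h t"
  proof (rule AE_ud_eq)
    show "AE t in unit_leb. ((\<lambda>t. c + A t) has_vector_derivative h t) (at t within {0..1})"
      using Ad
    proof eventually_elim
      case (elim t)
      from has_vector_derivative_add[OF has_vector_derivative_const[of c] elim] show ?case by simp
    qed
  qed
  moreover have "AE t in unit_leb. ud (ud X) t = ud (\<lambda>t. c + A t) t"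
    by (rule H1e_cong(2)[OF cA udX])
  ultimately show "AE t in unit_leb. ud (ud X) t = h t"
    by eventually_elim simp
qed

lemma sqn_uniform:
  assumes "sqint u" "\<And>t. t \<in> {0..1} \<Longrightarrow> cmod (u t) \<le> e" "0 \<le> e"
  shows "sqn u \<le> e\<^sup>2"
proof -
  have "sqn u \<le> (\<integral>t. e\<^sup>2 \<partial>unit_leb)"
    unfolding sqn_def
  proof (rule integral_mono_AE)
    show "AE t in unit_leb. (cmod (u t))\<^sup>2 \<le> e\<^sup>2"
      by (rule AE_unit_leb) (use assms in \<open>auto intro!: power_mono\<close>)
  qed (use assms in \<open>auto simp: sqint_def\<close>)
  then show ?thesis by (simp add: unit_leb_measure)
qed

lemma sqint_inner_limit:
  assumes u: "\<And>n. sqint (u n)" and U: "sqint U" and v: "sqint v"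
    and lim: "(\<lambda>n. sqn (\<lambda>t. u n t - U t)) \<longlonglongrightarrow> 0"
  shows "(\<lambda>n. \<integral>t. u n t * cnj (v t) \<partial>unit_leb) \<longlonglongrightarrow> (\<integral>t. U t * cnj (v t) \<partial>unit_leb)"
proof (rule LIM_zero_cancel, rule tendsto_norm_zero_cancel)
  have b: "norm (norm ((\<integral>t. u n t * cnj (v t) \<partial>unit_leb) - (\<integral>t. U t * cnj (v t) \<partial>unit_leb)))
      \<le> sqrt (sqn (\<lambda>t. u n t - U t) * sqn v)" for n
  proof -
    have "(\<integral>t. u n t * cnj (v t) \<partial>unit_leb) - (\<integral>t. U t * cnj (v t) \<partial>unit_leb) = (\<integral>t. (u n t - U t) * cnj (v t) \<partial>unit_leb)"
      using sqint_mult_cnj_integrable[OF u v] sqint_mult_cnj_integrable[OF U v] by (simp add: left_diff_distrib)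
    then show ?thesis
      using real_le_rsqrt[OF sqint_Cauchy_Schwarz[OF sqint_diff[OF u U] v]] by simp
  qed
  have "(\<lambda>n. sqrt (sqn (\<lambda>t. u n t - U t) * sqn v)) \<longlonglongrightarrow> sqrt (0 * sqn v)"
    by (intro tendsto_intros lim)
  then have "(\<lambda>n. sqrt (sqn (\<lambda>t. u n t - U t) * sqn v)) \<longlonglongrightarrow> 0" by simp
  then show "(\<lambda>n. norm ((\<integral>t. u n t * cnj (v t) \<partial>unit_leb) - (\<integral>t. U t * cnj (v t) \<partial>unit_leb))) \<longlonglongrightarrow> 0"
    by (rule Lim_null_comparison[OF always_eventually[OF allI[OF b]]])
qed

context conormal_bvp
begin

text \<open>Compactness: a sequence that is bounded in the Sobolev norm has a uniformly convergent
  subsequence. The edges are placed at integer heights in the plane, so that the Arzela-Ascoli theorem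
  applies to all of them at once.\<close>

lemma uniform_subsequence:
  assumes x: "\<And>n. x n \<in> DF" and b0: "\<And>n. N0 (x n) \<le> b" and b1: "\<And>n. N1 (x n) \<le> b"
  shows "\<exists>X (k :: nat \<Rightarrow> nat). strict_mono k \<and> (\<forall>i\<in>E. continuous_on {0..1} (X i)) \<and>
    (\<forall>e>0. \<exists>N. \<forall>n i t. n \<ge> N \<and> i \<in> E \<and> t \<in> {0..1} \<longrightarrow> cmod (x (k n) i t - X i t) < e)"
proof -
  have b: "b \<ge> 0" using b0[of 0] N_nonneg(1)[of "x 0"] by linarith
  have s0: "sqn (x n i) \<le> b" if "i \<in> E" for n i
    using member_le_sum[of i E "\<lambda>i. sqn (x n i)"] that finite_E b0[of n] by (simp add: N0_def)
  have s1: "sqn (ud (x n i)) \<le> b" if "i \<in> E" for n i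
    using member_le_sum[of i E "\<lambda>i. sqn (ud (x n i))"] that finite_E b1[of n] by (simp add: N1_def)
  define G where "G n z = x n (nat \<lfloor>snd z\<rfloor>) (fst z)" for n and z :: "real \<times> real"
  define S where "S = {0..1::real} \<times> real ` E"
  have cS: "compact S" unfolding S_def by (rule compact_Times[OF compact_Icc finite_imp_compact[OF finite_imageI[OF finite_E]]])
  have bd: "norm (G n z) \<le> 2 * sqrt b" if z: "z \<in> S" for n z
  proof -
    obtain t i where z': "z = (t, real i)" "t \<in> {0..1}" "i \<in> E" using z by (auto simp: S_def)
    have "(cmod (x n i t))\<^sup>2 \<le> (2 / 1) * sqn (x n i) + 2 * 1 * sqn (ud (x n i))"
      by (rule H1e_trace[OF DF_H1e[OF x z'(3)] z'(2)]) auto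
    also have "\<dots> \<le> 4 * b" using s0[OF z'(3), of n] s1[OF z'(3), of n] by simp
    also have "\<dots> = (2 * sqrt b)\<^sup>2" using b by (simp add: power_mult_distrib)
    finally have "cmod (x n i t) \<le> 2 * sqrt b" by (rule power2_le_imp_le) (use b in simp)
    then show ?thesis by (simp add: G_def z'(1))
  qed
  have eq: "\<exists>d>0. \<forall>n w. w \<in> S \<and> norm (z - w) < d \<longrightarrow> norm (G n z - G n w) < e"
    if z: "z \<in> S" and e: "0 < e" for z e
  proof -
    obtain t i where z': "z = (t, real i)" "t \<in> {0..1}" "i \<in> E" using z by (auto simp: S_def)
    define d where "d = min 1 (e\<^sup>2 / (b + 1))"
    have d: "d > 0" using e b by (simp add: d_def)
    have "norm (G n z - G n w) < e" if w: "w \<in> S" and near: "norm (z - w) < d" for n w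
    proof -
      obtain r j where w': "w = (r, real j)" "r \<in> {0..1}" "j \<in> E" using w by (auto simp: S_def)
      have "norm (t - r) \<le> norm (z - w)" "norm (real i - real j) \<le> norm (z - w)"
        using norm_fst_le[of "t - r" "real i - real j"] norm_snd_le[of "real i - real j" "t - r"]
        by (simp_all add: z' w')
      then have tr: "\<bar>t - r\<bar> < d" and "\<bar>real i - real j\<bar> < 1"
        using near by (auto simp: d_def)
      then have ij: "j = i" by linarith
      have H: "(cmod (x n i t - x n i r))\<^sup>2 \<le> \<bar>t - r\<bar> * sqn (ud (x n i))"
      proof (cases "r \<le> t")
        case True
        then show ?thesis using H1e_Hoelder[OF DF_H1e[OF x z'(3)], of r t n] z' w' by simp
      next
        case False
        then show ?thesis using H1e_Hoelder[OF DF_H1e[OF x z'(3)], of t r n] z' w'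
          by (simp add: norm_minus_commute)
      qed
      also have "\<dots> \<le> d * b" using tr s1[OF z'(3), of n] by (intro mult_mono) auto
      also have "\<dots> \<le> (e\<^sup>2 / (b + 1)) * b" using b by (intro mult_right_mono) (auto simp: d_def)
      also have "\<dots> < e\<^sup>2" using b e by (simp add: field_simps)
      finally have "cmod (x n i t - x n i r) < e" by (rule power_less_imp_less_base) (use e in simp)
      then show ?thesis by (simp add: G_def z'(1) w'(1) ij)
    qed
    with d show ?thesis by blast
  qed
  obtain g k where g: "continuous_on S g" and k: "strict_mono (k :: nat \<Rightarrow> nat)"
    and conv: "\<And>e. 0 < e \<Longrightarrow> \<exists>N. \<forall>n z. n \<ge> N \<and> z \<in> S \<longrightarrow> norm (G (k n) z - g z) < e"
    using Arzela_Ascoli[OF cS bd eq] by metis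
  define X where "X i t = g (t, real i)" for i t
  have "continuous_on {0..1} (X i)" if i: "i \<in> E" for i
    unfolding X_def by (rule continuous_on_compose2[OF g]) (use i in \<open>auto simp: S_def intro!: continuous_intros\<close>)
  moreover have "\<exists>N. \<forall>n i t. n \<ge> N \<and> i \<in> E \<and> t \<in> {0..1} \<longrightarrow> cmod (x (k n) i t - X i t) < e" if e: "0 < e" for e
  proof -
    obtain N where N: "\<forall>n z. n \<ge> N \<and> z \<in> S \<longrightarrow> norm (G (k n) z - g z) < e" using conv[OF e] by blast
    have "cmod (x (k n) i t - X i t) < e" if "n \<ge> N" "i \<in> E" "t \<in> {0..1}" for n i t
    proof -
      have "(t, real i) \<in> S" using that by (simp add: S_def)
      then have "norm (G (k n) (t, real i) - g (t, real i)) < e" using N that by blast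
      then show ?thesis by (simp add: G_def X_def)
    qed
    then show ?thesis by blast
  qed
  ultimately show ?thesis using k by (intro exI[of _ X] exI[of _ k] conjI ballI allI impI)
qed

end

subsection \<open>The direct method\<close>

context conormal_bvp
begin

lemma F_scale_N:
  assumes x: "x \<in> DF"
  shows "Re (F (gscale a x) (gscale a x)) = (cmod a)\<^sup>2 * Re (F x x)" "N0 (gscale a x) = (cmod a)\<^sup>2 * N0 x"
proof -
  interpret L: semi_ip "L2 E" "L2_inner E" by (rule L2_semi_ip)
  have s: "gscale a x \<in> DF" unfolding gscale_glin using x x by (rule glin_DF)
  have left: "F (gscale a x) z = a * F x z" if "z \<in> DF" for z
    unfolding gscale_glin using F_glin_left[OF x x that, of a 0] by simp
  have "F (gscale a x) (gscale a x) = a * F x (gscale a x)" by (rule left[OF s])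
  also have "F x (gscale a x) = cnj (a * F x x)"
    using F_herm[OF s x] left[OF x] by simp
  also have "\<dots> = cnj a * F x x" using F_herm[OF x x] by simp
  finally have "F (gscale a x) (gscale a x) = of_real ((cmod a)\<^sup>2) * F x x"
    by (simp add: complex_norm_square[symmetric] mult.assoc[symmetric] del: of_real_power)
  then show "Re (F (gscale a x) (gscale a x)) = (cmod a)\<^sup>2 * Re (F x x)" by (simp del: of_real_power)
  have "(form_norm (L2_inner E) (gscale a x))\<^sup>2 = (cmod a * form_norm (L2_inner E) x)\<^sup>2"
    using L.nrm_gscale[OF DF_L2[OF x]] by simp
  then show "N0 (gscale a x) = (cmod a)\<^sup>2 * N0 x"
    by (simp add: L2_norm_sq N0_def power_mult_distrib)
qed

text \<open>A uniform limit of a minimizing sequence for the Rayleigh quotient is an eigenfunction of the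
  operator: testing with tents gives the differential equation and testing with functions that are
  linear on the edges gives the boundary conditions (II).\<close>

lemma Rayleigh_minimum:
  assumes ex: "\<exists>x\<in>DF. N0 x \<noteq> 0"
  shows "\<exists>\<mu> X. X \<in> dom_L P \<and> N0 X = 1 \<and>
    (\<forall>i\<in>E. AE t in unit_leb. lop P X i t = of_real \<mu> * X i t) \<and>
    (\<forall>x\<in>DF. \<mu> * N0 x \<le> Re (F x x))"
proof -
  interpret L: semi_ip "L2 E" "L2_inner E" by (rule L2_semi_ip)
  obtain k where k: "k \<ge> 0" "\<And>x. x \<in> DF \<Longrightarrow> N1 x / 2 - k * N0 x \<le> Re (F x x)"
      "\<And>x. x \<in> DF \<Longrightarrow> Re (F x x) \<le> 2 * N1 x + k * N0 x"
    by (metis Garding)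
  define S where "S = {Re (F x x) |x. x \<in> DF \<and> N0 x = 1}"
  have bel: "- k \<le> r" if "r \<in> S" for r
  proof -
    obtain x where x: "x \<in> DF" "N0 x = 1" "r = Re (F x x)" using \<open>r \<in> S\<close> by (auto simp: S_def)
    show ?thesis using k(2)[OF x(1)] x N_nonneg(2)[of x] by simp
  qed
  then have bdd: "bdd_below S" by (rule bdd_belowI)
  have unit: "Re (F x x) / N0 x \<in> S" if x: "x \<in> DF" and n: "N0 x \<noteq> 0" for x
  proof -
    define a where "a = complex_of_real (1 / sqrt (N0 x))"
    have pos: "N0 x > 0" using n N_nonneg(1)[of x] by simp
    have a: "(cmod a)\<^sup>2 = 1 / N0 x" using pos unfolding a_def norm_of_real by (simp add: power_divide)
    have "gscale a x \<in> DF" unfolding gscale_glin using x x by (rule glin_DF)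
    moreover have "N0 (gscale a x) = 1" using pos by (simp add: F_scale_N(2)[OF x] a)
    moreover have "Re (F (gscale a x) (gscale a x)) = Re (F x x) / N0 x" by (simp add: F_scale_N(1)[OF x] a)
    ultimately show ?thesis unfolding S_def by (metis (mono_tags, lifting) mem_Collect_eq)
  qed
  have ne: "S \<noteq> {}" using ex unit by blast
  define \<mu> where "\<mu> = Inf S"
  have low: "\<mu> * N0 x \<le> Re (F x x)" if x: "x \<in> DF" for x
  proof (cases "N0 x = 0")
    case True
    then show ?thesis using k(2)[OF x] N_nonneg(2)[of x] by simp
  next
    case False
    then have "\<mu> \<le> Re (F x x) / N0 x" unfolding \<mu>_def by (intro cInf_lower[OF _ bdd] unit[OF x])
    then show ?thesis using False N_nonneg(1)[of x] by (simp add: pos_le_divide_eq)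
  qed
  interpret M: semi_ip DF "\<lambda>x y. F x y - of_real \<mu> * L2_inner E x y"
    by (rule F_shift_semi_ip[OF low])
  have "\<exists>x. x \<in> DF \<and> N0 x = 1 \<and> Re (F x x) < \<mu> + 1 / (real n + 1)" for n
  proof -
    have "Inf S < \<mu> + 1 / (real n + 1)" by (simp add: \<mu>_def)
    from cInf_lessD[OF ne this] show ?thesis by (auto simp: S_def)
  qed
  then obtain x0 where x0: "\<And>n. x0 n \<in> DF" "\<And>n. N0 (x0 n) = 1" "\<And>n::nat. Re (F (x0 n) (x0 n)) < \<mu> + 1 / (real n + 1)"
    by metis
  define b where "b = 2 * (\<bar>\<mu>\<bar> + 1 + k)"
  have b0: "N0 (x0 n) \<le> b" for n using k(1) by (simp add: x0 b_def)
  have b1: "N1 (x0 n) \<le> b" for n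
  proof -
    have "1 / (real n + 1) \<le> 1" by simp
    moreover have "N1 (x0 n) / 2 - k \<le> Re (F (x0 n) (x0 n))"
      using k(2)[OF x0(1)[of n]] by (simp add: x0(2))
    ultimately have "N1 (x0 n) / 2 \<le> \<bar>\<mu>\<bar> + 1 + k" using x0(3)[of n] by linarith
    then show ?thesis by (simp add: b_def)
  qed
  from uniform_subsequence[of x0 b, OF x0(1) b0 b1] obtain X and r :: "nat \<Rightarrow> nat" where
    *: "strict_mono r \<and> (\<forall>i\<in>E. continuous_on {0..1} (X i)) \<and>
    (\<forall>e>0. \<exists>N. \<forall>n i t. n \<ge> N \<and> i \<in> E \<and> t \<in> {0..1} \<longrightarrow> cmod (x0 (r n) i t - X i t) < e)"
    by (elim exE)
  then have r: "strict_mono r" and Xc: "\<And>i. i \<in> E \<Longrightarrow> continuous_on {0..1} (X i)"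
    and uni: "\<And>e. 0 < e \<Longrightarrow> \<exists>N. \<forall>n i t. n \<ge> N \<and> i \<in> E \<and> t \<in> {0..1} \<longrightarrow> cmod (x0 (r n) i t - X i t) < e"
    by simp_all
  define x where "x n = x0 (r n)" for n
  have x: "x n \<in> DF" "N0 (x n) = 1" for n by (simp_all add: x_def x0)
  have xmin: "Re (F (x n) (x n)) < \<mu> + 1 / (real n + 1)" for n
  proof -
    have "n \<le> r n" using r by (rule seq_suble)
    then have "1 / (real (r n) + 1) \<le> 1 / (real n + 1)" by (intro divide_left_mono) auto
    then show ?thesis using x0(3)[of "r n"] by (simp add: x_def)
  qed
  have Xs: "sqint (X i)" if "i \<in> E" for i using Xc[OF that] by (rule sqint_continuous)
  have xs: "sqint (x n i)" if "i \<in> E" for n i using DF_H1e[OF x(1) that] by (rule H1e_sqint)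
  have pt: "(\<lambda>n. x n i t) \<longlonglongrightarrow> X i t" if "i \<in> E" "t \<in> {0..1}" for i t
    using uni that unfolding LIMSEQ_iff x_def by meson
  have sq: "(\<lambda>n. sqn (\<lambda>t. x n i t - X i t)) \<longlonglongrightarrow> 0" if i: "i \<in> E" for i
  proof (rule LIMSEQ_I)
    fix e :: real assume e: "0 < e"
    obtain N where N: "\<forall>n i t. n \<ge> N \<and> i \<in> E \<and> t \<in> {0..1} \<longrightarrow> cmod (x0 (r n) i t - X i t) < sqrt e / 2"
      using uni[of "sqrt e / 2"] e by auto
    have "norm (sqn (\<lambda>t. x n i t - X i t) - 0) < e" if "n \<ge> N" for n
    proof -
      have "sqn (\<lambda>t. x n i t - X i t) \<le> (sqrt e / 2)\<^sup>2"
      proof (rule sqn_uniform[OF sqint_diff[OF xs[OF i] Xs[OF i]]])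
        show "cmod (x n i t - X i t) \<le> sqrt e / 2" if "t \<in> {0..1}" for t
          using N \<open>n \<ge> N\<close> i that unfolding x_def by (meson less_imp_le)
      qed (use e in simp)
      also have "\<dots> = e / 4" using e by (simp add: power_divide)
      also have "\<dots> < e" using e by simp
      finally show ?thesis by simp
    qed
    then show "\<exists>N. \<forall>n\<ge>N. norm (sqn (\<lambda>t. x n i t - X i t) - 0) < e" by blast
  qed
  have XL2: "X \<in> L2 E" using Xs by (simp add: L2_sqint)
  have N0X: "N0 X = 1"
  proof -
    have nx: "L.nrm (x n) = 1" for n
      using L2_norm_sq[of E "x n"] x(2)[of n] L.nrm_nonneg[OF DF_L2[OF x(1)[of n]]]
      by (simp add: N0_def power2_eq_1_iff)
    have d: "(\<lambda>n. L.nrm (gsub (x n) X)) \<longlonglongrightarrow> 0"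
    proof -
      have "(\<lambda>n. sqrt (\<Sum>i\<in>E. sqn (\<lambda>t. x n i t - X i t))) \<longlonglongrightarrow> sqrt (\<Sum>i\<in>E. 0)"
        by (intro tendsto_real_sqrt tendsto_sum sq)
      moreover have "L.nrm (gsub (x n) X) = sqrt (\<Sum>i\<in>E. sqn (\<lambda>t. x n i t - X i t))" for n
        by (simp add: form_norm_def L2_inner_self gsub_def)
      ultimately show ?thesis by simp
    qed
    have "\<bar>1 - L.nrm X\<bar> \<le> L.nrm (gsub (x n) X)" for n
      using L.nrm_triangle_sub[OF DF_L2[OF x(1)[of n]] XL2] nx[of n] by linarith
    then have "\<bar>1 - L.nrm X\<bar> \<le> 0" by (intro LIMSEQ_le_const[OF d]) auto
    then have "L.nrm X = 1" by simp
    then show ?thesis using L2_norm_sq[of E X] by (simp add: N0_def)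
  qed
  \<comment> \<open>By the Cauchy-Schwarz inequality for the shifted form, which is positive semidefinite because \<open>\<mu>\<close>
    is a lower bound, a minimizing sequence becomes orthogonal to all test functions.\<close>
  have test: "(\<lambda>n. F (x n) y - of_real \<mu> * L2_inner E (x n) y) \<longlonglongrightarrow> 0" if y: "y \<in> DF" for y
  proof (rule Lim_null_comparison)
    show "\<forall>\<^sub>F n in sequentially. norm (F (x n) y - of_real \<mu> * L2_inner E (x n) y) \<le> sqrt (1 / (real n + 1)) * M.nrm y"
    proof (rule always_eventually, rule allI)
      fix n
      have "M.nrm (x n) \<le> sqrt (1 / (real n + 1))"
        unfolding form_norm_def using xmin[of n] x(2)[of n] by (simp add: L2_inner_N0)
      then show "norm (F (x n) y - of_real \<mu> * L2_inner E (x n) y) \<le> sqrt (1 / (real n + 1)) * M.nrm y"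
        using M.Cauchy_Schwarz[OF x(1)[of n] y] M.nrm_nonneg[OF y] by (meson mult_right_mono order_trans)
    qed
    have "(\<lambda>n. 1 / (real n + 1)) \<longlonglongrightarrow> 0"
      using LIMSEQ_inverse_real_of_nat by (simp add: inverse_eq_divide add.commute)
    then have "(\<lambda>n. sqrt (1 / (real n + 1)) * M.nrm y) \<longlonglongrightarrow> sqrt 0 * M.nrm y"
      by (intro tendsto_intros)
    then show "(\<lambda>n. sqrt (1 / (real n + 1)) * M.nrm y) \<longlonglongrightarrow> 0" by simp
  qed
  have qlim: "(\<lambda>n. \<integral>t. q i t * x n i t * cnj (y i t) \<partial>unit_leb) \<longlonglongrightarrow> (\<integral>t. q i t * X i t * cnj (y i t) \<partial>unit_leb)"
    if y: "y \<in> DF" and i: "i \<in> E" for y i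
  proof -
    have "(\<lambda>n. \<integral>t. x n i t * cnj (q i t * y i t) \<partial>unit_leb) \<longlonglongrightarrow> (\<integral>t. X i t * cnj (q i t * y i t) \<partial>unit_leb)"
      by (rule sqint_inner_limit[OF xs[OF i] Xs[OF i] sqint_q[OF i H1e_sqint[OF DF_H1e[OF y i]]] sq[OF i]])
    then show ?thesis by (simp add: mult_ac)
  qed
  \<comment> \<open>The derivatives of \<open>x n\<close> need not converge, so the limits \<open>l i\<close> of their inner products with the derivative of
    the test function are supplied separately for each kind of test function.\<close>
  have identity: "Fbd X y + (\<Sum>i\<in>E. l i + (\<integral>t. q i t * X i t * cnj (y i t) \<partial>unit_leb)) = of_real \<mu> * L2_inner E X y"
    if y: "y \<in> DF" and l: "\<And>i. i \<in> E \<Longrightarrow> (\<lambda>n. \<integral>t. ud (x n i) t * cnj (ud (y i) t) \<partial>unit_leb) \<longlonglongrightarrow> l i" for y l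
  proof -
    have "(\<lambda>n. Fbd (x n) y) \<longlonglongrightarrow> Fbd X y"
      unfolding Fbd_def by (intro tendsto_sum tendsto_intros pt) auto
    moreover have "(\<lambda>n. Fint (x n) y) \<longlonglongrightarrow> (\<Sum>i\<in>E. l i + (\<integral>t. q i t * X i t * cnj (y i t) \<partial>unit_leb))"
      unfolding Fint_def by (intro tendsto_sum tendsto_add l qlim[OF y])
    moreover have "(\<lambda>n. L2_inner E (x n) y) \<longlonglongrightarrow> L2_inner E X y"
      unfolding L2_inner_def gint_def
      by (intro tendsto_sum sqint_inner_limit xs Xs sq H1e_sqint DF_H1e[OF y])
    ultimately have "(\<lambda>n. (Fbd (x n) y + Fint (x n) y) - of_real \<mu> * L2_inner E (x n) y) \<longlonglongrightarrow>
        (Fbd X y + (\<Sum>i\<in>E. l i + (\<integral>t. q i t * X i t * cnj (y i t) \<partial>unit_leb))) - of_real \<mu> * L2_inner E X y"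
      by (intro tendsto_diff tendsto_add tendsto_mult tendsto_const)
    then have "(\<lambda>n. F (x n) y - of_real \<mu> * L2_inner E (x n) y) \<longlonglongrightarrow>
        (Fbd X y + (\<Sum>i\<in>E. l i + (\<integral>t. q i t * X i t * cnj (y i t) \<partial>unit_leb))) - of_real \<mu> * L2_inner E X y"
      by (simp only: F_split[OF x(1) y])
    from LIMSEQ_unique[OF this test[OF y]] show ?thesis by simp
  qed
  obtain Q where Q: "Q \<ge> 0" "\<And>i. i \<in> E \<Longrightarrow> AE t in unit_leb. cmod (q i t) \<le> Q"
    using potential_bound by blast
  \<comment> \<open>The expected second derivative of \<open>X\<close>, altered on a null set so that it is bounded everywhere.\<close>
  define h where "h i t = (if cmod (q i t) \<le> Q then (q i t - of_real \<mu>) * X i t else 0)" for i t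
  have hae: "AE t in unit_leb. h i t = q i t * X i t - of_real \<mu> * X i t" if "i \<in> E" for i
    using Q(2)[OF that] by eventually_elim (simp add: h_def algebra_simps)
  have hm: "h i \<in> borel_measurable unit_leb" if i: "i \<in> E" for i
  proof (rule unit_leb_AE_eq_measurable)
    show "(\<lambda>t. q i t * X i t - of_real \<mu> * X i t) \<in> borel_measurable unit_leb"
      using sqint_q[OF i Xs[OF i]] Xs[OF i]
      by (intro borel_measurable_diff borel_measurable_times borel_measurable_const q_measurable[OF i]) (auto simp: sqint_def)
    show "AE t in unit_leb. q i t * X i t - of_real \<mu> * X i t = h i t"
      using hae[OF i] by eventually_elim simp
  qed
  have hint: "(\<integral>t. h i t * cnj (v t) \<partial>unit_leb) =
      (\<integral>t. q i t * X i t * cnj (v t) \<partial>unit_leb) - of_real \<mu> * (\<integral>t. X i t * cnj (v t) \<partial>unit_leb)"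
    if i: "i \<in> E" and v: "sqint v" for i v
  proof -
    have ii: "integrable unit_leb (\<lambda>t. q i t * X i t * cnj (v t))" "integrable unit_leb (\<lambda>t. X i t * cnj (v t))"
      using sqint_mult_cnj_integrable[OF sqint_q[OF i Xs[OF i]] v] sqint_mult_cnj_integrable[OF Xs[OF i] v] by auto
    have "(\<integral>t. h i t * cnj (v t) \<partial>unit_leb) = (\<integral>t. q i t * X i t * cnj (v t) - of_real \<mu> * (X i t * cnj (v t)) \<partial>unit_leb)"
    proof (rule integral_cong_AE)
      show "(\<lambda>t. h i t * cnj (v t)) \<in> borel_measurable unit_leb"
        by (rule borel_measurable_times[OF hm[OF i] sqint_measurable]) (simp add: v)
      show "(\<lambda>t. q i t * X i t * cnj (v t) - of_real \<mu> * (X i t * cnj (v t))) \<in> borel_measurable unit_leb"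
        using ii by (intro borel_measurable_integrable Bochner_Integration.integrable_diff integrable_mult_right)
      show "AE t in unit_leb. h i t * cnj (v t) = q i t * X i t * cnj (v t) - of_real \<mu> * (X i t * cnj (v t))"
        using hae[OF i] by eventually_elim (simp add: left_diff_distrib mult.assoc)
    qed
    then show ?thesis using ii by simp
  qed
  have reg: "H1e (X i)" "H1e (ud (X i))" "AE t in unit_leb. ud (ud (X i)) t = h i t" if i: "i \<in> E" for i
  proof -
    have "bounded (X i ` {0..1})"
      using Xc[OF i] by (intro compact_imp_bounded compact_continuous_image) auto
    then obtain B where B: "\<forall>t\<in>{0..1}. cmod (X i t) \<le> B" by (auto simp: bounded_iff)
    have hb: "cmod (h i t) \<le> (Q + \<bar>\<mu>\<bar>) * B" if t: "t \<in> {0..1}" for t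
    proof (cases "cmod (q i t) \<le> Q")
      case True
      then have "cmod (q i t - of_real \<mu>) \<le> Q + \<bar>\<mu>\<bar>"
        using norm_triangle_ineq4[of "q i t" "of_real \<mu>"] unfolding norm_of_real by linarith
      moreover have "cmod (X i t) \<le> B" using B t by blast
      ultimately show ?thesis using Q(1) True by (simp add: h_def norm_mult mult_mono)
    next
      case False
      have "0 \<le> B" by (rule order_trans[OF norm_ge_zero bspec[OF B t]])
      then show ?thesis using False Q(1) by (simp add: h_def)
    qed
    have weak: "X i s - of_real (1 - s) * X i 0 - of_real s * X i 1 + (\<integral>t. h i t * cnj (tent s t) \<partial>unit_leb) = 0"
      if s: "0 < s" "s < 1" for s
    proof -
      have s': "0 \<le> s" "s \<le> 1" using s by auto
      \<comment> \<open>The test function is the tent with peak at \<open>s\<close> on the edge \<open>i\<close> and zero on all other edges.\<close>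
      define y where "y j = (if j = i then tent s else (\<lambda>t. 0))" for j
      have H0: "H1e (\<lambda>t. 0)" by (rule continuous_H1e[of _ "\<lambda>_. 0"]) auto
      have ye: "y j 0 = 0" "y j 1 = 0" for j using tent_ends[OF s'] by (simp_all add: y_def)
      have y: "y \<in> DF"
        unfolding DF_iff using tent_H1e(1)[OF s'] H0 ye by (simp add: y_def bc_I_def)
      define l where "l j = (if j = i then X i s - of_real (1 - s) * X i 0 - of_real s * X i 1 else 0)" for j
      have "(\<lambda>n. \<integral>t. ud (x n j) t * cnj (ud (y j) t) \<partial>unit_leb) \<longlonglongrightarrow> l j" if j: "j \<in> E" for j
      proof (cases "j = i")
        case True
        have "(\<integral>t. ud (x n i) t * cnj (ud (tent s) t) \<partial>unit_leb) =
            x n i s - of_real (1 - s) * x n i 0 - of_real s * x n i 1" for n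
          using DF_H1e[OF x(1) i]
          by (intro tent_integral s' H1e_AC1 AC1_derivative H1e_sqint_ud)
        moreover have "(\<lambda>n. x n i s - of_real (1 - s) * x n i 0 - of_real s * x n i 1) \<longlonglongrightarrow> l i"
          unfolding l_def if_P[OF refl] using s' by (intro tendsto_intros pt[OF i]) auto
        ultimately show ?thesis using True by (simp add: y_def)
      next
        case False
        have "(\<integral>t. ud (x n j) t * cnj (ud (\<lambda>t. 0) t) \<partial>unit_leb) = (\<integral>t. 0 \<partial>unit_leb)" for n
        proof (intro Bochner_Integration.integral_cong refl)
          fix t assume "t \<in> space unit_leb"
          then have "ud (\<lambda>t. 0) t = 0" by (intro ud_eq) auto
          then show "ud (x n j) t * cnj (ud (\<lambda>t. 0) t) = 0" by simp
        qed
        then show ?thesis using False by (simp add: y_def l_def)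
      qed
      from identity[OF y this]
      have "(\<Sum>j\<in>E. l j + (\<integral>t. q j t * X j t * cnj (y j t) \<partial>unit_leb)) = of_real \<mu> * L2_inner E X y"
        by (simp add: Fbd_def ye)
      also have "(\<Sum>j\<in>E. l j + (\<integral>t. q j t * X j t * cnj (y j t) \<partial>unit_leb)) =
          (\<Sum>j\<in>E. if j = i then l i + (\<integral>t. q i t * X i t * cnj (tent s t) \<partial>unit_leb) else 0)"
        by (intro sum.cong refl) (simp add: l_def y_def)
      also have "\<dots> = l i + (\<integral>t. q i t * X i t * cnj (tent s t) \<partial>unit_leb)"
        using finite_E i by simp
      also have "L2_inner E X y = (\<Sum>j\<in>E. if j = i then (\<integral>t. X i t * cnj (tent s t) \<partial>unit_leb) else 0)"
        unfolding L2_inner_def gint_def by (intro sum.cong refl) (simp add: y_def)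
      also have "\<dots> = (\<integral>t. X i t * cnj (tent s t) \<partial>unit_leb)" using finite_E i by simp
      finally have "l i + ((\<integral>t. q i t * X i t * cnj (tent s t) \<partial>unit_leb) - of_real \<mu> * (\<integral>t. X i t * cnj (tent s t) \<partial>unit_leb)) = 0"
        by (simp add: add_diff_eq)
      then show ?thesis unfolding hint[OF i H1e_sqint[OF tent_H1e(1)[OF s']]] l_def by simp
    qed
    show "H1e (X i)" "H1e (ud (X i))" "AE t in unit_leb. ud (ud (X i)) t = h i t"
      by (rule weak_solution_regular[OF hm[OF i] hb weak]; assumption)+
  qed
  have bcI: "bc_I P X"
    unfolding bc_I_def
  proof
    fix i assume i: "i \<in> {1..ndir P}"
    have "(\<lambda>n. \<Sum>j\<in>E. cA P i j * x n j 0 + cC P i j * x n j 1) \<longlonglongrightarrow> (\<Sum>j\<in>E. cA P i j * X j 0 + cC P i j * X j 1)"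
      by (intro tendsto_sum tendsto_intros pt) auto
    moreover have "(\<Sum>j\<in>E. cA P i j * x n j 0 + cC P i j * x n j 1) = 0" for n
      using x(1)[of n] i by (simp add: DF_iff bc_I_def)
    ultimately show "(\<Sum>j\<in>E. cA P i j * X j 0 + cC P i j * X j 1) = 0"
      by (simp add: LIMSEQ_const_iff)
  qed
  have XD: "X \<in> DF" using reg(1) bcI by (simp add: DF_iff)
  have XH2: "X \<in> H2 E" using reg(1,2) by (simp add: H2_H1e)
  have bd: "bdint E (\<lambda>i t. (f i t * X i t + gderiv X i t) * cnj (y i t)) = 0" if y: "y \<in> DF" for y
  proof -
    \<comment> \<open>The test function with the end values of \<open>y\<close> that is linear on every edge.\<close>
    define z where "z i t = y i 0 + of_real t * (y i 1 - y i 0)" for i t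
    have zd: "(z i has_vector_derivative (y i 1 - y i 0)) (at t within {0..1})" for i t
    proof -
      have "((\<lambda>t. complex_of_real t) has_vector_derivative 1) (at t within {0..1})"
        by (auto intro!: derivative_eq_intros)
      from has_vector_derivative_add[OF has_vector_derivative_const[of "y i 0"]
          has_vector_derivative_mult_left[OF this, of "y i 1 - y i 0"]]
      show ?thesis by (simp add: z_def[abs_def])
    qed
    have zH: "H1e (z i)" for i by (rule continuous_H1e[OF zd]) simp
    have ze: "z i 0 = y i 0" "z i 1 = y i 1" for i by (simp_all add: z_def)
    have z: "z \<in> DF" using y zH bc_I_cong[of z y] ze by (simp add: DF_iff)
    have zint: "(\<integral>t. ud v t * cnj (ud (z i) t) \<partial>unit_leb) = (v 1 - v 0) * cnj (y i 1 - y i 0)" if v: "H1e v" for v i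
    proof -
      have "(\<integral>t. ud v t * cnj (ud (z i) t) \<partial>unit_leb) = (\<integral>t. ud v t * cnj (y i 1 - y i 0) \<partial>unit_leb)"
        by (intro Bochner_Integration.integral_cong refl) (simp add: ud_eq[OF _ zd])
      also have "\<dots> = (\<integral>t. ud v t \<partial>unit_leb) * cnj (y i 1 - y i 0)"
        using sqint_integrable[OF H1e_sqint_ud[OF v]] by simp
      also have "(\<integral>t. ud v t \<partial>unit_leb) = v 1 - v 0"
        by (rule AC1_integral[OF H1e_AC1[OF v] AC1_derivative[OF H1e_AC1[OF v]] sqint_integrable[OF H1e_sqint_ud[OF v]]])
      finally show ?thesis .
    qed
    have "Fbd X z + (\<Sum>i\<in>E. (X i 1 - X i 0) * cnj (y i 1 - y i 0) + (\<integral>t. q i t * X i t * cnj (z i t) \<partial>unit_leb))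
        = of_real \<mu> * L2_inner E X z"
    proof (rule identity[OF z])
      show "(\<lambda>n. \<integral>t. ud (x n i) t * cnj (ud (z i) t) \<partial>unit_leb) \<longlonglongrightarrow> (X i 1 - X i 0) * cnj (y i 1 - y i 0)"
        if i: "i \<in> E" for i
        unfolding zint[OF DF_H1e[OF x(1) i]] using i by (intro tendsto_intros pt) auto
    qed
    moreover have "(\<Sum>i\<in>E. (X i 1 - X i 0) * cnj (y i 1 - y i 0) + (\<integral>t. q i t * X i t * cnj (z i t) \<partial>unit_leb))
        - of_real \<mu> * L2_inner E X z = (\<Sum>i\<in>E. ud (X i) 1 * cnj (z i 1) - ud (X i) 0 * cnj (z i 0))"
      unfolding L2_inner_def gint_def sum_distrib_left sum_subtractf[symmetric]
    proof (rule sum.cong[OF refl])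
      fix i assume i: "i \<in> E"
      have "(\<integral>t. ud (ud (X i)) t * cnj (z i t) \<partial>unit_leb) = (\<integral>t. h i t * cnj (z i t) \<partial>unit_leb)"
      proof (rule integral_cong_AE)
        show "(\<lambda>t. ud (ud (X i)) t * cnj (z i t)) \<in> borel_measurable unit_leb"
          by (intro borel_measurable_integrable sqint_mult_cnj_integrable H1e_sqint_ud[OF reg(2)[OF i]] H1e_sqint zH)
        show "(\<lambda>t. h i t * cnj (z i t)) \<in> borel_measurable unit_leb"
          by (rule borel_measurable_times[OF hm[OF i] sqint_measurable]) (simp add: H1e_sqint zH)
        show "AE t in unit_leb. ud (ud (X i)) t * cnj (z i t) = h i t * cnj (z i t)"
          using reg(3)[OF i] by eventually_elim simp
      qed
      then have "(X i 1 - X i 0) * cnj (y i 1 - y i 0) + ((\<integral>t. q i t * X i t * cnj (z i t) \<partial>unit_leb)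
          - of_real \<mu> * (\<integral>t. X i t * cnj (z i t) \<partial>unit_leb)) = ud (X i) 1 * cnj (z i 1) - ud (X i) 0 * cnj (z i 0)"
        using integration_by_parts[OF reg(2)[OF i] zH[of i]]
        unfolding hint[OF i H1e_sqint[OF zH]] zint[OF reg(1)[OF i]] by simp
      then show "(X i 1 - X i 0) * cnj (y i 1 - y i 0) + (\<integral>t. q i t * X i t * cnj (z i t) \<partial>unit_leb)
          - of_real \<mu> * (\<integral>t. X i t * cnj (z i t) \<partial>unit_leb) = ud (X i) 1 * cnj (z i 1) - ud (X i) 0 * cnj (z i 0)"
        by (simp only: add_diff_eq)
    qed
    moreover have "bdint E (\<lambda>i t. (f i t * X i t + gderiv X i t) * cnj (y i t)) =
        Fbd X z + (\<Sum>i\<in>E. ud (X i) 1 * cnj (z i 1) - ud (X i) 0 * cnj (z i 0))"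
      unfolding bdint_def Fbd_def sum.distrib[symmetric] ze
      by (intro sum.cong refl) (simp add: gderiv_ud algebra_simps)
    moreover have "g = 0" if "a + s = r" "s - r = u" "g = a + u" for a s r u g :: complex
      unfolding that(3) that(2)[symmetric] add_diff_eq that(1) by simp
    ultimately show ?thesis by blast
  qed
  have "bc_II P X" using conormal XD XH2 bd unfolding conormal_via_def by blast
  then have XdL: "X \<in> dom_L P" using XD XH2 by (simp add: dom_L_H2)
  have lopX: "AE t in unit_leb. lop P X i t = of_real \<mu> * X i t" if i: "i \<in> E" for i
    using reg(3)[OF i] hae[OF i] by eventually_elim (simp add: lop_def gderiv_ud')
  show ?thesis
    using XdL N0X lopX low by (intro exI[of _ \<mu>] exI[of _ X] conjI ballI)
qed

text \<open>Since the minimal value is an eigenvalue, it is positive when \<open>L\<close> is positive definite.\<close>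

theorem coercive:
  assumes pos: "L_positive_definite P"
  obtains c where "c > 0" "\<And>x. x \<in> DF \<Longrightarrow> c * (N0 x + N1 x) \<le> Re (F x x)"
proof -
  have "\<exists>\<mu>>0. \<forall>x\<in>DF. \<mu> * N0 x \<le> Re (F x x)"
  proof (cases "\<exists>x\<in>DF. N0 x \<noteq> 0")
    case True
    from Rayleigh_minimum[OF True] obtain \<mu> X where *: "X \<in> dom_L P \<and> N0 X = 1 \<and>
      (\<forall>i\<in>E. AE t in unit_leb. lop P X i t = of_real \<mu> * X i t) \<and> (\<forall>x\<in>DF. \<mu> * N0 x \<le> Re (F x x))"
      by (elim exE)
    then have X: "X \<in> dom_L P" "N0 X = 1"
      "\<And>i. i \<in> E \<Longrightarrow> AE t in unit_leb. lop P X i t = of_real \<mu> * X i t"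
      and low: "\<And>x. x \<in> DF \<Longrightarrow> \<mu> * N0 x \<le> Re (F x x)"
      by simp_all
    have XD: "X \<in> DF" "X \<in> H2 E" using X(1) dom_L_H2 by auto
    have nz: "\<exists>i\<in>E. \<exists>t\<in>{0..1}. X i t \<noteq> 0"
    proof (rule ccontr)
      assume "\<not> ?thesis"
      then have "sqn (X i) = 0" if "i \<in> E" for i
        unfolding sqn_def using that by (subst Bochner_Integration.integral_cong[OF refl, of _ _ "\<lambda>_. 0"]) auto
      then show False using X(2) by (simp add: N0_def)
    qed
    have "L2_inner E (lop P X) X = of_real \<mu> * L2_inner E X X"
      unfolding L2_inner_def gint_def sum_distrib_left
    proof (rule sum.cong[OF refl])
      fix i assume i: "i \<in> E"
      have XH: "sqint (X i)" using DF_H1e[OF XD(1) i] by (rule H1e_sqint)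
      have ii: "integrable unit_leb (\<lambda>t. X i t * cnj (X i t))" using XH XH by (rule sqint_mult_cnj_integrable)
      have "(\<integral>t. lop P X i t * cnj (X i t) \<partial>unit_leb) = (\<integral>t. of_real \<mu> * (X i t * cnj (X i t)) \<partial>unit_leb)"
      proof (rule integral_cong_AE)
        show "(\<lambda>t. lop P X i t * cnj (X i t)) \<in> borel_measurable unit_leb"
          by (intro borel_measurable_integrable sqint_mult_cnj_integrable lop_sqint XD i XH)
        show "(\<lambda>t. of_real \<mu> * (X i t * cnj (X i t))) \<in> borel_measurable unit_leb"
          using ii by (intro borel_measurable_integrable integrable_mult_right)
        show "AE t in unit_leb. lop P X i t * cnj (X i t) = of_real \<mu> * (X i t * cnj (X i t))"
          using X(3)[OF i] by eventually_elim simp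
      qed
      then show "(\<integral>t. lop P X i t * cnj (X i t) \<partial>unit_leb) = of_real \<mu> * (\<integral>t. X i t * cnj (X i t) \<partial>unit_leb)" by simp
    qed
    then have "Re (L2_inner E (lop P X) X) = \<mu>" using X(2) by (simp add: L2_inner_N0)
    then have "\<mu> > 0" using pos X(1) nz unfolding L_positive_definite_def by metis
    then show ?thesis using low by blast
  next
    case False
    obtain k where k: "k \<ge> 0" "\<And>x. x \<in> DF \<Longrightarrow> N1 x / 2 - k * N0 x \<le> Re (F x x)"
        "\<And>x. x \<in> DF \<Longrightarrow> Re (F x x) \<le> 2 * N1 x + k * N0 x"
      by (metis Garding)
    have "1 * N0 x \<le> Re (F x x)" if "x \<in> DF" for x
    proof -
      have "N0 x = 0" using False that by blast
      then show ?thesis using k(2)[OF that] N_nonneg(2)[of x] by simp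
    qed
    then show ?thesis using zero_less_one by blast
  qed
  then obtain \<mu> where \<mu>: "\<mu> > 0" "\<And>x. x \<in> DF \<Longrightarrow> \<mu> * N0 x \<le> Re (F x x)" by blast
  obtain k where k: "k \<ge> 0" "\<And>x. x \<in> DF \<Longrightarrow> N1 x / 2 - k * N0 x \<le> Re (F x x)"
      "\<And>x. x \<in> DF \<Longrightarrow> Re (F x x) \<le> 2 * N1 x + k * N0 x"
    by (metis Garding)
  \<comment> \<open>Garding's inequality bounds \<open>N1\<close> by the form and \<open>N0\<close>, and \<open>N0\<close> is bounded by the form.\<close>
  define M where "M = 1 / \<mu> + 2 * (1 + k / \<mu>)"
  have M: "M > 0" using \<mu>(1) k(1) unfolding M_def by (simp add: add_pos_nonneg)
  have "(1 / M) * (N0 x + N1 x) \<le> Re (F x x)" if x: "x \<in> DF" for x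
  proof -
    have n0: "N0 x \<le> Re (F x x) / \<mu>" using \<mu>(2)[OF x] \<mu>(1) by (simp add: pos_le_divide_eq mult.commute)
    have "N1 x \<le> 2 * (Re (F x x) + k * N0 x)" using k(2)[OF x] by simp
    also have "\<dots> \<le> 2 * (Re (F x x) + k * (Re (F x x) / \<mu>))" using mult_left_mono[OF n0 k(1)] by simp
    finally have "N0 x + N1 x \<le> Re (F x x) / \<mu> + 2 * (Re (F x x) + k * (Re (F x x) / \<mu>))" using n0 by simp
    also have "\<dots> = M * Re (F x x)" by (simp add: M_def algebra_simps)
    finally show ?thesis using M by (simp add: pos_divide_le_eq mult.commute)
  qed
  then show ?thesis using that[of "1 / M"] M by simp
qed

end

section \<open>Half-range expansions\<close>

lemma L2_inner_cong:
  assumes "\<And>i t. i \<in> E \<Longrightarrow> x i t = x' i t" "\<And>i t. i \<in> E \<Longrightarrow> y i t = y' i t"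
  shows "L2_inner E x y = L2_inner E x' y'"
  unfolding L2_inner_def gint_def using assms by (intro sum.cong refl) simp

lemma form_norm_L2_cong:
  assumes "\<And>i t. i \<in> E \<Longrightarrow> x i t = x' i t"
  shows "form_norm (L2_inner E) x = form_norm (L2_inner E) x'"
  unfolding form_norm_def using L2_inner_cong[of E x x' x x'] assms by simp

lemma L2_mono: "A \<subseteq> B \<Longrightarrow> L2 B \<subseteq> L2 A"
  by (auto simp: L2_def)

lemma sum_cnj_self: "(\<Sum>n\<in>A. c n * cnj (c n)) = complex_of_real (\<Sum>n\<in>A. (cmod (c n))\<^sup>2)"
  unfolding of_real_sum complex_norm_square ..

text \<open>An abstract form of the half-range theorem. The space of all square integrable functions splits
  as \<open>L2 Ea \<oplus> L2 Eb\<close>, and \<open>z\<close> is a total family that is orthonormal, up to signs \<open>\<sigma>\<close>, for the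
  indefinite form that is positive on the first summand and negative on the second. An upper estimate
  for the norm of linear combinations by their coefficients is assumed; the corresponding lower estimate
  for positive signs is a consequence of the indefinite orthonormality.\<close>

locale indefinite_system =
  fixes Ea Eb :: "nat set" and z :: "nat \<Rightarrow> gfun" and \<sigma> :: "nat \<Rightarrow> real" and C :: real
  assumes fin: "finite Ea" "finite Eb" and disj: "Ea \<inter> Eb = {}"
    and zL2: "\<And>n. z n \<in> L2 (Ea \<union> Eb)"
    and sign: "\<And>n. \<sigma> n = 1 \<or> \<sigma> n = -1"
    and orth: "\<And>m n. L2_inner Ea (z m) (z n) - L2_inner Eb (z m) (z n) = (if m = n then of_real (\<sigma> n) else 0)"
    and C1: "C \<ge> 1"
    and upper: "\<And>A c. finite A \<Longrightarrow>
      (form_norm (L2_inner (Ea \<union> Eb)) (gsum c z A))\<^sup>2 \<le> C * (\<Sum>n\<in>A. (cmod (c n))\<^sup>2)"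
    and total: "\<And>w \<epsilon>. w \<in> L2 (Ea \<union> Eb) \<Longrightarrow> 0 < \<epsilon> \<Longrightarrow>
      \<exists>A c. finite A \<and> form_norm (L2_inner (Ea \<union> Eb)) (gsub w (gsum c z A)) < \<epsilon>"
begin

sublocale a: complete_semi_ip "L2 Ea" "L2_inner Ea" by (rule L2_complete[OF fin(1)])
sublocale b: semi_ip "L2 Eb" "L2_inner Eb" by (rule L2_semi_ip)
sublocale e: semi_ip "L2 (Ea \<union> Eb)" "L2_inner (Ea \<union> Eb)" by (rule L2_semi_ip)

text \<open>The indices with positive sign, and the indefinite form.\<close>

definition I :: "nat set" where "I = {n. \<sigma> n = 1}"

definition br :: "gfun \<Rightarrow> gfun \<Rightarrow> complex" where
  "br x y = L2_inner Ea x y - L2_inner Eb x y"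

lemma Eb_notin: "i \<in> Eb \<Longrightarrow> i \<notin> Ea"
  using disj by blast

lemma L2_sub: "x \<in> L2 (Ea \<union> Eb) \<Longrightarrow> x \<in> L2 Ea" "x \<in> L2 (Ea \<union> Eb) \<Longrightarrow> x \<in> L2 Eb"
  using L2_mono[of Ea "Ea \<union> Eb"] L2_mono[of Eb "Ea \<union> Eb"] by auto

lemma norm_split: "(e.nrm x)\<^sup>2 = (a.nrm x)\<^sup>2 + (b.nrm x)\<^sup>2"
  unfolding L2_norm_sq by (rule sum.union_disjoint[OF fin disj])

lemma a_le_e:
  assumes "x \<in> L2 (Ea \<union> Eb)"
  shows "a.nrm x \<le> e.nrm x" "b.nrm x \<le> e.nrm x"
  by (rule power2_le_imp_le[OF _ e.nrm_nonneg[OF assms]], simp add: norm_split)+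

lemma br_glin_left:
  assumes "x \<in> L2 (Ea \<union> Eb)" "y \<in> L2 (Ea \<union> Eb)" "w \<in> L2 (Ea \<union> Eb)"
  shows "br (gsub x y) w = br x w - br y w"
  using assms by (simp add: br_def L2_sub a.ip_gsub_left b.ip_gsub_left)

lemma br_bound:
  assumes x: "x \<in> L2 (Ea \<union> Eb)" and y: "y \<in> L2 (Ea \<union> Eb)"
  shows "cmod (br x y) \<le> e.nrm x * e.nrm y"
proof -
  \<comment> \<open>The indefinite form is the inner product with the function reflected on the second summand.\<close>
  define x' where "x' i t = (if i \<in> Ea then x i t else - x i t)" for i t
  have "sqint (x' i)" if "sqint (x i)" for i
    using that sqint_cmult[OF that, of "-1"] by (cases "i \<in> Ea") (simp_all add: x'_def[abs_def])
  then have x': "x' \<in> L2 (Ea \<union> Eb)"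
    using x by (simp add: L2_sqint)
  have "L2_inner Eb x' y = - L2_inner Eb x y"
    unfolding L2_inner_def gint_def sum_negf[symmetric] by (intro sum.cong refl) (simp add: x'_def Eb_notin)
  moreover have "L2_inner Ea x' y = L2_inner Ea x y"
    by (rule L2_inner_cong) (simp_all add: x'_def)
  moreover have "L2_inner (Ea \<union> Eb) x' y = L2_inner Ea x' y + L2_inner Eb x' y"
    unfolding L2_inner_def gint_def by (rule sum.union_disjoint[OF fin disj])
  ultimately have "br x y = L2_inner (Ea \<union> Eb) x' y" by (simp add: br_def)
  moreover have "sqn (x' i) = sqn (x i)" for i
    by (cases "i \<in> Ea") (simp_all add: x'_def[abs_def] sqn_def)
  then have "(e.nrm x')\<^sup>2 = (e.nrm x)\<^sup>2"
    unfolding L2_norm_sq by simp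
  then have "e.nrm x' = e.nrm x" by (rule power2_eq_imp_eq[OF _ e.nrm_nonneg[OF x'] e.nrm_nonneg[OF x]])
  ultimately show ?thesis using e.Cauchy_Schwarz[OF x' y] by simp
qed

lemma gsum_L2: "finite A \<Longrightarrow> gsum c z A \<in> L2 (Ea \<union> Eb)"
  by (intro e.gsum_in zL2)

lemma br_gsum:
  assumes A: "finite A" and B: "finite B"
  shows "br (gsum c z A) (gsum d z B) = (\<Sum>n\<in>A \<inter> B. of_real (\<sigma> n) * (c n * cnj (d n)))"
proof -
  have "br (gsum c z A) (gsum d z B) = (\<Sum>m\<in>A. c m * (\<Sum>n\<in>B. cnj (d n) * (L2_inner Ea (z m) (z n) - L2_inner Eb (z m) (z n))))"
  proof -
    have "L2_inner Ea (gsum c z A) (gsum d z B) = (\<Sum>m\<in>A. c m * (\<Sum>n\<in>B. cnj (d n) * L2_inner Ea (z m) (z n)))"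
      by (subst a.ip_gsum_left[OF A]) (auto simp: a.ip_gsum_right[OF B] L2_sub zL2 gsum_L2[OF B])
    moreover have "L2_inner Eb (gsum c z A) (gsum d z B) = (\<Sum>m\<in>A. c m * (\<Sum>n\<in>B. cnj (d n) * L2_inner Eb (z m) (z n)))"
      by (subst b.ip_gsum_left[OF A]) (auto simp: b.ip_gsum_right[OF B] L2_sub zL2 gsum_L2[OF B])
    ultimately show ?thesis
      by (simp add: br_def sum_subtractf right_diff_distrib)
  qed
  also have "\<dots> = (\<Sum>m\<in>A. if m \<in> B then of_real (\<sigma> m) * (c m * cnj (d m)) else 0)"
  proof (rule sum.cong[OF refl])
    fix m assume "m \<in> A"
    have "(\<Sum>n\<in>B. cnj (d n) * (L2_inner Ea (z m) (z n) - L2_inner Eb (z m) (z n))) =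
        (\<Sum>n\<in>B. if m = n then cnj (d n) * of_real (\<sigma> n) else 0)"
      by (rule sum.cong[OF refl]) (simp add: orth)
    also have "\<dots> = (if m \<in> B then cnj (d m) * of_real (\<sigma> m) else 0)" using B by simp
    finally show "c m * (\<Sum>n\<in>B. cnj (d n) * (L2_inner Ea (z m) (z n) - L2_inner Eb (z m) (z n))) =
        (if m \<in> B then of_real (\<sigma> m) * (c m * cnj (d m)) else 0)" by simp
  qed
  also have "\<dots> = (\<Sum>n\<in>A \<inter> B. of_real (\<sigma> n) * (c n * cnj (d n)))"
    using A by (simp add: sum.inter_restrict)
  finally show ?thesis .
qed

lemma br_self: "x \<in> L2 (Ea \<union> Eb) \<Longrightarrow> br x x = of_real ((a.nrm x)\<^sup>2 - (b.nrm x)\<^sup>2)"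
  by (simp add: br_def a.ip_self b.ip_self L2_sub)

lemma lower:
  assumes A: "finite A" "A \<subseteq> I"
  shows "(\<Sum>n\<in>A. (cmod (c n))\<^sup>2) \<le> (a.nrm (gsum c z A))\<^sup>2"
proof -
  have "br (gsum c z A) (gsum c z A) = (\<Sum>n\<in>A. c n * cnj (c n))"
    unfolding br_gsum[OF A(1) A(1)] using A(2) by (intro sum.cong) (auto simp: I_def)
  also have "\<dots> = of_real (\<Sum>n\<in>A. (cmod (c n))\<^sup>2)" by (rule sum_cnj_self)
  finally have "(a.nrm (gsum c z A))\<^sup>2 - (b.nrm (gsum c z A))\<^sup>2 = (\<Sum>n\<in>A. (cmod (c n))\<^sup>2)"
    unfolding br_self[OF gsum_L2[OF A(1)]] of_real_eq_iff .
  then show ?thesis using zero_le_power2[of "b.nrm (gsum c z A)"] by linarith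
qed

text \<open>One step of approximation in \<open>L2 Ea\<close>. The function \<open>w\<close>, extended by zero, is close to a combination
  \<open>u\<close> of the whole family. A suitable multiple of the part \<open>p\<close> of \<open>u\<close> with positive signs reduces the
  distance to \<open>w\<close> by a fixed factor, because the squared coefficient norm of \<open>p\<close> is both close to the
  inner product of \<open>w\<close> and \<open>p\<close> and not much smaller than the squared norm of \<open>w\<close>.\<close>

lemma approximation_step:
  assumes w: "w \<in> L2 Ea"
  shows "\<exists>s\<in>fspan z I. (a.nrm (gsub w s))\<^sup>2 \<le> (1 - 1 / (8 * C)) * (a.nrm w)\<^sup>2"
proof (cases "a.nrm w = 0")
  case True
  have "gsub w (\<lambda>i t. 0) = w" by (simp add: gsub_def)
  then show ?thesis using True fspan_zero[of z I] by (intro bexI[of _ "\<lambda>i t. 0"]) auto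
next
  case False
  define R where "R = a.nrm w"
  have R: "R > 0" using False a.nrm_nonneg[OF w] by (simp add: R_def)
  \<comment> \<open>The error of the approximation by the whole family. It is a small multiple of the norm of \<open>w\<close>; the factor
    is dictated by the last two estimates, where the terms with \<open>\<epsilon>\<close> have to be absorbed.\<close>
  define \<epsilon> where "\<epsilon> = R / (8 * sqrt C)"
  have C0: "C > 0" "sqrt C \<ge> 1" using C1 by auto
  have \<epsilon>: "\<epsilon> > 0" using R C0 by (simp add: \<epsilon>_def)
  have \<epsilon>R: "\<epsilon> \<le> R / 8"
    unfolding \<epsilon>_def using R C0 by (intro divide_left_mono) auto
  have \<epsilon>2: "\<epsilon>\<^sup>2 = R\<^sup>2 / (64 * C)" using C0 by (simp add: \<epsilon>_def power_divide power_mult_distrib)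
  define W where "W i t = (if i \<in> Ea then w i t else 0)" for i t
  have "sqint (W i)" for i
    using w by (cases "i \<in> Ea") (simp_all add: W_def[abs_def] L2_sqint)
  then have WL: "W \<in> L2 (Ea \<union> Eb)" by (simp add: L2_sqint)
  have Wa: "a.nrm W = R" unfolding R_def by (rule form_norm_L2_cong) (simp add: W_def)
  have W0: "L2_inner Eb W v = 0" for v
    unfolding L2_inner_def gint_def by (intro sum.neutral ballI) (simp add: W_def Eb_notin)
  have We: "e.nrm W = R"
  proof -
    have "b.nrm W = 0" by (simp add: form_norm_def W0)
    then have "(e.nrm W)\<^sup>2 = R\<^sup>2" using norm_split[of W] Wa by simp
    then show ?thesis by (rule power2_eq_imp_eq[OF _ e.nrm_nonneg[OF WL] less_imp_le[OF R]])
  qed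
  obtain B c where B: "finite B" and u: "e.nrm (gsub W (gsum c z B)) < \<epsilon>"
    using total[OF WL \<epsilon>] by blast
  define u where "u = gsum c z B"
  define p where "p = gsum c z (B \<inter> I)"
  have uL: "u \<in> L2 (Ea \<union> Eb)" and pL: "p \<in> L2 (Ea \<union> Eb)"
    unfolding u_def p_def using B by (auto intro: gsum_L2)
  have dL: "gsub W u \<in> L2 (Ea \<union> Eb)" using WL uL by (rule e.gsub_in)
  have d: "e.nrm (gsub W u) < \<epsilon>" using u by (simp add: u_def)
  define r where "r = sqrt (\<Sum>n\<in>B \<inter> I. (cmod (c n))\<^sup>2)"
  have r0: "r \<ge> 0" by (simp add: r_def sum_nonneg)
  have r2: "r\<^sup>2 = (\<Sum>n\<in>B \<inter> I. (cmod (c n))\<^sup>2)" by (simp add: r_def sum_nonneg)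
  define \<rho> where "\<rho> = r / sqrt C"
  have \<rho>: "\<rho> \<ge> 0" "r = sqrt C * \<rho>" "r\<^sup>2 = C * \<rho>\<^sup>2" using r0 C0 by (auto simp: \<rho>_def power_divide)
  have bup: "br u p = of_real (r\<^sup>2)"
  proof -
    have "br u p = (\<Sum>n\<in>B \<inter> I. c n * cnj (c n))"
      unfolding u_def p_def using B by (subst br_gsum) (auto intro!: sum.cong simp: I_def)
    then show ?thesis by (simp only: sum_cnj_self r2)
  qed
  have pe: "(e.nrm p)\<^sup>2 \<le> C * r\<^sup>2" unfolding p_def r2 using B by (intro upper) simp
  have pe': "e.nrm p \<le> sqrt C * r"
    by (rule power2_le_imp_le) (use pe C0 r0 in \<open>auto simp: power_mult_distrib\<close>)
  have pa: "(a.nrm p)\<^sup>2 \<le> C * r\<^sup>2"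
    using pe norm_split[of p] zero_le_power2[of "b.nrm p"] by linarith
  have inner: "r\<^sup>2 - \<epsilon> * (sqrt C * r) \<le> Re (L2_inner Ea w p)"
  proof -
    have "L2_inner Ea w p = L2_inner Ea W p" by (rule L2_inner_cong) (simp_all add: W_def)
    also have "\<dots> = br W p" by (simp add: br_def W0)
    also have "\<dots> = br (gsub W u) p + br u p" by (simp add: br_glin_left[OF WL uL pL])
    finally have eq: "L2_inner Ea w p = br (gsub W u) p + of_real (r\<^sup>2)" by (simp only: bup)
    have "cmod (br (gsub W u) p) \<le> e.nrm (gsub W u) * e.nrm p" by (rule br_bound[OF dL pL])
    also have "\<dots> \<le> \<epsilon> * (sqrt C * r)"
      using d pe' e.nrm_nonneg[OF pL] \<epsilon> by (intro mult_mono) auto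
    finally have "- (\<epsilon> * (sqrt C * r)) \<le> Re (br (gsub W u) p)"
      using abs_Re_le_cmod[of "br (gsub W u) p"] by linarith
    then show ?thesis unfolding eq by simp
  qed
  \<comment> \<open>Negative signs only decrease \<open>br u u\<close>, while \<open>u\<close> is close to \<open>w\<close> on \<open>Ea\<close> and small on \<open>Eb\<close>.\<close>
  have rlow: "R\<^sup>2 / 2 \<le> r\<^sup>2"
  proof -
    have "Re (br u u) \<le> r\<^sup>2"
    proof -
      have "br u u = of_real (\<Sum>n\<in>B. \<sigma> n * (cmod (c n))\<^sup>2)"
        unfolding u_def br_gsum[OF B B]
        by (simp only: Int_absorb of_real_sum of_real_mult complex_norm_square)
      then have "Re (br u u) = (\<Sum>n\<in>B. \<sigma> n * (cmod (c n))\<^sup>2)" by simp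
      also have "\<dots> \<le> (\<Sum>n\<in>B. if n \<in> I then (cmod (c n))\<^sup>2 else 0)"
        proof (rule sum_mono)
          fix n
          show "\<sigma> n * (cmod (c n))\<^sup>2 \<le> (if n \<in> I then (cmod (c n))\<^sup>2 else 0)"
            using sign[of n] by (auto simp: I_def)
        qed
      also have "\<dots> = r\<^sup>2" using B by (simp add: r2 sum.inter_restrict)
      finally show ?thesis .
    qed
    moreover have "R - \<epsilon> \<le> a.nrm u" "b.nrm u \<le> \<epsilon>"
    proof -
      show "R - \<epsilon> \<le> a.nrm u"
        using a.nrm_triangle_sub(1)[OF L2_sub(1)[OF WL] L2_sub(1)[OF uL]] a_le_e(1)[OF dL] d Wa by linarith
      have "b.nrm u \<le> b.nrm W + b.nrm (gsub W u)"
        by (rule b.nrm_triangle_sub(2)[OF L2_sub(2)[OF WL] L2_sub(2)[OF uL]])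
      moreover have "b.nrm W = 0" by (simp add: form_norm_def W0)
      ultimately show "b.nrm u \<le> \<epsilon>" using a_le_e(2)[OF dL] d by linarith
    qed
    moreover have "Re (br u u) = (a.nrm u)\<^sup>2 - (b.nrm u)\<^sup>2" by (simp add: br_self[OF uL])
    moreover have "(R - \<epsilon>)\<^sup>2 \<le> (a.nrm u)\<^sup>2"
      by (rule power_mono[OF \<open>R - \<epsilon> \<le> a.nrm u\<close>]) (use \<epsilon>R R in linarith)
    moreover have "(b.nrm u)\<^sup>2 \<le> \<epsilon>\<^sup>2"
      by (rule power_mono[OF \<open>b.nrm u \<le> \<epsilon>\<close> b.nrm_nonneg[OF L2_sub(2)[OF uL]]])
    ultimately have "(R - \<epsilon>)\<^sup>2 - \<epsilon>\<^sup>2 \<le> r\<^sup>2" by linarith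
    moreover have "(R - \<epsilon>)\<^sup>2 - \<epsilon>\<^sup>2 = R\<^sup>2 - 2 * (R * \<epsilon>)"
      by (simp add: power2_eq_square algebra_simps)
    moreover have "R * \<epsilon> \<le> R * (R / 8)" using \<epsilon>R R by (intro mult_left_mono) auto
    then have "R * \<epsilon> \<le> R\<^sup>2 / 8" by (simp add: power2_eq_square)
    ultimately show ?thesis using zero_le_power2[of R] by linarith
  qed
  \<comment> \<open>The factor \<open>\<tau> = 1 / C\<close> minimizes \<open>C \<tau>\<^sup>2 r\<^sup>2 - 2 \<tau> r\<^sup>2\<close>.\<close>
  define s where "s = gscale (of_real (1 / C)) p"
  have sI: "s \<in> fspan z I"
    unfolding s_def gscale_glin p_def using B by (intro fspan_glin fspanI) auto
  have "(a.nrm (gsub w s))\<^sup>2 = R\<^sup>2 + (1 / C)\<^sup>2 * (a.nrm p)\<^sup>2 - 2 * (1 / C) * Re (L2_inner Ea w p)"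
  proof -
    have "gsub w s = glin 1 w (of_real (- 1 / C)) p"
      by (simp add: gsub_def s_def gscale_def glin_def)
    then show ?thesis
      using a.nrm_sq_glin[OF w L2_sub(1)[OF pL], of 1 "of_real (- 1 / C)"] C0
      by (simp add: R_def power_divide norm_divide)
  qed
  also have "\<dots> \<le> R\<^sup>2 + (1 / C)\<^sup>2 * (C * r\<^sup>2) - 2 * (1 / C) * (r\<^sup>2 - \<epsilon> * (sqrt C * r))"
    using pa inner C0 by (intro diff_mono add_mono mult_left_mono) auto
  also have "\<dots> = R\<^sup>2 - \<rho>\<^sup>2 + 2 * (\<epsilon> * \<rho>)"
  proof -
    have "(1 / C)\<^sup>2 * (C * (C * v)) = v" for v using C0(1) by (simp add: power2_eq_square)
    then have 1: "(1 / C)\<^sup>2 * (C * r\<^sup>2) = \<rho>\<^sup>2" by (simp only: \<rho>(3))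
    have 2: "(1 / C) * (r\<^sup>2 - \<epsilon> * (sqrt C * r)) = \<rho>\<^sup>2 - \<epsilon> * \<rho>"
    proof -
      have "sqrt C * r = C * \<rho>" using C0 by (simp add: \<rho>(2))
      then have "r\<^sup>2 - \<epsilon> * (sqrt C * r) = C * (\<rho>\<^sup>2 - \<epsilon> * \<rho>)" by (simp add: \<rho>(3) algebra_simps)
      then show ?thesis using C0(1) by simp
    qed
    have "2 * (1 / C) * (r\<^sup>2 - \<epsilon> * (sqrt C * r)) = 2 * (\<rho>\<^sup>2 - \<epsilon> * \<rho>)"
      by (simp only: mult.assoc 2)
    then show ?thesis unfolding 1 by (simp only: right_diff_distrib)
  qed
  also have "\<dots> \<le> R\<^sup>2 - \<rho>\<^sup>2 / 2 + 2 * \<epsilon>\<^sup>2"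
  proof -
    have "0 \<le> (\<rho> - 2 * \<epsilon>)\<^sup>2" by simp
    then show ?thesis by (simp add: power2_eq_square algebra_simps)
  qed
  also have "\<dots> \<le> R\<^sup>2 - R\<^sup>2 / (4 * C) + R\<^sup>2 / (32 * C)"
  proof -
    have "R\<^sup>2 / (2 * C) \<le> \<rho>\<^sup>2"
      using rlow C0(1) unfolding \<rho>(3) by (simp add: pos_divide_le_eq mult_ac)
    moreover have "2 * \<epsilon>\<^sup>2 = R\<^sup>2 / (32 * C)" by (simp add: \<epsilon>2)
    moreover have "R\<^sup>2 / (4 * C) = R\<^sup>2 / (2 * C) / 2" by simp
    ultimately show ?thesis by linarith
  qed
  also have "\<dots> \<le> (1 - 1 / (8 * C)) * R\<^sup>2"
  proof -
    define v where "v = R\<^sup>2 / C"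
    have v: "R\<^sup>2 / (4 * C) = v / 4" "R\<^sup>2 / (32 * C) = v / 32"
      "(1 - 1 / (8 * C)) * R\<^sup>2 = R\<^sup>2 - v / 8" "0 \<le> v"
      using C0(1) by (simp_all add: v_def left_diff_distrib)
    show ?thesis unfolding v(1-3) using v(4) by linarith
  qed
  finally show ?thesis using sI unfolding R_def by blast
qed

lemma half_range_dense:
  assumes w: "w \<in> L2 Ea" and "0 < \<epsilon>"
  shows "\<exists>s\<in>fspan z I. a.nrm (gsub w s) < \<epsilon>"
proof -
  define \<theta> where "\<theta> = 1 - 1 / (8 * C)"
  have \<theta>: "0 \<le> \<theta>" "\<theta> < 1" using C1 by (auto simp: \<theta>_def)
  have zL: "z n \<in> L2 Ea" for n using zL2 L2_sub by blast
  have sub: "fspan z I \<subseteq> L2 Ea" by (rule a.fspan_subset) (rule zL)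
  have iter: "\<exists>s\<in>fspan z I. (a.nrm (gsub w s))\<^sup>2 \<le> \<theta>^n * (a.nrm w)\<^sup>2" for n
  proof (induction n)
    case 0
    have "gsub w (\<lambda>i t. 0) = w" by (simp add: gsub_def)
    then show ?case using fspan_zero[of z I] by (intro bexI[of _ "\<lambda>i t. 0"]) auto
  next
    case (Suc n)
    then obtain s where s: "s \<in> fspan z I" "(a.nrm (gsub w s))\<^sup>2 \<le> \<theta>^n * (a.nrm w)\<^sup>2" by blast
    have "gsub w s \<in> L2 Ea" using w s sub by (intro a.gsub_in) auto
    from approximation_step[OF this] obtain s' where s': "s' \<in> fspan z I"
      "(a.nrm (gsub (gsub w s) s'))\<^sup>2 \<le> \<theta> * (a.nrm (gsub w s))\<^sup>2" by (auto simp: \<theta>_def)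
    have "gsub (gsub w s) s' = gsub w (glin 1 s 1 s')" by (simp add: gsub_def glin_def algebra_simps)
    moreover have "\<theta> * (a.nrm (gsub w s))\<^sup>2 \<le> \<theta>^Suc n * (a.nrm w)\<^sup>2"
      using mult_left_mono[OF s(2) \<theta>(1)] by (simp add: mult.assoc)
    ultimately have "(a.nrm (gsub w (glin 1 s 1 s')))\<^sup>2 \<le> \<theta>^Suc n * (a.nrm w)\<^sup>2"
      using s'(2) by simp
    then show ?case using fspan_glin[OF s(1) s'(1)] by (intro bexI)
  qed
  have "(\<lambda>n. \<theta>^n * (a.nrm w)\<^sup>2) \<longlonglongrightarrow> 0 * (a.nrm w)\<^sup>2"
    by (intro tendsto_mult_right LIMSEQ_power_zero) (use \<theta> in auto)
  then have "(\<lambda>n. \<theta>^n * (a.nrm w)\<^sup>2) \<longlonglongrightarrow> 0" by simp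
  moreover have "0 < \<epsilon>\<^sup>2" using \<open>0 < \<epsilon>\<close> by simp
  ultimately have "\<forall>\<^sub>F n in sequentially. \<theta>^n * (a.nrm w)\<^sup>2 < \<epsilon>\<^sup>2" by (rule order_tendstoD(2))
  then obtain n where n: "\<theta>^n * (a.nrm w)\<^sup>2 < \<epsilon>\<^sup>2" by (auto simp: eventually_sequentially)
  obtain s where s: "s \<in> fspan z I" "(a.nrm (gsub w s))\<^sup>2 \<le> \<theta>^n * (a.nrm w)\<^sup>2" using iter by blast
  have "a.nrm (gsub w s) < \<epsilon>"
    by (rule power_less_imp_less_base[OF le_less_trans[OF s(2) n]]) (use \<open>0 < \<epsilon>\<close> in simp)
  then show ?thesis using s by blast
qed

text \<open>Normalization in \<open>L2 Ea\<close> changes the members of positive sign by factors between \<open>C powr (- 1/2)\<close> and \<open>1\<close>.\<close>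

theorem half_range_riesz_basis:
  assumes x: "\<And>n i t. n \<in> I \<Longrightarrow> i \<in> Ea \<Longrightarrow> x n i t = of_real (1 / form_norm (L2_inner Ea) (z n)) * z n i t"
  shows "riesz_basis (L2 Ea) (L2_inner Ea) I x"
proof -
  have zL: "z n \<in> L2 Ea" for n using zL2 L2_sub by blast
  define \<beta> where "\<beta> n = 1 / a.nrm (z n)" for n
  have zn: "1 \<le> (a.nrm (z n))\<^sup>2" "(a.nrm (z n))\<^sup>2 \<le> C" if "n \<in> I" for n
  proof -
    have g: "gsum (\<lambda>_. 1) z {n} = z n" by (simp add: gsum_def)
    show "1 \<le> (a.nrm (z n))\<^sup>2" using lower[of "{n}" "\<lambda>_. 1"] that by (simp add: g)
    have "(e.nrm (z n))\<^sup>2 \<le> C" using upper[of "{n}" "\<lambda>_. 1"] by (simp add: g)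
    then show "(a.nrm (z n))\<^sup>2 \<le> C"
      using norm_split[of "z n"] zero_le_power2[of "b.nrm (z n)"] by linarith
  qed
  have \<beta>: "\<beta> n > 0" "(\<beta> n)\<^sup>2 \<le> 1" "1 / C \<le> (\<beta> n)\<^sup>2" if "n \<in> I" for n
  proof -
    have p: "a.nrm (z n) > 0" using zn(1)[OF that] a.nrm_nonneg[OF zL, of n]
      by (metis less_eq_real_def not_one_le_zero power_zero_numeral)
    then show "\<beta> n > 0" by (simp add: \<beta>_def)
    have p2: "0 < (a.nrm (z n))\<^sup>2" using p by simp
    show "(\<beta> n)\<^sup>2 \<le> 1" using zn(1)[OF that] p2 by (simp add: \<beta>_def power_divide)
    show "1 / C \<le> (\<beta> n)\<^sup>2" using zn(2)[OF that] p2 C1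
      unfolding \<beta>_def power_divide by (simp add: frac_le)
  qed
  have xL: "x n \<in> L2 Ea" if "n \<in> I" for n
  proof -
    have "x n i = (\<lambda>t. of_real (\<beta> n) * z n i t)" if "i \<in> Ea" for i
      using x[OF \<open>n \<in> I\<close> that] by (simp add: \<beta>_def fun_eq_iff)
    moreover have "sqint (\<lambda>t. of_real (\<beta> n) * z n i t)" if "i \<in> Ea" for i
      using zL[of n] that by (intro sqint_cmult) (simp add: L2_sqint)
    ultimately show ?thesis by (simp add: L2_sqint)
  qed
  have gx: "gsum c x A i t = gsum (\<lambda>n. c n * of_real (\<beta> n)) z A i t" if "A \<subseteq> I" "i \<in> Ea" for c A i t
    unfolding gsum_def by (intro sum.cong refl) (use x that in \<open>auto simp: \<beta>_def\<close>)
  have nx: "a.nrm (gsum c x A) = a.nrm (gsum (\<lambda>n. c n * of_real (\<beta> n)) z A)" if "A \<subseteq> I" for c A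
    by (rule form_norm_L2_cong) (rule gx[OF that])
  show ?thesis
  proof (rule a.riesz_basis_criterion)
    show "0 < 1 / C" "0 \<le> C" using C1 by auto
    fix A and c :: "nat \<Rightarrow> complex" assume A: "finite A" "A \<subseteq> I"
    have "(1 / C) * (\<Sum>n\<in>A. (cmod (c n))\<^sup>2) \<le> (\<Sum>n\<in>A. (cmod (c n * of_real (\<beta> n)))\<^sup>2)"
      unfolding sum_distrib_left
    proof (rule sum_mono)
      fix n assume "n \<in> A"
      then have "n \<in> I" using A by blast
      from mult_right_mono[OF \<beta>(3)[OF this], of "(cmod (c n))\<^sup>2"]
      show "1 / C * (cmod (c n))\<^sup>2 \<le> (cmod (c n * of_real (\<beta> n)))\<^sup>2"
        by (simp add: norm_mult power_mult_distrib mult.commute)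
    qed
    also have "\<dots> \<le> (a.nrm (gsum c x A))\<^sup>2" unfolding nx[OF A(2)] by (rule lower[OF A])
    finally show "1 / C * (\<Sum>n\<in>A. (cmod (c n))\<^sup>2) \<le> (a.nrm (gsum c x A))\<^sup>2" .
    have "(a.nrm (gsum c x A))\<^sup>2 \<le> (e.nrm (gsum (\<lambda>n. c n * of_real (\<beta> n)) z A))\<^sup>2"
      unfolding nx[OF A(2)] norm_split by simp
    also have "\<dots> \<le> C * (\<Sum>n\<in>A. (cmod (c n * of_real (\<beta> n)))\<^sup>2)" by (rule upper[OF A(1)])
    also have "\<dots> \<le> C * (\<Sum>n\<in>A. (cmod (c n))\<^sup>2)"
    proof (intro mult_left_mono sum_mono)
      fix n assume "n \<in> A"
      then have "n \<in> I" using A by blast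
      from mult_left_mono[OF \<beta>(2)[OF this], of "(cmod (c n))\<^sup>2"]
      show "(cmod (c n * of_real (\<beta> n)))\<^sup>2 \<le> (cmod (c n))\<^sup>2"
        by (simp add: norm_mult power_mult_distrib)
    qed (use C1 in simp)
    finally show "(a.nrm (gsum c x A))\<^sup>2 \<le> C * (\<Sum>n\<in>A. (cmod (c n))\<^sup>2)" .
  next
    fix w and \<epsilon> :: real assume w: "w \<in> L2 Ea" and \<epsilon>: "0 < \<epsilon>"
    obtain s where s: "s \<in> fspan z I" "a.nrm (gsub w s) < \<epsilon>" using half_range_dense[OF w \<epsilon>] by blast
    then obtain A c where A: "finite A" "A \<subseteq> I" "s = gsum c z A" by (auto simp: fspan_def)
    have "gsum (\<lambda>n. c n / of_real (\<beta> n)) x A i t = s i t" if "i \<in> Ea" for i t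
    proof -
      have "gsum (\<lambda>n. c n / of_real (\<beta> n)) x A i t = gsum (\<lambda>n. c n / of_real (\<beta> n) * of_real (\<beta> n)) z A i t"
        by (rule gx[OF A(2) that])
      also have "gsum (\<lambda>n. c n / of_real (\<beta> n) * of_real (\<beta> n)) z A = gsum c z A"
        using A(2) \<beta>(1) by (intro gsum_cong) force
      finally show ?thesis by (simp add: A(3))
    qed
    then have "a.nrm (gsub w (gsum (\<lambda>n. c n / of_real (\<beta> n)) x A)) = a.nrm (gsub w s)"
      by (intro form_norm_L2_cong) (simp add: gsub_def)
    then show "\<exists>A c. finite A \<and> A \<subseteq> I \<and> a.nrm (gsub w (gsum c x A)) < \<epsilon>"
      using s A by (intro exI[of _ A] exI[of _ "\<lambda>n. c n / of_real (\<beta> n)"]) simp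
  qed (rule xL)
qed

end

text \<open>A logarithmically convex sequence whose growth rate is at most \<open>M\<close> has first ratio at most \<open>M\<close>.\<close>

lemma log_convex_ratio:
  fixes r :: "nat \<Rightarrow> real"
  assumes nn: "\<And>j. 0 \<le> r j" and cvx: "\<And>j. (r (Suc j))\<^sup>2 \<le> r j * r (Suc (Suc j))"
    and growth: "\<And>j. r j \<le> K * M^j" and M: "0 < M"
  shows "r 1 \<le> M * r 0"
proof (rule ccontr)
  assume "\<not> ?thesis"
  then have gt: "M * r 0 < r 1" by simp
  have r0: "r 0 > 0"
  proof (rule ccontr)
    assume "\<not> r 0 > 0"
    then have "r 0 = 0" using nn[of 0] by simp
    then have "(r 1)\<^sup>2 \<le> 0" using cvx[of 0] by simp
    then show False using gt \<open>r 0 = 0\<close> by simp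
  qed
  define \<rho> where "\<rho> = r 1 / r 0"
  have \<rho>: "\<rho> > M" using gt r0 by (simp add: \<rho>_def pos_less_divide_eq)
  have step: "r j > 0 \<and> \<rho> * r j \<le> r (Suc j)" for j
  proof (induction j)
    case 0
    then show ?case using r0 by (simp add: \<rho>_def)
  next
    case (Suc j)
    then have pos: "r (Suc j) > 0" using \<rho> M by (smt (verit) mult_pos_pos)
    have "\<rho> * r j * r (Suc j) \<le> (r (Suc j))\<^sup>2"
      unfolding power2_eq_square using Suc pos by (intro mult_right_mono) auto
    also have "\<dots> \<le> r j * r (Suc (Suc j))" by (rule cvx)
    finally have "r j * (\<rho> * r (Suc j)) \<le> r j * r (Suc (Suc j))" by (simp add: mult_ac)
    then have "\<rho> * r (Suc j) \<le> r (Suc (Suc j))" using Suc by simp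
    then show ?case using pos by simp
  qed
  have pw: "\<rho>^j * r 0 \<le> r j" for j
  proof (induction j)
    case (Suc j)
    have "\<rho> * (\<rho>^j * r 0) \<le> \<rho> * r j" using Suc \<rho> M by (intro mult_left_mono) auto
    also have "\<dots> \<le> r (Suc j)" using step by blast
    finally show ?case by (simp add: mult.assoc)
  qed simp
  obtain j where j: "K / r 0 < (\<rho> / M)^j"
    using real_arch_pow[of "\<rho> / M" "K / r 0"] \<rho> M by auto
  have "(\<rho> / M)^j * r 0 = \<rho>^j * r 0 / M^j" by (simp add: power_divide)
  also have "\<dots> \<le> K"
    using order_trans[OF pw[of j] growth[of j]] M by (simp add: pos_divide_le_eq)
  finally show False using j r0 by (simp add: pos_divide_less_eq)
qed

section \<open>The eigenfunction expansion\<close>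

text \<open>An orthonormal basis of the form domain that consists of eigenfunctions, with \<open>L\<close> positive definite.\<close>

locale eigen_basis = conormal_bvp P f for P :: "'v graph_problem" and f +
  fixes y :: "nat \<Rightarrow> gfun" and ev :: "nat \<Rightarrow> real"
  assumes posdef: "L_positive_definite P"
    and basis: "orthonormal_basis (dom_F P) (F_form P f) UNIV y"
    and eig: "\<And>n. eigenfunction P (ev n) (y n)"
begin

abbreviation "Ep \<equiv> pos_edges P"
abbreviation "En \<equiv> neg_edges P"

lemma weight_cases: "weight P i = 1 \<or> weight P i = -1"
  by (simp add: weight_def)

lemma E_split: "E = Ep \<union> En" "Ep \<inter> En = {}"
  using weight_cases by (auto simp: pos_edges_def neg_edges_def)

lemma fin_pn: "finite Ep" "finite En"
  using finite_E E_split by auto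

sublocale L: semi_ip "L2 E" "L2_inner E" by (rule L2_semi_ip)
sublocale Lp: semi_ip "L2 Ep" "L2_inner Ep" by (rule L2_semi_ip)
sublocale Ln: semi_ip "L2 En" "L2_inner En" by (rule L2_semi_ip)

sublocale G: semi_ip DF F
proof -
  obtain c where c: "c > 0" "\<And>x. x \<in> DF \<Longrightarrow> c * (N0 x + N1 x) \<le> Re (F x x)"
    using coercive[OF posdef] by blast
  have "0 * N0 x \<le> Re (F x x)" if "x \<in> DF" for x
  proof -
    have "0 \<le> c * (N0 x + N1 x)" using c(1) N_nonneg[of x] by simp
    then show ?thesis using c(2)[OF that] by simp
  qed
  from F_shift_semi_ip[OF this] show "semi_ip DF F" by simp
qed

lemma DF_L2': "x \<in> DF \<Longrightarrow> x \<in> L2 Ep" "x \<in> DF \<Longrightarrow> x \<in> L2 En"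
  using DF_L2 L2_mono[of Ep E] L2_mono[of En E] E_split(1) by auto

lemma nrm_N0: "(L.nrm x)\<^sup>2 = N0 x"
  by (simp add: L2_norm_sq N0_def)

text \<open>The indefinite form \<open>(B x, v)\<close>.\<close>

definition B :: "gfun \<Rightarrow> gfun \<Rightarrow> complex" where
  "B x v = L2_inner Ep x v - L2_inner En x v"

lemma B_weight: "B x v = (\<Sum>i\<in>E. of_real (weight P i) * (\<integral>t. x i t * cnj (v i t) \<partial>unit_leb))"
proof -
  have "(\<Sum>i\<in>E. of_real (weight P i) * (\<integral>t. x i t * cnj (v i t) \<partial>unit_leb)) =
      (\<Sum>i\<in>Ep. of_real (weight P i) * (\<integral>t. x i t * cnj (v i t) \<partial>unit_leb)) +
      (\<Sum>i\<in>En. of_real (weight P i) * (\<integral>t. x i t * cnj (v i t) \<partial>unit_leb))"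
    unfolding E_split(1) by (rule sum.union_disjoint[OF fin_pn E_split(2)])
  moreover have "(\<Sum>i\<in>Ep. of_real (weight P i) * (\<integral>t. x i t * cnj (v i t) \<partial>unit_leb)) = L2_inner Ep x v"
    unfolding L2_inner_def gint_def by (rule sum.cong) (simp_all add: pos_edges_def)
  moreover have "(\<Sum>i\<in>En. of_real (weight P i) * (\<integral>t. x i t * cnj (v i t) \<partial>unit_leb)) = - L2_inner En x v"
    unfolding L2_inner_def gint_def sum_negf[symmetric] by (rule sum.cong) (simp_all add: neg_edges_def)
  ultimately show ?thesis by (simp add: B_def)
qed

lemma B_herm: "x \<in> DF \<Longrightarrow> v \<in> DF \<Longrightarrow> B v x = cnj (B x v)"
  unfolding B_def using Lp.ip_herm[of x v] Ln.ip_herm[of x v] DF_L2' by simp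

lemma B_gscale: "x \<in> DF \<Longrightarrow> v \<in> DF \<Longrightarrow> B (gscale a x) v = a * B x v"
  "x \<in> DF \<Longrightarrow> v \<in> DF \<Longrightarrow> B x (gscale a v) = cnj a * B x v"
  unfolding B_def by (simp_all add: DF_L2' Lp.ip_gscale_left Ln.ip_gscale_left
      Lp.ip_gscale_right Ln.ip_gscale_right right_diff_distrib)

lemma B_gsum_right:
  assumes "finite A" "\<And>n. n \<in> A \<Longrightarrow> v n \<in> DF" "x \<in> DF"
  shows "B x (gsum c v A) = (\<Sum>n\<in>A. cnj (c n) * B x (v n))"
  unfolding B_def using assms
  by (simp add: DF_L2' Lp.ip_gsum_right Ln.ip_gsum_right sum_subtractf right_diff_distrib)

lemma yD: "y n \<in> DF" "y n \<in> H2 E" "bc_II P (y n)"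
  using eig[of n] dom_L_H2[of "y n"] by (auto simp: eigenfunction_def)

lemma eigen_form:
  assumes v: "v \<in> DF"
  shows "F (y n) v = of_real (ev n) * B (y n) v"
proof -
  have "(\<integral>t. lop P (y n) i t * cnj (v i t) \<partial>unit_leb) =
      of_real (ev n) * (of_real (weight P i) * (\<integral>t. y n i t * cnj (v i t) \<partial>unit_leb))" if i: "i \<in> E" for i
  proof -
    have ii: "integrable unit_leb (\<lambda>t. y n i t * cnj (v i t))"
      by (intro sqint_mult_cnj_integrable H1e_sqint DF_H1e[OF yD(1) i] DF_H1e[OF v i])
    have "(\<integral>t. lop P (y n) i t * cnj (v i t) \<partial>unit_leb) =
        (\<integral>t. of_real (ev n * weight P i) * (y n i t * cnj (v i t)) \<partial>unit_leb)"
    proof (rule integral_cong_AE)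
      show "(\<lambda>t. lop P (y n) i t * cnj (v i t)) \<in> borel_measurable unit_leb"
        by (intro borel_measurable_integrable sqint_mult_cnj_integrable lop_sqint yD i H1e_sqint DF_H1e[OF v i])
      show "(\<lambda>t. of_real (ev n * weight P i) * (y n i t * cnj (v i t))) \<in> borel_measurable unit_leb"
        by (intro borel_measurable_integrable integrable_mult_right ii)
      have "AE t in unit_leb. lop P (y n) i t = of_real (ev n * weight P i) * y n i t"
        using eig[of n] i by (simp add: eigenfunction_def)
      then show "AE t in unit_leb. lop P (y n) i t * cnj (v i t) = of_real (ev n * weight P i) * (y n i t * cnj (v i t))"
        by eventually_elim simp
    qed
    also have "\<dots> = of_real (ev n * weight P i) * (\<integral>t. y n i t * cnj (v i t) \<partial>unit_leb)" by simp
    finally show ?thesis by simp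
  qed
  then have "L2_inner E (lop P (y n)) v = of_real (ev n) * B (y n) v"
    unfolding L2_inner_def gint_def B_weight sum_distrib_left by (rule sum.cong[OF refl])
  then show ?thesis using Green[OF yD v] by simp
qed

lemma y_orth: "F (y m) (y n) = (if m = n then 1 else 0)"
  using basis by (simp add: orthonormal_basis_def)

lemma ev_nonzero: "ev n \<noteq> 0"
  using eigen_form[OF yD(1), of n n] y_orth[of n n] by auto

text \<open>The eigenfunctions, scaled so that they are orthonormal up to sign for the indefinite form.\<close>

definition z :: "nat \<Rightarrow> gfun" where
  "z n = gscale (of_real (sqrt \<bar>ev n\<bar>)) (y n)"

lemma zD: "z n \<in> DF"
  unfolding z_def by (rule G.gscale_in[OF yD(1)])

lemma eigen_form_z: "v \<in> DF \<Longrightarrow> F (z n) v = of_real (ev n) * B (z n) v"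
  unfolding z_def by (simp add: G.ip_gscale_left yD(1) eigen_form B_gscale)

lemma z_orth: "B (z m) (z n) = (if m = n then of_real (sgn (ev n)) else 0)"
proof -
  have "of_real (ev m) * B (y m) (y n) = (if m = n then 1 else 0)"
    using eigen_form[OF yD(1), of m n] y_orth[of m n] by simp
  then have By: "B (y m) (y n) = (if m = n then 1 / of_real (ev n) else 0)"
    using ev_nonzero[of m] by (auto simp: field_simps split: if_splits)
  have "B (z m) (z n) = of_real (sqrt \<bar>ev m\<bar> * sqrt \<bar>ev n\<bar>) * B (y m) (y n)"
    unfolding z_def by (simp add: B_gscale yD(1) G.gscale_in)
  also have "\<dots> = (if m = n then of_real (\<bar>ev n\<bar> / ev n) else 0)"
    unfolding By by (cases "m = n") (simp_all del: of_real_mult)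
  also have "\<bar>ev n\<bar> / ev n = sgn (ev n)" using ev_nonzero[of n] by (simp add: sgn_if)
  finally show ?thesis .
qed

lemma z_orth_F: "F (z m) (z n) = (if m = n then of_real \<bar>ev n\<bar> else 0)"
proof -
  have "ev n * sgn (ev n) = \<bar>ev n\<bar>" by (simp add: sgn_if)
  then show ?thesis
    using eigen_form_z[OF zD, of m n] z_orth[of m n] by (auto simp flip: of_real_mult)
qed

lemma u_DF: "finite A \<Longrightarrow> gsum c z A \<in> DF"
  by (intro G.gsum_in zD)

lemma F_norm_gsum:
  assumes A: "finite A"
  shows "(G.nrm (gsum c z A))\<^sup>2 = (\<Sum>n\<in>A. \<bar>ev n\<bar> * (cmod (c n))\<^sup>2)"
proof -
  have "F (gsum c z A) (gsum c z A) = (\<Sum>m\<in>A. c m * (\<Sum>n\<in>A. cnj (c n) * F (z m) (z n)))"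
    by (subst G.ip_gsum_left[OF A zD u_DF[OF A]]) (simp add: G.ip_gsum_right[OF A zD zD])
  also have "\<dots> = (\<Sum>m\<in>A. of_real (\<bar>ev m\<bar> * (cmod (c m))\<^sup>2))"
  proof (rule sum.cong[OF refl])
    fix m assume m: "m \<in> A"
    have "(\<Sum>n\<in>A. cnj (c n) * F (z m) (z n)) = (\<Sum>n\<in>A. if m = n then cnj (c n) * of_real \<bar>ev n\<bar> else 0)"
      by (rule sum.cong[OF refl]) (simp add: z_orth_F)
    also have "\<dots> = cnj (c m) * of_real \<bar>ev m\<bar>" using A m by simp
    finally have "c m * (\<Sum>n\<in>A. cnj (c n) * F (z m) (z n)) = of_real \<bar>ev m\<bar> * (c m * cnj (c m))"
      by (simp add: mult_ac)
    then show "c m * (\<Sum>n\<in>A. cnj (c n) * F (z m) (z n)) = of_real (\<bar>ev m\<bar> * (cmod (c m))\<^sup>2)"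
      by (simp only: of_real_mult complex_norm_square)
  qed
  finally show ?thesis using G.nrm_sq[OF u_DF[OF A]] by (simp only: of_real_sum[symmetric] Re_complex_of_real)
qed

subsection \<open>A symmetric positive operator on the form domain\<close>

text \<open>\<open>W\<close> is the identity where the weight is positive. Where the weight is negative it is minus
  the identity plus a symmetric operator that restores the end values and has quadratic form at most \<open>4/5\<close>. So \<open>W\<close> preserves all end
  values and hence the form domain, whatever the conditions (I) are, while \<open>(B W x, x)\<close> is positive.\<close>

definition W :: "gfun \<Rightarrow> gfun" where
  "W x = (\<lambda>i t. if weight P i = 1 then x i t else 2 * end_op (x i) t + (-1) * x i t)"

lemma W_pos_edge: "i \<in> Ep \<Longrightarrow> W x i = x i"
  by (simp add: W_def pos_edges_def)

lemma W_neg_edge: "i \<in> En \<Longrightarrow> W x i = (\<lambda>t. 2 * end_op (x i) t + (-1) * x i t)"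
  by (simp add: W_def neg_edges_def)

lemma W_DF:
  assumes x: "x \<in> DF"
  shows "W x \<in> DF"
proof -
  have "H1e (W x i)" if i: "i \<in> E" for i
  proof (cases "i \<in> Ep")
    case True
    then show ?thesis using DF_H1e[OF x i] by (simp add: W_pos_edge)
  next
    case False
    then have "i \<in> En" using i E_split(1) by blast
    then show ?thesis
      using H1e_lin[OF H1e_end_op(1)[OF DF_H1e[OF x i]] DF_H1e[OF x i]] by (simp only: W_neg_edge)
  qed
  moreover have "W x i 0 = x i 0" "W x i 1 = x i 1" for i
    by (simp_all add: W_def end_op_ends)
  then have "bc_I P (W x)" using bc_I_cong[of "W x" x] x by (simp add: DF_iff)
  ultimately show ?thesis by (simp add: DF_iff)
qed

lemma W_symmetric:
  assumes x: "x \<in> DF" and v: "v \<in> DF"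
  shows "B (W x) v = B x (W v)"
proof -
  have "(\<integral>t. W x i t * cnj (v i t) \<partial>unit_leb) = (\<integral>t. x i t * cnj (W v i t) \<partial>unit_leb)" if i: "i \<in> E" for i
  proof (cases "i \<in> Ep")
    case True
    then show ?thesis by (simp add: W_pos_edge)
  next
    case False
    then have n: "i \<in> En" using i E_split(1) by blast
    have s: "sqint (x i)" "sqint (v i)" using x v i by (auto intro: H1e_sqint DF_H1e)
    have ii: "integrable unit_leb (\<lambda>t. end_op (x i) t * cnj (v i t))" "integrable unit_leb (\<lambda>t. x i t * cnj (v i t))"
      "integrable unit_leb (\<lambda>t. x i t * cnj (end_op (v i) t))"
      using s by (auto intro!: sqint_mult_cnj_integrable sqint_end_op)
    have "(\<integral>t. W x i t * cnj (v i t) \<partial>unit_leb) =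
        (\<integral>t. 2 * (end_op (x i) t * cnj (v i t)) + (-1) * (x i t * cnj (v i t)) \<partial>unit_leb)"
      by (intro Bochner_Integration.integral_cong refl) (simp add: W_neg_edge[OF n] algebra_simps)
    also have "\<dots> = 2 * (\<integral>t. end_op (x i) t * cnj (v i t) \<partial>unit_leb) + (-1) * (\<integral>t. x i t * cnj (v i t) \<partial>unit_leb)"
      using ii by (simp only: Bochner_Integration.integral_add integrable_mult_right integral_mult_right_zero)
    also have "\<dots> = 2 * (\<integral>t. x i t * cnj (end_op (v i) t) \<partial>unit_leb) + (-1) * (\<integral>t. x i t * cnj (v i t) \<partial>unit_leb)"
      unfolding end_op_symmetric[OF s] ..
    also have "\<dots> = (\<integral>t. 2 * (x i t * cnj (end_op (v i) t)) + (-1) * (x i t * cnj (v i t)) \<partial>unit_leb)"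
      using ii by (simp only: Bochner_Integration.integral_add integrable_mult_right integral_mult_right_zero)
    also have "\<dots> = (\<integral>t. x i t * cnj (W v i t) \<partial>unit_leb)"
      by (intro Bochner_Integration.integral_cong refl) (simp add: W_neg_edge[OF n] algebra_simps)
    finally show ?thesis .
  qed
  then show ?thesis unfolding B_weight by (intro sum.cong refl) simp
qed

lemma W_positive:
  assumes x: "x \<in> DF"
  shows "N0 x / 5 \<le> Re (B (W x) x)"
proof -
  have "sqn (x i) / 5 \<le> Re (of_real (weight P i) * (\<integral>t. W x i t * cnj (x i t) \<partial>unit_leb))" if i: "i \<in> E" for i
  proof -
    have s: "sqint (x i)" using x i by (auto intro: H1e_sqint DF_H1e)
    have self: "(\<integral>t. x i t * cnj (x i t) \<partial>unit_leb) = of_real (sqn (x i))"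
      unfolding sqn_def complex_norm_square[symmetric] by (rule integral_complex_of_real)
    show ?thesis
    proof (cases "i \<in> Ep")
      case True
      then have "weight P i = 1" by (simp add: pos_edges_def)
      then show ?thesis using W_pos_edge[OF True, of x] self sqn_nonneg[of "x i"] by simp
    next
      case False
      then have n: "i \<in> En" using i E_split(1) by blast
      then have wt: "weight P i = -1" by (simp add: neg_edges_def)
      have ii: "integrable unit_leb (\<lambda>t. end_op (x i) t * cnj (x i t))" "integrable unit_leb (\<lambda>t. x i t * cnj (x i t))"
        using s by (auto intro!: sqint_mult_cnj_integrable sqint_end_op)
      have "(\<integral>t. W x i t * cnj (x i t) \<partial>unit_leb) =
          (\<integral>t. 2 * (end_op (x i) t * cnj (x i t)) + (-1) * (x i t * cnj (x i t)) \<partial>unit_leb)"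
        by (intro Bochner_Integration.integral_cong refl) (simp add: W_neg_edge[OF n] algebra_simps)
      also have "\<dots> = 2 * (\<integral>t. end_op (x i) t * cnj (x i t) \<partial>unit_leb) + (-1) * (\<integral>t. x i t * cnj (x i t) \<partial>unit_leb)"
        using ii by (simp only: Bochner_Integration.integral_add integrable_mult_right integral_mult_right_zero)
      finally have "Re (\<integral>t. W x i t * cnj (x i t) \<partial>unit_leb) =
          2 * Re (\<integral>t. end_op (x i) t * cnj (x i t) \<partial>unit_leb) - sqn (x i)"
        by (simp add: self)
      then show ?thesis using end_op_bound[OF s] wt by simp
    qed
  qed
  then have "(\<Sum>i\<in>E. sqn (x i) / 5) \<le> (\<Sum>i\<in>E. Re (of_real (weight P i) * (\<integral>t. W x i t * cnj (x i t) \<partial>unit_leb)))"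
    by (rule sum_mono)
  then show ?thesis unfolding B_weight N0_def Re_sum sum_divide_distrib .
qed

lemma W_bounded:
  obtains M where "M > 0" "\<And>x. x \<in> DF \<Longrightarrow> G.nrm (W x) \<le> M * G.nrm x"
proof -
  obtain c where c: "c > 0" "\<And>x. x \<in> DF \<Longrightarrow> c * (N0 x + N1 x) \<le> Re (F x x)"
    using coercive[OF posdef] by blast
  obtain k where k: "k \<ge> 0" "\<And>x. x \<in> DF \<Longrightarrow> N1 x / 2 - k * N0 x \<le> Re (F x x)"
    "\<And>x. x \<in> DF \<Longrightarrow> Re (F x x) \<le> 2 * N1 x + k * N0 x"
    by (metis Garding)
  have edge: "sqn (W x i) \<le> 8002 * sqn (x i)" "sqn (ud (W x i)) \<le> 25602 * (sqn (x i) + sqn (ud (x i)))"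
    if x: "x \<in> DF" and i: "i \<in> E" for x i
  proof -
    have H: "H1e (x i)" by (rule DF_H1e[OF x i])
    have K: "H1e (end_op (x i))" by (rule H1e_end_op(1)[OF H])
    have "sqn (W x i) \<le> 8002 * sqn (x i) \<and> sqn (ud (W x i)) \<le> 25602 * (sqn (x i) + sqn (ud (x i)))"
    proof (cases "i \<in> Ep")
      case True
      then show ?thesis unfolding W_pos_edge[OF True]
        using sqn_nonneg[of "x i"] sqn_nonneg[of "ud (x i)"] by simp
    next
      case False
      then have n: "i \<in> En" using i E_split(1) by blast
      have "sqn (W x i) \<le> 2 * (cmod 2)\<^sup>2 * sqn (end_op (x i)) + 2 * (cmod (-1))\<^sup>2 * sqn (x i)"
        unfolding W_neg_edge[OF n] by (rule sqn_lin[OF H1e_sqint[OF K] H1e_sqint[OF H]])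
      then have 1: "sqn (W x i) \<le> 8 * sqn (end_op (x i)) + 2 * sqn (x i)" by simp
      have d: "AE t in unit_leb. 2 * ud (end_op (x i)) t + (-1) * ud (x i) t = ud (W x i) t"
        using ud_lin[OF H1e_AC1[OF K] H1e_AC1[OF H], of 2 "-1"]
        unfolding W_neg_edge[OF n] by eventually_elim simp
      have s: "sqint (\<lambda>t. 2 * ud (end_op (x i)) t + (-1) * ud (x i) t)"
        by (rule sqint_lin[OF H1e_sqint_ud[OF K] H1e_sqint_ud[OF H]])
      have "sqn (ud (W x i)) = sqn (\<lambda>t. 2 * ud (end_op (x i)) t + (-1) * ud (x i) t)"
        by (rule sqint_AE_cong(2)[OF s d])
      also have "\<dots> \<le> 2 * (cmod 2)\<^sup>2 * sqn (ud (end_op (x i))) + 2 * (cmod (-1))\<^sup>2 * sqn (ud (x i))"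
        by (rule sqn_lin[OF H1e_sqint_ud[OF K] H1e_sqint_ud[OF H]])
      finally have 2: "sqn (ud (W x i)) \<le> 8 * sqn (ud (end_op (x i))) + 2 * sqn (ud (x i))" by simp
      show ?thesis
      proof
        show "sqn (W x i) \<le> 8002 * sqn (x i)"
          using 1 sqn_end_op[OF H1e_sqint[OF H]] by linarith
        have "8 * sqn (ud (end_op (x i))) + 2 * sqn (ud (x i)) \<le>
            8 * (3200 * (sqn (x i) + sqn (ud (x i)))) + 2 * (sqn (x i) + sqn (ud (x i)))"
          by (intro add_mono mult_left_mono H1e_end_op(2)[OF H]) auto
        with 2 show "sqn (ud (W x i)) \<le> 25602 * (sqn (x i) + sqn (ud (x i)))" by simp
      qed
    qed
    then show "sqn (W x i) \<le> 8002 * sqn (x i)" "sqn (ud (W x i)) \<le> 25602 * (sqn (x i) + sqn (ud (x i)))"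
      by auto
  qed
  define M2 where "M2 = (51204 + 8002 * k) / c"
  have M2: "M2 > 0" unfolding M2_def using c(1) k(1) by (intro divide_pos_pos) auto
  have b: "(G.nrm (W x))\<^sup>2 \<le> M2 * (G.nrm x)\<^sup>2" if x: "x \<in> DF" for x
  proof -
    have n0: "N0 (W x) \<le> 8002 * (N0 x + N1 x)"
    proof -
      have "N0 (W x) \<le> 8002 * N0 x"
        unfolding N0_def sum_distrib_left by (intro sum_mono edge(1)[OF x])
      also have "\<dots> \<le> 8002 * (N0 x + N1 x)" using N_nonneg(2)[of x] by simp
      finally show ?thesis .
    qed
    have n1: "N1 (W x) \<le> 25602 * (N0 x + N1 x)"
      unfolding N0_def N1_def sum.distrib[symmetric] sum_distrib_left by (intro sum_mono edge(2)[OF x])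
    have "Re (F (W x) (W x)) \<le> 2 * N1 (W x) + k * N0 (W x)" by (rule k(3)[OF W_DF[OF x]])
    also have "\<dots> \<le> 2 * (25602 * (N0 x + N1 x)) + k * (8002 * (N0 x + N1 x))"
      using n0 n1 k(1) by (intro add_mono mult_left_mono) auto
    also have "\<dots> = (51204 + 8002 * k) * (N0 x + N1 x)" by (simp add: algebra_simps)
    also have "\<dots> \<le> (51204 + 8002 * k) * (Re (F x x) / c)"
      using c(2)[OF x] c(1) k(1) by (intro mult_left_mono) (auto simp: pos_le_divide_eq mult.commute)
    finally show ?thesis
      using G.nrm_sq[OF x] G.nrm_sq[OF W_DF[OF x]] by (simp add: M2_def)
  qed
  have "G.nrm (W x) \<le> sqrt M2 * G.nrm x" if x: "x \<in> DF" for x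
  proof (rule power2_le_imp_le)
    show "(G.nrm (W x))\<^sup>2 \<le> (sqrt M2 * G.nrm x)\<^sup>2" using b[OF x] M2 by (simp add: power_mult_distrib)
    show "0 \<le> sqrt M2 * G.nrm x" using M2 G.nrm_nonneg[OF x] by simp
  qed
  moreover have "sqrt M2 > 0" using M2 by simp
  ultimately show ?thesis using that[of "sqrt M2"] by simp
qed

subsection \<open>The norm estimate\<close>

lemma cs_sum:
  fixes c d :: "nat \<Rightarrow> complex"
  shows "cmod (\<Sum>n\<in>A. c n * cnj (d n)) \<le> sqrt (\<Sum>n\<in>A. (cmod (c n))\<^sup>2) * sqrt (\<Sum>n\<in>A. (cmod (d n))\<^sup>2)"
proof -
  have "cmod (\<Sum>n\<in>A. c n * cnj (d n)) \<le> (\<Sum>n\<in>A. cmod (c n) * cmod (d n))"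
    by (rule order_trans[OF norm_sum]) (simp add: norm_mult)
  also have "\<dots> \<le> sqrt ((\<Sum>n\<in>A. (cmod (c n))\<^sup>2) * (\<Sum>n\<in>A. (cmod (d n))\<^sup>2))"
    by (rule real_le_rsqrt) (rule Cauchy_Schwarz_ineq_sum)
  finally show ?thesis by (simp add: real_sqrt_mult)
qed

text \<open>On a finite span the form \<open>(B W u, v)\<close> is Hermitian; in the coordinates \<open>z\<close> it is the matrix of an
  operator \<open>T\<close> on coefficient vectors that is symmetric for the Euclidean norm and bounded by \<open>M\<close> in the
  energy norm. A symmetric operator that is bounded in an equivalent norm is bounded by the same constant
  in its own norm, which is seen by iteration; the constant does not depend on the span. With the
  positivity of \<open>W\<close> this bounds the norm of a combination by its coefficients.\<close>

lemma norm_estimate: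
  obtains C where "C \<ge> 1"
    "\<And>A c. finite A \<Longrightarrow> (L.nrm (gsum c z A))\<^sup>2 \<le> C * (\<Sum>n\<in>A. (cmod (c n))\<^sup>2)"
proof -
  obtain M where M: "M > 0" "\<And>x. x \<in> DF \<Longrightarrow> G.nrm (W x) \<le> M * G.nrm x"
    using W_bounded by blast
  have est: "N0 (gsum c z A) \<le> 5 * M * (\<Sum>n\<in>A. (cmod (c n))\<^sup>2)" if A: "finite A" for A c
  proof -
    define u where "u d = gsum d z A" for d
    have uD: "u d \<in> DF" for d unfolding u_def by (rule u_DF[OF A])
    define T where "T d m = B (W (u d)) (z m)" for d m
    have T: "(\<Sum>m\<in>A. T d m * cnj (e m)) = B (W (u d)) (u e)" for d e
      unfolding u_def[of e] B_gsum_right[OF A zD W_DF[OF uD]] by (simp add: T_def mult.commute)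
    have energy: "G.nrm (u (T d)) \<le> M * G.nrm (u d)" for d
    proof -
      \<comment> \<open>The signs turn the form \<open>F (W (u d)) (u e)\<close> into the square of the energy norm of \<open>u (T d)\<close>.\<close>
      define e where "e m = of_real (sgn (ev m)) * T d m" for m
      have nz: "cmod (e m) = cmod (T d m)" for m
        using ev_nonzero[of m] by (simp add: e_def norm_mult abs_sgn_eq)
      have eq: "G.nrm (u e) = G.nrm (u (T d))"
      proof (rule power2_eq_imp_eq[OF _ G.nrm_nonneg[OF uD] G.nrm_nonneg[OF uD]])
        show "(G.nrm (u e))\<^sup>2 = (G.nrm (u (T d)))\<^sup>2" unfolding u_def F_norm_gsum[OF A] by (simp add: nz)
      qed
      have Fz: "F (W (u d)) (z m) = of_real (ev m) * T d m" for m
      proof -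
        have "F (W (u d)) (z m) = cnj (F (z m) (W (u d)))" by (rule F_herm[OF zD W_DF[OF uD]])
        also have "\<dots> = of_real (ev m) * cnj (B (z m) (W (u d)))"
          by (simp add: eigen_form_z[OF W_DF[OF uD]])
        also have "cnj (B (z m) (W (u d))) = T d m" unfolding T_def by (rule B_herm[OF zD W_DF[OF uD], symmetric])
        finally show ?thesis .
      qed
      have "F (W (u d)) (u e) = (\<Sum>m\<in>A. cnj (e m) * (of_real (ev m) * T d m))"
        unfolding u_def[of e] G.ip_gsum_right[OF A zD W_DF[OF uD]] Fz ..
      also have "\<dots> = (\<Sum>m\<in>A. of_real (\<bar>ev m\<bar> * (cmod (T d m))\<^sup>2))"
      proof (rule sum.cong[OF refl])
        fix m
        have "cnj (e m) * (of_real (ev m) * T d m) = of_real (sgn (ev m) * ev m) * (T d m * cnj (T d m))"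
          by (simp add: e_def mult_ac)
        also have "sgn (ev m) * ev m = \<bar>ev m\<bar>" by (simp add: sgn_if)
        finally show "cnj (e m) * (of_real (ev m) * T d m) = of_real (\<bar>ev m\<bar> * (cmod (T d m))\<^sup>2)"
          by (simp only: of_real_mult complex_norm_square)
      qed
      also have "\<dots> = of_real ((G.nrm (u (T d)))\<^sup>2)" unfolding u_def F_norm_gsum[OF A] of_real_sum ..
      finally have "(G.nrm (u (T d)))\<^sup>2 = cmod (F (W (u d)) (u e))" by (simp del: of_real_power)
      also have "\<dots> \<le> G.nrm (W (u d)) * G.nrm (u e)" by (rule G.Cauchy_Schwarz[OF W_DF[OF uD] uD])
      finally have le: "G.nrm (u (T d)) * G.nrm (u (T d)) \<le> G.nrm (W (u d)) * G.nrm (u (T d))"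
        by (simp add: eq power2_eq_square)
      have "G.nrm (u (T d)) \<le> G.nrm (W (u d))"
      proof (cases "G.nrm (u (T d)) = 0")
        case True
        then show ?thesis using G.nrm_nonneg[OF W_DF[OF uD]] by simp
      next
        case False
        then have "0 < G.nrm (u (T d))" using G.nrm_nonneg[OF uD, of "T d"] by simp
        with le show ?thesis by (rule mult_right_le_imp_le)
      qed
      also have "\<dots> \<le> M * G.nrm (u d)" by (rule M(2)[OF uD])
      finally show ?thesis .
    qed
    define v where "v j = (T ^^ j) c" for j :: nat
    have vS: "v (Suc j) = T (v j)" for j by (simp add: v_def)
    define r where "r j = sqrt (\<Sum>n\<in>A. (cmod (v j n))\<^sup>2)" for j
    have r0: "0 \<le> r j" for j by (simp add: r_def sum_nonneg)
    have rsq: "(r j)\<^sup>2 = (\<Sum>n\<in>A. (cmod (v j n))\<^sup>2)" for j by (simp add: r_def sum_nonneg)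
    have "r 1 \<le> M * r 0"
    proof (rule log_convex_ratio[OF r0 _ _ M(1)])
      fix j
      have "of_real ((r (Suc j))\<^sup>2) = (\<Sum>m\<in>A. v (Suc j) m * cnj (v (Suc j) m))"
        unfolding rsq sum_cnj_self ..
      also have "\<dots> = B (W (u (v j))) (u (v (Suc j)))" unfolding vS[of j] by (rule T)
      also have "\<dots> = B (u (v j)) (W (u (v (Suc j))))" by (rule W_symmetric[OF uD uD])
      also have "\<dots> = cnj (B (W (u (v (Suc j)))) (u (v j)))" by (rule B_herm[OF W_DF[OF uD] uD])
      also have "\<dots> = cnj (\<Sum>m\<in>A. v (Suc (Suc j)) m * cnj (v j m))" unfolding vS[of "Suc j"] T ..
      finally have "cmod (of_real ((r (Suc j))\<^sup>2)) = cmod (\<Sum>m\<in>A. v (Suc (Suc j)) m * cnj (v j m))"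
        by (simp only: complex_mod_cnj)
      then have "(r (Suc j))\<^sup>2 = cmod (\<Sum>m\<in>A. v (Suc (Suc j)) m * cnj (v j m))" by (simp del: of_real_power)
      also have "\<dots> \<le> r (Suc (Suc j)) * r j" unfolding r_def by (rule cs_sum)
      finally show "(r (Suc j))\<^sup>2 \<le> r j * r (Suc (Suc j))" by (simp add: mult.commute)
    next
      fix j
      \<comment> \<open>On the finite span the Euclidean norm is bounded by the energy norm. The constant depends on the span
        but drops out, because only the growth rate enters.\<close>
      define S where "S = (\<Sum>n\<in>A. 1 / \<bar>ev n\<bar>)"
      have S: "S \<ge> 0" by (simp add: S_def sum_nonneg)
      have iter: "G.nrm (u (v j)) \<le> M^j * G.nrm (u (v 0))"
      proof (induction j)
        case (Suc j)
        have "G.nrm (u (v (Suc j))) \<le> M * G.nrm (u (v j))" unfolding vS by (rule energy)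
        also have "\<dots> \<le> M * (M^j * G.nrm (u (v 0)))" using Suc M(1) by (intro mult_left_mono) auto
        finally show ?case by (simp add: mult.assoc)
      qed simp
      have "(r j)\<^sup>2 \<le> S * (G.nrm (u (v j)))\<^sup>2"
        unfolding rsq u_def F_norm_gsum[OF A] sum_distrib_left
      proof (rule sum_mono)
        fix n assume n: "n \<in> A"
        have "1 / \<bar>ev n\<bar> \<le> S" unfolding S_def using A n by (intro member_le_sum) auto
        then have "1 \<le> S * \<bar>ev n\<bar>" using ev_nonzero[of n] by (simp add: pos_divide_le_eq)
        then have "1 * (cmod (v j n))\<^sup>2 \<le> S * \<bar>ev n\<bar> * (cmod (v j n))\<^sup>2" by (intro mult_right_mono) auto
        then show "(cmod (v j n))\<^sup>2 \<le> S * (\<bar>ev n\<bar> * (cmod (v j n))\<^sup>2)" by (simp add: mult.assoc)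
      qed
      then have "(r j)\<^sup>2 \<le> (sqrt S * G.nrm (u (v j)))\<^sup>2" using S by (simp add: power_mult_distrib)
      then have "r j \<le> sqrt S * G.nrm (u (v j))"
        by (rule power2_le_imp_le) (use S G.nrm_nonneg[OF uD] in simp)
      also have "\<dots> \<le> sqrt S * (M^j * G.nrm (u (v 0)))" using iter S by (intro mult_left_mono) auto
      finally show "r j \<le> (sqrt (\<Sum>n\<in>A. 1 / \<bar>ev n\<bar>) * G.nrm (u (v 0))) * M^j"
        unfolding S_def by (simp add: mult_ac)
    qed
    have "N0 (u c) / 5 \<le> Re (B (W (u c)) (u c))" by (rule W_positive[OF uD])
    also have "\<dots> \<le> cmod (B (W (u c)) (u c))" by (rule complex_Re_le_cmod)
    also have "\<dots> = cmod (\<Sum>m\<in>A. v 1 m * cnj (v 0 m))" by (simp add: v_def T)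
    also have "\<dots> \<le> r 1 * r 0" unfolding r_def by (rule cs_sum)
    also have "\<dots> \<le> (M * r 0) * r 0" using \<open>r 1 \<le> M * r 0\<close> r0[of 0] by (rule mult_right_mono)
    also have "\<dots> = M * (r 0)\<^sup>2" by (simp add: power2_eq_square)
    finally have "N0 (u c) \<le> 5 * M * (r 0)\<^sup>2" by simp
    then show ?thesis unfolding rsq by (simp add: u_def v_def)
  qed
  have "(L.nrm (gsum c z A))\<^sup>2 \<le> max 1 (5 * M) * (\<Sum>n\<in>A. (cmod (c n))\<^sup>2)" if "finite A" for A c
  proof -
    have "(L.nrm (gsum c z A))\<^sup>2 \<le> 5 * M * (\<Sum>n\<in>A. (cmod (c n))\<^sup>2)"
      unfolding nrm_N0 by (rule est[OF that])
    also have "\<dots> \<le> max 1 (5 * M) * (\<Sum>n\<in>A. (cmod (c n))\<^sup>2)"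
      by (intro mult_right_mono sum_nonneg) auto
    finally show ?thesis .
  qed
  then show ?thesis using that[of "max 1 (5 * M)"] by simp
qed

subsection \<open>Totality\<close>

lemma z_total:
  assumes w: "w \<in> L2 E" and \<epsilon>: "0 < \<epsilon>"
  shows "\<exists>A c. finite A \<and> L.nrm (gsub w (gsum c z A)) < \<epsilon>"
proof -
  obtain k where k: "k > 0" "\<And>x. x \<in> DF \<Longrightarrow> k * (N0 x + N1 x) \<le> Re (F x x)"
    using coercive[OF posdef] by blast
  define \<delta> where "\<delta> = (\<epsilon> / 2)\<^sup>2 / (real (card E) + 1)"
  have \<delta>: "\<delta> > 0" using \<epsilon> by (simp add: \<delta>_def)
  have "\<exists>v. H1e v \<and> v 0 = 0 \<and> v 1 = 0 \<and> sqn (\<lambda>t. w i t - v t) < \<delta>" if i: "i \<in> E" for i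
  proof -
    have "sqint (w i)" using w i by (simp add: L2_sqint)
    from H1e_dense[OF this \<delta>] show ?thesis by metis
  qed
  then obtain v where v: "\<And>i. i \<in> E \<Longrightarrow> H1e (v i) \<and> v i 0 = 0 \<and> v i 1 = 0 \<and> sqn (\<lambda>t. w i t - v i t) < \<delta>"
    by metis
  have vD: "v \<in> DF" using v by (simp add: DF_iff bc_I_def)
  have wv: "L.nrm (gsub w v) < \<epsilon> / 2"
  proof (rule power_less_imp_less_base)
    have "(L.nrm (gsub w v))\<^sup>2 \<le> (\<Sum>i\<in>E. \<delta>)"
      unfolding L2_norm_sq using v by (intro sum_mono) (simp add: gsub_def less_imp_le)
    also have "\<dots> < (real (card E) + 1) * \<delta>" using \<delta> by simp
    also have "\<dots> = (\<epsilon> / 2)\<^sup>2" by (simp add: \<delta>_def)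
    finally show "(L.nrm (gsub w v))\<^sup>2 < (\<epsilon> / 2)\<^sup>2" .
  qed (use \<epsilon> in simp)
  have "sqrt k * (\<epsilon> / 2) > 0" using k(1) \<epsilon> by simp
  then obtain A c where A: "finite A" "G.nrm (gsub v (gsum c y A)) < sqrt k * (\<epsilon> / 2)"
    using basis vD unfolding orthonormal_basis_def by blast
  have yA: "gsum c y A \<in> DF" using A(1) by (intro G.gsum_in yD)
  have dD: "gsub v (gsum c y A) \<in> DF" using vD yA by (rule G.gsub_in)
  have "L.nrm (gsub v (gsum c y A)) < \<epsilon> / 2"
  proof (rule power_less_imp_less_base)
    have "k * N0 (gsub v (gsum c y A)) \<le> k * (N0 (gsub v (gsum c y A)) + N1 (gsub v (gsum c y A)))"
      using k(1) N_nonneg(2) by (intro mult_left_mono) auto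
    also have "\<dots> \<le> (G.nrm (gsub v (gsum c y A)))\<^sup>2" unfolding G.nrm_sq[OF dD] by (rule k(2)[OF dD])
    also have "\<dots> < (sqrt k * (\<epsilon> / 2))\<^sup>2"
      using A(2) G.nrm_nonneg[OF dD] by (intro power_strict_mono) auto
    also have "\<dots> = k * (\<epsilon> / 2)\<^sup>2" using k(1) by (simp only: power_mult_distrib real_sqrt_pow2 less_imp_le)
    finally show "(L.nrm (gsub v (gsum c y A)))\<^sup>2 < (\<epsilon> / 2)\<^sup>2" unfolding nrm_N0 using k(1) by simp
  qed (use \<epsilon> in simp)
  then have "L.nrm (gsub w (gsum c y A)) < \<epsilon>"
    using L.nrm_triangle[OF w DF_L2[OF vD] DF_L2[OF yA]] wv by linarith
  moreover have "gsum c y A = gsum (\<lambda>n. c n / of_real (sqrt \<bar>ev n\<bar>)) z A"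
    unfolding gsum_def z_def gscale_def using ev_nonzero by (intro ext sum.cong refl) simp
  ultimately show ?thesis using A(1) by (intro exI[of _ A] exI[of _ "\<lambda>n. c n / of_real (sqrt \<bar>ev n\<bar>)"]) simp
qed

lemma normalized_z:
  assumes "\<And>i t. i \<in> S \<Longrightarrow> x i t = y n i t" "i \<in> S" "y n \<in> L2 S"
  shows "normalized (L2_inner S) x i t = of_real (1 / form_norm (L2_inner S) (z n)) * z n i t"
proof -
  interpret S: semi_ip "L2 S" "L2_inner S" by (rule L2_semi_ip)
  have "form_norm (L2_inner S) x = form_norm (L2_inner S) (y n)"
    by (rule form_norm_L2_cong) (rule assms(1))
  moreover have "form_norm (L2_inner S) (z n) = sqrt \<bar>ev n\<bar> * form_norm (L2_inner S) (y n)"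
    unfolding z_def using S.nrm_gscale[OF assms(3), of "of_real (sqrt \<bar>ev n\<bar>)"] by simp
  ultimately show ?thesis
    using ev_nonzero[of n] assms(1)[OF assms(2)] by (simp add: normalized_def gscale_def z_def)
qed

theorem half_range_completeness:
  "riesz_basis (L2 Ep) (L2_inner Ep) {n. ev n > 0} (\<lambda>n. normalized (L2_inner Ep) (Q_pos P (y n)))"
  "riesz_basis (L2 En) (L2_inner En) {n. ev n < 0} (\<lambda>n. normalized (L2_inner En) (Q_neg P (y n)))"
proof -
  obtain C where C: "C \<ge> 1"
    "\<And>A c. finite A \<Longrightarrow> (L.nrm (gsum c z A))\<^sup>2 \<le> C * (\<Sum>n\<in>A. (cmod (c n))\<^sup>2)"
    using norm_estimate by blast
  have sg: "sgn (ev n) = 1 \<or> sgn (ev n) = -1" for n using ev_nonzero[of n] by (auto simp: sgn_if)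
  have E': "Ep \<union> En = E" "En \<union> Ep = E" using E_split(1) by auto
  have o: "L2_inner Ep (z m) (z n) - L2_inner En (z m) (z n) = (if m = n then of_real (sgn (ev n)) else 0)" for m n
    using z_orth[of m n] by (simp add: B_def)
  interpret P: indefinite_system Ep En z "\<lambda>n. sgn (ev n)" C
    by unfold_locales (use fin_pn E_split(2) C sg o z_total DF_L2[OF zD] in \<open>simp_all add: E'\<close>)
  \<comment> \<open>For the negative half the summands are exchanged and all signs are reversed.\<close>
  have "L2_inner En (z m) (z n) - L2_inner Ep (z m) (z n) = (if m = n then of_real (- sgn (ev n)) else 0)" for m n
  proof -
    have "L2_inner En (z m) (z n) - L2_inner Ep (z m) (z n) =
        - (L2_inner Ep (z m) (z n) - L2_inner En (z m) (z n))" by simp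
    then show ?thesis unfolding o by simp
  qed
  moreover have "- sgn (ev n) = 1 \<or> - sgn (ev n) = -1" for n using sg[of n] by auto
  moreover have "En \<inter> Ep = {}" using E_split(2) by blast
  ultimately interpret N: indefinite_system En Ep z "\<lambda>n. - sgn (ev n)" C
    by unfold_locales (use fin_pn C z_total DF_L2[OF zD] in \<open>simp_all add: E'\<close>)
  have IP: "P.I = {n. ev n > 0}"
    unfolding P.I_def by (auto simp: sgn_if split: if_splits)
  have IN: "N.I = {n. ev n < 0}"
    unfolding N.I_def by (auto simp: sgn_if split: if_splits)
  show "riesz_basis (L2 Ep) (L2_inner Ep) {n. ev n > 0} (\<lambda>n. normalized (L2_inner Ep) (Q_pos P (y n)))"
    unfolding IP[symmetric]
    by (rule P.half_range_riesz_basis, rule normalized_z)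
      (auto simp: Q_pos_def pos_edges_def intro: DF_L2'(1)[OF yD(1), unfolded pos_edges_def])
  show "riesz_basis (L2 En) (L2_inner En) {n. ev n < 0} (\<lambda>n. normalized (L2_inner En) (Q_neg P (y n)))"
    unfolding IN[symmetric]
    by (rule N.half_range_riesz_basis, rule normalized_z)
      (auto simp: Q_neg_def neg_edges_def intro: DF_L2'(2)[OF yD(1), unfolded neg_edges_def])
qed

end

theorem theorem5p5:
  fixes P :: "'v graph_problem"
    and f :: gfun
    and y :: "nat \<Rightarrow> gfun"
    and ev :: "nat \<Rightarrow> real"
  assumes "graph_bvp P"
    and "conormal_via P f"
    and "L_positive_definite P"
    and "orthonormal_basis (dom_F P) (F_form P f) UNIV y"
    and "\<And>n. eigenfunction P (ev n) (y n)"
  shows "riesz_basis (L2 (pos_edges P)) (L2_inner (pos_edges P)) {n. ev n > 0}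
           (\<lambda>n. normalized (L2_inner (pos_edges P)) (Q_pos P (y n)))
       \<and> riesz_basis (L2 (neg_edges P)) (L2_inner (neg_edges P)) {n. ev n < 0}
           (\<lambda>n. normalized (L2_inner (neg_edges P)) (Q_neg P (y n)))"
proof -
  interpret eigen_basis P f y ev
    using assms by unfold_locales
  show ?thesis using half_range_completeness by blast
qed

end
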